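(* Let $m\ge 3$ be an integer and let $$U_0(x)=(b_0,u_{1,0},u_{2,0},u_{3,0})^{\top}(x_h,x_3)+(b^L_0,u^L_{1,0},u^L_{2,0},u^L_{3,0})^{\top}(x_h),$$ where $b_0\in H^m(\mathbb{R}^3)$, $u_0=(u_{1,0},u_{2,0},u_{3,0})^{\top}\in H^m(\mathbb{R}^3)$, $b_0^L\in H^{m+3}(\mathbb{R}^2)$, $u^L_{h,0}=(u^L_{1,0},u^L_{2,0})^{\top}\in H^{m+3}(\mathbb{R}^2)$ and $u^L_{3,0}\in H^{m+3}(\mathbb{R}^2)$ are all independent of $\delta$. Then there exists a time $T>0$ such that for any $\delta>0$ the Cauchy problem $$\partial_t U+\frac{\bar\gamma}{\delta}\mathcal{L}U+\mathcal{N}(U,\nabla U)=0,\qquad U|_{t=0}=U_0,$$ admits a unique solution $U$ on $[0,T]$ of the form $$U(t,x)=(a,w)^{\top}(t,x_h)+(\vartheta,v)^{\top}(t,x),$$ where $(a,w)^{\top}=(a,w_h,w_3)^{\top}\in C([0,T];H^{m+3}(\mathbb{R}^2))$ is a solution of $$\begin{cases} \partial_t a+w_h\cdot\nabla_h a+\bar\gamma a\operatorname{div}_h w_h+\frac{\bar\gamma}{\delta}\operatorname{div}_h w_h=0,\\ \partial_t w_h+(w_h\cdot\nabla_h)w_h+\bar\gamma a\nabla_h a+\frac{\bar\gamma}{\delta}\nu w_h^{\bot}+\frac{\bar\gamma}{\delta}\nabla_h a=0,\\ \partial_t w_3+w_h\cdot\nabla_h w_3=0,\\ \partial_{x_3}w_h=0,\quad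 \partial_{x_3}w_3=0,\\ (a,w_h,w_3)|_{t=0}=(b_0^L,u_{h,0}^L,u_{3,0}^L), \end{cases}$$ and $(\vartheta,v)^{\top}\in C([0,T];H^m(\mathbb{R}^3))$ is a solution of $$\begin{cases} \partial_t\vartheta+v\cdot\nabla\vartheta+\bar\gamma\vartheta\operatorname{div}v+\frac{\bar\gamma}{\delta}\operatorname{div}v=-w\cdot\nabla\vartheta-v\cdot\nabla a-\bar\gamma a\operatorname{div}v-\bar\gamma\vartheta\operatorname{div}w,\\ \partial_t v+(v\cdot\nabla)v+\bar\gamma\vartheta\nabla\vartheta+\frac{\bar\gamma}{\delta}\nu\mathbf{e}_3\times v+\frac{\bar\gamma}{\delta}\nabla\vartheta=-(w\cdot\nabla)v-(v\cdot\nabla)w-\bar\gamma a\nabla\vartheta-\bar\gamma\vartheta\nabla a,\\ (\vartheta,v)|_{t=0}=(b_0,u_0). \end{cases}$$ Moreover, there exists a constant $C=C(m,U_0)>0$, independent of $\delta$, such that $$\sup_{t\in[0,T]}\|(a,w)(t)\|_{H^{m+3}(\mathbb{R}^2)}+\sup_{t\in[0,T]}\|(\vartheta,v)(t)\|_{H^m(\mathbb{R}^3)}\le C.$$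
   Context: Fix $\gamma>1$ and set $\bar\gamma=\frac{\gamma-1}{2}$. The Mach number $\delta>0$ and the Rossby number $\varepsilon>0$ are linked so that $\nu=\frac{\delta}{\bar\gamma\varepsilon}$ is a fixed positive constant; thus $\gamma$ and $\nu$ are fixed and $\delta$ is the only varying parameter. Write $x=(x_h,x_3)\in\mathbb{R}^3$ with $x_h=(x_1,x_2)\in\mathbb{R}^2$, $\mathbf{e}_3=(0,0,1)^{\top}$, $\nabla_h=(\partial_1,\partial_2)$, $\operatorname{div}_h$ the horizontal divergence, $w_h=(w_1,w_2)^{\top}$, $w=(w_h,w_3)^{\top}$, $w_h^{\bot}=(-w_2,w_1)^{\top}$. Functions of $x_h$ only are also regarded as functions on $\mathbb{R}^3$ independent of $x_3$. For $U=(b,u)^{\top}$ with $b$ scalar and $u=(u_1,u_2,u_3)^{\top}$, $$\mathcal{L}U=\begin{pmatrix}\operatorname{div}u\\ \nu\mathbf{e}_3\times u+\nabla b\end{pmatrix},\qquad \mathcal{N}(U,\nabla U)=\begin{pmatrix}u\cdot\nabla b+\bar\gamma b\operatorname{div}u\\ (u\cdot\nabla)u+\bar\gamma b\nabla b\end{pmatrix}.$$ (The equation for $U$ is the reformulation of the 3D rotating isentropic compressible Euler equations with pressure $P(\rho)=\gamma^{-1}\rho^\gamma$ under $\rho=(\bar\gamma(1+\delta b))^{1/\bar\gamma}$.) *)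

theory Defs
  imports "HOL-Analysis.Analysis"
begin

section \<open>Test functions, weak derivatives and the spaces \<open>H\<^sup>m(\<real>\<^sup>n)\<close>\<close>

text \<open>
  Functions other than test functions stand for their almost-everywhere classes; no notion below depends on the
  chosen representative. An iterated derivative is indexed by the list of its directions,
  so \<open>[i, j]\<close> stands for \<open>\<partial>\<^sub>i \<partial>\<^sub>j\<close>.
\<close>

definition partial_deriv :: "'n::finite \<Rightarrow> (real^'n \<Rightarrow> real) \<Rightarrow> real^'n \<Rightarrow> real" where
  "partial_deriv i \<phi> x = frechet_derivative \<phi> (at x) (axis i 1)"

definition test_function :: "(real^'n::finite \<Rightarrow> real) \<Rightarrow> bool" where
  "test_function \<phi> \<longleftrightarrow>
     (\<forall>is x. foldr partial_deriv is \<phi> differentiable (at x)) \<and>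
     compact (closure {x. \<phi> x \<noteq> 0})"

definition locally_integrable :: "(real^'n::finite \<Rightarrow> 'b::euclidean_space) \<Rightarrow> bool" where
  "locally_integrable f \<longleftrightarrow> (\<forall>K. compact K \<longrightarrow> set_integrable lebesgue K f)"

definition has_weak_deriv ::
  "'n::finite list \<Rightarrow> (real^'n \<Rightarrow> 'b::euclidean_space) \<Rightarrow> (real^'n \<Rightarrow> 'b) \<Rightarrow> bool" where
  "has_weak_deriv is f g \<longleftrightarrow>
     locally_integrable f \<and> locally_integrable g \<and>
     (\<forall>\<phi>. test_function \<phi> \<longrightarrow>
        (LINT x|lebesgue. foldr partial_deriv is \<phi> x *\<^sub>R f x) =
        (-1) ^ length is *\<^sub>R (LINT x|lebesgue. \<phi> x *\<^sub>R g x))"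

text \<open>A representative of the weak derivative; meaningful only where one exists.\<close>

definition weak_deriv ::
  "'n::finite list \<Rightarrow> (real^'n \<Rightarrow> 'b::euclidean_space) \<Rightarrow> real^'n \<Rightarrow> 'b" where
  "weak_deriv is f = (SOME g. has_weak_deriv is f g)"

definition square_integrable :: "(real^'n::finite \<Rightarrow> 'b::euclidean_space) \<Rightarrow> bool" where
  "square_integrable f \<longleftrightarrow>
     f \<in> borel_measurable lebesgue \<and> integrable lebesgue (\<lambda>x. (norm (f x))\<^sup>2)"

definition sobolev :: "nat \<Rightarrow> (real^'n::finite \<Rightarrow> 'b::euclidean_space) set" where
  "sobolev m = {f. \<forall>is. length is \<le> m \<longrightarrow> (\<exists>g. has_weak_deriv is f g \<and> square_integrable g)}"

text \<open>
  Summing over lists of directions gives the square root of \<open>\<Sum>\<^bsub>k \<le> m\<^esub> \<parallel>\<nabla>\<^sup>k f\<parallel>\<^sup>2\<close>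
  (\<open>L\<^sup>2\<close> norms of the full derivative tensors); compared with the sum over multi-indices,
  only positive weights depending on \<open>m\<close> and \<open>n\<close> change.
\<close>

definition sobolev_norm :: "nat \<Rightarrow> (real^'n::finite \<Rightarrow> 'b::euclidean_space) \<Rightarrow> real" where
  "sobolev_norm m f =
     sqrt (\<Sum>is | length is \<le> m. LINT x|lebesgue. (norm (weak_deriv is f x))\<^sup>2)"

definition continuous_in_sobolev ::
  "real \<Rightarrow> nat \<Rightarrow> (real \<Rightarrow> real^'n::finite \<Rightarrow> 'b::euclidean_space) \<Rightarrow> bool" where
  "continuous_in_sobolev T m f \<longleftrightarrow>
     (\<forall>t\<in>{0..T}. f t \<in> sobolev m \<and>
        ((\<lambda>s. sobolev_norm m (\<lambda>x. f s x - f t x)) \<longlongrightarrow> 0) (at t within {0..T}))"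


section \<open>Evolution equations\<close>

text \<open>
  \<open>solves_ivp T F f0 f\<close>: \<open>\<partial>\<^sub>t f + F t f = 0\<close> on \<open>[0,T]\<close> with \<open>f(0) = f0\<close>, where \<open>F\<close> is a
  first-order differential operator in \<open>x\<close>. Space derivatives are weak derivatives, and the
  time derivative is taken in the sense of distributions in \<open>x\<close>, i.e. after integration
  against an arbitrary test function (one-sided at the two endpoints).
\<close>

definition solves_ivp ::
  "real \<Rightarrow> (real \<Rightarrow> (real^'n::finite \<Rightarrow> 'b::euclidean_space) \<Rightarrow> real^'n \<Rightarrow> 'b) \<Rightarrow>
   (real^'n \<Rightarrow> 'b) \<Rightarrow> (real \<Rightarrow> real^'n \<Rightarrow> 'b) \<Rightarrow> bool" where
  "solves_ivp T F f0 f \<longleftrightarrow>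
     (\<forall>t\<in>{0..T}.
        (\<forall>i. \<exists>g. has_weak_deriv [i] (f t) g) \<and>
        locally_integrable (F t (f t)) \<and>
        (\<forall>\<phi>. test_function \<phi> \<longrightarrow>
           ((\<lambda>s. LINT x|lebesgue. \<phi> x *\<^sub>R f s x) has_vector_derivative
              - (LINT x|lebesgue. \<phi> x *\<^sub>R F t (f t) x)) (at t within {0..T}))) \<and>
     (AE x in lebesgue. f 0 x = f0 x)"


section \<open>The equations\<close>

definition grad :: "(real^'n::finite \<Rightarrow> real) \<Rightarrow> real^'n \<Rightarrow> real^'n" where
  "grad b x = (\<chi> i. weak_deriv [i] b x)"

definition divergence :: "(real^'n::finite \<Rightarrow> real^'n) \<Rightarrow> real^'n \<Rightarrow> real" where
  "divergence u x = (\<Sum>i\<in>UNIV. weak_deriv [i] (\<lambda>y. u y $ i) x)"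

text \<open>\<open>(u \<cdot> \<nabla>) f\<close> for scalar or vector-valued \<open>f\<close>\<close>

definition advect ::
  "(real^'n::finite \<Rightarrow> real^'n) \<Rightarrow> (real^'n \<Rightarrow> 'b::euclidean_space) \<Rightarrow> real^'n \<Rightarrow> 'b" where
  "advect u f x = (\<Sum>i\<in>UNIV. u x $ i *\<^sub>R weak_deriv [i] f x)"

definition horiz :: "real^3 \<Rightarrow> real^2" where
  "horiz x = vector [x $ 1, x $ 2]"

definition join3 :: "real^2 \<Rightarrow> real \<Rightarrow> real^3" where
  "join3 h z = vector [h $ 1, h $ 2, z]"

definition perp :: "real^2 \<Rightarrow> real^2" where
  "perp h = vector [- h $ 2, h $ 1]"

text \<open>A function of \<open>x\<^sub>h\<close> regarded as a function on \<open>\<real>\<^sup>3\<close>\<close>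

definition lift3 :: "(real^2 \<Rightarrow> 'b) \<Rightarrow> real^3 \<Rightarrow> 'b" where
  "lift3 f x = f (horiz x)"

text \<open>States are pairs \<open>(b, u)\<close> of a scalar and a vector in \<open>\<real>\<^sup>3\<close>.\<close>

type_synonym state = "real \<times> (real^3)"

definition op_L :: "real \<Rightarrow> (real^3 \<Rightarrow> state) \<Rightarrow> real^3 \<Rightarrow> state" where
  "op_L \<nu> U x =
     (let b = (\<lambda>y. fst (U y)); u = (\<lambda>y. snd (U y)) in
       (divergence u x,
        \<nu> *\<^sub>R cross3 (axis 3 1) (u x) + grad b x))"

definition op_N :: "real \<Rightarrow> (real^3 \<Rightarrow> state) \<Rightarrow> real^3 \<Rightarrow> state" where
  "op_N gb U x =
     (let b = (\<lambda>y. fst (U y)); u = (\<lambda>y. snd (U y)) in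
       (advect u b x + gb * b x * divergence u x,
        advect u u x + (gb * b x) *\<^sub>R grad b x))"

definition full_system :: "real \<Rightarrow> real \<Rightarrow> real \<Rightarrow> (real^3 \<Rightarrow> state) \<Rightarrow> real^3 \<Rightarrow> state" where
  "full_system gb \<nu> \<delta> U x = (gb / \<delta>) *\<^sub>R op_L \<nu> U x + op_N gb U x"

text \<open>The system for \<open>(a, w)\<close>, functions of \<open>x\<^sub>h\<close>, where \<open>w\<close> has three components\<close>

definition planar_system :: "real \<Rightarrow> real \<Rightarrow> real \<Rightarrow> (real^2 \<Rightarrow> state) \<Rightarrow> real^2 \<Rightarrow> state" where
  "planar_system gb \<nu> \<delta> A x =
     (let a = (\<lambda>y. fst (A y)); wh = (\<lambda>y. horiz (snd (A y))); w3 = (\<lambda>y. snd (A y) $ 3) in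
       (advect wh a x + gb * a x * divergence wh x + (gb / \<delta>) * divergence wh x,
        join3
          (advect wh wh x + (gb * a x) *\<^sub>R grad a x
             + (gb / \<delta> * \<nu>) *\<^sub>R perp (wh x) + (gb / \<delta>) *\<^sub>R grad a x)
          (advect wh w3 x)))"

text \<open>
  The right-hand side of the system for \<open>(\<theta>, v)\<close>; its left-hand side is that of the full
  system, with \<open>(\<theta>, v)\<close> in place of \<open>U\<close>.
\<close>

definition coupling :: "real \<Rightarrow> (real^2 \<Rightarrow> state) \<Rightarrow> (real^3 \<Rightarrow> state) \<Rightarrow> real^3 \<Rightarrow> state" where
  "coupling gb A V x =
     (let a = lift3 (\<lambda>y. fst (A y)); w = lift3 (\<lambda>y. snd (A y));
          \<theta> = (\<lambda>y. fst (V y)); v = (\<lambda>y. snd (V y)) in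
       (- advect w \<theta> x - advect v a x - gb * a x * divergence v x - gb * \<theta> x * divergence w x,
        - advect w v x - advect v w x - (gb * a x) *\<^sub>R grad \<theta> x - (gb * \<theta> x) *\<^sub>R grad a x))"

definition perturbation_system ::
  "real \<Rightarrow> real \<Rightarrow> real \<Rightarrow> (real^2 \<Rightarrow> state) \<Rightarrow> (real^3 \<Rightarrow> state) \<Rightarrow> real^3 \<Rightarrow> state" where
  "perturbation_system gb \<nu> \<delta> A V x = full_system gb \<nu> \<delta> V x - coupling gb A V x"

text \<open>
  \<open>U\<close> solves the Cauchy problem with data \<open>A0(x\<^sub>h) + V0(x)\<close> and has the form
  \<open>U(t,x) = A(t,x\<^sub>h) + V(t,x)\<close>, with \<open>A = (a, w)\<close> and \<open>V = (\<theta>, v)\<close> in the stated spaces and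
  solving their own systems. The condition \<open>\<partial>\<^sub>3 w = 0\<close> holds by the typing of \<open>A\<close>,
  and is recorded because it belongs to the system for \<open>(a, w)\<close>.
\<close>

definition split_solution ::
  "real \<Rightarrow> real \<Rightarrow> real \<Rightarrow> nat \<Rightarrow> real \<Rightarrow> (real^2 \<Rightarrow> state) \<Rightarrow> (real^3 \<Rightarrow> state) \<Rightarrow>
   (real \<Rightarrow> real^3 \<Rightarrow> state) \<Rightarrow> (real \<Rightarrow> real^2 \<Rightarrow> state) \<Rightarrow> (real \<Rightarrow> real^3 \<Rightarrow> state) \<Rightarrow> bool" where
  "split_solution gb \<nu> \<delta> m T A0 V0 U A V \<longleftrightarrow>
     solves_ivp T (\<lambda>t. full_system gb \<nu> \<delta>) (\<lambda>x. lift3 A0 x + V0 x) U \<and>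
     (\<forall>t\<in>{0..T}. AE x in lebesgue. U t x = lift3 (A t) x + V t x) \<and>
     continuous_in_sobolev T (m + 3) A \<and>
     solves_ivp T (\<lambda>t. planar_system gb \<nu> \<delta>) A0 A \<and>
     (\<forall>t\<in>{0..T}. has_weak_deriv [3] (lift3 (\<lambda>y. snd (A t y))) (\<lambda>x. 0)) \<and>
     continuous_in_sobolev T m V \<and>
     solves_ivp T (\<lambda>t. perturbation_system gb \<nu> \<delta> (A t)) V0 V"

end

theory Submission
  imports Defs
begin

text \<open>
 Both systems have the form \<open>V' = - F(E, V)\<close>, \<open>F(E, V) = \<Sum>\<^sub>j (S\<^sub>j(V + E) \<partial>\<^sub>j V + S\<^sub>j(V) \<partial>\<^sub>j E) + G V\<close>, where the matrices \<open>S\<^sub>j(u)\<close>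
 are symmetric and linear in \<open>u\<close> and \<open>G\<close> is skew. The singular terms are put into the background: \<open>E = (1/\<delta>, 0)\<close> for the
 planar system and \<open>E = (1/\<delta>, 0) + A\<close> for the perturbation. The \<open>H\<^sup>m\<close> energy estimate sees neither \<open>G\<close> nor \<open>E\<close>, only
 derivatives of \<open>E\<close> of order at most \<open>m + 1\<close>, which for the lifted \<open>A\<close> are bounded by its \<open>H\<^bsup>m+3\<^esup>(\<real>\<^sup>2)\<close> norm;
 so the existence time and the bounds do not depend on \<open>\<delta>\<close>. Solutions are limits of the \<open>L\<^sup>2\<close>-valued equations
 \<open>z' = - F(E, J J z)\<close> with mollifiers \<open>J\<close>; an \<open>L\<^sup>2\<close> estimate of differences gives convergence and uniqueness. Restarting the
 equation at any time, forwards and backwards, bounds the \<open>H\<^sup>m\<close> norm near that time by its value there, which turns weak into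
 strong continuity in \<open>H\<^sup>m\<close>.
\<close>

section \<open>The Hilbert space of square-integrable functions\<close>

text \<open>The two factors \<open>J\<close> in the approximate equation make its energy estimate
  exact: v = J z satisfies v' = - J F(E, J v), and by symmetry of \<open>J\<close> the pairing of v
  with J F(E, J v) is that of W = J v with F(E, W), where W is smooth. No commutator of a mollifier
  with the nonlinearity occurs. All norms are those of an L^2 Hilbert space. The full solution is
  not in it, since its planar part does not decay in the third variable; this is why the planar part
  becomes a bounded background, seen only through sup norms. A sup norm costs two derivatives in
  dimensions 2 and 3, and order m + 1 of the background is differentiated, so the planar data need
  order m + 1 + 2 = m + 3. The sup bound comes from averaging over dilations, the L^4 bounds for
  products of intermediate derivatives from integration by parts; with both, m = 3 is enough in
  dimension 3. The estimate of differences has constants that grow with 1/\<delta>. This is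
  harmless, because it serves convergence and uniqueness at fixed \<delta>, never the existence
  time.\<close>

abbreviation bmeas :: "('a::topological_space => 'b::topological_space) => bool" where
 "bmeas f \<equiv> f \<in> borel_measurable borel"

text \<open>Borel functions and \<open>lborel\<close> instead of Lebesgue ones: Fubini, translations
  and dilations then apply directly. The passage to the Lebesgue-measurable functions of the
  statement is made later, by \<open>rep\<close>.\<close>

definition sqi :: "('a::euclidean_space => 'b::euclidean_space) => bool" where
 "sqi f \<longleftrightarrow> f \<in> borel_measurable borel & integrable lborel (%x. (norm (f x))^2)"

lemma sqi_measurable [measurable_dest]: "sqi f ==> bmeas f"
 by (simp add: sqi_def)

lemma sqi_integrable: "sqi f ==> integrable lborel (%x. (norm (f x))^2)"
 by (simp add: sqi_def)

lemma sqi_dominated: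
 assumes [measurable]: "bmeas f" and g: "sqi g"
  and le: "AE x in lborel. norm (f x) <= c * norm (g x)"
 shows "sqi f"
proof -
 have "integrable lborel (%x. (norm (f x))^2)"
 proof (rule Bochner_Integration.integrable_bound[where f="%x. c^2 * (norm (g x))^2"])
  show "integrable lborel (%x. c^2 * (norm (g x))^2)"
   using sqi_integrable[OF g] by simp
  show "AE x in lborel. norm ((norm (f x))^2) <= norm (c^2 * (norm (g x))^2)"
   using le
  proof (eventually_elim)
   case (elim x)
   have "(norm (f x))^2 <= (c * norm (g x))^2"
    using elim by (intro power_mono) auto
   thus ?case by (simp add: power_mult_distrib)
  qed
 qed measurable
 thus ?thesis by (simp add: sqi_def)
qed

lemma sqi_zero [simp]: "sqi (%x. 0)"
 by (simp add: sqi_def)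

lemma sqi_norm: "sqi f ==> sqi (%x. norm (f x))"
 by (rule sqi_dominated[where g=f and c=1]) auto

lemma sqi_bounded_linear:
 assumes "bounded_linear L" "sqi f" shows "sqi (%x. L (f x))"
proof -
 obtain K where K: "!!x. norm (L x) <= norm x * K" using bounded_linear.bounded[OF assms(1)] by blast
 have [measurable]: "bmeas L"
  by (rule borel_measurable_continuous_onI[OF linear_continuous_on[OF assms(1)]])
 note [measurable] = sqi_measurable[OF assms(2)]
 show ?thesis
  by (rule sqi_dominated[where g=f and c=K]) (simp_all add: assms K mult.commute[of K])
qed

lemma sqi_scaleR [simp]: "sqi f ==> sqi (%x. c *\<^sub>R f x)"
 by (rule sqi_bounded_linear[OF bounded_linear_scaleR_right])

lemma sqi_minus [simp]: "sqi f ==> sqi (%x. - f x)"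
 using sqi_scaleR[of f "-1"] by simp

lemma sqi_add [simp]:
 assumes f: "sqi f" and g: "sqi g" shows "sqi (%x. f x + g x)"
proof -
 note [measurable] = sqi_measurable[OF f] sqi_measurable[OF g]
 have "integrable lborel (%x. (norm (f x + g x))^2)"
 proof (rule Bochner_Integration.integrable_bound[where f="%x. 2 * (norm (f x))^2 + 2 * (norm (g x))^2"])
  show "integrable lborel (%x. 2 * (norm (f x))^2 + 2 * (norm (g x))^2)"
   using sqi_integrable[OF f] sqi_integrable[OF g] by simp
  have "(norm (f x + g x))^2 <= 2 * (norm (f x))^2 + 2 * (norm (g x))^2" for x
  proof -
   have "(norm (f x + g x))^2 <= (norm (f x) + norm (g x))^2"
    by (intro power_mono norm_triangle_ineq) auto
   thus ?thesis using sum_squares_bound[of "norm (f x)" "norm (g x)"]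
    by (simp add: power2_sum)
  qed
  thus "AE x in lborel. norm ((norm (f x + g x))^2) <= norm (2 * (norm (f x))^2 + 2 * (norm (g x))^2)"
   by (intro AE_I2) (simp add: add_nonneg_nonneg)
 qed measurable
 thus ?thesis by (simp add: sqi_def)
qed

lemma sqi_diff [simp]: "sqi f ==> sqi g ==> sqi (%x. f x - g x)"
 using sqi_add[of f "%x. - g x"] by simp

lemma sqi_sum [simp]: "(!!i. i \<in> I ==> sqi (f i)) ==> sqi (%x. \<Sum>i\<in>I. f i x)"
 by (induction I rule: infinite_finite_induct) auto

lemma sqi_cong_AE:
 "sqi f ==> g \<in> borel_measurable borel ==> AE x in lborel. f x = g x ==> sqi g"
 by (erule sqi_dominated[where c=1, rotated]) (auto elim: eventually_mono)

lemma sqi_prod_integrable: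
 assumes f: "sqi f" and g: "sqi g"
 shows "integrable lborel (%x. norm (f x) * norm (g x))"
proof -
 note [measurable] = sqi_measurable[OF f] sqi_measurable[OF g]
 show ?thesis
 proof (rule Bochner_Integration.integrable_bound[where f="%x. (norm (f x))^2 + (norm (g x))^2"])
  show "integrable lborel (%x. (norm (f x))^2 + (norm (g x))^2)"
   using sqi_integrable[OF f] sqi_integrable[OF g] by simp
  have "norm (f x) * norm (g x) <= (norm (f x))^2 + (norm (g x))^2" for x
  proof -
   have "0 <= norm (f x) * norm (g x)" by simp
   thus ?thesis using sum_squares_bound[of "norm (f x)" "norm (g x)"] by linarith
  qed
  thus "AE x in lborel. norm (norm (f x) * norm (g x)) <= norm ((norm (f x))^2 + (norm (g x))^2)"
   by (intro AE_I2) (simp add: add_nonneg_nonneg)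
 qed measurable
qed

lemma sqi_inner_integrable:
 assumes f: "sqi f" and g: "sqi g"
 shows "integrable lborel (%x. f x \<bullet> g x)"
proof -
 note [measurable] = sqi_measurable[OF f] sqi_measurable[OF g]
 show ?thesis
  by (rule Bochner_Integration.integrable_bound[OF sqi_prod_integrable[OF f g]])
   (auto simp: Cauchy_Schwarz_ineq2)
qed

definition l2_class :: "('a::euclidean_space => 'b::euclidean_space) => ('a => 'b) set" where
 "l2_class f = {g. sqi g & (AE x in lborel. f x = g x)}"

text \<open>As a type of the classes \<open>real_inner\<close> and \<open>banach\<close>, L^2 can be
  the range of curves: vector derivatives, integrals and fixed points of L^2-valued maps become
  available without carrying a norm along.\<close>

typedef (overloaded) ('a, 'b) l2 = "{l2_class (f :: 'a::euclidean_space => 'b::euclidean_space) | f. sqi f}"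
 by (auto intro: exI[of _ "%x. 0"])

definition cl :: "('a::euclidean_space => 'b::euclidean_space) => ('a, 'b) l2" where
 "cl f = Abs_l2 (l2_class f)"

definition rp :: "('a::euclidean_space, 'b::euclidean_space) l2 => 'a => 'b" where
 "rp u = (SOME f. f \<in> Rep_l2 u)"

lemma rp_in: "rp u \<in> Rep_l2 u"
proof -
 obtain f where "sqi f" "Rep_l2 u = l2_class f" using Rep_l2[of u] by auto
 hence "f \<in> Rep_l2 u" by (auto simp: l2_class_def)
 thus ?thesis unfolding rp_def by (rule someI[of "%f. f \<in> Rep_l2 u"])
qed

lemma sqi_rp [simp]: "sqi (rp u)"
 using rp_in[of u] Rep_l2[of u] by (auto simp: l2_class_def)

lemma rp_measurable [measurable]: "bmeas (rp u)"
 by (rule sqi_measurable) simp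

lemma rp_cl: assumes "sqi f" shows "AE x in lborel. rp (cl f) x = f x"
proof -
 have "Rep_l2 (cl f) = l2_class f"
  unfolding cl_def by (rule Abs_l2_inverse) (use assms in auto)
 thus ?thesis using rp_in[of "cl f"] by (auto simp: l2_class_def)
qed

lemma cl_cong: assumes "sqi f" "sqi g" "AE x in lborel. f x = g x" shows "cl f = cl g"
proof -
 have "l2_class f = l2_class g"
  using assms(3) unfolding l2_class_def
  by (intro Collect_cong conj_cong refl) (auto elim: eventually_elim2)
 thus ?thesis by (simp add: cl_def)
qed

lemma cl_rp [simp]: "cl (rp u) = u"
proof -
 obtain f where f: "sqi f" "Rep_l2 u = l2_class f" using Rep_l2[of u] by auto
 hence "AE x in lborel. rp u x = f x" using rp_in[of u] by (auto simp: l2_class_def)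
 hence "cl (rp u) = cl f" using f by (intro cl_cong) auto
 also have "... = u" using f by (simp add: cl_def Rep_l2_inverse flip: f(2))
 finally show ?thesis .
qed

lemma l2_eqI: "AE x in lborel. rp u x = rp v x ==> u = v"
 using cl_cong[of "rp u" "rp v"] by simp

instantiation l2 :: (euclidean_space, euclidean_space) real_vector
begin
definition zero_l2 :: "('a,'b) l2" where "zero_l2 = cl (%x. 0)"
definition plus_l2 :: "('a,'b) l2 => ('a,'b) l2 => ('a,'b) l2" where
 "plus_l2 u v = cl (%x. rp u x + rp v x)"
definition minus_l2 :: "('a,'b) l2 => ('a,'b) l2 => ('a,'b) l2" where
 "minus_l2 u v = cl (%x. rp u x - rp v x)"
definition uminus_l2 :: "('a,'b) l2 => ('a,'b) l2" where "uminus_l2 u = cl (%x. - rp u x)"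
definition scaleR_l2 :: "real => ('a,'b) l2 => ('a,'b) l2" where
 "scaleR_l2 c u = cl (%x. c *\<^sub>R rp u x)"

lemma rp_add: "AE x in lborel. rp (u + v) x = rp u x + rp v x"
 unfolding plus_l2_def by (rule rp_cl) simp
lemma rp_diff: "AE x in lborel. rp (u - v) x = rp u x - rp v x"
 unfolding minus_l2_def by (rule rp_cl) simp
lemma rp_minus: "AE x in lborel. rp (- u) x = - rp u x"
 unfolding uminus_l2_def by (rule rp_cl) simp
lemma rp_scaleR: "AE x in lborel. rp (c *\<^sub>R u) x = c *\<^sub>R rp u x"
 unfolding scaleR_l2_def by (rule rp_cl) simp
lemma rp_zero: "AE x in lborel. rp 0 x = 0"
 unfolding zero_l2_def by (rule rp_cl) simp

instance
proof
 fix a b c :: "('a,'b) l2" and s t :: real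
 show "a + b + c = a + (b + c)"
  using rp_add[of "a+b" c] rp_add[of a b] rp_add[of b c] rp_add[of a "b+c"]
  by (intro l2_eqI, eventually_elim) (simp add: add.assoc)
 show "a + b = b + a" by (simp add: plus_l2_def add.commute)
 show "0 + a = a"
  using rp_add[of 0 a] rp_zero by (intro l2_eqI, eventually_elim) simp
 show "- a + a = 0"
  using rp_add[of "-a" a] rp_minus[of a] rp_zero by (intro l2_eqI, eventually_elim) simp
 show "a - b = a + - b"
  using rp_add[of a "-b"] rp_minus[of b] rp_diff[of a b] by (intro l2_eqI, eventually_elim) simp
 show "s *\<^sub>R (a + b) = s *\<^sub>R a + s *\<^sub>R b"
  using rp_scaleR[of s "a+b"] rp_add[of a b] rp_add[of "s *\<^sub>R a" "s *\<^sub>R b"] rp_scaleR[of s a] rp_scaleR[of s b]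
  by (intro l2_eqI, eventually_elim) (simp add: scaleR_add_right)
 show "(s + t) *\<^sub>R a = s *\<^sub>R a + t *\<^sub>R a"
  using rp_scaleR[of "s+t" a] rp_add[of "s *\<^sub>R a" "t *\<^sub>R a"] rp_scaleR[of s a] rp_scaleR[of t a]
  by (intro l2_eqI, eventually_elim) (simp add: scaleR_add_left)
 show "s *\<^sub>R t *\<^sub>R a = (s * t) *\<^sub>R a"
  using rp_scaleR[of s "t *\<^sub>R a"] rp_scaleR[of t a] rp_scaleR[of "s * t" a]
  by (intro l2_eqI, eventually_elim) simp
 show "1 *\<^sub>R a = a"
  using rp_scaleR[of 1 a] by (intro l2_eqI, eventually_elim) simp
qed
end

instantiation l2 :: (euclidean_space, euclidean_space) real_inner
begin
definition inner_l2 :: "('a,'b) l2 => ('a,'b) l2 => real" where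
 "inner_l2 u v = (LINT x|lborel. rp u x \<bullet> rp v x)"
definition norm_l2 :: "('a,'b) l2 => real" where "norm_l2 u = sqrt (u \<bullet> u)"
definition dist_l2 :: "('a,'b) l2 => ('a,'b) l2 => real" where "dist_l2 u v = norm (u - v)"
definition sgn_l2 :: "('a,'b) l2 => ('a,'b) l2" where "sgn_l2 u = u /\<^sub>R norm u"
definition uniformity_l2 :: "(('a,'b) l2 \<times> ('a,'b) l2) filter" where
 "uniformity_l2 = (INF e\<in>{0 <..}. principal {(x, y). dist x y < e})"
definition open_l2 :: "('a,'b) l2 set => bool" where
 "open_l2 U = (\<forall>x\<in>U. eventually (%(x', y). x' = x --> y \<in> U) uniformity)"

instance
proof
 fix a b c :: "('a,'b) l2" and s t :: real
 show "a \<bullet> b = b \<bullet> a" by (simp add: inner_l2_def inner_commute)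
 have "(a + b) \<bullet> c = (LINT x|lborel. rp a x \<bullet> rp c x + rp b x \<bullet> rp c x)"
  unfolding inner_l2_def using rp_add[of a b]
  by (intro integral_cong_AE) (auto elim!: eventually_mono simp: inner_add_left)
 thus "(a + b) \<bullet> c = a \<bullet> c + b \<bullet> c"
  by (simp add: inner_l2_def sqi_inner_integrable)
 have "(s *\<^sub>R a) \<bullet> b = (LINT x|lborel. s * (rp a x \<bullet> rp b x))"
  unfolding inner_l2_def using rp_scaleR[of s a]
  by (intro integral_cong_AE) (auto elim!: eventually_mono)
 thus "(s *\<^sub>R a) \<bullet> b = s * (a \<bullet> b)"
  by (simp add: inner_l2_def)
 show "0 <= a \<bullet> a" by (simp add: inner_l2_def)
 show "(a \<bullet> a = 0) = (a = 0)"
 proof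
  assume "a \<bullet> a = 0"
  hence "AE x in lborel. rp a x \<bullet> rp a x = 0"
   unfolding inner_l2_def
   by (subst (asm) integral_nonneg_eq_0_iff_AE) (auto simp: sqi_inner_integrable)
  thus "a = 0"
   using rp_zero by (intro l2_eqI, eventually_elim) simp
 next
  assume "a = 0"
  have "(LINT x|lborel. rp (0::('a,'b) l2) x \<bullet> rp 0 x) = (LINT (x::'a)|lborel. 0)"
   using rp_zero by (intro integral_cong_AE) (auto elim!: eventually_mono)
  thus "a \<bullet> a = 0" by (simp add: inner_l2_def \<open>a = 0\<close>)
 qed
 show "norm a = sqrt (a \<bullet> a)" by (rule norm_l2_def)
 show "dist a b = norm (a - b)" by (rule dist_l2_def)
 show "sgn a = a /\<^sub>R norm a" by (rule sgn_l2_def)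
 show "uniformity = (INF e\<in>{0 <..}. principal {(x::('a,'b) l2, y). dist x y < e})"
  by (rule uniformity_l2_def)
 show "open U = (\<forall>x\<in>U. eventually (%(x', y). x' = x --> y \<in> U) uniformity)" for U :: "('a,'b) l2 set"
  by (rule open_l2_def)
qed
end

lemma inner_cl: assumes "sqi f" "sqi g" shows "cl f \<bullet> cl g = (LINT x|lborel. f x \<bullet> g x)"
 unfolding inner_l2_def using rp_cl[OF assms(1)] rp_cl[OF assms(2)] sqi_measurable[OF assms(1)] sqi_measurable[OF assms(2)]
 by (intro integral_cong_AE) (auto elim: eventually_elim2)

lemma norm_l2_sq: "(norm u)^2 = (LINT x|lborel. (norm (rp u x))^2)"
 by (simp add: power2_norm_eq_inner inner_l2_def)

lemma norm_cl_sq: assumes "sqi f" shows "(norm (cl f))^2 = (LINT x|lborel. (norm (f x))^2)"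
 using inner_cl[OF assms assms] by (simp add: power2_norm_eq_inner)

lemma cl_add: assumes "sqi f" "sqi g" shows "cl (%x. f x + g x) = cl f + cl g"
 unfolding plus_l2_def using assms rp_cl[OF assms(1)] rp_cl[OF assms(2)]
 by (intro cl_cong) (auto elim: eventually_elim2)

lemma cl_diff: assumes "sqi f" "sqi g" shows "cl (%x. f x - g x) = cl f - cl g"
 unfolding minus_l2_def using assms rp_cl[OF assms(1)] rp_cl[OF assms(2)]
 by (intro cl_cong) (auto elim: eventually_elim2)

lemma cl_scaleR: assumes "sqi f" shows "cl (%x. c *\<^sub>R f x) = c *\<^sub>R cl f"
 unfolding scaleR_l2_def using assms rp_cl[OF assms(1)]
 by (intro cl_cong) (auto elim: eventually_mono)

lemma cl_minus: assumes "sqi f" shows "cl (%x. - f x) = - cl f"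
 using cl_scaleR[OF assms, of "-1"] by simp

lemma cl_zero: "cl (%x. 0) = 0"
 by (simp add: zero_l2_def)

lemma cl_sum: assumes "!!i. i \<in> I ==> sqi (f i)" shows "cl (%x. \<Sum>i\<in>I. f i x) = (\<Sum>i\<in>I. cl (f i))"
 using assms by (induction I rule: infinite_finite_induct) (auto simp: cl_add cl_zero)

lemma norm_cl_le:
 assumes f: "bmeas f" and g: "sqi g" and c: "c >= 0"
  and le: "AE x in lborel. norm (f x) <= c * norm (g x)"
 shows "sqi f" "norm (cl f) <= c * norm (cl g)"
proof -
 show sf: "sqi f" by (rule sqi_dominated[OF f g le])
 have "AE x in lborel. (norm (f x))^2 <= c^2 * (norm (g x))^2"
  using le by eventually_elim (use power_mono[where n=2] in "fastforce simp: power_mult_distrib")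
 hence "(LINT x|lborel. (norm (f x))^2) <= (LINT x|lborel. c^2 * (norm (g x))^2)"
  using sqi_integrable[OF sf] sqi_integrable[OF g] by (intro integral_mono_AE) auto
 hence "(norm (cl f))^2 <= (c * norm (cl g))^2"
  by (simp add: norm_cl_sq sf g power_mult_distrib)
 thus "norm (cl f) <= c * norm (cl g)"
  using c by (meson power2_le_imp_le norm_ge_zero mult_nonneg_nonneg)
qed

text \<open>With d_k the increments, the weight 2^k still leaves the integral of the sum of 2^k
  |d_k|^2 finite. The sum is then finite almost everywhere, and there |d_k| is dominated by a
  geometric sequence of ratio 2^(-1/2).\<close>

lemma l2_Cauchy_AE:
 fixes X :: "nat => ('a::euclidean_space,'b::euclidean_space) l2"
 assumes le: "!!k. norm (X (Suc k) - X k) <= (1/2) ^ k"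
 shows "AE x in lborel. convergent (%k. rp (X k) x)"
proof -
 let ?d = "%k x. rp (X (Suc k) - X k) x"
 have "(\<integral>\<^sup>+x. (\<Sum>k. ennreal (2 ^ k * (norm (?d k x))^2)) \<partial>lborel)
   = (\<Sum>k. (\<integral>\<^sup>+x. ennreal (2 ^ k * (norm (?d k x))^2) \<partial>lborel))"
  by (rule nn_integral_suminf) measurable
 also have "... <= (\<Sum>k. ennreal ((1/2) ^ k))"
 proof (rule suminf_le)
  fix k
  have "(\<integral>\<^sup>+x. ennreal (2 ^ k * (norm (?d k x))^2) \<partial>lborel) = ennreal (LINT x|lborel. 2 ^ k * (norm (?d k x))^2)"
   using sqi_integrable[OF sqi_rp] by (intro nn_integral_eq_integral) auto
  also have "(LINT x|lborel. 2 ^ k * (norm (?d k x))^2) = 2 ^ k * (norm (X (Suc k) - X k))^2"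
   by (simp add: norm_l2_sq)
  also have "... <= 2 ^ k * ((1/2) ^ k)^2"
   using le[of k] by (intro mult_left_mono power_mono) auto
  also have "... = (1/2) ^ k" by (simp add: power2_eq_square power_divide)
  finally show "(\<integral>\<^sup>+x. ennreal (2 ^ k * (norm (?d k x))^2) \<partial>lborel) <= ennreal ((1/2) ^ k)"
   by (simp add: ennreal_leI)
 qed auto
 also have "... < \<infinity>"
  using summable_geometric[of "1/2::real"] by (subst suminf_ennreal2) auto
 finally have "AE x in lborel. (\<Sum>k. ennreal (2 ^ k * (norm (?d k x))^2)) ~= \<infinity>"
  by (intro nn_integral_PInf_AE) auto
 moreover have "AE x in lborel. ALL k. ?d k x = rp (X (Suc k)) x - rp (X k) x"
  unfolding AE_all_countable using rp_diff by blast
 ultimately show ?thesis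
 proof eventually_elim
  case (elim x)
  define s where "s = enn2real (\<Sum>k. ennreal (2 ^ k * (norm (?d k x))^2))"
  have s: "2 ^ k * (norm (?d k x))^2 <= s" for k
  proof -
   have "ennreal (2 ^ k * (norm (?d k x))^2) = (\<Sum>i\<in>{k}. ennreal (2 ^ i * (norm (?d i x))^2))" by simp
   also have "... <= (\<Sum>k. ennreal (2 ^ k * (norm (?d k x))^2))"
    by (intro sum_le_suminf) auto
   also have "... = ennreal s"
    unfolding s_def using elim(1) by (subst ennreal_enn2real) (auto simp: less_top)
   finally show ?thesis by (subst (asm) ennreal_le_iff) (auto simp: s_def)
  qed
  have "norm (?d k x) <= sqrt s * (sqrt (1/2)) ^ k" for k
  proof (rule power2_le_imp_le)
   have "(norm (?d k x))^2 <= s * (1/2)^k" using s[of k] by (simp add: field_simps)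
   moreover have "0 <= s" unfolding s_def by simp
   moreover have "(sqrt (1/2) ^ k)^2 = (1/2::real) ^ k"
    by (subst power_mult[symmetric], subst mult.commute, subst power_mult) simp
   ultimately show "(norm (?d k x))^2 <= (sqrt s * sqrt (1/2) ^ k)^2"
    by (simp add: power_mult_distrib)
  qed (simp add: s_def)
  moreover have "summable (%k. sqrt s * (sqrt (1/2)) ^ k)"
   by (rule summable_mult, rule summable_geometric) simp
  ultimately have "summable (%k. ?d k x)"
   by (rule summable_comparison_test'[where N=0, rotated])
  hence "convergent (%n. \<Sum>k<n. ?d k x)"
   by (simp add: summable_iff_convergent)
  moreover have "(\<Sum>k<n. ?d k x) = rp (X n) x - rp (X 0) x" for n
   using elim(2) sum_lessThan_telescope[of "%k. rp (X k) x" n] by simp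
  ultimately have "convergent (%n. rp (X n) x - rp (X 0) x)" by simp
  from convergent_add[OF this convergent_const[of "rp (X 0) x"]] show ?case by simp
 qed
qed

instance l2 :: (euclidean_space, euclidean_space) complete_space
proof
 fix X :: "nat => ('a,'b) l2" assume C: "Cauchy X"
 have "EX N. \<forall>m\<ge>N. \<forall>n\<ge>N. norm (X m - X n) < (1/2)^k" for k
  using C[unfolded Cauchy_def] by (simp add: dist_norm)
 then obtain N where N: "!!k m n. m >= N k ==> n >= N k ==> norm (X m - X n) < (1/2)^k"
  by metis
 \<comment> \<open>Strictly increasing with \<open>r k >= N k\<close>, so that consecutive terms
   along \<open>r\<close> are within 2^-k.\<close>
 define r where "r = rec_nat (N 0) (%k m. Suc (max m (N (Suc k))))"
 have r_Suc: "r (Suc k) = Suc (max (r k) (N (Suc k)))" for k by (simp add: r_def)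
 have r_N: "r k >= N k" for k by (cases k) (auto simp: r_def)
 have smr: "strict_mono r" by (rule strict_monoI_Suc) (simp add: r_Suc)
 define Y where "Y = X \<circ> r"
 have YS: "norm (Y (Suc k) - Y k) <= (1/2)^k" for k
  using N[of k "r (Suc k)" "r k"] r_N[of k] strict_mono_less[OF smr, of k "Suc k"] by (simp add: Y_def)
 note conv = l2_Cauchy_AE[OF YS]
 define f where "f x = lim (%k. rp (Y k) x)" for x
 have f_meas [measurable]: "bmeas f"
  unfolding f_def by (rule borel_measurable_lim_metric) simp
 have lim: "AE x in lborel. (%k. rp (Y k) x) \<longlonglongrightarrow> f x"
  using conv by eventually_elim (simp add: f_def convergent_LIMSEQ_iff)
 \<comment> \<open>Fatou's lemma: the distance from \<open>Y k\<close> to the pointwise limit is at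
   most the liminf of its distances to the later \<open>Y n\<close>.\<close>
 have est: "(\<integral>\<^sup>+x. ennreal ((norm (f x - rp (Y k) x))^2) \<partial>lborel) <= ennreal (((1/2)^k)^2)" for k
 proof -
  have "(\<integral>\<^sup>+x. ennreal ((norm (f x - rp (Y k) x))^2) \<partial>lborel)
    = (\<integral>\<^sup>+x. liminf (%n. ennreal ((norm (rp (Y n) x - rp (Y k) x))^2)) \<partial>lborel)"
  proof (rule nn_integral_cong_AE, use lim in eventually_elim)
   case (elim x)
   have "(%n. ennreal ((norm (rp (Y n) x - rp (Y k) x))^2)) \<longlonglongrightarrow> ennreal ((norm (f x - rp (Y k) x))^2)"
    using elim by (intro tendsto_intros) auto
   thus ?case by (intro lim_imp_Liminf[symmetric]) auto
  qed
  also have "... <= liminf (%n. \<integral>\<^sup>+x. ennreal ((norm (rp (Y n) x - rp (Y k) x))^2) \<partial>lborel)"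
   by (rule nn_integral_liminf) measurable
  also have "... <= ennreal (((1/2)^k)^2)"
  proof (rule Liminf_le)
   show "\<forall>\<^sub>F n in sequentially. (\<integral>\<^sup>+x. ennreal ((norm (rp (Y n) x - rp (Y k) x))^2) \<partial>lborel) <= ennreal (((1/2)^k)^2)"
    using eventually_ge_at_top[of k]
   proof eventually_elim
    case (elim n)
    have "(\<integral>\<^sup>+x. ennreal ((norm (rp (Y n) x - rp (Y k) x))^2) \<partial>lborel)
      = ennreal (LINT x|lborel. (norm (rp (Y n) x - rp (Y k) x))^2)"
     by (intro nn_integral_eq_integral sqi_integrable) auto
    also have "... = ennreal ((norm (Y n - Y k))^2)"
     by (subst norm_cl_sq[symmetric]) (auto simp: cl_diff)
    also have "... <= ennreal (((1/2)^k)^2)"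
    proof -
     have "r k <= r n" using elim smr by (simp add: strict_mono_less_eq)
     hence "norm (Y n - Y k) < (1/2)^k"
      using N[of k "r n" "r k"] r_N[of k] by (simp add: Y_def)
     thus ?thesis by (intro ennreal_leI power_mono) auto
    qed
    finally show ?case .
   qed
  qed simp
  finally show ?thesis .
 qed
 have sq: "sqi (%x. f x - rp (Y k) x)" for k
  unfolding sqi_def
 proof
  show "integrable lborel (%x. (norm (f x - rp (Y k) x))^2)"
   using est[of k] by (intro integrableI_bounded) (auto intro: le_less_trans simp: power2_eq_square)
 qed measurable
 have sf: "sqi f" using sqi_add[OF sq[of 0] sqi_rp[of "Y 0"]] by simp
 have nY: "norm (Y k - cl f) <= (1/2)^k" for k
 proof -
  have "ennreal ((norm (cl f - Y k))^2) <= ennreal (((1/2)^k)^2)"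
   using est[of k] nn_integral_eq_integral[OF sqi_integrable[OF sq[of k]]] norm_cl_sq[OF sq[of k]]
   by (simp add: cl_diff sf)
  hence "(norm (cl f - Y k))^2 <= ((1/2)^k)^2"
   by (subst (asm) ennreal_le_iff) simp_all
  hence "norm (cl f - Y k) <= (1/2)^k"
   by (rule power2_le_imp_le) simp
  thus ?thesis by (simp add: norm_minus_commute)
 qed
 have "X \<longlonglongrightarrow> cl f"
 proof (rule Cauchy_converges_subseq[OF C smr])
  have "(%k. (1/2::real)^k) \<longlonglongrightarrow> 0" by (intro LIMSEQ_power_zero) simp
  thus "(X \<circ> r) \<longlonglongrightarrow> cl f"
   unfolding Y_def[symmetric]
   by (rule LIM_zero_cancel[OF Lim_null_comparison[OF always_eventually[OF allI[OF nY]]]])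
 qed
 thus "convergent X" by (auto simp: convergent_def)
qed

instance l2 :: (euclidean_space, euclidean_space) banach ..

section \<open>Hilbert space and ODE tools\<close>

text \<open>A sequence in the unit ball along which \<open>l\<close> tends to its norm
  \<open>c\<close> is Cauchy by the parallelogram identity; its limit \<open>v\<close> is a unit
  vector with l v = c. Comparing \<open>l\<close> at v + t x with its bound for all t then forces
  \<open>l\<close> to be the pairing with c v.\<close>

lemma riesz_representation:
 fixes l :: "'h::{real_inner,complete_space} => real"
 assumes "bounded_linear l"
 shows "EX v. ALL x. l x = v \<bullet> x"
proof (cases "ALL x. l x = 0")
 case True
 thus ?thesis by (intro exI[of _ 0]) simp
next
 case False
 interpret bounded_linear l by fact
 define c where "c = onorm l"
 have le: "\<bar>l x\<bar> <= c * norm x" for x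
  using onorm[OF assms, of x] by (simp add: c_def)
 have c0: "c > 0" using False onorm_pos_lt[OF assms] by (auto simp: c_def)
 have "EX x. norm x <= 1 & l x > c * (1 - 1 / real (k + 2))" for k :: nat
 proof (rule ccontr)
  assume "\<not> ?thesis"
  hence *: "!!x. norm x <= 1 ==> l x <= c * (1 - 1 / real (k + 2))" by force
  have "norm (l x) <= (c * (1 - 1 / real (k + 2))) * norm x" for x
  proof (cases "x = 0")
   case False
   have "l (sgn x) <= c * (1 - 1 / real (k + 2))" "l (- sgn x) <= c * (1 - 1 / real (k + 2))"
    using *[of "sgn x"] *[of "- sgn x"] by (auto simp: norm_sgn)
   hence "\<bar>l (sgn x)\<bar> <= c * (1 - 1 / real (k + 2))" by (simp add: neg)
   moreover have "l x = norm x * l (sgn x)"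
    using False by (simp add: sgn_div_norm scaleR)
   ultimately show ?thesis
    by (simp add: abs_mult mult.commute[of _ "norm x"] mult_left_mono del: of_nat_add)
  qed (simp add: zero)
  hence "onorm l <= c * (1 - 1 / real (k + 2))"
   using c0 by (intro onorm_bound) (auto simp: field_simps)
  hence "c <= c * (1 - 1 / real (k + 2))" by (simp add: c_def)
  thus False using c0 by (simp add: field_simps)
 qed
 then obtain X where X: "!!k::nat. norm (X k) <= 1" "!!k::nat. l (X k) > c * (1 - 1 / real (k + 2))"
  by metis
 have lim1: "(%k::nat. c * (1 - 1 / real (k + 2))) \<longlonglongrightarrow> c * (1 - 0)"
 proof -
  have "(%k::nat. 1 / real (k + 2)) \<longlonglongrightarrow> 0"
   using LIMSEQ_ignore_initial_segment[OF lim_1_over_n, of 2] by simp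
  from tendsto_mult[OF tendsto_const tendsto_diff[OF tendsto_const this]] show ?thesis .
 qed
 have "Cauchy X"
 proof (rule metric_CauchyI)
  fix e :: real assume e: "e > 0"
  obtain N :: nat where N: "8 / e^2 < N" using reals_Archimedean2 by blast
  show "EX M. \<forall>m\<ge>M. \<forall>n\<ge>M. dist (X m) (X n) < e"
  proof (intro exI allI impI)
   fix m n assume mn: "m >= N" "n >= N"
   have N0: "N > 0"
   proof (rule ccontr)
    assume "\<not> N > 0" hence "8 / e^2 < 0" using N by simp
    thus False using e by (simp add: divide_less_0_iff)
   qed
   define q where "q = 1 / real N"
   have q: "0 < q" "q < e^2 / 8" "q <= 1" using N N0 e by (auto simp: q_def field_simps)
   have lb: "l (X i) > c * (1 - q)" if "i >= N" for i
   proof -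
    have "1 / real (i + 2) <= q" using that N0 by (simp add: q_def field_simps)
    hence "c * (1 - q) <= c * (1 - 1 / real (i + 2))" using c0 by (intro mult_left_mono) auto
    thus ?thesis using X(2)[of i] by simp
   qed
   have "2 * (c * (1 - q)) <= l (X m + X n)" using lb[OF mn(1)] lb[OF mn(2)] by (simp add: add)
   also have "... <= c * norm (X m + X n)" using le[of "X m + X n"] by simp
   finally have "c * (2 * (1 - q)) <= c * norm (X m + X n)" by (simp add: mult.left_commute)
   hence "2 * (1 - q) <= norm (X m + X n)" using c0 by (simp only: mult_le_cancel_left_pos)
   hence "(2 * (1 - q))^2 <= (norm (X m + X n))^2"
    using q by (intro power_mono) auto
   moreover have "(norm (X m - X n))^2 = 2 * (norm (X m))^2 + 2 * (norm (X n))^2 - (norm (X m + X n))^2"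
    by (simp add: power2_norm_eq_inner inner_add inner_diff inner_commute)
   moreover have "(norm (X m))^2 <= 1" "(norm (X n))^2 <= 1"
    using X(1) by (auto simp: power_le_one)
   moreover have "(2 * (1 - q))^2 = 4 - 8 * q + 4 * q^2" by (simp add: power2_eq_square algebra_simps)
   ultimately have "(norm (X m - X n))^2 <= 8 * q - 4 * q^2" by linarith
   also have "... <= 8 * q" by simp
   also have "... < e^2" using q by simp
   finally show "dist (X m) (X n) < e" using e by (simp add: dist_norm power2_less_imp_less)
  qed
 qed
 then obtain v where v: "X \<longlonglongrightarrow> v" using Cauchy_convergent_iff convergentD by blast
 have nv: "norm v <= 1" using tendsto_norm[OF v] X(1) by (intro LIMSEQ_le_const2) auto
 have "(%k. l (X k)) \<longlonglongrightarrow> l v" by (rule tendsto[OF v])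
 hence "c <= l v" using lim1 X(2) by (intro LIMSEQ_le[of "%k::nat. c * (1 - 1 / real (k + 2))"]) (auto intro: less_imp_le)
 moreover have "l v <= c * norm v" using le[of v] by simp
 moreover from calculation have "1 <= norm v" using c0 by (smt (verit) mult_less_cancel_left2)
 ultimately have nv1: "norm v = 1" "l v = c"
  using nv by auto
 have "l x = (c *\<^sub>R v) \<bullet> x" for x
 proof -
  define d where "d = l x - c * (v \<bullet> x)"
  have key: "2 * c * t * d <= t^2 * (c^2 * (norm x)^2)" for t
  proof -
   have "(l (v + t *\<^sub>R x))^2 <= (c * norm (v + t *\<^sub>R x))^2"
    using le by (metis abs_ge_zero power2_abs power_mono)
   moreover have "l (v + t *\<^sub>R x) = c + t * l x" by (simp add: add scaleR nv1)
   moreover have "(norm (v + t *\<^sub>R x))^2 = 1 + 2 * t * (v \<bullet> x) + t^2 * (norm x)^2"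
   proof -
    have "v \<bullet> v = 1" using nv1(1) by (simp add: norm_eq_1)
    thus ?thesis unfolding power2_norm_eq_inner
     by (simp add: inner_add_left inner_add_right inner_commute[of x v] power2_eq_square algebra_simps)
   qed
   ultimately have "(c + t * l x)^2 <= c^2 * (1 + 2 * t * (v \<bullet> x) + t^2 * (norm x)^2)"
    by (simp add: power_mult_distrib)
   moreover have "0 <= (t * l x)^2" by simp
   ultimately show ?thesis
    unfolding d_def by (simp add: power2_sum algebra_simps power2_eq_square)
  qed
  have "d = 0"
  proof (rule ccontr)
   assume "d ~= 0"
   \<comment> \<open>In \<open>key\<close> the left side is linear in t and the right side
     quadratic, so t = c d / K violates it unless d = 0. The added 1 keeps \<open>K\<close>
     positive.\<close>
   define K where "K = c^2 * (norm x)^2 + 1"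
   have "K > 0" by (auto simp: K_def add_nonneg_pos)
   have "2 * c * (c * d / K) * d <= (c * d / K)^2 * (c^2 * (norm x)^2)" by (rule key)
   also have "... <= (c * d / K)^2 * K" by (intro mult_left_mono) (auto simp: K_def)
   also have "... = (c * d)^2 / K" using \<open>K > 0\<close> by (simp add: power2_eq_square)
   also have "2 * c * (c * d / K) * d = 2 * ((c * d)^2 / K)" by (simp add: power2_eq_square)
   finally have "(c * d)^2 / K <= 0" by simp
   moreover have "(c * d)^2 / K > 0" using \<open>d ~= 0\<close> c0 \<open>K > 0\<close> by simp
   ultimately show False by simp
  qed
  thus ?thesis by (simp add: d_def)
 qed
 thus ?thesis by blast
qed

text \<open>The uniform bound carries convergence of the pairings from a dense set to all vectors,
  and Riesz represents the limit functional. No subsequence is extracted: in the applications,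
  convergence on the dense set follows from strong convergence in a weaker norm.\<close>

lemma weak_limit_exists:
 fixes v :: "nat => 'h::{real_inner,complete_space}"
 assumes bd: "!!k. norm (v k) <= M"
  and dense: "!!x e. e > 0 ==> \<exists>d\<in>D. norm (x - d) < e"
  and conv: "!!d. d \<in> D ==> convergent (%k. v k \<bullet> d)"
 shows "EX w. norm w <= M & (ALL x. (%k. v k \<bullet> x) \<longlonglongrightarrow> w \<bullet> x)"
proof -
 have M0: "M >= 0" using bd[of 0] norm_ge_zero order_trans by blast
 have cv: "convergent (%k. v k \<bullet> x)" for x
  unfolding Cauchy_convergent_iff[symmetric]
 proof (rule metric_CauchyI)
  fix e :: real assume e: "e > 0"
  define q where "q = e / 3 / (M + 1)"
  have q: "(M + 1) * q = e / 3" "q > 0"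
   unfolding q_def using M0 e by (subst times_divide_eq_right, subst nonzero_mult_div_cancel_left, auto intro!: divide_pos_pos)
  obtain d where d: "d \<in> D" "norm (x - d) < q"
   using dense[OF q(2)] by blast
  have "Cauchy (%k. v k \<bullet> d)" using conv[OF d(1)] by (simp add: Cauchy_convergent_iff)
  then obtain N where N: "!!m n. m >= N ==> n >= N ==> dist (v m \<bullet> d) (v n \<bullet> d) < e / 3"
   using e unfolding Cauchy_def by (metis divide_pos_pos zero_less_numeral)
  have sm: "\<bar>v k \<bullet> (x - d)\<bar> <= e / 3" for k
  proof -
   have "\<bar>v k \<bullet> (x - d)\<bar> <= norm (v k) * norm (x - d)" by (rule Cauchy_Schwarz_ineq2)
   also have "... <= (M + 1) * q"
    using bd[of k] d(2) M0 by (intro mult_mono) auto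
   also have "... = e / 3" by (rule q(1))
   finally show ?thesis .
  qed
  show "EX N. \<forall>m\<ge>N. \<forall>n\<ge>N. dist (v m \<bullet> x) (v n \<bullet> x) < e"
  proof (intro exI allI impI)
   fix m n assume "m >= N" "n >= N"
   note this = N[OF this] sm[of m] sm[of n]
   moreover have "v m \<bullet> x - v n \<bullet> x = (v m \<bullet> d - v n \<bullet> d) + v m \<bullet> (x - d) - v n \<bullet> (x - d)"
    by (simp add: inner_diff_right)
   ultimately show "dist (v m \<bullet> x) (v n \<bullet> x) < e"
    unfolding dist_real_def by linarith
  qed
 qed
 define l where "l x = lim (%k. v k \<bullet> x)" for x
 have lim: "(%k. v k \<bullet> x) \<longlonglongrightarrow> l x" for x
  using cv[of x] by (simp add: l_def convergent_LIMSEQ_iff)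
 have bl: "\<bar>l x\<bar> <= norm x * M" for x
 proof (rule LIMSEQ_le_const2[OF tendsto_rabs[OF lim]])
  have "\<bar>v k \<bullet> x\<bar> <= norm x * M" for k
   using Cauchy_Schwarz_ineq2[of "v k" x] mult_right_mono[OF bd[of k], of "norm x"]
   by (simp add: mult.commute)
  thus "EX N. \<forall>n\<ge>N. \<bar>v n \<bullet> x\<bar> <= norm x * M" by blast
 qed
 have "bounded_linear l"
 proof (rule bounded_linear_intro)
  show "l (x + y) = l x + l y" for x y
   using tendsto_add[OF lim[of x] lim[of y]] lim[of "x + y"] LIMSEQ_unique
   by (fastforce simp: inner_add_right)
  show "l (r *\<^sub>R x) = r *\<^sub>R l x" for r x
   using tendsto_mult_left[OF lim[of x], of r] lim[of "r *\<^sub>R x"] LIMSEQ_unique by fastforce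
  show "norm (l x) <= norm x * M" for x using bl by simp
 qed
 then obtain w where w: "!!x. l x = w \<bullet> x" using riesz_representation by blast
 have "norm w <= M"
 proof (cases "w = 0")
  case False
  have "norm w * norm w <= norm w * M" using bl[of w] w by (simp add: power2_norm_eq_inner[symmetric] power2_eq_square)
  thus ?thesis using False by simp
 qed (simp add: M0)
 thus ?thesis using lim w by metis
qed

text \<open>The equation V' = f paired with one vector. \<open>solves_ivp\<close> provides it for
  test functions only; the next lemmas extend it to every vector of the space.\<close>

definition weak_deriv_on ::
 "real => (real => 'h::real_inner) => (real => 'h) => 'h => bool" where
 "weak_deriv_on T V f \<psi> \<longleftrightarrow>
  (\<forall>t\<in>{0..T}. ((%s. V s \<bullet> \<psi>) has_real_derivative f t \<bullet> \<psi>) (at t within {0..T}))"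

text \<open>For d in the dense set the mean value inequality bounds the increment of the pairing
  with d by K |s - t| norm d; density and duality turn this into a bound of the norm.\<close>

lemma weak_deriv_lipschitz:
 fixes V f :: "real => 'h::real_inner"
 assumes dense: "!!x e. e > 0 ==> \<exists>d\<in>D. norm (x - d) < e"
  and wd: "!!d. d \<in> D ==> weak_deriv_on T V f d"
  and bd: "!!t. t \<in> {0..T} ==> norm (f t) <= K"
  and st: "s \<in> {0..T}" "t \<in> {0..T}"
 shows "norm (V s - V t) <= K * \<bar>s - t\<bar>"
proof -
 have K0: "K >= 0" using bd[OF st(1)] norm_ge_zero order_trans by blast
 have d_le: "\<bar>(V s - V t) \<bullet> d\<bar> <= K * \<bar>s - t\<bar> * norm d" if "d \<in> D" for d
 proof -
  have "norm (V s \<bullet> d - V t \<bullet> d) <= (K * norm d) * norm (s - t)"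
  proof (rule field_differentiable_bound[where S="{0..T}" and f'="%t. f t \<bullet> d"])
   show "((%s. V s \<bullet> d) has_field_derivative f z \<bullet> d) (at z within {0..T})" if "z \<in> {0..T}" for z
    using wd[OF \<open>d \<in> D\<close>] that by (auto simp: weak_deriv_on_def)
   show "norm (f z \<bullet> d) <= K * norm d" if "z \<in> {0..T}" for z
    using Cauchy_Schwarz_ineq2[of "f z" d] mult_right_mono[OF bd[OF that], of "norm d"] by simp
  qed (use st in auto)
  thus ?thesis by (simp add: inner_diff_left mult_ac)
 qed
 have "\<bar>(V s - V t) \<bullet> x\<bar> <= K * \<bar>s - t\<bar> * norm x" for x
 proof (rule field_le_epsilon)
  fix e :: real assume e: "e > 0"
  define q where "q = norm (V s - V t) + K * \<bar>s - t\<bar> + 1"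
  have q: "q > 0" using K0 by (auto simp: q_def intro!: add_nonneg_pos)
  obtain d where d: "d \<in> D" "norm (x - d) < e / q" using dense[of "e / q" x] e q by auto
  have "(V s - V t) \<bullet> x = (V s - V t) \<bullet> d + (V s - V t) \<bullet> (x - d)" by (simp add: inner_diff_right)
  hence "\<bar>(V s - V t) \<bullet> x\<bar> <= \<bar>(V s - V t) \<bullet> d\<bar> + \<bar>(V s - V t) \<bullet> (x - d)\<bar>" by linarith
  also have "... <= K * \<bar>s - t\<bar> * norm d + norm (V s - V t) * norm (x - d)"
   using d_le[OF d(1)] Cauchy_Schwarz_ineq2 by (intro add_mono) auto
  also have "norm d <= norm x + norm (x - d)" by (metis add.commute norm_triangle_sub norm_minus_commute)
  hence "K * \<bar>s - t\<bar> * norm d <= K * \<bar>s - t\<bar> * (norm x + norm (x - d))"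
   using K0 by (intro mult_left_mono) auto
  also have "K * \<bar>s - t\<bar> * (norm x + norm (x - d)) + norm (V s - V t) * norm (x - d)
    <= K * \<bar>s - t\<bar> * norm x + q * norm (x - d)"
   by (simp add: q_def algebra_simps)
  also have "q * norm (x - d) <= q * (e / q)" using d q by (intro mult_left_mono) auto
  finally show "\<bar>(V s - V t) \<bullet> x\<bar> <= K * \<bar>s - t\<bar> * norm x + e" using q by simp
 qed
 from this[of "V s - V t"]
 have "norm (V s - V t) * norm (V s - V t) <= K * \<bar>s - t\<bar> * norm (V s - V t)"
  by (simp add: power2_norm_eq_inner[symmetric] power2_eq_square)
 thus ?thesis using K0 by (cases "V s = V t") auto
qed

text \<open>Since \<open>V\<close> is Lipschitz, replacing \<psi> by a nearby d changes every
  difference quotient by at most \<open>K\<close> times their distance, uniformly in s.\<close>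

lemma weak_deriv_dense:
 fixes V f :: "real => 'h::real_inner"
 assumes dense: "!!x e. e > 0 ==> \<exists>d\<in>D. norm (x - d) < e"
  and wd: "!!d. d \<in> D ==> weak_deriv_on T V f d"
  and bd: "!!t. t \<in> {0..T} ==> norm (f t) <= K"
 shows "weak_deriv_on T V f \<psi>"
 unfolding weak_deriv_on_def has_field_derivative_iff
proof (intro ballI tendstoI)
 fix t e :: real assume t: "t \<in> {0..T}" and e: "e > 0"
 have K0: "K >= 0" using bd[OF t] norm_ge_zero order_trans by blast
 define q where "q = e / 4 / (K + 1)"
 have q: "(K + 1) * q = e / 4" "q > 0"
  unfolding q_def using K0 e by (subst times_divide_eq_right, subst nonzero_mult_div_cancel_left, auto intro!: divide_pos_pos)
 obtain d where d: "d \<in> D" "norm (\<psi> - d) < q"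
  using dense[OF q(2)] by blast
 have Kd: "K * norm (\<psi> - d) <= e / 4"
  unfolding q(1)[symmetric] using d K0 by (intro mult_mono) auto
 have "((%s. (V s \<bullet> d - V t \<bullet> d) / (s - t)) \<longlongrightarrow> f t \<bullet> d) (at t within {0..T})"
  using wd[OF d(1)] t by (auto simp: weak_deriv_on_def has_field_derivative_iff)
 from tendstoD[OF this, of "e/4"] e
 have "\<forall>\<^sub>F s in at t within {0..T}. dist ((V s \<bullet> d - V t \<bullet> d) / (s - t)) (f t \<bullet> d) < e / 4" by simp
 moreover have "\<forall>\<^sub>F s in at t within {0..T}. s \<in> {0..T} & s ~= t"
  by (auto simp: eventually_at_filter)
 ultimately show "\<forall>\<^sub>F s in at t within {0..T}. dist ((V s \<bullet> \<psi> - V t \<bullet> \<psi>) / (s - t)) (f t \<bullet> \<psi>) < e"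
 proof eventually_elim
  case (elim s)
  have "\<bar>(V s - V t) \<bullet> (\<psi> - d) / (s - t)\<bar> <= e / 4"
  proof -
   have "\<bar>(V s - V t) \<bullet> (\<psi> - d)\<bar> <= norm (V s - V t) * norm (\<psi> - d)" by (rule Cauchy_Schwarz_ineq2)
   also have "... <= (K * \<bar>s - t\<bar>) * norm (\<psi> - d)"
    using weak_deriv_lipschitz[OF dense wd bd, of s t] elim t by (intro mult_right_mono) auto
   also have "... <= \<bar>s - t\<bar> * (e / 4)" using mult_left_mono[OF Kd, of "\<bar>s - t\<bar>"] by (simp add: mult_ac)
   finally show ?thesis using elim by (simp add: abs_divide divide_le_eq mult.commute)
  qed
  moreover have "\<bar>f t \<bullet> (\<psi> - d)\<bar> <= e / 4"
   using Cauchy_Schwarz_ineq2[of "f t" "\<psi> - d"] mult_right_mono[OF bd[OF t], of "norm (\<psi> - d)"] Kd by simp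
  moreover have "(V s \<bullet> \<psi> - V t \<bullet> \<psi>) / (s - t) - f t \<bullet> \<psi>
   = ((V s \<bullet> d - V t \<bullet> d) / (s - t) - f t \<bullet> d) + (V s - V t) \<bullet> (\<psi> - d) / (s - t) - f t \<bullet> (\<psi> - d)"
   by (simp add: inner_diff_left inner_diff_right diff_divide_distrib)
  ultimately show ?case using elim e unfolding dist_real_def by linarith
 qed
qed

text \<open>Weak differentiability is enough for the square of the norm: |V s|^2 - |V t|^2 = 2 <V s
  - V t, V t> + |V s - V t|^2, and the last term is of second order because \<open>V\<close> is
  Lipschitz.\<close>

lemma weak_deriv_norm_sq:
 fixes V f :: "real => 'h::real_inner"
 assumes wd: "!!\<psi>. weak_deriv_on T V f \<psi>"
  and bd: "!!t. t \<in> {0..T} ==> norm (f t) <= K" and t: "t \<in> {0..T}"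
 shows "((%s. (norm (V s))^2) has_real_derivative 2 * (f t \<bullet> V t)) (at t within {0..T})"
proof -
 have dense: "!!x e. e > 0 ==> \<exists>d\<in>UNIV. norm (x - d :: 'h) < e"
  by (rule_tac x=x in bexI) auto
 have lip: "norm (V s - V t) <= K * \<bar>s - t\<bar>" if "s \<in> {0..T}" for s
  using weak_deriv_lipschitz[OF dense wd bd that t] by simp
 have "((%s. (V s \<bullet> V t - V t \<bullet> V t) / (s - t)) \<longlongrightarrow> f t \<bullet> V t) (at t within {0..T})"
  using wd[of "V t"] t by (auto simp: weak_deriv_on_def has_field_derivative_iff)
 hence 1: "((%s. 2 * ((V s \<bullet> V t - V t \<bullet> V t) / (s - t))) \<longlongrightarrow> 2 * (f t \<bullet> V t)) (at t within {0..T})"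
  by (intro tendsto_intros)
 have 2: "((%s. (norm (V s - V t))^2 / (s - t)) \<longlongrightarrow> 0) (at t within {0..T})"
 proof (rule Lim_null_comparison)
  show "\<forall>\<^sub>F s in at t within {0..T}. norm ((norm (V s - V t))^2 / (s - t)) <= K^2 * \<bar>s - t\<bar>"
   unfolding eventually_at_filter
  proof (intro always_eventually allI impI)
   fix s assume s: "s ~= t" "s \<in> {0..T}"
   have "(norm (V s - V t))^2 <= (K * \<bar>s - t\<bar>)^2" using lip[OF s(2)] by (intro power_mono) auto
   also have "... = (K^2 * \<bar>s - t\<bar>) * \<bar>s - t\<bar>" by (simp add: power2_eq_square)
   finally show "norm ((norm (V s - V t))^2 / (s - t)) <= K^2 * \<bar>s - t\<bar>"
    using s by (simp add: abs_divide divide_le_eq)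
  qed
  show "((%s. K^2 * \<bar>s - t\<bar>) \<longlongrightarrow> 0) (at t within {0..T})"
   by (auto intro!: tendsto_eq_intros)
 qed
 have "((%s. 2 * ((V s \<bullet> V t - V t \<bullet> V t) / (s - t)) + (norm (V s - V t))^2 / (s - t)) \<longlongrightarrow> 2 * (f t \<bullet> V t) + 0) (at t within {0..T})"
  by (rule tendsto_add[OF 1 2])
 moreover have "2 * ((V s \<bullet> V t - V t \<bullet> V t) / (s - t)) + (norm (V s - V t))^2 / (s - t) = ((norm (V s))^2 - (norm (V t))^2) / (s - t)" for s
  by (simp add: power2_norm_eq_inner inner_diff inner_commute add_divide_distrib[symmetric] diff_divide_distrib[symmetric])
 ultimately show ?thesis by (simp add: has_field_derivative_iff)
qed

section \<open>Differential inequalities and ordinary differential equations in Banach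
  spaces\<close>

lemma nonincreasing_within:
 fixes g g' :: "real => real"
 assumes der: "!!t. t \<in> {0..T} ==> (g has_real_derivative g' t) (at t within {0..T})"
  and le: "!!t. t \<in> {0..T} ==> g' t <= 0" and t: "t \<in> {0..T}"
 shows "g t <= g 0"
proof (rule DERIV_nonpos_imp_decreasing_open[of 0 t g])
 show "EX y. (g has_real_derivative y) (at x) & y <= 0" if "0 < x" "x < t" for x
  using der[of x] le[of x] that t by (auto simp: at_within_Icc_at)
 have "continuous_on {0..T} g"
  by (auto simp: continuous_on_eq_continuous_within intro!: DERIV_continuous[OF der])
 thus "continuous_on {0..t} g" by (rule continuous_on_subset) (use t in auto)
qed (use t in auto)

lemma gronwall:
 fixes y y' :: "real => real"
 assumes der: "!!t. t \<in> {0..T} ==> (y has_real_derivative y' t) (at t within {0..T})"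
  and le: "!!t. t \<in> {0..T} ==> y' t <= C * y t + b" and "C >= 0" "b >= 0" and t: "t \<in> {0..T}"
 shows "y t <= exp (C * t) * (y 0 + b * t)"
proof -
 let ?g = "%s. exp (- (C * s)) * y s - b * s"
 let ?g' = "%s. exp (- (C * s)) * y' s - C * exp (- (C * s)) * y s - b"
 have "?g t <= ?g 0"
 proof (rule nonincreasing_within[OF _ _ t])
  fix s assume s: "s \<in> {0..T}"
  show "(?g has_real_derivative ?g' s) (at s within {0..T})"
   using der[OF s] by (auto intro!: derivative_eq_intros)
  have "exp (- (C * s)) * (y' s - C * y s) <= exp (- (C * s)) * b"
   using le[OF s] by (intro mult_left_mono) auto
  also have "... <= 1 * b" using \<open>C >= 0\<close> \<open>b >= 0\<close> s by (intro mult_right_mono) auto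
  finally show "?g' s <= 0" by (simp add: algebra_simps)
 qed
 hence "exp (- (C * t)) * y t <= y 0 + b * t" by simp
 hence "exp (C * t) * (exp (- (C * t)) * y t) <= exp (C * t) * (y 0 + b * t)" by (intro mult_left_mono) auto
 moreover have "exp (C * t) * (exp (- (C * t)) * y t) = y t"
  by (metis exp_minus_inverse mult.assoc mult_1)
 ultimately show ?thesis by simp
qed

text \<open>Continuity argument: the bound of y' is known only where y <= b. Up to the first time at
  which y reaches b it has been in force, which gives y <= y 0 + c T < b at that time, a
  contradiction.\<close>

lemma riccati_bound:
 fixes y y' :: "real => real"
 assumes der: "!!t. t \<in> {0..T} ==> (y has_real_derivative y' t) (at t within {0..T})"
  and le: "!!t. t \<in> {0..T} ==> y t <= b ==> y' t <= c"
  and c: "c >= 0" and small: "y 0 + c * T < b" and t: "t \<in> {0..T}"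
 shows "y t <= y 0 + c * t"
proof -
 have cont: "continuous_on {0..T} y"
  by (auto simp: continuous_on_eq_continuous_within intro!: DERIV_continuous[OF der])
 have grow: "y s <= y 0 + c * s" if s: "s \<in> {0..T}" and bd: "!!r. r \<in> {0..s} ==> y r <= b" for s
 proof -
  have "(%r. y r - c * r) s <= (%r. y r - c * r) 0"
  proof (rule nonincreasing_within[where T=s])
   fix r assume r: "r \<in> {0..s}"
   have "(y has_real_derivative y' r) (at r within {0..s})"
    using der[of r] r s by (auto intro: DERIV_subset)
   thus "((%r. y r - c * r) has_real_derivative (y' r - c)) (at r within {0..s})"
    by (auto intro!: derivative_eq_intros)
   show "y' r - c <= 0" using le[of r] bd[of r] r s by auto
  qed (use s in auto)
  thus ?thesis by simp
 qed
 have lt: "\<forall>s\<in>{0..T}. y s < b"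
 proof (rule ccontr)
  assume nl: "\<not> ?thesis"
  define S where "S = {0..T} \<inter> y -` {b..}"
  have "S ~= {}" using nl by (auto simp: S_def not_less)
  moreover have "closed S" unfolding S_def by (rule continuous_closed_preimage[OF cont]) auto
  moreover have "bounded S" by (rule bounded_subset[of "{0..T}"]) (auto simp: S_def)
  ultimately have S: "compact S" "S ~= {}" by (auto simp: compact_eq_bounded_closed)
  obtain s where s: "s \<in> S" "!!r. r \<in> S ==> s <= r"
   using compact_attains_inf[OF S] by auto
  have "y s = b"
  proof (rule ccontr)
   assume "y s ~= b"
   hence gt: "y s > b" using s by (auto simp: S_def)
   have "s \<in> {0..T}" using s by (auto simp: S_def)
   have "0 <= c * T" using c t by (intro mult_nonneg_nonneg) auto
   hence "y 0 <= b" using small by linarith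
   have "\<exists>r\<ge>0. r <= s & y r = b"
    using gt \<open>y 0 <= b\<close> \<open>s \<in> {0..T}\<close> by (intro IVT') (auto intro: continuous_on_subset[OF cont])
   then obtain r where r: "0 <= r" "r <= s" "y r = b" by blast
   hence "r \<in> S" using \<open>s \<in> {0..T}\<close> by (auto simp: S_def)
   hence "r = s" using s(2)[of r] r by simp
   thus False using r gt by simp
  qed
  have s': "s \<in> {0..T}" using s by (auto simp: S_def)
  have "y s <= y 0 + c * s"
  proof (rule grow[OF s'])
   fix r assume r: "r \<in> {0..s}"
   show "y r <= b"
   proof (rule ccontr)
    assume "\<not> y r <= b"
    hence "r \<in> S" using r s' by (auto simp: S_def)
    hence "r = s" using s(2)[of r] r by simp
    thus False using \<open>y s = b\<close> \<open>\<not> y r <= b\<close> by simp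
   qed
  qed
  also have "... <= y 0 + c * T" using s' c by (intro add_mono mult_left_mono) auto
  finally show False using small \<open>y s = b\<close> by simp
 qed
 show ?thesis by (rule grow[OF t]) (use lt t in "force intro: less_imp_le")
qed

lemma continuous_on_lipschitz_comp:
 fixes f :: "real => 'h::real_normed_vector => 'h"
 assumes lip: "!!t x y. t \<in> A ==> norm (f t x - f t y) <= L * norm (x - y)"
  and cont: "!!x. continuous_on A (%t. f t x)" and h: "continuous_on A h"
 shows "continuous_on A (%t. f t (h t))"
 unfolding continuous_on_def
proof
 fix t assume t: "t \<in> A"
 have "((%s. (f s (h s) - f s (h t)) + f s (h t)) \<longlongrightarrow> 0 + f t (h t)) (at t within A)"
 proof (rule tendsto_add)
  show "((%s. f s (h t)) \<longlongrightarrow> f t (h t)) (at t within A)"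
   using cont[of "h t"] t by (auto simp: continuous_on_def)
  show "((%s. f s (h s) - f s (h t)) \<longlongrightarrow> 0) (at t within A)"
  proof (rule Lim_null_comparison)
   show "\<forall>\<^sub>F s in at t within A. norm (f s (h s) - f s (h t)) <= L * norm (h s - h t)"
    using lip by (auto simp: eventually_at_filter)
   have "(h \<longlongrightarrow> h t) (at t within A)" using h t by (auto simp: continuous_on_def)
   hence "((%s. L * norm (h s - h t)) \<longlongrightarrow> L * norm (h t - h t)) (at t within A)"
    by (intro tendsto_intros)
   thus "((%s. L * norm (h s - h t)) \<longlongrightarrow> 0) (at t within A)" by simp
  qed
 qed
 thus "((%t. f t (h t)) \<longlongrightarrow> f t (h t)) (at t within A)" by simp
qed

text \<open>The substitution z = exp(2 l t) w makes the integral operator a contraction with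
  constant 1/2 in the sup norm over the whole interval, so a single fixed point gives the solution
  up to time T.\<close>

lemma picard_lindeloef_global:
 fixes f :: "real => 'h::banach => 'h"
 assumes lip: "!!t x y. t \<in> {0..T} ==> norm (f t x - f t y) <= L * norm (x - y)"
  and cont: "!!x. continuous_on {0..T} (%t. f t x)" and T: "T >= 0"
 shows "EX z. z 0 = z0 & (\<forall>t\<in>{0..T}. (z has_vector_derivative f t (z t)) (at t within {0..T}))"
proof -
 define l where "l = max L 1"
 have l: "l > 0" "L <= l" by (auto simp: l_def)
 \<comment> \<open>Clipping times to the interval turns curves into bounded continuous functions on
   the whole line, the complete space in which the fixed point is taken.\<close>
 define c where "c t = max 0 (min T t)" for t :: real
 have c: "c t \<in> {0..T}" for t using T by (auto simp: c_def)
 have ct: "c t = t" if "t \<in> {0..T}" for t using that by (auto simp: c_def)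
 have cc: "continuous_on UNIV c" unfolding c_def by (intro continuous_intros)
 define F where "F w s = f s (exp (2 * l * s) *\<^sub>R apply_bcontfun w s)" for w s
 have Fc: "continuous_on {0..T} (F w)" for w
  unfolding F_def
  by (rule continuous_on_lipschitz_comp[OF lip cont])
   (auto intro!: continuous_intros continuous_on_apply_bcontfun)
 have Fi: "F w integrable_on {0..t}" if "t \<in> {0..T}" for w t
  by (rule integrable_continuous_interval, rule continuous_on_subset[OF Fc]) (use that in auto)
 define P where "P w t = z0 + integral {0..t} (F w)" for w t
 have Pder: "(P w has_vector_derivative F w t) (at t within {0..T})" if "t \<in> {0..T}" for w t
  unfolding P_def using integral_has_vector_derivative[OF Fc that]
  by (auto intro!: derivative_eq_intros)
 have Pc: "continuous_on {0..T} (P w)" for w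
  by (auto simp: continuous_on_eq_continuous_within intro!: has_vector_derivative_continuous[OF Pder])
 define Q where "Q w = (%t. exp (- (2 * l * c t)) *\<^sub>R P w (c t))" for w
 have Qb: "Q w \<in> bcontfun" for w
 proof -
  have 1: "continuous_on UNIV (Q w)" unfolding Q_def
   by (intro continuous_intros cc continuous_on_compose2[OF Pc cc]) (use c in auto)
  have "compact ((%t. exp (- (2 * l * t)) *\<^sub>R P w t) ` {0..T})"
   by (intro compact_continuous_image continuous_intros Pc) auto
  then obtain B where "!!t. t \<in> {0..T} ==> norm (exp (- (2 * l * t)) *\<^sub>R P w t) <= B"
   by (meson bounded_iff compact_imp_bounded imageI)
  hence "norm (Q w t) <= B" for t unfolding Q_def using c by blast
  with 1 show ?thesis by (rule bcontfun_normI)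
 qed
 define G where "G w = Bcontfun (Q w)" for w
 have G: "apply_bcontfun (G w) t = Q w t" for w t by (simp add: G_def Bcontfun_inverse[OF Qb])
 have "\<exists>!w. G w = w"
 proof (rule banach_fix_type[where c="1/2"])
  show "ALL w v. dist (G w) (G v) <= 1/2 * dist w v"
  proof (intro allI)
   fix w v
   show "dist (G w) (G v) <= 1/2 * dist w v"
   proof (rule dist_bound)
    fix t0
    define t where "t = c t0"
    have t: "t \<in> {0..T}" using c by (simp add: t_def)
    have bnd: "norm (F w s - F v s) <= (l * dist w v) * exp (2 * l * s)" if "s \<in> {0..t}" for s
    proof -
     have "norm (F w s - F v s) <= L * norm (exp (2 * l * s) *\<^sub>R w s - exp (2 * l * s) *\<^sub>R v s)"
      unfolding F_def using that t by (intro lip) auto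
     also have "... = L * (exp (2 * l * s) * dist (w s) (v s))"
      by (simp add: scaleR_diff_right[symmetric] dist_norm)
     also have "... <= l * (exp (2 * l * s) * dist w v)"
      using l by (intro mult_mono dist_bounded) auto
     finally show ?thesis by (simp add: mult_ac)
    qed
    have ei: "((%s. (l * dist w v) * exp (2 * l * s)) has_integral (dist w v / 2 * exp (2 * l * t) - dist w v / 2 * exp (2 * l * 0))) {0..t}"
     using t l by (intro fundamental_theorem_of_calculus)
      (auto intro!: derivative_eq_intros simp flip: has_real_derivative_iff_has_vector_derivative)
    have "norm (integral {0..t} (%s. F w s - F v s)) <= integral {0..t} (%s. (l * dist w v) * exp (2 * l * s))"
     using bnd ei t by (intro integral_norm_bound_integral integrable_diff Fi) auto
    also have "... = dist w v / 2 * exp (2 * l * t) - dist w v / 2" using integral_unique[OF ei] by simp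
    also have "... <= dist w v / 2 * exp (2 * l * t)" by simp
    finally have I: "norm (integral {0..t} (%s. F w s - F v s)) <= dist w v / 2 * exp (2 * l * t)" .
    have "dist (Q w t0) (Q v t0) = exp (- (2 * l * t)) * norm (integral {0..t} (%s. F w s - F v s))"
     using t by (simp add: Q_def P_def t_def[symmetric] dist_norm scaleR_diff_right[symmetric] Henstock_Kurzweil_Integration.integral_diff[OF Fi Fi])
    also have "... <= exp (- (2 * l * t)) * (dist w v / 2 * exp (2 * l * t))"
     using I by (intro mult_left_mono) auto
    also have "... = 1/2 * dist w v" by (simp add: exp_minus field_simps)
    finally show "dist (G w t0) (G v t0) <= 1/2 * dist w v" by (simp add: G)
   qed
  qed
 qed auto
 then obtain w where w: "G w = w" by blast
 have Pw: "exp (2 * l * t) *\<^sub>R apply_bcontfun w t = P w t" if "t \<in> {0..T}" for t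
 proof -
  have "apply_bcontfun w t = exp (- (2 * l * t)) *\<^sub>R P w t"
   using G[of w t] w ct[OF that] by (simp add: Q_def)
  thus ?thesis by (simp add: exp_minus)
 qed
 show ?thesis
 proof (intro exI conjI ballI)
  show "P w 0 = z0" by (simp add: P_def)
  fix t assume t: "t \<in> {0..T}"
  show "(P w has_vector_derivative f t (P w t)) (at t within {0..T})"
   using Pder[OF t, of w] Pw[OF t] by (simp add: F_def)
 qed
qed

section \<open>Smooth functions\<close>

text \<open>The vector-valued version of \<open>partial_deriv\<close>.\<close>

definition pd :: "'n::finite => (real^'n => 'b::real_normed_vector) => real^'n => 'b" where
 "pd i f x = frechet_derivative f (at x) (axis i 1)"

definition D :: "'n::finite list => (real^'n => 'b::real_normed_vector) => real^'n => 'b" where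
 "D is f = foldr pd is f"

definition smooth :: "(real^'n::finite => 'b::real_normed_vector) => bool" where
 "smooth f \<longleftrightarrow> (ALL is x. D is f differentiable (at x))"

lemma partial_deriv_eq_pd: "partial_deriv = pd"
 by (intro ext) (simp add: partial_deriv_def pd_def)

lemma D_Nil [simp]: "D [] f = f" by (simp add: D_def)
lemma D_Cons [simp]: "D (i # is) f = pd i (D is f)" by (simp add: D_def)
lemma D_append: "D (is @ js) f = D is (D js f)" by (simp add: D_def)

lemma test_function_iff: "test_function \<phi> \<longleftrightarrow> smooth \<phi> & compact (closure {x. \<phi> x ~= 0})"
 by (simp add: test_function_def smooth_def partial_deriv_eq_pd D_def)

lemma smooth_D: "smooth f ==> smooth (D is f)"
 by (simp add: smooth_def D_append[symmetric])

lemma smooth_pd: "smooth f ==> smooth (pd i f)"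
 using smooth_D[of f "[i]"] by simp

lemma smooth_differentiable: "smooth f ==> f differentiable (at x)"
 using D_Nil[of f] unfolding smooth_def by metis

lemma smooth_has_derivative: "smooth f ==> (f has_derivative frechet_derivative f (at x)) (at x)"
 using smooth_differentiable frechet_derivative_works by blast

lemma smooth_continuous: "smooth f ==> continuous_on S f"
 by (meson continuous_at_imp_continuous_on differentiable_imp_continuous_within smooth_differentiable)

lemma smooth_measurable: "smooth (f :: real^'n::finite => 'b::euclidean_space) ==> bmeas f"
 by (intro borel_measurable_continuous_onI smooth_continuous)

text \<open>Smoothness of coordinates, of the bump functions and of lifted functions is obtained by
  naming a family closed under \<open>pd\<close>, instead of computing iterated derivatives.\<close>

lemma smooth_family:
 assumes P: "P f" and step: "!!g. P g ==> (ALL x. g differentiable (at x)) & (ALL i. P (pd i g))"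
 shows "smooth f"
proof -
 have "P (D is f)" for "is"
  by (induction "is") (use P step in auto)
 thus ?thesis using step by (auto simp: smooth_def)
qed

lemma pd_eqI: "(f has_derivative f') (at x) ==> pd i f x = f' (axis i 1)"
 by (simp add: pd_def frechet_derivative_at[symmetric])

lemma pd_const [simp]: "pd i (%x. c) = (%x. 0)"
 by (intro ext) (simp add: pd_def)

lemma pd_add:
 assumes "f differentiable (at x)" "g differentiable (at x)"
 shows "pd i (%x. f x + g x) x = pd i f x + pd i g x"
 by (subst pd_eqI[OF has_derivative_add[OF frechet_derivative_works[THEN iffD1, OF assms(1)] frechet_derivative_works[THEN iffD1, OF assms(2)]]])
  (simp add: pd_def)

lemma pd_linear:
 assumes "bounded_linear L" "f differentiable (at x)"
 shows "pd i (%x. L (f x)) x = L (pd i f x)"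
 by (subst pd_eqI[OF bounded_linear.has_derivative[OF assms(1) frechet_derivative_works[THEN iffD1, OF assms(2)]]])
  (simp add: pd_def)

lemma pd_bilinear:
 assumes "bounded_bilinear \<beta>" "f differentiable (at x)" "g differentiable (at x)"
 shows "pd i (%x. \<beta> (f x) (g x)) x = \<beta> (f x) (pd i g x) + \<beta> (pd i f x) (g x)"
 by (subst pd_eqI[OF bounded_bilinear.FDERIV[OF assms(1) frechet_derivative_works[THEN iffD1, OF assms(2)] frechet_derivative_works[THEN iffD1, OF assms(3)]]])
  (simp add: pd_def)

lemma pd_affine:
 assumes "f differentiable (at (c *\<^sub>R x + a))"
 shows "pd i (%x. f (c *\<^sub>R x + a)) x = c *\<^sub>R pd i f (c *\<^sub>R x + a)"
proof -
 have 1: "((%x. c *\<^sub>R x + a) has_derivative (%h. c *\<^sub>R h)) (at x)"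
  by (auto intro!: derivative_eq_intros)
 have f: "(f has_derivative frechet_derivative f (at (c *\<^sub>R x + a))) (at (c *\<^sub>R x + a))"
  using assms frechet_derivative_works by blast
 have "linear (frechet_derivative f (at (c *\<^sub>R x + a)))"
  using f has_derivative_linear by blast
 thus ?thesis
  by (subst pd_eqI[OF has_derivative_compose[OF 1 f]]) (simp add: pd_def linear_cmul)
qed

lemma D_const: "D is (%x. c) = (%x. if is = [] then c else 0)"
 by (induction "is") auto

lemma smooth_const [simp]: "smooth (%x. c)"
 by (simp add: smooth_def D_const)

lemma D_add: assumes "smooth f" "smooth g" shows "D is (%x. f x + g x) = (%x. D is f x + D is g x)"
proof (induction "is")
 case (Cons i "is")
 show ?case unfolding D_Cons Cons
  by (intro ext pd_add) (use assms in "auto simp: smooth_def")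
qed simp

lemma smooth_add [simp]: assumes "smooth f" "smooth g" shows "smooth (%x. f x + g x)"
 using assms by (auto simp: smooth_def D_add[OF assms] intro!: derivative_intros differentiable_add)

lemma D_linear: assumes "bounded_linear L" "smooth f" shows "D is (%x. L (f x)) = (%x. L (D is f x))"
proof (induction "is")
 case (Cons i "is")
 show ?case unfolding D_Cons Cons
  by (intro ext pd_linear) (use assms in "auto simp: smooth_def")
qed simp

lemma bounded_linear_differentiable: "bounded_linear L ==> f differentiable F ==> (%x. L (f x)) differentiable F"
 unfolding differentiable_def using bounded_linear.has_derivative by blast

lemma smooth_linear: assumes "bounded_linear L" "smooth f" shows "smooth (%x. L (f x))"
 using assms by (auto simp: smooth_def D_linear[OF assms] intro: bounded_linear_differentiable)

lemma smooth_minus [simp]: "smooth f ==> smooth (%x. - f x)"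
 by (rule smooth_linear[OF bounded_linear_minus[OF bounded_linear_ident]])

lemma D_minus: "smooth f ==> D is (%x. - f x) = (%x. - D is f x)"
 by (rule D_linear[OF bounded_linear_minus[OF bounded_linear_ident]])

lemma smooth_diff [simp]: "smooth f ==> smooth g ==> smooth (%x. f x - g x)"
 using smooth_add[of f "%x. - g x"] by simp

lemma D_diff: "smooth f ==> smooth g ==> D is (%x. f x - g x) = (%x. D is f x - D is g x)"
 using D_add[of f "%x. - g x" "is"] by (simp add: D_minus)

lemma smooth_sum: "(!!j. j \<in> J ==> smooth (f j)) ==> smooth (%x. \<Sum>j\<in>J. f j x)"
 by (induction J rule: infinite_finite_induct) auto

lemma D_sum: "(!!j. j \<in> J ==> smooth (f j)) ==> D is (%x. \<Sum>j\<in>J. f j x) = (%x. \<Sum>j\<in>J. D is (f j) x)"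
 by (induction J rule: infinite_finite_induct) (auto simp: D_const D_add smooth_sum)

lemma D_affine: assumes "smooth f"
 shows "D is (%x. f (c *\<^sub>R x + a)) = (%x. c ^ length is *\<^sub>R D is f (c *\<^sub>R x + a))"
proof (induction "is")
 case (Cons i "is")
 have d: "D is f differentiable (at x)" for x using assms by (simp add: smooth_def)
 show ?case unfolding D_Cons Cons
 proof
  fix x
  have "(%x. D is f (c *\<^sub>R x + a)) differentiable (at x)"
   by (rule differentiable_compose[OF d]) (auto intro!: derivative_intros)
  hence "pd i (%x. c ^ length is *\<^sub>R D is f (c *\<^sub>R x + a)) x = c ^ length is *\<^sub>R pd i (%x. D is f (c *\<^sub>R x + a)) x"
   by (rule pd_linear[OF bounded_linear_scaleR_right])
  thus "pd i (%x. c ^ length is *\<^sub>R D is f (c *\<^sub>R x + a)) x = c ^ length (i # is) *\<^sub>R pd i (D is f) (c *\<^sub>R x + a)"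
   by (simp add: pd_affine[OF d] mult.commute)
 qed
qed simp

lemma smooth_affine: assumes "smooth f" shows "smooth (%x. f (c *\<^sub>R x + a))"
 unfolding smooth_def D_affine[OF assms]
proof (intro allI)
 fix "is" x
 have d: "D is f differentiable (at x)" for x using assms by (simp add: smooth_def)
 have "(%x. D is f (c *\<^sub>R x + a)) differentiable (at x)"
  by (rule differentiable_compose[OF d]) (auto intro!: derivative_intros)
 thus "(%x. c ^ length is *\<^sub>R D is f (c *\<^sub>R x + a)) differentiable (at x)"
  by (rule bounded_linear_differentiable[OF bounded_linear_scaleR_right])
qed

text \<open>All ways of distributing the listed derivatives over two factors, with repetitions, so
  that the Leibniz rule holds without binomial coefficients.\<close>

fun splits :: "'a list => ('a list \<times> 'a list) list" where
 "splits [] = [([], [])]"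
| "splits (x # xs) = map (%(a, b). (a, x # b)) (splits xs) @ map (%(a, b). (x # a, b)) (splits xs)"

lemma bilinear_differentiable:
 assumes "bounded_bilinear \<beta>" "f differentiable (at x)" "g differentiable (at x)"
 shows "(%x. \<beta> (f x) (g x)) differentiable (at x)"
 using assms bounded_bilinear.FDERIV[OF assms(1)] unfolding differentiable_def by blast

lemma splits_length: "(a, b) \<in> set (splits xs) ==> length a + length b = length xs"
 by (induction xs arbitrary: a b) fastforce+

text \<open>Isolates the split with every derivative on the second factor. It produces the top-order
  term, which the energy estimate handles by symmetry; all other splits differentiate the
  coefficient at least once.\<close>

lemma splits_Cons: "EX r. splits xs = ([], xs) # r & (\<forall>(a, b)\<in>set r. a ~= [])"
 by (induction xs) fastforce+

lemma D_bilinear_differentiable: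
 assumes b: "bounded_bilinear \<beta>" and fg: "smooth f" "smooth g"
 shows "(%x. sum_list (map (%(a, b). \<beta> (D a f x) (D b g x)) ps)) differentiable (at x)"
proof (induction ps)
 case (Cons p ps)
 have "(%x. \<beta> (D (fst p) f x) (D (snd p) g x)) differentiable (at x)"
  using fg by (intro bilinear_differentiable[OF b]) (auto simp: smooth_def)
 thus ?case using Cons by (simp add: split_beta differentiable_add)
qed simp

lemma pd_sum_list_bilinear:
 assumes b: "bounded_bilinear \<beta>" and fg: "smooth f" "smooth g"
 shows "pd i (%x. sum_list (map (%(a, b). \<beta> (D a f x) (D b g x)) ps)) x =
  sum_list (map (%(a, b). \<beta> (D a f x) (D (i # b) g x) + \<beta> (D (i # a) f x) (D b g x)) ps)"
proof (induction ps)
 case (Cons p ps)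
 have d: "D a f differentiable (at x)" "D a g differentiable (at x)" for a
  using fg by (auto simp: smooth_def)
 have "(%x. \<beta> (D (fst p) f x) (D (snd p) g x)) differentiable (at x)"
  using fg by (intro bilinear_differentiable[OF b]) (auto simp: smooth_def)
 from pd_add[OF this D_bilinear_differentiable[OF b fg, of ps]] Cons
 show ?case by (simp add: case_prod_unfold pd_bilinear[OF b d(1) d(2)])
qed simp

lemma D_bilinear:
 assumes b: "bounded_bilinear \<beta>" and fg: "smooth f" "smooth g"
 shows "D is (%x. \<beta> (f x) (g x)) = (%x. sum_list (map (%(a, b). \<beta> (D a f x) (D b g x)) (splits is)))"
proof (induction "is")
 case (Cons i "is")
 show ?case unfolding D_Cons Cons pd_sum_list_bilinear[OF b fg]
  by (intro ext) (simp add: sum_list_addf split_beta comp_def case_prod_unfold)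
qed simp

lemma smooth_bilinear:
 assumes "bounded_bilinear \<beta>" "smooth f" "smooth g" shows "smooth (%x. \<beta> (f x) (g x))"
 unfolding smooth_def D_bilinear[OF assms] using D_bilinear_differentiable[OF assms] by blast

lemma smooth_line:
 assumes "smooth f"
 shows "((%s. f (x + s *\<^sub>R v)) has_vector_derivative (\<Sum>i\<in>UNIV. v $ i *\<^sub>R pd i f (x + s *\<^sub>R v))) (at s within S)"
proof -
 let ?f' = "frechet_derivative f (at (x + s *\<^sub>R v))"
 have 1: "((%s. x + s *\<^sub>R v) has_derivative (%h. h *\<^sub>R v)) (at s within S)"
  by (auto intro!: derivative_eq_intros)
 have f: "(f has_derivative ?f') (at (x + s *\<^sub>R v))"
  using smooth_has_derivative[OF assms] .
 have lin: "linear ?f'" using f has_derivative_linear by blast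
 have "?f' v = ?f' (\<Sum>i\<in>UNIV. v $ i *\<^sub>R axis i 1)"
  using basis_expansion[of v] by (simp add: scalar_mult_eq_scaleR)
 also have "... = (\<Sum>i\<in>UNIV. v $ i *\<^sub>R pd i f (x + s *\<^sub>R v))"
  by (simp add: linear_sum[OF lin] linear_cmul[OF lin] pd_def)
 finally show ?thesis
  using has_derivative_compose[OF 1 f] by (simp add: has_vector_derivative_def linear_cmul[OF lin])
qed

lemma smooth_line_axis:
 assumes "smooth f"
 shows "((%s. f (x + s *\<^sub>R axis i 1)) has_vector_derivative pd i f (x + s *\<^sub>R axis i 1)) (at s within S)"
proof -
 have "(\<Sum>j\<in>UNIV. (axis i (1::real) :: real^'a) $ j *\<^sub>R pd j f y) = pd i f y" for y
  by (simp add: axis_def if_distrib[where f="%c. c *\<^sub>R _"] sum.delta' cong: if_cong)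
 thus ?thesis using smooth_line[OF assms, of x "axis i 1" s S] by simp
qed

text \<open>By differentiation under the integral sign, the increment of \<open>pd i f\<close> from
  x to x + t e_j is the integral of \<open>pd i (pd j f)\<close> along the segment. Both sides are
  then differentiated at t = 0 from the right.\<close>

lemma pd_commute:
 fixes f :: "real^'n::finite => 'b::euclidean_space"
 assumes f: "smooth f" shows "pd i (pd j f) = pd j (pd i f)"
proof
 fix x
 let ?ei = "axis i 1 :: real^'n" and ?ej = "axis j 1 :: real^'n"
 have c: "continuous_on S (pd i (pd j f))" "continuous_on S (pd j f)" for S
  by (auto intro!: smooth_continuous smooth_pd f)
 have ftc: "((%t. pd j f (y + t *\<^sub>R ?ej)) has_integral (f (y + t *\<^sub>R ?ej) - f (y + 0 *\<^sub>R ?ej))) {0..t}" if "t >= 0" for y t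
  using that by (intro fundamental_theorem_of_calculus smooth_line_axis[OF f]) auto
 have key: "pd i f (x + t *\<^sub>R ?ej) - pd i f x = integral {0..t} (%\<tau>. pd i (pd j f) (x + \<tau> *\<^sub>R ?ej))" if t: "t >= 0" for t
 proof -
  have "((%s. integral (cbox 0 t) (%\<tau>. pd j f (x + \<tau> *\<^sub>R ?ej + s *\<^sub>R ?ei))) has_vector_derivative
    integral (cbox 0 t) (%\<tau>. pd i (pd j f) (x + \<tau> *\<^sub>R ?ej + 0 *\<^sub>R ?ei))) (at 0 within UNIV)"
  proof (rule leibniz_rule_vector_derivative)
   show "((%s. pd j f (x + \<tau> *\<^sub>R ?ej + s *\<^sub>R ?ei)) has_vector_derivative pd i (pd j f) (x + \<tau> *\<^sub>R ?ej + s *\<^sub>R ?ei)) (at s within UNIV)" for s \<tau>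
    by (rule smooth_line_axis[OF smooth_pd[OF f]])
   show "(%\<tau>. pd j f (x + \<tau> *\<^sub>R ?ej + s *\<^sub>R ?ei)) integrable_on cbox 0 t" for s
    by (intro integrable_continuous continuous_on_compose2[OF c(2)[of UNIV]]) (auto intro!: continuous_intros)
   show "continuous_on (UNIV \<times> cbox 0 t) (%(s, \<tau>). pd i (pd j f) (x + \<tau> *\<^sub>R ?ej + s *\<^sub>R ?ei))"
    unfolding case_prod_unfold
    by (intro continuous_on_compose2[OF c(1)[of UNIV]]) (auto intro!: continuous_intros)
  qed auto
  moreover have "integral (cbox 0 t) (%\<tau>. pd j f (x + \<tau> *\<^sub>R ?ej + s *\<^sub>R ?ei)) = f ((x + t *\<^sub>R ?ej) + s *\<^sub>R ?ei) - f (x + s *\<^sub>R ?ei)" for s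
   using integral_unique[OF ftc[OF t, of "x + s *\<^sub>R ?ei"]] by (simp add: add_ac)
  ultimately have "((%s. f ((x + t *\<^sub>R ?ej) + s *\<^sub>R ?ei) - f (x + s *\<^sub>R ?ei)) has_vector_derivative
    integral {0..t} (%\<tau>. pd i (pd j f) (x + \<tau> *\<^sub>R ?ej))) (at 0)" by simp
  moreover have "((%s. f ((x + t *\<^sub>R ?ej) + s *\<^sub>R ?ei) - f (x + s *\<^sub>R ?ei)) has_vector_derivative
    (pd i f ((x + t *\<^sub>R ?ej) + 0 *\<^sub>R ?ei) - pd i f (x + 0 *\<^sub>R ?ei))) (at 0)"
   by (intro has_vector_derivative_diff smooth_line_axis[OF f])
  ultimately show ?thesis by (auto dest: vector_derivative_unique_at)
 qed
 have "((%t. integral {0..t} (%\<tau>. pd i (pd j f) (x + \<tau> *\<^sub>R ?ej))) has_vector_derivative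
   pd i (pd j f) (x + 0 *\<^sub>R ?ej)) (at 0 within {0..1})"
  by (intro integral_has_vector_derivative continuous_on_compose2[OF c(1)[of UNIV]]) (auto intro!: continuous_intros)
 hence X: "((%t. integral {0..t} (%\<tau>. pd i (pd j f) (x + \<tau> *\<^sub>R ?ej))) has_vector_derivative
   pd i (pd j f) x) (at 0 within {0..1})" by simp
 have 1: "((%t. pd i f (x + t *\<^sub>R ?ej) - pd i f x) has_vector_derivative pd i (pd j f) x) (at 0 within {0..1})"
 proof (rule has_vector_derivative_transform[OF _ _ X])
  fix t :: real assume "t \<in> {0..1}"
  thus "pd i f (x + t *\<^sub>R ?ej) - pd i f x = integral {0..t} (%\<tau>. pd i (pd j f) (x + \<tau> *\<^sub>R ?ej))"
   by (intro key) simp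
 qed simp
 have 2: "((%t. pd i f (x + t *\<^sub>R ?ej) - pd i f x) has_vector_derivative pd j (pd i f) (x + 0 *\<^sub>R ?ej) - 0) (at 0 within {0..1})"
  by (intro has_vector_derivative_diff smooth_line_axis[OF smooth_pd[OF f]]) simp
 have "at (0::real) within {0..1} ~= bot" by (simp add: at_within_Icc_at_right)
 thus "pd i (pd j f) x = pd j (pd i f) x"
  using vector_derivative_unique_within[OF _ 1 2] by simp
qed

lemma D_pd_commute:
 fixes f :: "real^'n::finite => 'b::euclidean_space"
 assumes f: "smooth f" shows "D is (pd j f) = pd j (D is f)"
proof (induction "is")
 case (Cons i "is")
 show ?case unfolding D_Cons Cons by (rule pd_commute[OF smooth_D[OF f]])
qed simp

section \<open>Translation, dilation and integration by parts\<close>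

lemma lborel_integrable_affine:
 fixes f :: "'a::euclidean_space => 'b::{banach, second_countable_topology}"
 assumes f: "integrable lborel f" and c: "c ~= 0"
 shows "integrable lborel (%x. f (t + c *\<^sub>R x))"
proof -
 have m[measurable]: "bmeas f" using f by auto
 have "integrable (density (distr lborel borel (%x. t + c *\<^sub>R x)) (%_. \<bar>c\<bar>^DIM('a))) f"
  using f by (subst (asm) lborel_affine[OF c, of t]) simp
 hence "integrable lborel (%x. \<bar>c\<bar>^DIM('a) *\<^sub>R f (t + c *\<^sub>R x))"
  by (simp add: integrable_density integrable_distr_eq)
 from integrable_scaleR_right[OF this, of "1 / \<bar>c\<bar>^DIM('a)"] show ?thesis using c by simp
qed

lemma lborel_integral_affine:
 fixes f :: "'a::euclidean_space => 'b::{banach, second_countable_topology}"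
 assumes [measurable]: "bmeas f" and c: "c ~= 0"
 shows "(LINT x|lborel. f x) = \<bar>c\<bar>^DIM('a) *\<^sub>R (LINT x|lborel. f (t + c *\<^sub>R x))"
proof -
 have "(LINT x|lborel. f x) = (LINT x|density (distr lborel borel (%x. t + c *\<^sub>R x)) (%_. \<bar>c\<bar>^DIM('a)). f x)"
  using lborel_affine[OF c, of t] by simp
 thus ?thesis by (simp add: integral_density integral_distr)
qed

lemma lborel_integral_translate:
 fixes f :: "'a::euclidean_space => 'b::{banach, second_countable_topology}"
 assumes "bmeas f"
 shows "(LINT x|lborel. f (x + t)) = (LINT x|lborel. f x)"
 using lborel_integral_affine[OF assms, of 1 t] by (simp add: add.commute)

lemma lborel_integrable_translate:
 fixes f :: "'a::euclidean_space => 'b::{banach, second_countable_topology}"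
 assumes "integrable lborel f" shows "integrable lborel (%x. f (x + t))"
 using lborel_integrable_affine[OF assms, of 1 t] by (simp add: add.commute)

text \<open>Integrability replaces compact support: the integral of f(x + e_i) - f(x) vanishes by
  translation invariance, and by Fubini it equals the average over s in [0, 1] of the integrals of
  \<open>pd i f\<close> translated by s e_i, all of which are equal.\<close>

lemma integral_pd_zero:
 fixes f :: "real^'n::finite => 'b::euclidean_space"
 assumes sm: "smooth f" and f: "integrable lborel f" and g: "integrable lborel (pd i f)"
 shows "(LINT x|lborel. pd i f x) = 0"
proof -
 let ?e = "axis i 1 :: real^'n"
 have c: "continuous_on S (pd i f)" for S by (intro smooth_continuous smooth_pd sm)
 have [measurable]: "bmeas f" "bmeas (pd i f)"
  using f g by auto
 let ?G = "%s x. indicator {0..1::real} s *\<^sub>R pd i f (x + s *\<^sub>R ?e)"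
 have "integrable (lborel \<Otimes>\<^sub>M lborel) (case_prod ?G)"
 proof (rule lborel_pair.Fubini_integrable)
  have "(LINT x|lborel. norm (?G s x)) = indicator {0..1} s * (LINT x|lborel. norm (pd i f x))" for s
   using lborel_integral_translate[of "%x. norm (pd i f x)" "s *\<^sub>R ?e"] by simp
  moreover have "integrable lborel (%s. indicator {0..1::real} s * (LINT x|lborel. norm (pd i f x)))"
   by (intro integrable_mult_left) simp
  ultimately show "integrable lborel (%x. LINT y|lborel. norm (case (x, y) of (s, x) => ?G s x))"
   by (simp only: prod.case)
  show "AE x in lborel. integrable lborel (%y. case (x, y) of (s, x) => ?G s x)"
   using lborel_integrable_translate[OF g] by auto
 qed measurable
 from lborel_pair.Fubini_integral[OF this]
 have "(LINT x|lborel. LINT s|lborel. ?G s x) = (LINT s|lborel. LINT x|lborel. ?G s x)" .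
 also have "... = (LINT s|lborel. indicator {0..1::real} s *\<^sub>R (LINT x|lborel. pd i f x))"
  by (simp add: lborel_integral_translate)
 also have "... = (LINT x|lborel. pd i f x)" by simp
 also have "(LINT x|lborel. LINT s|lborel. ?G s x) = (LINT x|lborel. f (x + ?e) - f x)"
 proof (rule Bochner_Integration.integral_cong)
  fix x
  have "(LINT s|lborel. ?G s x) = f (x + 1 *\<^sub>R ?e) - f (x + 0 *\<^sub>R ?e)"
   by (intro integral_FTC_atLeastAtMost smooth_line_axis[OF sm] continuous_on_compose2[OF c[of UNIV]])
    (auto intro!: continuous_intros)
  thus "(LINT s|lborel. ?G s x) = f (x + ?e) - f x" by simp
 qed simp
 also have "... = 0"
  using f lborel_integrable_translate[OF f, of ?e] by (simp add: lborel_integral_translate)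
 finally show ?thesis by simp
qed

lemma sqi_bilinear_integrable:
 assumes b: "bounded_bilinear \<beta>" and f: "sqi f" and g: "sqi g"
 shows "integrable lborel (%x. \<beta> (f x) (g x) :: 'c::euclidean_space)"
proof -
 note [measurable] = sqi_measurable[OF f] sqi_measurable[OF g]
 have [measurable]: "bmeas (%x. \<beta> (f x) (g x))"
  by (intro borel_measurable_continuous_Pair[where H=\<beta>] bounded_bilinear.continuous_on[OF b] continuous_intros) simp_all
 obtain K where K: "!!a b. norm (\<beta> a b) <= norm a * norm b * K" "K > 0"
  using bounded_bilinear.pos_bounded[OF b] by blast
 show ?thesis
  by (rule Bochner_Integration.integrable_bound[where f="%x. (norm (f x) * norm (g x)) * K"])
   (use sqi_prod_integrable[OF f g] K in auto)
qed

lemma integral_by_parts: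
 fixes \<beta> :: "'b::euclidean_space => 'c::euclidean_space => 'd::euclidean_space"
 assumes b: "bounded_bilinear \<beta>" and sm: "smooth f" "smooth g"
  and sq: "sqi f" "sqi (pd i f)" "sqi g" "sqi (pd i g)"
 shows "(LINT x|lborel. \<beta> (f x) (pd i g x)) = - (LINT x|lborel. \<beta> (pd i f x) (g x))"
proof -
 have eq: "pd i (%x. \<beta> (f x) (g x)) = (%x. \<beta> (f x) (pd i g x) + \<beta> (pd i f x) (g x))"
  by (intro ext pd_bilinear[OF b] smooth_differentiable sm)
 have "(LINT x|lborel. pd i (%x. \<beta> (f x) (g x)) x) = 0"
  by (intro integral_pd_zero smooth_bilinear[OF b] sm) (auto simp: eq intro!: sqi_bilinear_integrable[OF b] sq)
 thus ?thesis unfolding eq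
  by (subst (asm) Bochner_Integration.integral_add) (auto intro!: sqi_bilinear_integrable[OF b] sq simp: eq_neg_iff_add_eq_0)
qed

section \<open>A radial bump function\<close>

text \<open>The functions p(1/x) exp(-1/x), continued by 0, form a family closed under
  differentiation; this is what gives smoothness at 0.\<close>

definition flat :: "real poly => real => real" where
 "flat p x = (if x > 0 then poly p (1 / x) * exp (- (1 / x)) else 0)"

text \<open>The derivative of p(1/x) exp(-1/x) is x^(-2) (p - p')(1/x) exp(-1/x).\<close>

definition flat_step :: "real poly => real poly" where
 "flat_step p = monom 1 2 * (p - pderiv p)"

lemma poly_exp_tendsto_0: "((%u. poly p u * exp (- u)) \<longlongrightarrow> (0::real)) at_top"
proof -
 have "((%u. \<Sum>i\<le>degree p. coeff p i * (u ^ i / exp u)) \<longlongrightarrow> (\<Sum>i\<le>degree p. coeff p i * 0)) at_top"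
  by (intro tendsto_intros tendsto_power_div_exp_0)
 moreover have "(\<Sum>i\<le>degree p. coeff p i * (u ^ i / exp u)) = poly p u * exp (- u)" for u
  by (simp add: poly_altdef sum_distrib_right exp_minus divide_inverse mult.assoc)
 ultimately show ?thesis by simp
qed

lemma flat_has_derivative: "(flat p has_real_derivative flat (flat_step p) x) (at x)"
proof -
 consider "x < 0" | "x > 0" | "x = 0" by linarith
 thus ?thesis
 proof cases
  case 1
  have "((%x. 0) has_real_derivative 0) (at x)" by simp
  thus ?thesis
   by (rule has_field_derivative_transform_within_open[where S="{..<0}", THEN DERIV_cong])
    (use 1 in "auto simp: flat_def")
 next
  case 2
  have "((%x. poly p (1 / x) * exp (- (1 / x))) has_real_derivative flat (flat_step p) x) (at x)"
   using 2 by (auto intro!: derivative_eq_intros simp: flat_def flat_step_def poly_monom power2_eq_square field_simps)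
  thus ?thesis
   by (rule has_field_derivative_transform_within_open[where S="{0<..}"]) (use 2 in "auto simp: flat_def")
 next
  case 3
  have "((%y. (flat p y - flat p 0) / (y - 0)) \<longlongrightarrow> 0) (at (0::real))"
  proof (rule filterlim_split_at)
   have "\<forall>\<^sub>F y in at_left 0. (flat p y - flat p 0) / (y - 0) = 0"
    by (auto simp: eventually_at_filter flat_def)
   thus "((%y. (flat p y - flat p 0) / (y - 0)) \<longlongrightarrow> 0) (at_left (0::real))"
    by (rule tendsto_eventually)
   have "((%y. poly (pCons 0 p) (inverse y) * exp (- inverse y)) \<longlongrightarrow> 0) (at_right (0::real))"
    by (rule filterlim_compose[OF poly_exp_tendsto_0 filterlim_inverse_at_top_right])
   moreover have "\<forall>\<^sub>F y in at_right (0::real). poly (pCons 0 p) (inverse y) * exp (- inverse y) = (flat p y - flat p 0) / (y - 0)"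
    by (auto simp: eventually_at_filter flat_def field_simps)
   ultimately show "((%y. (flat p y - flat p 0) / (y - 0)) \<longlongrightarrow> 0) (at_right (0::real))"
    by (rule Lim_transform_eventually)
  qed
  thus ?thesis using 3 by (simp add: has_field_derivative_iff flat_def)
 qed
qed

definition rad :: "real^'n::finite => real" where "rad x = 1 - x \<bullet> x"

text \<open>The derivative of a base element is a sum of two base elements, hence the closure under
  sums; the factor \<open>q\<close> absorbs the -2 x_i of the chain rule.\<close>

inductive rad_fam :: "(real^'n::finite => real) => bool" where
 base: "smooth q ==> rad_fam (%x. flat p (rad x) * q x)"
| add: "rad_fam f ==> rad_fam g ==> rad_fam (%x. f x + g x)"

lemma smooth_component: "smooth (%x::real^'n::finite. x $ i)"
proof (rule smooth_family[where P="%f. (EX c. f = (%x. c)) \<or> f = (%x. x $ i)"])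
 fix g :: "real^'n => real" assume g: "(EX c. g = (%x. c)) \<or> g = (%x. x $ i)"
 have d: "((%x. x $ i) has_derivative (%h. h $ i)) (at x)" for x :: "real^'n"
  by (rule bounded_linear.has_derivative[OF bounded_linear_vec_nth has_derivative_ident])
 have "pd j (%x. x $ i) = (%x. axis j 1 $ i)" for j :: 'n
  by (intro ext pd_eqI[OF d])
 thus "(ALL x. g differentiable (at x)) & (ALL j. (EX c. pd j g = (%x. c)) \<or> pd j g = (%x. x $ i))"
  using g d by (auto simp: differentiable_def intro: has_derivative_const)
qed simp

lemma flat_rad_has_derivative:
 "((%x. flat p (rad x)) has_derivative (%h. flat (flat_step p) (rad x) * (- 2 * (x \<bullet> h)))) (at x)"
proof -
 have "(rad has_derivative (%h. - 2 * (x \<bullet> h))) (at x)"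
  unfolding rad_def by (auto intro!: derivative_eq_intros simp: inner_commute)
 from has_derivative_compose[OF this flat_has_derivative[of p "rad x", unfolded has_field_derivative_def]]
 show ?thesis by simp
qed

lemma pd_flat_rad: "pd i (%x. flat p (rad x)) x = flat (flat_step p) (rad x) * (- 2 * (x $ i))"
 by (subst pd_eqI[OF flat_rad_has_derivative]) (simp add: inner_axis)

lemma smooth_rad_fam: assumes "rad_fam f" shows "smooth f"
proof (rule smooth_family[where P=rad_fam, OF assms])
 fix g :: "real^'n::finite => real" assume "rad_fam g"
 thus "(ALL x. g differentiable (at x)) & (ALL i. rad_fam (pd i g))"
 proof induction
  case (base q p)
  have dq: "q differentiable (at x)" for x by (rule smooth_differentiable[OF base])
  have df: "(%x. flat p (rad x)) differentiable (at x)" for x :: "real^'n"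
   using flat_rad_has_derivative by (auto simp: differentiable_def)
  have "pd i (%x. flat p (rad x) * q x) = (%x. flat p (rad x) * pd i q x + flat (flat_step p) (rad x) * (- 2 * x $ i * q x))" for i
   by (intro ext) (simp add: pd_bilinear[OF bounded_bilinear_mult df dq] pd_flat_rad)
  moreover have "rad_fam (%x. flat p (rad x) * pd i q x + flat (flat_step p) (rad x) * (- 2 * x $ i * q x))" for i
   by (intro rad_fam.intros smooth_pd base smooth_bilinear[OF bounded_bilinear_mult] smooth_component smooth_const)
  ultimately show ?case using differentiable_mult[OF df dq] by simp
 next
  case (add f g)
  have "pd i (%x. f x + g x) = (%x. pd i f x + pd i g x)" for i
   using add by (intro ext pd_add) auto
  thus ?case using add by (auto intro: rad_fam.intros differentiable_add)
 qed
qed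

text \<open>Chosen together with \<open>bump1\<close>: for \<phi>(r) = exp(-1/r), r > 0,
  \<open>bump0\<close> is \<phi>' and \<open>bump1\<close> is -\<phi>/2, both taken at r = 1 -
  |x|^2. Then the gradient of \<open>bump1\<close> is x times \<open>bump0\<close>, the relation on
  which the Sobolev sup bound rests.\<close>

definition bump0 :: "real^'n::finite => real" where
 "bump0 x = flat (flat_step [:1:]) (rad x)"

definition bump1 :: "real^'n::finite => real" where
 "bump1 x = - flat [:1:] (rad x) / 2"

lemma smooth_flat_rad: "smooth (%x. flat p (rad x))"
 using smooth_rad_fam[OF rad_fam.base[OF smooth_const[of 1], of p]] by simp

lemma smooth_bump0: "smooth bump0"
 unfolding bump0_def[abs_def] by (rule smooth_flat_rad)

lemma smooth_bump1: "smooth bump1"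
 using smooth_linear[OF bounded_linear_mult_right[of "- 1/2"] smooth_flat_rad[of "[:1:]"]]
 by (simp add: bump1_def[abs_def])

lemma pd_bump1: "pd i bump1 x = x $ i * bump0 x"
proof -
 have "pd i (%x. (- 1/2) * flat [:1:] (rad x)) x = (- 1/2) * pd i (%x. flat [:1:] (rad x)) x"
  by (rule pd_linear[OF bounded_linear_mult_right]) (rule smooth_differentiable[OF smooth_flat_rad])
 thus ?thesis by (simp add: bump1_def[abs_def] bump0_def pd_flat_rad)
qed

lemma bump0_nonneg: "bump0 x >= 0"
 by (auto simp: bump0_def flat_def flat_step_def poly_monom)

lemma bump0_pos: "norm x < 1 ==> bump0 x > 0"
 by (auto simp: bump0_def flat_def flat_step_def poly_monom rad_def dot_square_norm power_less_one_iff
   intro!: mult_pos_pos divide_pos_pos zero_less_power)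

lemma bump_support: assumes "norm x >= 1" shows "bump0 x = 0" "bump1 x = 0"
proof -
 have "1 <= x \<bullet> x" using assms by (simp add: dot_square_norm)
 thus "bump0 x = 0" "bump1 x = 0" by (auto simp: bump0_def bump1_def flat_def rad_def)
qed

lemma bump_even: "bump0 (- x) = bump0 x"
 by (simp add: bump0_def rad_def)

lemma test_functionI: assumes "smooth f" "!!x. norm x > r ==> f x = 0" shows "test_function f"
proof -
 have "{x. f x ~= 0} \<subseteq> cball 0 r" using assms(2) by (force simp: not_less[symmetric])
 hence "bounded {x. f x ~= 0}" using bounded_cball bounded_subset by blast
 thus ?thesis using assms(1) by (simp add: test_function_iff)
qed

lemma test_bump0: "test_function bump0"
 by (rule test_functionI[OF smooth_bump0, of 1]) (simp add: bump_support)

lemma test_bump1: "test_function bump1"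
 by (rule test_functionI[OF smooth_bump1, of 1]) (simp add: bump_support)

section \<open>Convolution\<close>

text \<open>Bounded with bounded support makes both |k| and k^2 integrable, so one notion serves the
  L^2 bound of a convolution and its sup bound.\<close>

definition kernel :: "('a::euclidean_space => real) => bool" where
 "kernel k \<longleftrightarrow> k \<in> borel_measurable borel & (EX r. ALL x. norm x > r --> k x = 0) & (EX B. ALL x. \<bar>k x\<bar> <= B)"

definition conv :: "('a::euclidean_space => real) => ('a => 'b::euclidean_space) => 'a => 'b" where
 "conv k f x = (LINT y|lborel. k (x - y) *\<^sub>R f y)"

lemma kernel_measurable [measurable_dest]: "kernel k ==> bmeas k"
 by (simp add: kernel_def)

lemma kernel_integrable: assumes k: "kernel k" shows "integrable lborel k"
proof -
 note [measurable] = kernel_measurable[OF k]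
 obtain r where r: "!!x. norm x > r ==> k x = 0" using k by (auto simp: kernel_def)
 obtain B where B: "!!x. \<bar>k x\<bar> <= B" using k by (auto simp: kernel_def)
 show ?thesis
 proof (rule Bochner_Integration.integrable_bound[where f="%x. B * indicator (cball 0 r) x"])
  show "integrable lborel (%x. B * indicator (cball 0 r) x)"
   by (intro integrable_mult_right integrable_real_indicator) (use emeasure_bounded_finite[OF bounded_cball] in auto)
  show "AE x in lborel. norm (k x) <= norm (B * indicator (cball 0 r) x)"
   using r order_trans[OF B abs_ge_self] by (intro AE_I2) (auto simp: indicator_def abs_mult)
 qed measurable
qed

lemma kernel_power: assumes k: "kernel k" shows "kernel (%x. (k x)^2)"
proof -
 note [measurable] = kernel_measurable[OF k]
 obtain B where "!!x. \<bar>k x\<bar> <= B" using k by (auto simp: kernel_def)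
 hence "\<bar>(k x)^2\<bar> <= B^2" for x using power_mono[of "\<bar>k x\<bar>" B 2] by simp
 moreover have "bmeas (%x. (k x)^2)" by measurable
 ultimately show ?thesis using k unfolding kernel_def by fastforce
qed

lemma kernel_abs: "kernel k ==> kernel (%x. \<bar>k x\<bar>)"
 unfolding kernel_def by fastforce

lemma kernel_sqrt: assumes k: "kernel k" shows "kernel (%x. sqrt \<bar>k x\<bar>)"
proof -
 note [measurable] = kernel_measurable[OF k]
 obtain r B where "!!x. norm x > r ==> k x = 0" "!!x. \<bar>k x\<bar> <= B" using k unfolding kernel_def by blast
 thus ?thesis unfolding kernel_def
  by (intro conjI exI[of _ r] exI[of _ "sqrt B"] allI impI) (simp_all add: real_sqrt_le_mono)
qed

lemma kernel_affine:
 assumes k: "kernel k" and c: "c ~= 0" shows "kernel (%x. k (c *\<^sub>R x + a))"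
proof -
 note [measurable] = kernel_measurable[OF k]
 obtain r where r: "!!x. norm x > r ==> k x = 0" using k by (auto simp: kernel_def)
 have "k (c *\<^sub>R x + a) = 0" if "norm x > (r + norm a) / \<bar>c\<bar>" for x
 proof (rule r)
  have "r + norm a < \<bar>c\<bar> * norm x" using that c by (simp add: divide_less_eq mult.commute)
  thus "r < norm (c *\<^sub>R x + a)"
   using norm_diff_ineq[of "c *\<^sub>R x" a] by simp
 qed
 moreover have "bmeas (%x. k (c *\<^sub>R x + a))" by measurable
 ultimately show ?thesis using k unfolding kernel_def by blast
qed

lemma kernel_reflect: "kernel k ==> kernel (%y. k (x - y))"
 using kernel_affine[of k "-1" x] by simp

lemma kernel_uminus: "kernel k ==> kernel (%y. k (- y))"
 using kernel_affine[of k "-1" 0] by simp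

lemma kernel_sqi: "kernel k ==> sqi k"
 unfolding sqi_def using kernel_integrable[OF kernel_power] by (simp add: kernel_def)

lemma integral_reflect:
 fixes k :: "'a::euclidean_space => 'b::{banach, second_countable_topology}"
 assumes "bmeas k" shows "(LINT y|lborel. k (x - y)) = (LINT y|lborel. k y)"
 using lborel_integral_affine[OF assms, of "-1" x] by simp

lemma conv_integrable:
 assumes k: "kernel k" and f: "sqi f"
 shows "integrable lborel (%y. k (x - y) *\<^sub>R f y)"
 by (rule sqi_bilinear_integrable[OF bounded_bilinear_scaleR kernel_sqi[OF kernel_reflect[OF k]] f])

lemma conv_cong_AE:
 assumes k: "kernel k" and m: "bmeas f" "bmeas g"
  and eq: "AE x in lborel. f x = g x"
 shows "conv k f = conv k g"
proof
 fix x
 note [measurable] = kernel_measurable[OF k] m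
 show "conv k f x = conv k g x" unfolding conv_def
  by (rule integral_cong_AE) (use eq in "auto elim: eventually_mono")
qed

lemma conv_add:
 assumes k: "kernel k" and f: "sqi f" and g: "sqi g"
 shows "conv k (%x. f x + g x) x = conv k f x + conv k g x"
 unfolding conv_def scaleR_add_right
 by (rule Bochner_Integration.integral_add[OF conv_integrable[OF k f] conv_integrable[OF k g]])

lemma conv_linear:
 assumes k: "kernel k" and f: "sqi f" and L: "bounded_linear L"
 shows "conv k (%x. L (f x)) x = L (conv k f x)"
proof -
 interpret bounded_linear L by fact
 show ?thesis unfolding conv_def
  by (subst integral_bounded_linear[OF L conv_integrable[OF k f], symmetric]) (simp add: scaleR)
qed

lemma conv_scaleR: "kernel k ==> sqi f ==> conv k (%x. c *\<^sub>R f x) x = c *\<^sub>R conv k f x"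
 by (rule conv_linear[OF _ _ bounded_linear_scaleR_right])

lemma conv_measurable [measurable]:
 assumes k: "kernel k" and f: "bmeas f"
 shows "bmeas (conv k f)"
proof -
 note [measurable] = kernel_measurable[OF k] f
 show ?thesis unfolding conv_def[abs_def] by measurable
qed

lemma l2_inner_le:
 assumes "sqi f" "sqi g" shows "(LINT x|lborel. norm (f x) * norm (g x)) <= norm (cl f) * norm (cl g)"
proof -
 have "(LINT x|lborel. norm (f x) * norm (g x)) = cl (%x. norm (f x)) \<bullet> cl (%x. norm (g x))"
  by (subst inner_cl) (auto simp: assms sqi_norm)
 also have "... <= norm (cl (%x. norm (f x))) * norm (cl (%x. norm (g x)))"
  by (rule norm_cauchy_schwarz)
 also have "norm (cl (%x. norm (f x))) = norm (cl f)"
  by (rule power2_eq_imp_eq) (simp_all add: norm_cl_sq assms sqi_norm)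
 also have "norm (cl (%x. norm (g x))) = norm (cl g)"
  by (rule power2_eq_imp_eq) (simp_all add: norm_cl_sq assms sqi_norm)
 finally show ?thesis .
qed

lemma norm_cl_reflect: assumes k: "kernel k" shows "norm (cl (%y. k (x - y))) = norm (cl k)"
proof -
 note [measurable] = kernel_measurable[OF k]
 have "(norm (cl (%y. k (x - y))))^2 = (norm (cl k))^2"
  using integral_reflect[of "%x. (norm (k x))^2" x]
  by (simp add: norm_cl_sq kernel_sqi k kernel_reflect)
 thus ?thesis by simp
qed

lemma conv_sup:
 assumes k: "kernel k" and f: "sqi f"
 shows "norm (conv k f x) <= norm (cl k) * norm (cl f)"
proof -
 have "norm (conv k f x) <= (LINT y|lborel. norm (k (x - y) *\<^sub>R f y))"
  unfolding conv_def by (rule integral_norm_bound)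
 also have "... <= norm (cl (%y. k (x - y))) * norm (cl f)"
  using l2_inner_le[OF kernel_sqi[OF kernel_reflect[OF k, of x]] f] by simp
 finally show ?thesis by (simp add: norm_cl_reflect[OF k])
qed

text \<open>Cauchy-Schwarz with |k| split evenly as the product of sqrt |k| and sqrt |k| |f|;
  integrated over x it becomes Young's inequality in \<open>conv_l2\<close>.\<close>

lemma conv_jensen:
 assumes k: "kernel k" and f: "sqi f"
 shows "(norm (conv k f x))^2 <= (LINT y|lborel. \<bar>k y\<bar>) * (LINT y|lborel. \<bar>k (x - y)\<bar> * (norm (f y))^2)"
  "integrable lborel (%y. \<bar>k (x - y)\<bar> * (norm (f y))^2)"
proof -
 let ?a = "%y. sqrt \<bar>k (x - y)\<bar>" and ?b = "%y. sqrt \<bar>k (x - y)\<bar> *\<^sub>R f y"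
 note [measurable] = kernel_measurable[OF k] sqi_measurable[OF f]
 obtain B where B: "!!x. \<bar>k x\<bar> <= B" using k by (auto simp: kernel_def)
 have a: "sqi ?a" by (intro kernel_sqi kernel_sqrt kernel_reflect k)
 have "norm (?b y) <= sqrt B * norm (f y)" for y
  using B by (auto intro!: mult_right_mono simp: real_sqrt_le_mono)
 hence b: "sqi ?b" by (intro sqi_dominated[OF _ f]) auto
 have nb: "(norm (?b y))^2 = \<bar>k (x - y)\<bar> * (norm (f y))^2" for y by (simp add: power_mult_distrib)
 show i: "integrable lborel (%y. \<bar>k (x - y)\<bar> * (norm (f y))^2)"
  using sqi_integrable[OF b] nb by simp
 have "norm (conv k f x) <= (LINT y|lborel. norm (k (x - y) *\<^sub>R f y))"
  unfolding conv_def by (rule integral_norm_bound)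
 also have "... = (LINT y|lborel. norm (?a y) * norm (?b y))"
  by (intro Bochner_Integration.integral_cong) (auto simp flip: mult.assoc)
 also have "... <= norm (cl ?a) * norm (cl ?b)" by (rule l2_inner_le[OF a b])
 finally have le: "norm (conv k f x) <= norm (cl ?a) * norm (cl ?b)" .
 have "(norm (conv k f x))^2 <= (norm (cl ?a))^2 * (norm (cl ?b))^2"
  using power_mono[OF le norm_ge_zero, of 2] unfolding power_mult_distrib .
 also have "(norm (cl ?a))^2 = (LINT y|lborel. \<bar>k y\<bar>)"
  using integral_reflect[of "%x. \<bar>k x\<bar>" x] by (simp add: norm_cl_sq[OF a])
 also have "(norm (cl ?b))^2 = (LINT y|lborel. \<bar>k (x - y)\<bar> * (norm (f y))^2)"
  unfolding norm_cl_sq[OF b] nb ..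
 finally show "(norm (conv k f x))^2 <= (LINT y|lborel. \<bar>k y\<bar>) * (LINT y|lborel. \<bar>k (x - y)\<bar> * (norm (f y))^2)" .
qed

lemma sqi_nn_integralI:
 assumes m: "bmeas f" and c: "c >= 0"
  and le: "(\<integral>\<^sup>+x. ennreal ((norm (f x))^2) \<partial>lborel) <= ennreal (c^2)"
 shows "sqi f" "norm (cl f) <= c"
proof -
 note [measurable] = m
 have "integrable lborel (%x. (norm (f x))^2)"
  using le by (intro integrableI_bounded) (auto intro: le_less_trans)
 thus s: "sqi f" by (simp add: sqi_def m)
 have "ennreal ((norm (cl f))^2) <= ennreal (c^2)"
  using le nn_integral_eq_integral[OF sqi_integrable[OF s]] by (simp add: norm_cl_sq[OF s])
 hence "(norm (cl f))^2 <= c^2" by (subst (asm) ennreal_le_iff) simp_all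
 thus "norm (cl f) <= c" by (rule power2_le_imp_le) (rule c)
qed

lemma conv_l2:
 assumes k: "kernel k" and f: "sqi f"
 shows "sqi (conv k f)" "norm (cl (conv k f)) <= (LINT y|lborel. \<bar>k y\<bar>) * norm (cl f)"
proof -
 note [measurable] = kernel_measurable[OF k] sqi_measurable[OF f] conv_measurable[OF k sqi_measurable[OF f]]
 let ?K = "LINT y|lborel. \<bar>k y\<bar>"
 have K0: "?K >= 0" by simp
 have ik: "(\<integral>\<^sup>+x. ennreal \<bar>k (x - y)\<bar> \<partial>lborel) = ennreal ?K" for y
 proof -
  have "integrable lborel (%x. \<bar>k x\<bar>)" by (intro kernel_integrable kernel_abs k)
  from lborel_integrable_translate[OF this, of "-y"] lborel_integral_translate[of "%x. \<bar>k x\<bar>" "-y"]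
  show ?thesis by (subst nn_integral_eq_integral) auto
 qed
 have "(\<integral>\<^sup>+x. ennreal ((norm (conv k f x))^2) \<partial>lborel)
  <= (\<integral>\<^sup>+x. ennreal ?K * (\<integral>\<^sup>+y. ennreal (\<bar>k (x - y)\<bar> * (norm (f y))^2) \<partial>lborel) \<partial>lborel)"
 proof (rule nn_integral_mono)
  fix x
  have "(\<integral>\<^sup>+y. ennreal (\<bar>k (x - y)\<bar> * (norm (f y))^2) \<partial>lborel) = ennreal (LINT y|lborel. \<bar>k (x - y)\<bar> * (norm (f y))^2)"
   by (rule nn_integral_eq_integral[OF conv_jensen(2)[OF k f]]) auto
  thus "ennreal ((norm (conv k f x))^2) <= ennreal ?K * (\<integral>\<^sup>+y. ennreal (\<bar>k (x - y)\<bar> * (norm (f y))^2) \<partial>lborel)"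
   using conv_jensen(1)[OF k f, of x] by (simp add: ennreal_mult[symmetric] K0 ennreal_leI)
 qed
 also have "... = ennreal ?K * (\<integral>\<^sup>+x. (\<integral>\<^sup>+y. ennreal (\<bar>k (x - y)\<bar> * (norm (f y))^2) \<partial>lborel) \<partial>lborel)"
  by (rule nn_integral_cmult) measurable
 also have "(\<integral>\<^sup>+x. (\<integral>\<^sup>+y. ennreal (\<bar>k (x - y)\<bar> * (norm (f y))^2) \<partial>lborel) \<partial>lborel)
  = (\<integral>\<^sup>+y. (\<integral>\<^sup>+x. ennreal (\<bar>k (x - y)\<bar> * (norm (f y))^2) \<partial>lborel) \<partial>lborel)"
  by (rule lborel_pair.Fubini') measurable
 also have "... = (\<integral>\<^sup>+y. ennreal ?K * ennreal ((norm (f y))^2) \<partial>lborel)"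
  by (simp add: ennreal_mult nn_integral_multc ik)
 also have "... = ennreal ?K * ennreal ((norm (cl f))^2)"
  using nn_integral_eq_integral[OF sqi_integrable[OF f]] by (simp add: nn_integral_cmult norm_cl_sq[OF f])
 also have "ennreal ?K * (ennreal ?K * ennreal ((norm (cl f))^2)) = ennreal ((?K * norm (cl f))^2)"
  by (simp add: ennreal_mult[symmetric] K0 power2_eq_square mult_ac)
 finally have "(\<integral>\<^sup>+x. ennreal ((norm (conv k f x))^2) \<partial>lborel) <= ennreal ((?K * norm (cl f))^2)" .
 from sqi_nn_integralI[OF _ _ this]
 show "sqi (conv k f)" "norm (cl (conv k f)) <= ?K * norm (cl f)" by (auto simp: K0)
qed

lemma conv_inner:
 assumes k: "kernel k" and f: "sqi f" and g: "sqi g"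
 shows "cl (conv k f) \<bullet> cl g = cl f \<bullet> cl (conv (%y. k (- y)) g)"
proof -
 note [measurable] = kernel_measurable[OF k] sqi_measurable[OF f] sqi_measurable[OF g]
 let ?G = "%x y. k (x - y) * (f y \<bullet> g x)"
 have "integrable (lborel \<Otimes>\<^sub>M lborel) (case_prod ?G)"
 proof (rule lborel_pair.Fubini_integrable)
  have "integrable lborel (%x. conv (%y. \<bar>k y\<bar>) (%y. norm (f y)) x * norm (g x))"
   using sqi_inner_integrable[OF conv_l2(1)[OF kernel_abs[OF k] sqi_norm[OF f]] sqi_norm[OF g]] by simp
  moreover have "integrable lborel (%y. norm (?G x y))" for x
  proof (rule Bochner_Integration.integrable_bound)
   show "integrable lborel (%y. norm (k (x - y) *\<^sub>R f y) * norm (g x))"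
    using conv_integrable[OF k f, of x] by (intro integrable_mult_left integrable_norm)
   show "AE y in lborel. norm (norm (?G x y)) <= norm (norm (k (x - y) *\<^sub>R f y) * norm (g x))"
    by (intro AE_I2) (simp add: abs_mult mult.assoc mult_left_mono Cauchy_Schwarz_ineq2)
  qed measurable
  note int = this
  have le: "(LINT y|lborel. norm (?G x y)) <= conv (%y. \<bar>k y\<bar>) (%y. norm (f y)) x * norm (g x)" for x
  proof -
   have "(LINT y|lborel. norm (?G x y)) <= (LINT y|lborel. norm (k (x - y) *\<^sub>R f y) * norm (g x))"
   proof (rule integral_mono[OF int])
    show "integrable lborel (%y. norm (k (x - y) *\<^sub>R f y) * norm (g x))"
     using conv_integrable[OF k f, of x] by (intro integrable_mult_left integrable_norm)
   qed (simp add: abs_mult mult.assoc mult_left_mono Cauchy_Schwarz_ineq2)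
   thus ?thesis by (simp add: conv_def)
  qed
  ultimately show "integrable lborel (%x. LINT y|lborel. norm (case (x, y) of (x, y) => ?G x y))"
   by (elim Bochner_Integration.integrable_bound)
    (auto intro!: AE_I2 order_trans[OF _ abs_ge_self] le simp del: norm_mult)
  show "AE x in lborel. integrable lborel (%y. case (x, y) of (x, y) => ?G x y)"
  proof (rule AE_I2)
   fix x show "integrable lborel (%y. case (x, y) of (x, y) => ?G x y)"
   proof -
    have m: "?G x \<in> borel_measurable lborel" by measurable
    from int[of x] show ?thesis unfolding integrable_norm_iff[OF m] prod.case .
   qed
  qed
 qed measurable
 from lborel_pair.Fubini_integral[OF this]
 have eq: "(LINT y|lborel. LINT x|lborel. ?G x y) = (LINT x|lborel. LINT y|lborel. ?G x y)" .
 have "cl (conv k f) \<bullet> cl g = (LINT x|lborel. conv k f x \<bullet> g x)"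
  by (rule inner_cl[OF conv_l2(1)[OF k f] g])
 also have "... = (LINT x|lborel. LINT y|lborel. ?G x y)"
  unfolding conv_def
  by (intro Bochner_Integration.integral_cong refl)
   (subst integral_inner_left[symmetric], auto intro: conv_integrable[OF k f])
 also have "... = (LINT y|lborel. f y \<bullet> conv (%y. k (- y)) g y)"
  unfolding eq[symmetric] conv_def
 proof (intro Bochner_Integration.integral_cong refl)
  fix y
  have "f y \<bullet> (LINT x|lborel. k (- (y - x)) *\<^sub>R g x) = (LINT x|lborel. f y \<bullet> (k (- (y - x)) *\<^sub>R g x))"
   by (rule integral_inner_right[symmetric]) (rule conv_integrable[OF kernel_uminus[OF k] g])
  thus "(LINT x|lborel. ?G x y) = f y \<bullet> (LINT x|lborel. k (- (y - x)) *\<^sub>R g x)" by simp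
 qed
 also have "... = cl f \<bullet> cl (conv (%y. k (- y)) g)"
  by (rule inner_cl[symmetric, OF f conv_l2(1)[OF kernel_uminus[OF k] g]])
 finally show ?thesis .
qed

section \<open>Convolution with test functions\<close>

lemma test_function_radius:
 assumes "test_function k" obtains r where "r >= 0" "!!x. norm x > r ==> k x = 0"
proof -
 have "bounded {x. k x ~= 0}"
  using assms bounded_closure_image compact_imp_bounded bounded_subset closure_subset
  unfolding test_function_iff by metis
 then obtain r where "\<forall>x\<in>{x. k x ~= 0}. norm x <= r" by (auto simp: bounded_iff)
 thus ?thesis by (intro that[of "max r 0"]) force+
qed

lemma pd_zero_outside:
 assumes "!!x. norm x > r ==> f x = 0" "norm x > r" shows "pd i f x = 0"
proof -
 have "((%x. 0) has_derivative (%h. 0)) (at x)" by simp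
 hence "(f has_derivative (%h. 0)) (at x)"
  by (rule has_derivative_transform_within_open[where s="- cball 0 r"])
   (use assms in "auto simp: open_Compl")
 thus ?thesis by (subst pd_eqI) auto
qed

lemma D_zero_outside: "(!!x. norm x > r ==> f x = 0) ==> norm x > r ==> D is f x = 0"
 by (induction "is" arbitrary: x) (auto intro: pd_zero_outside[where r=r])

lemma test_function_D: assumes "test_function k" shows "test_function (D is k)"
proof -
 obtain r where r: "!!x. norm x > r ==> k x = 0" using test_function_radius[OF assms] by metis
 show ?thesis
  by (rule test_functionI[of _ r])
   (use assms in "auto simp: test_function_iff intro: smooth_D D_zero_outside[of r] r")
qed

lemma test_function_pd: "test_function k ==> test_function (pd i k)"
 using test_function_D[of k "[i]"] by simp

lemma test_function_affine: assumes k: "test_function k" and c: "c ~= 0" shows "test_function (%x. k (c *\<^sub>R x + a))"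
proof -
 obtain r where r: "!!x. norm x > r ==> k x = 0" using test_function_radius[OF k] by metis
 show ?thesis
 proof (rule test_functionI[of _ "(r + norm a) / \<bar>c\<bar>"])
  show "smooth (%x. k (c *\<^sub>R x + a))" using k by (auto simp: test_function_iff intro: smooth_affine)
  fix x :: "real^'a" assume "norm x > (r + norm a) / \<bar>c\<bar>"
  hence "r + norm a < \<bar>c\<bar> * norm x" using c by (simp add: divide_less_eq mult.commute)
  hence "r < norm (c *\<^sub>R x + a)" using norm_diff_ineq[of "c *\<^sub>R x" a] by simp
  thus "k (c *\<^sub>R x + a) = 0" by (rule r)
 qed
qed

lemma smooth_compact_bounded:
 fixes k :: "real^'n::finite => 'b::real_normed_vector"
 assumes "smooth k" "!!x. norm x > r ==> k x = 0" shows "\<exists>B\<ge>0. ALL x. norm (k x) <= B"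
proof -
 have "compact (k ` cball 0 r)"
  by (intro compact_continuous_image smooth_continuous assms) auto
 hence "bounded (k ` cball 0 r)" by (rule compact_imp_bounded)
 then obtain B where "\<forall>x\<in>cball 0 r. norm (k x) <= B" by (auto simp: bounded_iff)
 hence B: "!!x. norm x <= r ==> norm (k x) <= B" by auto
 have "norm (k x) <= max B 0" for x
  using B[of x] assms(2)[of x] by (cases "norm x <= r") auto
 thus ?thesis by (intro exI[of _ "max B 0"]) auto
qed

lemma test_function_kernel: assumes k: "test_function k" shows "kernel k"
proof -
 obtain r where r: "!!x. norm x > r ==> k x = 0" using test_function_radius[OF k] by metis
 have sm: "smooth k" using k by (simp add: test_function_iff)
 have "\<exists>B\<ge>0. ALL x. norm (k x) <= B" by (rule smooth_compact_bounded[OF sm, of r]) (rule r)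
 thus ?thesis
  using smooth_measurable[OF sm] r unfolding kernel_def by auto
qed

text \<open>The mean value inequality along the segment, once for the first derivative and once for
  the remainder. The bound is uniform in z, hence survives convolution.\<close>

lemma test_function_taylor:
 assumes k: "test_function k"
 shows "\<exists>C\<ge>0. ALL z h. \<bar>k (z + h) - k z - (\<Sum>i\<in>UNIV. h $ i * pd i k z)\<bar> <= C * (norm h)^2"
proof -
 have sm: "smooth k" using k by (simp add: test_function_iff)
 have "\<exists>B\<ge>0. ALL x. norm (pd j (pd i k) x) <= B" for i j
 proof -
  obtain r where "!!x. norm x > r ==> pd j (pd i k) x = 0"
   using test_function_radius[OF test_function_pd[OF test_function_pd[OF k]]] by metis
  thus ?thesis by (intro smooth_compact_bounded[of _ r] smooth_pd sm)
 qed
 hence "ALL i j. EX B. B >= 0 & (ALL x. \<bar>pd j (pd i k) x\<bar> <= B)" by auto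
 then obtain B where "ALL i j. B i j >= 0 & (ALL x. \<bar>pd j (pd i k) x\<bar> <= B i j)" by metis
 hence B: "!!i j. B i j >= 0" "!!i j x. \<bar>pd j (pd i k) x\<bar> <= B i j" by auto
 define C where "C = (\<Sum>i\<in>UNIV. \<Sum>j\<in>UNIV. B i j)"
 have C0: "C >= 0" using B by (auto simp: C_def intro!: sum_nonneg)
 have "\<bar>k (z + h) - k z - (\<Sum>i\<in>UNIV. h $ i * pd i k z)\<bar> <= C * (norm h)^2" for z h
 proof -
  define g' where "g' s = (\<Sum>i\<in>UNIV. h $ i * pd i k (z + s *\<^sub>R h))" for s
  have hc: "\<bar>h $ i\<bar> <= norm h" for i by (rule component_le_norm_cart)
  have g'd: "(g' has_real_derivative (\<Sum>i\<in>UNIV. h $ i * (\<Sum>j\<in>UNIV. h $ j * pd j (pd i k) (z + s *\<^sub>R h)))) (at s within {0..1})" for s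
   unfolding g'_def
   using smooth_line[OF smooth_pd[OF sm], of _ z h s "{0..1}"]
   by (intro DERIV_sum DERIV_cmult) (auto simp: has_real_derivative_iff_has_vector_derivative)
  have g'b: "\<bar>\<Sum>i\<in>UNIV. h $ i * (\<Sum>j\<in>UNIV. h $ j * pd j (pd i k) y)\<bar> <= C * (norm h)^2" for y
  proof -
   have "\<bar>\<Sum>i\<in>UNIV. h $ i * (\<Sum>j\<in>UNIV. h $ j * pd j (pd i k) y)\<bar>
    <= (\<Sum>i\<in>UNIV. norm h * (\<Sum>j\<in>UNIV. norm h * B i j))"
    by (intro order_trans[OF sum_abs] sum_mono)
     (auto simp: abs_mult intro!: mult_mono hc order_trans[OF sum_abs] sum_mono B)
   also have "... = C * (norm h)^2"
    by (simp add: C_def sum_distrib_left sum_distrib_right power2_eq_square mult_ac)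
   finally show ?thesis .
  qed
  have lip: "\<bar>g' s - g' 0\<bar> <= C * (norm h)^2" if "s \<in> {0..1}" for s
  proof -
   have "norm (g' s - g' 0) <= (C * (norm h)^2) * norm (s - 0)"
    by (rule field_differentiable_bound[where S="{0..1}", OF _ g'd]) (use that g'b in auto)
   also have "... <= (C * (norm h)^2) * 1" using that C0 by (intro mult_left_mono) auto
   finally show ?thesis by simp
  qed
  let ?f = "%s. k (z + s *\<^sub>R h) - s * g' 0"
  have "norm (?f 1 - ?f 0) <= (C * (norm h)^2) * norm (1 - 0 :: real)"
  proof (rule field_differentiable_bound[where S="{0..1}"])
   fix s :: real assume s: "s \<in> {0..1}"
   have "((%s. k (z + s *\<^sub>R h)) has_real_derivative g' s) (at s within {0..1})"
    using smooth_line[OF sm, of z h s "{0..1}"]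
    by (simp add: has_real_derivative_iff_has_vector_derivative g'_def)
   thus "(?f has_real_derivative (g' s - g' 0)) (at s within {0..1})"
    by (auto intro!: derivative_eq_intros)
   show "norm (g' s - g' 0) <= C * (norm h)^2" using lip[OF s] by simp
  qed auto
  thus ?thesis by (simp add: g'_def algebra_simps)
 qed
 thus ?thesis using C0 by blast
qed

lemma conv_has_derivative:
 fixes k :: "real^'n::finite => real" and f :: "real^'n => 'b::euclidean_space"
 assumes k: "test_function k" and f: "sqi f"
 shows "(conv k f has_derivative (%h. \<Sum>i\<in>UNIV. h $ i *\<^sub>R conv (pd i k) f x)) (at x)"
proof -
 obtain C where C: "C >= 0" "!!z h. \<bar>k (z + h) - k z - (\<Sum>i\<in>UNIV. h $ i * pd i k z)\<bar> <= C * (norm h)^2"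
  using test_function_taylor[OF k] by blast
 obtain r where r: "r >= 0" "!!x. norm x > r ==> k x = 0" using test_function_radius[OF k] by blast
 have rp: "pd i k x = 0" if "norm x > r" for i x by (rule pd_zero_outside[of r k]) (use that r in auto)
 \<comment> \<open>For norm h < 1 the ball of radius r + 1 contains the supports of
   \<open>k\<close>, of its derivatives and of the shifted kernel, so the Taylor remainder is
   dominated by (norm h)^2 times one fixed kernel.\<close>
 let ?I = "indicator (cball 0 (r + 1)) :: real^'n => real"
 have kI: "kernel ?I" unfolding kernel_def
 proof (intro conjI)
  show "EX s. ALL x. norm x > s --> ?I x = 0" by (intro exI[of _ "r + 1"]) auto
  show "EX B. ALL x. \<bar>?I x\<bar> <= B" by (intro exI[of _ 1]) (auto simp: indicator_def)
  show "bmeas ?I" by (intro borel_measurable_indicator) auto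
 qed
 define M where "M = C * (LINT y|lborel. norm (?I (x - y) *\<^sub>R f y))"
 have M0: "M >= 0" using C(1) by (simp add: M_def)
 have est: "norm (conv k f (x + h) - conv k f x - (\<Sum>i\<in>UNIV. h $ i *\<^sub>R conv (pd i k) f x)) <= M * (norm h)^2"
  if h: "norm h < 1" for h
 proof -
  have kk: "kernel k" "kernel (pd i k)" for i
   by (auto intro!: test_function_kernel test_function_pd k)
  note ci = conv_integrable[OF kk(1) f] conv_integrable[OF kk(2) f]
  let ?R = "%z. k (z + h) - k z - (\<Sum>i\<in>UNIV. h $ i * pd i k z)"
  have eq: "conv k f (x + h) - conv k f x - (\<Sum>i\<in>UNIV. h $ i *\<^sub>R conv (pd i k) f x)
   = (LINT y|lborel. k ((x + h) - y) *\<^sub>R f y - k (x - y) *\<^sub>R f y - (\<Sum>i\<in>UNIV. h $ i *\<^sub>R (pd i k (x - y) *\<^sub>R f y)))"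
   unfolding conv_def
   by (simp add: ci Bochner_Integration.integral_diff Bochner_Integration.integrable_diff
     Bochner_Integration.integrable_sum del: scaleR_scaleR)
  also have "... = (LINT y|lborel. ?R (x - y) *\<^sub>R f y)"
   by (intro Bochner_Integration.integral_cong)
    (auto simp: scaleR_diff_left scaleR_sum_left algebra_simps)
  finally have eq: "conv k f (x + h) - conv k f x - (\<Sum>i\<in>UNIV. h $ i *\<^sub>R conv (pd i k) f x) = (LINT y|lborel. ?R (x - y) *\<^sub>R f y)" .
  have bd: "\<bar>?R z\<bar> <= C * (norm h)^2 * ?I z" for z
  proof (cases "norm z <= r + 1")
   case True thus ?thesis using C(2)[of z h] by simp
  next
   case False
   hence "norm z > r" "norm (z + h) > r" using h norm_diff_ineq[of z h] by auto
   thus ?thesis using r(2) rp False by simp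
  qed
  have "norm (LINT y|lborel. ?R (x - y) *\<^sub>R f y) <= (LINT y|lborel. (C * (norm h)^2) * norm (?I (x - y) *\<^sub>R f y))"
  proof (rule order_trans[OF integral_norm_bound integral_mono[OF integrable_norm]])
   show "integrable lborel (%y. ?R (x - y) *\<^sub>R f y)"
   proof -
    have "integrable lborel (%y. k ((x + h) - y) *\<^sub>R f y - k (x - y) *\<^sub>R f y - (\<Sum>i\<in>UNIV. h $ i *\<^sub>R (pd i k (x - y) *\<^sub>R f y)))"
     by (intro Bochner_Integration.integrable_diff Bochner_Integration.integrable_sum integrable_scaleR_right ci)
    thus ?thesis by (simp add: scaleR_diff_left scaleR_sum_left algebra_simps)
   qed
   show "integrable lborel (%y. (C * (norm h)^2) * norm (?I (x - y) *\<^sub>R f y))"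
    by (intro integrable_mult_right integrable_norm conv_integrable[OF kI f])
   show "norm (?R (x - y) *\<^sub>R f y) <= (C * (norm h)^2) * norm (?I (x - y) *\<^sub>R f y)" for y
    using mult_right_mono[OF bd[of "x - y"] norm_ge_zero[of "f y"]] by (simp add: mult.assoc)
  qed
  also have "... = M * (norm h)^2"
   unfolding M_def by (subst integral_mult_right_zero) (simp only: mult.assoc mult.left_commute mult.commute)
  finally show ?thesis unfolding eq .
 qed
 show ?thesis
  unfolding has_derivative_at
 proof
  show "bounded_linear (%h. \<Sum>i\<in>UNIV. h $ i *\<^sub>R conv (pd i k) f x)"
   by (intro bounded_linear_sum bounded_linear_scaleR_const bounded_linear_vec_nth)
  show "((%h. norm (conv k f (x + h) - conv k f x - (\<Sum>i\<in>UNIV. h $ i *\<^sub>R conv (pd i k) f x)) / norm h) \<longlongrightarrow> 0) (at 0)"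
  proof (rule Lim_null_comparison)
   show "((%h. M * norm h) \<longlongrightarrow> 0) (at (0::real^'n))" by (auto intro!: tendsto_eq_intros)
   show "\<forall>\<^sub>F h in at 0. norm (norm (conv k f (x + h) - conv k f x - (\<Sum>i\<in>UNIV. h $ i *\<^sub>R conv (pd i k) f x)) / norm h) <= M * norm h"
    unfolding eventually_at
   proof (intro exI[of _ 1] conjI ballI impI)
    fix h :: "real^'n" assume "h ~= 0 & dist h 0 < 1"
    thus "norm (norm (conv k f (x + h) - conv k f x - (\<Sum>i\<in>UNIV. h $ i *\<^sub>R conv (pd i k) f x)) / norm h) <= M * norm h"
     using est[of h] by (simp add: divide_le_eq power2_eq_square mult.assoc)
   qed simp
  qed
 qed
qed

lemma pd_conv:
 assumes "test_function k" "sqi f" shows "pd i (conv k f) = conv (pd i k) f"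
proof
 fix x
 have "(\<Sum>j\<in>UNIV. (axis i (1::real) :: real^'a) $ j *\<^sub>R conv (pd j k) f x) = conv (pd i k) f x"
  by (simp add: axis_def if_distrib[where f="%c. c *\<^sub>R _"] sum.delta' cong: if_cong)
 thus "pd i (conv k f) x = conv (pd i k) f x"
  using pd_eqI[OF conv_has_derivative[OF assms], of i x] by simp
qed

lemma D_conv: assumes "test_function k" "sqi f" shows "D is (conv k f) = conv (D is k) f"
 by (induction "is") (simp_all add: pd_conv[OF test_function_D[OF assms(1)] assms(2)])

lemma smooth_conv: assumes "test_function k" "sqi f" shows "smooth (conv k f)"
 unfolding smooth_def D_conv[OF assms]
 using conv_has_derivative[OF test_function_D[OF assms(1)] assms(2)] by (auto simp: differentiable_def)

lemma conv_pd:
 assumes k: "test_function k" and sm: "smooth f" and sq: "sqi f" "sqi (pd i f)"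
 shows "conv k (pd i f) = conv (pd i k) f"
proof
 fix x
 let ?k = "%y. k ((-1) *\<^sub>R y + x)"
 have smk: "smooth k" using k by (simp add: test_function_iff)
 have pk: "pd i ?k = (%y. - pd i k (x - y))"
  using D_affine[OF smk, of "[i]" "-1" x] by simp
 have kk: "kernel (%y. k (x - y))" "kernel (%y. pd i k (x - y))"
  by (auto intro!: kernel_reflect[OF test_function_kernel] test_function_pd k)
 have "(LINT y|lborel. ?k y *\<^sub>R pd i f y) = - (LINT y|lborel. pd i ?k y *\<^sub>R f y)"
 proof (rule integral_by_parts[OF bounded_bilinear_scaleR _ sm _ _ sq])
  show "smooth ?k" by (rule smooth_affine[OF smk])
  show "sqi ?k" using kernel_sqi[OF kk(1)] by simp
  show "sqi (pd i ?k)" unfolding pk by (intro sqi_minus kernel_sqi kk)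
 qed
 thus "conv k (pd i f) x = conv (pd i k) f x"
  unfolding pk by (simp add: conv_def)
qed

text \<open>Smooth members of all Sobolev spaces. Mollified L^2 functions belong to this class, and
  the estimates are first proved in it by classical calculus.\<close>

definition h_inf :: "(real^'n::finite => 'b::euclidean_space) => bool" where
 "h_inf f \<longleftrightarrow> smooth f & (ALL is. sqi (D is f))"

lemma h_inf_conv: assumes "test_function k" "sqi f" shows "h_inf (conv k f)"
 unfolding h_inf_def D_conv[OF assms]
 using smooth_conv[OF assms] conv_l2(1)[OF test_function_kernel[OF test_function_D[OF assms(1)]] assms(2)] by auto

lemma h_inf_sqi: "h_inf f ==> sqi (D is f)" by (simp add: h_inf_def)
lemma h_inf_smooth: "h_inf f ==> smooth f" by (simp add: h_inf_def)
lemma h_inf_D: "h_inf f ==> h_inf (D is f)"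
 by (simp add: h_inf_def smooth_D D_append[symmetric])

lemma conv_D:
 assumes k: "test_function k" and f: "h_inf f"
 shows "conv k (D is f) = conv (D is k) f"
 using k
proof (induction "is" arbitrary: k)
 case (Cons i "is")
 have "conv k (pd i (D is f)) = conv (pd i k) (D is f)"
  using Cons.prems h_inf_sqi[OF f, of "is"] h_inf_sqi[OF f, of "i # is"]
  by (intro conv_pd h_inf_smooth h_inf_D f) auto
 also have "... = conv (D is (pd i k)) f"
  by (rule Cons.IH[OF test_function_pd[OF Cons.prems]])
 also have "D is (pd i k) = D (i # is) k"
  using Cons.prems by (simp add: D_pd_commute test_function_iff)
 finally show ?case by simp
qed simp

section \<open>Mollifiers\<close>

definition bump_mass :: "'n::finite itself => real" where
 "bump_mass _ = (LINT x|lborel. bump0 (x :: real^'n))"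

definition moll :: "real => real^'n::finite => real" where
 "moll ep x = bump0 ((1 / ep) *\<^sub>R x + 0) / (bump_mass TYPE('n) * ep ^ CARD('n))"

lemma bump_mass_pos: "bump_mass TYPE('n::finite) > 0"
proof -
 have k: "kernel (bump0 :: real^'n => real)" by (rule test_function_kernel[OF test_bump0])
 note [measurable] = kernel_measurable[OF k]
 have "bump_mass TYPE('n) ~= 0"
 proof
  assume "bump_mass TYPE('n) = 0"
  hence "AE x in lborel. bump0 (x :: real^'n) = 0"
   unfolding bump_mass_def
   by (subst (asm) integral_nonneg_eq_0_iff_AE[OF kernel_integrable[OF k]]) (auto simp: bump0_nonneg)
  moreover have "(x :: real^'n) \<notin> ball 0 1" if "bump0 x = 0" for x
   using that bump0_pos[of x] by auto
  ultimately have "AE x in lborel. (x :: real^'n) \<notin> ball 0 1" by (auto elim: eventually_mono)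
  hence "emeasure lborel {x::real^'n. norm x < 1} = 0"
   by (subst (asm) AE_iff_measurable[OF _ refl]) (auto simp: Compl_eq_Diff_UNIV[symmetric])
  moreover have "ball (0::real^'n) 1 = {x. norm x < 1}" by auto
  ultimately have "emeasure lborel (ball (0::real^'n) 1) = 0" by simp
  moreover have "emeasure lborel (ball (0::real^'n) 1) ~= 0"
  proof -
   have "\<not> negligible (ball (0::real^'n) 1)" by (rule open_not_negligible) auto
   thus ?thesis by (auto simp: negligible_iff_emeasure0)
  qed
  ultimately show False by simp
 qed
 moreover have "bump_mass TYPE('n) >= 0" unfolding bump_mass_def by (simp add: bump0_nonneg)
 ultimately show ?thesis by simp
qed

lemma test_function_cmult: assumes k: "test_function k" shows "test_function (%x. c * k x)"
proof -
 obtain r where r: "!!x. norm x > r ==> k x = 0" using test_function_radius[OF k] by metis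
 show ?thesis
  by (rule test_functionI[of _ r])
   (use k r in "auto simp: test_function_iff intro!: smooth_linear[OF bounded_linear_mult_right]")
qed

lemma moll_test: assumes "ep > 0" shows "test_function (moll ep :: real^'n::finite => real)"
proof -
 have "test_function (%x::real^'n. (1 / (bump_mass TYPE('n) * ep ^ CARD('n))) * bump0 ((1 / ep) *\<^sub>R x + 0))"
  using assms by (intro test_function_cmult test_function_affine test_bump0) auto
 thus ?thesis by (simp add: moll_def[abs_def])
qed

lemma moll_kernel: "ep > 0 ==> kernel (moll ep)"
 by (rule test_function_kernel[OF moll_test])

lemma moll_nonneg: "ep > 0 ==> moll ep x >= 0"
 unfolding moll_def by (intro divide_nonneg_nonneg bump0_nonneg mult_nonneg_nonneg less_imp_le[OF bump_mass_pos]) auto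

lemma moll_even: "moll ep (- x) = moll ep x"
 using bump_even[of "x /\<^sub>R ep"] by (simp add: moll_def divide_inverse)

lemma moll_zero: assumes "ep > 0" "norm x >= ep" shows "moll ep x = 0"
proof -
 have "norm ((1 / ep) *\<^sub>R x) >= 1" using assms by (simp add: field_simps)
 thus ?thesis by (simp add: moll_def bump_support)
qed

lemma moll_integral: assumes "ep > 0" shows "(LINT x|lborel. moll ep (x :: real^'n::finite)) = 1"
proof -
 have m: "bmeas (bump0 :: real^'n => real)"
  by (rule kernel_measurable[OF test_function_kernel[OF test_bump0]])
 have "bump_mass TYPE('n) = \<bar>1 / ep\<bar> ^ CARD('n) *\<^sub>R (LINT x|lborel. bump0 (0 + (1 / ep) *\<^sub>R (x :: real^'n)))"
  unfolding bump_mass_def using lborel_integral_affine[OF m, of "1/ep" 0] assms by simp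
 hence "(LINT x|lborel. bump0 ((1 / ep) *\<^sub>R (x :: real^'n) + 0)) = bump_mass TYPE('n) * ep ^ CARD('n)"
  using assms by (simp add: field_simps power_divide)
 thus ?thesis using bump_mass_pos[where 'n='n] assms by (simp add: moll_def)
qed

lemma moll_abs_integral: "ep > 0 ==> (LINT x|lborel. \<bar>moll ep x\<bar>) = 1"
 by (simp add: moll_nonneg moll_integral)

text \<open>Stated in \<open>ennreal\<close>, so that it can be integrated by Tonelli before
  integrability of either side is known.\<close>

lemma jensen_sq:
 fixes F :: "'a::euclidean_space => 'b::euclidean_space"
 assumes [measurable]: "bmeas w" "bmeas F"
  and w: "!!y. w y >= 0" "(\<integral>\<^sup>+y. ennreal (w y) \<partial>lborel) = 1"
 shows "ennreal ((norm (LINT y|lborel. w y *\<^sub>R F y))^2) <= (\<integral>\<^sup>+y. ennreal (w y * (norm (F y))^2) \<partial>lborel)"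
proof (cases "(\<integral>\<^sup>+y. ennreal (w y * (norm (F y))^2) \<partial>lborel) < \<infinity>")
 case True
 let ?a = "%y. sqrt (w y)" and ?b = "%y. sqrt (w y) *\<^sub>R F y"
 have na: "(norm (?a y))^2 = w y" and nb: "(norm (?b y))^2 = w y * (norm (F y))^2" for y
  using w(1)[of y] by (auto simp: power_mult_distrib)
 have "integrable lborel w" using w by (intro integrableI_nonneg) auto
 hence a: "sqi ?a" using na by (simp add: sqi_def)
 have "integrable lborel (%y. w y * (norm (F y))^2)"
  using True w(1) by (intro integrableI_nonneg) auto
 hence b: "sqi ?b" using nb by (simp add: sqi_def)
 have "norm (LINT y|lborel. w y *\<^sub>R F y) <= (LINT y|lborel. norm (w y *\<^sub>R F y))" by (rule integral_norm_bound)
 also have "... = (LINT y|lborel. norm (?a y) * norm (?b y))"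
  using w(1) by (intro Bochner_Integration.integral_cong) (auto simp flip: mult.assoc)
 also have "... <= norm (cl ?a) * norm (cl ?b)" by (rule l2_inner_le[OF a b])
 finally have le: "norm (LINT y|lborel. w y *\<^sub>R F y) <= norm (cl ?a) * norm (cl ?b)" .
 have "(norm (cl ?a))^2 = 1"
  using nn_integral_eq_integral[OF \<open>integrable lborel w\<close>] w by (simp add: norm_cl_sq[OF a])
 hence "(norm (LINT y|lborel. w y *\<^sub>R F y))^2 <= (norm (cl ?b))^2"
  using power_mono[OF le norm_ge_zero, of 2] unfolding power_mult_distrib by simp
 also have "... = (LINT y|lborel. w y * (norm (F y))^2)" unfolding norm_cl_sq[OF b] nb ..
 finally show ?thesis
  using nn_integral_eq_integral[OF \<open>integrable lborel (%y. w y * (norm (F y))^2)\<close>] w(1)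
  by (simp add: ennreal_leI)
qed (auto simp: not_less top_unique)

text \<open>The difference is the integral over the segment of the derivative in direction z;
  Jensen's inequality and translation invariance of the L^2 norm give the bound.\<close>

lemma translate_l2:
 fixes f :: "real^'n::finite => 'b::euclidean_space"
 assumes sm: "smooth f" and sq: "!!i. sqi (pd i f)"
 shows "sqi (%x. f (x + z) - f x)"
  "norm (cl (%x. f (x + z) - f x)) <= norm z * (\<Sum>i\<in>UNIV. norm (cl (pd i f)))"
proof -
 define g where "g x = (\<Sum>i\<in>UNIV. z $ i *\<^sub>R pd i f x)" for x
 have g: "sqi g" unfolding g_def by (intro sqi_sum sqi_scaleR sq)
 note [measurable] = sqi_measurable[OF g] smooth_measurable[OF sm]
 have gc: "continuous_on S g" for S
  unfolding g_def by (intro continuous_intros smooth_continuous smooth_pd sm)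
 have ng: "norm (cl g) <= norm z * (\<Sum>i\<in>UNIV. norm (cl (pd i f)))"
 proof -
  have "cl g = (\<Sum>i\<in>UNIV. z $ i *\<^sub>R cl (pd i f))"
   unfolding g_def by (simp add: cl_sum cl_scaleR sq)
  also have "norm ... <= (\<Sum>i\<in>UNIV. norm z * norm (cl (pd i f)))"
   by (intro order_trans[OF norm_sum] sum_mono) (simp add: mult_right_mono component_le_norm_cart)
  finally show ?thesis by (simp add: sum_distrib_left)
 qed
 have pt: "ennreal ((norm (f (x + z) - f x))^2) <= (\<integral>\<^sup>+s. ennreal (indicator {0..1} s * (norm (g (x + s *\<^sub>R z)))^2) \<partial>lborel)" for x
 proof -
  have "(LINT s|lborel. indicator {0..1::real} s *\<^sub>R g (x + s *\<^sub>R z)) = f (x + 1 *\<^sub>R z) - f (x + 0 *\<^sub>R z)"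
   unfolding g_def
   by (intro integral_FTC_atLeastAtMost smooth_line[OF sm] continuous_intros
     continuous_on_compose2[OF smooth_continuous[OF smooth_pd[OF sm], of UNIV]]) auto
  moreover have "ennreal ((norm (LINT s|lborel. indicator {0..1::real} s *\<^sub>R g (x + s *\<^sub>R z)))^2)
    <= (\<integral>\<^sup>+s. ennreal (indicator {0..1} s * (norm (g (x + s *\<^sub>R z)))^2) \<partial>lborel)"
   by (rule jensen_sq) (auto simp: ennreal_indicator)
  ultimately show ?thesis by simp
 qed
 have ti: "(\<integral>\<^sup>+x. ennreal ((norm (g (x + t)))^2) \<partial>lborel) = ennreal ((norm (cl g))^2)" for t
  using lborel_integrable_translate[OF sqi_integrable[OF g], of t]
   lborel_integral_translate[of "%x. (norm (g x))^2" t]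
  by (subst nn_integral_eq_integral) (auto simp: norm_cl_sq[OF g])
 have "(\<integral>\<^sup>+x. ennreal ((norm (f (x + z) - f x))^2) \<partial>lborel)
  <= (\<integral>\<^sup>+x. (\<integral>\<^sup>+s. ennreal (indicator {0..1::real} s * (norm (g (x + s *\<^sub>R z)))^2) \<partial>lborel) \<partial>lborel)"
  by (rule nn_integral_mono) (rule pt)
 also have "... = (\<integral>\<^sup>+s. (\<integral>\<^sup>+x. ennreal (indicator {0..1::real} s * (norm (g (x + s *\<^sub>R z)))^2) \<partial>lborel) \<partial>lborel)"
  by (rule lborel_pair.Fubini') measurable
 also have "... = (\<integral>\<^sup>+s. indicator {0..1::real} s * ennreal ((norm (cl g))^2) \<partial>lborel)"
  by (intro nn_integral_cong) (auto simp: indicator_def ti)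
 also have "... = ennreal ((norm (cl g))^2)"
  by (subst nn_integral_multc) auto
 also have "... <= ennreal ((norm z * (\<Sum>i\<in>UNIV. norm (cl (pd i f))))^2)"
  using ng by (intro ennreal_leI power_mono) auto
 finally have le: "(\<integral>\<^sup>+x. ennreal ((norm (f (x + z) - f x))^2) \<partial>lborel)
  <= ennreal ((norm z * (\<Sum>i\<in>UNIV. norm (cl (pd i f))))^2)" .
 show "sqi (%x. f (x + z) - f x)"
  "norm (cl (%x. f (x + z) - f x)) <= norm z * (\<Sum>i\<in>UNIV. norm (cl (pd i f)))"
  by (rule sqi_nn_integralI[OF _ _ le]; auto intro!: mult_nonneg_nonneg sum_nonneg)+
qed

text \<open>Mollification minus identity is an average of translation differences over shifts
  shorter than \<open>ep\<close>.\<close>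

lemma moll_rate:
 fixes f :: "real^'n::finite => 'b::euclidean_space"
 assumes e: "ep > 0" and sm: "smooth f" and f: "sqi f" and sq: "!!i. sqi (pd i f)"
 shows "norm (cl (conv (moll ep) f) - cl f) <= ep * (\<Sum>i\<in>UNIV. norm (cl (pd i f)))"
proof -
 let ?K = "\<Sum>i\<in>UNIV. norm (cl (pd i f))"
 have K0: "?K >= 0" by (intro sum_nonneg) simp
 have k: "kernel (moll ep :: real^'n => real)" by (rule moll_kernel[OF e])
 note [measurable] = kernel_measurable[OF k] sqi_measurable[OF f] conv_measurable[OF k sqi_measurable[OF f]]
 have mi: "(\<integral>\<^sup>+y. ennreal (moll ep (y :: real^'n)) \<partial>lborel) = 1"
  using nn_integral_eq_integral[OF kernel_integrable[OF k]] by (simp add: moll_nonneg[OF e] moll_integral[OF e])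
 have pt: "ennreal ((norm (conv (moll ep) f x - f x))^2) <= (\<integral>\<^sup>+y. ennreal (moll ep y * (norm (f (x - y) - f x))^2) \<partial>lborel)" for x
 proof -
  have i1: "integrable lborel (%y. moll ep (x - y) *\<^sub>R f y)" by (rule conv_integrable[OF k f])
  have i2: "integrable lborel (%y. moll ep y *\<^sub>R f (x - y))"
   using lborel_integrable_affine[OF i1, of "-1" x] by simp
  have i3: "integrable lborel (%y::real^'n. moll ep y *\<^sub>R f x)"
   by (intro integrable_scaleR_left kernel_integrable k)
  have "conv (moll ep) f x = (LINT y|lborel. moll ep y *\<^sub>R f (x - y))"
   unfolding conv_def using integral_reflect[of "%y. moll ep (x - y) *\<^sub>R f y" x] by simp
  hence "conv (moll ep) f x - f x = (LINT y|lborel. moll ep y *\<^sub>R f (x - y) - moll ep y *\<^sub>R f x)"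
   using i2 i3 kernel_integrable[OF k] by (simp add: Bochner_Integration.integral_diff moll_integral[OF e] k)
  also have "... = (LINT y|lborel. moll ep y *\<^sub>R (f (x - y) - f x))"
   by (simp add: scaleR_diff_right)
  finally show ?thesis
   using jensen_sq[of "moll ep" "%y. f (x - y) - f x"] by (simp add: moll_nonneg[OF e] mi)
 qed
 have "(\<integral>\<^sup>+x. ennreal ((norm (conv (moll ep) f x - f x))^2) \<partial>lborel)
  <= (\<integral>\<^sup>+x. (\<integral>\<^sup>+y. ennreal (moll ep y * (norm (f (x - y) - f x))^2) \<partial>lborel) \<partial>lborel)"
  by (rule nn_integral_mono) (rule pt)
 also have "... = (\<integral>\<^sup>+y. (\<integral>\<^sup>+x. ennreal (moll ep y * (norm (f (x - y) - f x))^2) \<partial>lborel) \<partial>lborel)"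
  by (rule lborel_pair.Fubini') measurable
 also have "... <= (\<integral>\<^sup>+y. ennreal (moll ep (y :: real^'n)) * ennreal ((ep * ?K)^2) \<partial>lborel)"
 proof (rule nn_integral_mono)
  fix y :: "real^'n"
  show "(\<integral>\<^sup>+x. ennreal (moll ep y * (norm (f (x - y) - f x))^2) \<partial>lborel) <= ennreal (moll ep y) * ennreal ((ep * ?K)^2)"
  proof (cases "norm y >= ep")
   case True thus ?thesis by (simp add: moll_zero[OF e])
  next
   case False
   note t = translate_l2[OF sm sq, of "- y"]
   have "norm (cl (%x. f (x - y) - f x)) <= norm y * ?K" using t(2) by simp
   also have "... <= ep * ?K" using False K0 by (intro mult_right_mono) auto
   finally have "(norm (cl (%x. f (x - y) - f x)))^2 <= (ep * ?K)^2" by (intro power_mono) auto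
   moreover have s: "sqi (%x. f (x - y) - f x)" using t(1) by simp
   hence "(\<integral>\<^sup>+x. ennreal ((norm (f (x - y) - f x))^2) \<partial>lborel) = ennreal ((norm (cl (%x. f (x - y) - f x)))^2)"
    using nn_integral_eq_integral[OF sqi_integrable[OF s]] by (simp add: norm_cl_sq[OF s])
   ultimately have "(\<integral>\<^sup>+x. ennreal ((norm (f (x - y) - f x))^2) \<partial>lborel) <= ennreal ((ep * ?K)^2)"
    by (simp add: ennreal_leI)
   hence "ennreal (moll ep y) * (\<integral>\<^sup>+x. ennreal ((norm (f (x - y) - f x))^2) \<partial>lborel) <= ennreal (moll ep y) * ennreal ((ep * ?K)^2)"
    by (rule mult_left_mono) simp
   moreover have "(\<integral>\<^sup>+x. ennreal (moll ep y * (norm (f (x - y) - f x))^2) \<partial>lborel)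
     = ennreal (moll ep y) * (\<integral>\<^sup>+x. ennreal ((norm (f (x - y) - f x))^2) \<partial>lborel)"
    by (subst nn_integral_cmult[symmetric]) (auto simp: ennreal_mult moll_nonneg[OF e])
   ultimately show ?thesis by simp
  qed
 qed
 also have "... = ennreal ((ep * ?K)^2)"
  by (subst nn_integral_multc) (auto simp: mi)
 finally have le: "(\<integral>\<^sup>+x. ennreal ((norm (conv (moll ep) f x - f x))^2) \<partial>lborel) <= ennreal ((ep * ?K)^2)" .
 have "norm (cl (%x. conv (moll ep) f x - f x)) <= ep * ?K"
  by (rule sqi_nn_integralI(2)[OF _ _ le]) (use e K0 in auto)
 thus ?thesis using cl_diff[OF conv_l2(1)[OF k f] f] by simp
qed

section \<open>Density of smooth compactly supported functions\<close>

definition smooth_cpt :: "(real^'n::finite => 'b::real_normed_vector) => bool" where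
 "smooth_cpt f \<longleftrightarrow> smooth f & (EX r. ALL x. norm x > r --> f x = 0)"

lemma cpt_bounded_sqi:
 fixes f :: "'a::euclidean_space => 'b::euclidean_space"
 assumes [measurable]: "bmeas f"
  and "!!x. norm (f x) <= B" "!!x. norm x > r ==> f x = 0"
 shows "sqi f"
proof -
 have "kernel (%x. norm (f x))" using assms unfolding kernel_def by auto
 thus ?thesis using kernel_sqi[of "%x. norm (f x)"] by (simp add: sqi_def)
qed

lemma smooth_cpt_h_inf: fixes f :: "real^'n::finite => 'b::euclidean_space"
 assumes "smooth_cpt f" shows "h_inf f"
proof -
 obtain r where r: "!!x. norm x > r ==> f x = 0" using assms by (auto simp: smooth_cpt_def)
 have sm: "smooth f" using assms by (simp add: smooth_cpt_def)
 have "sqi (D is f)" for "is"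
 proof -
  have z: "D is f x = 0" if "norm x > r" for x by (rule D_zero_outside[of r f]) (use r that in auto)
  obtain B where "ALL x. norm (D is f x) <= B"
   using smooth_compact_bounded[OF smooth_D[OF sm] z] by blast
  thus ?thesis by (intro cpt_bounded_sqi[of _ B r]) (auto intro: smooth_measurable smooth_D sm z)
 qed
 thus ?thesis by (simp add: h_inf_def sm)
qed

text \<open>Used three times below: a = 0, c = B bounds the mollification; a = 0, c = 0 locates its
  support; a = G x measures its distance to \<open>G\<close>.\<close>

lemma conv_moll_bound:
 fixes G :: "real^'n::finite => 'b::euclidean_space"
 assumes e: "ep > 0" and G: "sqi G" and c: "!!y. norm (y - x) < ep ==> norm (G y - a) <= c" and c0: "c >= 0"
 shows "norm (conv (moll ep) G x - a) <= c"
proof -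
 have k: "kernel (moll ep :: real^'n => real)" by (rule moll_kernel[OF e])
 have i1: "integrable lborel (%y. moll ep (x - y) *\<^sub>R G y)" by (rule conv_integrable[OF k G])
 have i2: "integrable lborel (%y. moll ep (x - y))" by (rule kernel_integrable[OF kernel_reflect[OF k]])
 have one: "(LINT y|lborel. moll ep (x - y)) = 1"
  using integral_reflect[OF kernel_measurable[OF k], of x] by (simp add: moll_integral[OF e])
 have "conv (moll ep) G x - a = (LINT y|lborel. moll ep (x - y) *\<^sub>R G y - moll ep (x - y) *\<^sub>R a)"
  unfolding conv_def using i1 i2 one by (simp add: Bochner_Integration.integral_diff)
 also have "... = (LINT y|lborel. moll ep (x - y) *\<^sub>R (G y - a))" by (simp add: scaleR_diff_right)
 also have "norm ... <= (LINT y|lborel. moll ep (x - y) * c)"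
 proof (rule order_trans[OF integral_norm_bound integral_mono[OF integrable_norm]])
  show "integrable lborel (%y. moll ep (x - y) *\<^sub>R (G y - a))"
   using i1 i2 by (simp add: scaleR_diff_right)
  show "integrable lborel (%y. moll ep (x - y) * c)" using i2 by simp
  show "norm (moll ep (x - y) *\<^sub>R (G y - a)) <= moll ep (x - y) * c" for y
  proof (cases "norm (y - x) < ep")
   case True thus ?thesis using c moll_nonneg[OF e, of "x - y"] by (simp add: mult_left_mono)
  next
   case False thus ?thesis by (simp add: moll_zero[OF e] norm_minus_commute)
  qed
 qed
 also have "... = c" using one by simp
 finally show ?thesis .
qed

lemma smooth_approx_continuous:
 fixes G :: "real^'n::finite => 'b::euclidean_space"
 assumes c: "continuous_on UNIV G" and z: "!!x. norm x > r ==> G x = 0" and B: "!!x. norm (G x) <= B" and d: "d > 0"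
 shows "\<exists>\<phi>. smooth \<phi> & (ALL x. norm (\<phi> x - G x) <= d) & (ALL x. norm (\<phi> x) <= B) & (ALL x. norm x > r + 1 --> \<phi> x = 0)"
proof -
 have G: "sqi G" by (rule cpt_bounded_sqi[OF _ B z]) (auto intro: borel_measurable_continuous_onI c)
 have B0: "B >= 0" using B[of 0] norm_ge_zero order_trans by blast
 have "uniformly_continuous_on (cball 0 (r + 3)) G"
  by (rule compact_uniformly_continuous) (auto intro: continuous_on_subset[OF c])
 then obtain \<eta> where \<eta>: "\<eta> > 0" "!!x y. norm x <= r + 3 ==> norm y <= r + 3 ==> dist y x < \<eta> ==> dist (G y) (G x) < d"
  using d unfolding uniformly_continuous_on_def by (metis mem_cball_0)
 define ep where "ep = min \<eta> 1"
 have e: "ep > 0" "ep <= 1" "ep <= \<eta>" using \<eta>(1) by (auto simp: ep_def)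
 have near: "norm x - norm (y - x) <= norm y" for x y :: "real^'n"
  using norm_triangle_ineq2[of x "x - y"] by (simp add: norm_minus_commute)
 show ?thesis
 proof (intro exI conjI allI impI)
  show "smooth (conv (moll ep) G)" by (rule smooth_conv[OF moll_test[OF e(1)] G])
  show "norm (conv (moll ep) G x) <= B" for x
   using conv_moll_bound[OF e(1) G, of x 0 B] B B0 by simp
  show "conv (moll ep) G x = 0" if x: "norm x > r + 1" for x
  proof -
   have "norm (conv (moll ep) G x - 0) <= 0"
   proof (rule conv_moll_bound[OF e(1) G])
    fix y assume "norm (y - x) < ep"
    hence "norm y > r" using near[of x y] x e by linarith
    thus "norm (G y - 0) <= 0" by (simp add: z)
   qed simp
   thus ?thesis by simp
  qed
  show "norm (conv (moll ep) G x - G x) <= d" for x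
  proof (rule conv_moll_bound[OF e(1) G])
   fix y assume y: "norm (y - x) < ep"
   show "norm (G y - G x) <= d"
   proof (cases "norm x <= r + 2")
    case True
    have "norm y <= norm x + norm (y - x)" using norm_triangle_ineq[of x "y - x"] by simp
    hence "norm y <= r + 3" using True y e by linarith
    thus ?thesis using \<eta>(2)[of x y] True y e by (simp add: dist_norm less_imp_le)
   next
    case False
    hence "norm y > r" "norm x > r" using near[of x y] y e by linarith+
    thus ?thesis using z d by simp
   qed
  qed (use d in simp)
 qed
qed

text \<open>A measurable function is an almost everywhere limit of continuous ones. These are cut
  off in value and in space and then mollified with error 1/(n + 1).\<close>

lemma smooth_approx_AE:
 fixes \<psi> :: "real^'n::finite => 'b::euclidean_space"
 assumes m: "bmeas \<psi>" and B: "!!x. norm (\<psi> x) <= B" "B > 0"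
  and z: "!!x. norm x > r ==> \<psi> x = 0"
 obtains \<phi> where "!!n::nat. smooth (\<phi> n)" "!!n x. norm (\<phi> n x) <= B" "!!n x. norm x > r + 2 ==> \<phi> n x = 0"
  "AE x in lborel. (%n. \<phi> n x) \<longlonglongrightarrow> \<psi> x"
proof -
 have "\<psi> \<in> borel_measurable lebesgue" using m by (simp add: measurable_completion)
 hence "\<psi> measurable_on UNIV" by (simp add: measurable_on_iff_borel_measurable)
 then obtain N g where g: "negligible N" "!!n. continuous_on UNIV (g n)" "!!x. x \<notin> N ==> (%n. g n x) \<longlonglongrightarrow> \<psi> x"
  by (auto simp: measurable_on_def)
 define cut where "cut x = max 0 (min 1 (r + 1 - norm x))" for x :: "real^'n"
 \<comment> \<open>The factor B / max B |g| brings values into the ball of radius \<open>B\<close>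
   and is 1 inside it, so it tends to 1 wherever the limit obeys the bound.\<close>
 define G where "G n x = (cut x * (B / max B (norm (g n x)))) *\<^sub>R g n x" for n x
 have Gc: "continuous_on UNIV (G n)" for n
  unfolding G_def cut_def using B(2) by (intro continuous_intros g(2)) (auto simp: max_def)
 have Gb: "norm (G n x) <= B" for n x
 proof -
  have "B / max B (norm (g n x)) * norm (g n x) <= B"
   using B(2) by (auto simp: max_def field_simps)
  moreover have "0 <= cut x" "cut x <= 1" by (auto simp: cut_def)
  moreover have "norm (G n x) = cut x * (B / max B (norm (g n x)) * norm (g n x))"
   using B(2) \<open>0 <= cut x\<close> by (simp add: G_def abs_mult abs_of_pos max_def)
  ultimately show ?thesis
   using mult_mono[of "cut x" 1 "B / max B (norm (g n x)) * norm (g n x)" B] B(2) by auto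
 qed
 have Gz: "G n x = 0" if "norm x > r + 1" for n x using that by (simp add: G_def cut_def)
 have Glim: "(%n. G n x) \<longlonglongrightarrow> \<psi> x" if "x \<notin> N" for x
 proof -
  have mx: "max B (norm (\<psi> x)) = B" using B(1)[of x] by (simp add: max_def)
  have "(%n. G n x) \<longlonglongrightarrow> (cut x * (B / max B (norm (\<psi> x)))) *\<^sub>R \<psi> x"
   unfolding G_def using B(2) by (intro tendsto_intros g(3)[OF that]) (auto simp: mx)
  moreover have "(cut x * (B / max B (norm (\<psi> x)))) *\<^sub>R \<psi> x = \<psi> x"
  proof (cases "norm x <= r")
   case True thus ?thesis using B(2) by (simp add: mx cut_def)
  qed (simp add: z)
  ultimately show ?thesis by simp
 qed
 have "\<exists>\<phi>. smooth \<phi> & (ALL x. norm (\<phi> x - G n x) <= 1 / real (Suc n)) & (ALL x. norm (\<phi> x) <= B) & (ALL x. norm x > r + 1 + 1 --> \<phi> x = 0)" for n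
  by (rule smooth_approx_continuous[OF Gc Gz Gb]) auto
 then obtain \<phi> where \<phi>: "!!n. smooth (\<phi> n)" "!!n x. norm (\<phi> n x - G n x) <= 1 / real (Suc n)"
  "!!n x. norm (\<phi> n x) <= B" "!!n x. norm x > r + 1 + 1 ==> \<phi> n x = 0"
  by metis
 have "(%n. \<phi> n x) \<longlonglongrightarrow> \<psi> x" if "x \<notin> N" for x
 proof -
  have "(%n. \<phi> n x - G n x) \<longlonglongrightarrow> 0"
   by (rule Lim_null_comparison[OF always_eventually[OF allI[OF \<phi>(2)]]])
    (use LIMSEQ_inverse_real_of_nat in "simp add: inverse_eq_divide")
  from tendsto_add[OF this Glim[OF that]] show ?thesis by simp
 qed
 moreover have "AE x in lebesgue. x \<notin> N"
  using g(1) by (simp add: negligible_iff_null_sets AE_not_in)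
 ultimately have "AE x in lebesgue. (%n. \<phi> n x) \<longlonglongrightarrow> \<psi> x" by (auto elim: eventually_mono)
 hence "AE x in lborel. (%n. \<phi> n x) \<longlonglongrightarrow> \<psi> x"
  by (simp add: AE_completion_iff)
 thus ?thesis using \<phi> by (intro that[of \<phi>]) (auto simp: add.assoc)
qed

lemma l2_dominated_convergence:
 fixes f :: "'a::euclidean_space => 'b::euclidean_space" and w :: "'a => 'c::euclidean_space"
 assumes m: "bmeas f" "!!n. bmeas (g n)" and w: "sqi w"
  and lim: "AE x in lborel. (%n. g n x) \<longlonglongrightarrow> f x"
  and dom: "!!n x. norm (g n x - f x) <= norm (w x)"
  and f: "sqi f"
 shows "(%n. cl (g n)) \<longlonglongrightarrow> cl f"
proof -
 note [measurable] = m sqi_measurable[OF w]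
 have d: "sqi (%x. g n x - f x)" for n
  by (rule sqi_dominated[OF _ w, where c=1]) (auto simp: dom)
 have gs: "sqi (g n)" for n using sqi_add[OF d[of n] f] by simp
 have "(%n. LINT x|lborel. (norm (g n x - f x))^2) \<longlonglongrightarrow> (LINT x|(lborel::'a measure). 0)"
 proof (rule integral_dominated_convergence[where w="%x. (norm (w x))^2"])
  show "AE x in lborel. (%n. (norm (g n x - f x))^2) \<longlonglongrightarrow> 0"
   using lim
  proof eventually_elim
   case (elim x)
   have "(%n. (norm (g n x - f x))^2) \<longlonglongrightarrow> (norm (f x - f x))^2" by (intro tendsto_intros elim)
   thus ?case by simp
  qed
  show "AE x in lborel. norm ((norm (g n x - f x))^2) <= (norm (w x))^2" for n
   using dom by (intro AE_I2) (simp add: power_mono)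
 qed (use sqi_integrable[OF w] in auto)
 hence "(%n. (norm (cl (g n) - cl f))^2) \<longlonglongrightarrow> 0"
  by (simp add: norm_cl_sq[OF d] cl_diff[OF gs f, symmetric])
 hence "(%n. sqrt ((norm (cl (g n) - cl f))^2)) \<longlonglongrightarrow> sqrt 0" by (intro tendsto_intros)
 hence "(%n. norm (cl (g n) - cl f)) \<longlonglongrightarrow> 0" by simp
 thus ?thesis by (rule LIM_zero_cancel[OF tendsto_norm_zero_cancel])
qed

text \<open>Truncation in value and in space comes first, so that \<open>smooth_approx_AE\<close>
  and dominated convergence apply.\<close>

lemma smooth_cpt_dense:
 fixes u :: "(real^'n::finite, 'b::euclidean_space) l2"
 assumes e: "e > 0"
 shows "\<exists>\<phi>. smooth_cpt \<phi> & norm (u - cl \<phi>) < e"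
proof -
 define t where "t n x = (if norm x <= real n & norm (rp u x) <= real n then rp u x else 0)" for n x
 have tm [measurable]: "bmeas (t n)" for n unfolding t_def by measurable
 have "(%n. cl (t n)) \<longlonglongrightarrow> cl (rp u)"
 proof (rule l2_dominated_convergence[where w="rp u"])
  have "(%n. t n x) \<longlonglongrightarrow> rp u x" for x
  proof (rule tendsto_eventually)
   obtain N :: nat where N: "max (norm x) (norm (rp u x)) <= N" using real_arch_simple by blast
   show "\<forall>\<^sub>F n in sequentially. t n x = rp u x"
    using eventually_ge_at_top[of N]
   proof eventually_elim
    case (elim n)
    hence "real N <= real n" by simp
    thus ?case using N by (auto simp: t_def)
   qed
  qed
  thus "AE x in lborel. (%n. t n x) \<longlonglongrightarrow> rp u x" by simp
 qed (auto simp: t_def)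
 hence "(%n. norm (u - cl (t n))) \<longlonglongrightarrow> norm (u - u)" by (intro tendsto_intros) simp
 hence "\<forall>\<^sub>F n in sequentially. norm (u - cl (t n)) < e / 2"
  using e by (intro order_tendstoD(2)[where y=0]) auto
 then obtain n where n: "norm (u - cl (t n)) < e / 2" by (auto simp: eventually_sequentially)
 have tb: "norm (t n x) <= real n + 1" "norm x > real n ==> t n x = 0" for x by (auto simp: t_def)
 obtain \<phi> where \<phi>: "!!k::nat. smooth (\<phi> k)" "!!k x. norm (\<phi> k x) <= real n + 1" "!!k x. norm x > real n + 2 ==> \<phi> k x = 0"
  "AE x in lborel. (%k. \<phi> k x) \<longlonglongrightarrow> t n x"
  by (rule smooth_approx_AE[OF tm tb(1) _ tb(2)]) auto
 have ts: "sqi (t n)" by (rule cpt_bounded_sqi[OF tm tb])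
 have "(%k. cl (\<phi> k)) \<longlonglongrightarrow> cl (t n)"
 proof (rule l2_dominated_convergence[where w="%x. 2 * (real n + 1) * indicator (cball (0::real^'n) (real n + 2)) x :: real"])
  show "norm (\<phi> k x - t n x) <= norm (2 * (real n + 1) * indicator (cball 0 (real n + 2)) x :: real)" for k x
  proof (cases "norm x <= real n + 2")
   case True
   thus ?thesis using norm_triangle_ineq4[of "\<phi> k x" "t n x"] \<phi>(2)[of k x] tb(1)[of x] by simp
  qed (simp add: \<phi>(3) tb(2))
  show "sqi (%x. 2 * (real n + 1) * indicator (cball (0::real^'n) (real n + 2)) x :: real)"
   by (rule cpt_bounded_sqi[of _ "2 * (real n + 1)" "real n + 2"]) (auto simp: indicator_def intro!: borel_measurable_times borel_measurable_indicator)
 qed (use \<phi> ts in "auto intro: smooth_measurable")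
 hence "(%k. norm (cl (t n) - cl (\<phi> k))) \<longlonglongrightarrow> norm (cl (t n) - cl (t n))" by (intro tendsto_intros)
 hence "\<forall>\<^sub>F k in sequentially. norm (cl (t n) - cl (\<phi> k)) < e / 2"
  using e by (intro order_tendstoD(2)[where y=0]) auto
 then obtain k where k: "norm (cl (t n) - cl (\<phi> k)) < e / 2" by (auto simp: eventually_sequentially)
 have "norm (u - cl (\<phi> k)) <= norm (u - cl (t n)) + norm (cl (t n) - cl (\<phi> k))"
  using norm_triangle_ineq[of "u - cl (t n)" "cl (t n) - cl (\<phi> k)"] by simp
 hence "norm (u - cl (\<phi> k)) < e" using n k by simp
 moreover have "smooth_cpt (\<phi> k)" unfolding smooth_cpt_def using \<phi>(1,3) by blast
 ultimately show ?thesis by blast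
qed

text \<open>Smooth approximations of sgn g on a ball converge boundedly, so testing with them gives
  in the limit the integral of |g| over the ball.\<close>

lemma fundamental_lemma_real:
 fixes g :: "real^'n::finite => real"
 assumes m: "bmeas g" and li: "!!r. integrable lborel (%x. indicator (cball 0 r) x * g x)"
  and zero: "!!\<phi>. test_function \<phi> ==> (LINT x|lborel. \<phi> x * g x) = 0"
 shows "AE x in lborel. g x = 0"
proof -
 note [measurable] = m
 have "AE x in lborel. norm x <= real r --> g x = 0" for r :: nat
 proof -
  define \<psi> where "\<psi> x = (if norm x <= real r then sgn (g x) else 0)" for x
  have \<psi>m: "bmeas \<psi>" unfolding \<psi>_def by measurable
  have \<psi>b: "norm (\<psi> x) <= 1" and \<psi>z: "norm x > real r ==> \<psi> x = 0" for x
   by (auto simp: \<psi>_def abs_sgn_eq)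
  obtain \<phi> where \<phi>: "!!k::nat. smooth (\<phi> k)" "!!k x. norm (\<phi> k x) <= 1" "!!k x. norm x > real r + 2 ==> \<phi> k x = 0"
   "AE x in lborel. (%k. \<phi> k x) \<longlonglongrightarrow> \<psi> x"
   by (rule smooth_approx_AE[OF \<psi>m \<psi>b zero_less_one \<psi>z]) auto
  note [measurable] = smooth_measurable[OF \<phi>(1)]
  have "(%k. LINT x|lborel. \<phi> k x * g x) \<longlonglongrightarrow> (LINT x|lborel. \<psi> x * g x)"
  proof (rule integral_dominated_convergence[where w="%x. norm (indicator (cball 0 (real r + 2)) x * g x)"])
   show "AE x in lborel. (%k. \<phi> k x * g x) \<longlonglongrightarrow> \<psi> x * g x"
    using \<phi>(4) by eventually_elim (intro tendsto_intros)
   show "AE x in lborel. norm (\<phi> k x * g x) <= norm (indicator (cball 0 (real r + 2)) x * g x)" for k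
   proof (rule AE_I2)
    fix x
    show "norm (\<phi> k x * g x) <= norm (indicator (cball 0 (real r + 2)) x * g x)"
     using \<phi>(2)[of k x] \<phi>(3)[of x k] mult_right_mono[of "\<bar>\<phi> k x\<bar>" 1 "\<bar>g x\<bar>"]
     by (cases "norm x <= real r + 2") (auto simp: abs_mult)
   qed
  qed (use li \<psi>m in auto)
  moreover have "(LINT x|lborel. \<phi> k x * g x) = 0" for k
   by (intro zero test_functionI[of _ "real r + 2"] \<phi>)
  ultimately have "(LINT x|lborel. \<psi> x * g x) = 0" by (simp add: LIMSEQ_const_iff)
  moreover have "\<psi> x * g x = norm (indicator (cball 0 (real r)) x * g x)" for x
   by (auto simp: \<psi>_def abs_mult sgn_if)
  ultimately have "(LINT x|lborel. norm (indicator (cball 0 (real r)) x * g x)) = 0" by simp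
  hence "AE x in lborel. norm (indicator (cball 0 (real r)) x * g x) = 0"
   by (subst (asm) integral_nonneg_eq_0_iff_AE) (use li in auto)
  thus ?thesis by eventually_elim (auto split: split_indicator_asm)
 qed
 hence "AE x in lborel. \<forall>r::nat. norm x <= real r --> g x = 0" unfolding AE_all_countable by blast
 thus ?thesis by eventually_elim (use real_arch_simple in blast)
qed

section \<open>Convolution operators on the Hilbert space\<close>

definition cv :: "(real^'n::finite => real) => (real^'n, 'b::euclidean_space) l2 => (real^'n, 'b) l2" where
 "cv k u = cl (conv k (rp u))"

lemma conv_rp_cl: "kernel k ==> sqi f ==> conv k (rp (cl f)) = conv k f"
 by (intro conv_cong_AE rp_cl sqi_measurable) auto

lemma cv_cl: "kernel k ==> sqi f ==> cv k (cl f) = cl (conv k f)"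
 by (simp add: cv_def conv_rp_cl)

lemma conv_rp_add: "kernel k ==> conv k (rp (u + v)) x = conv k (rp u) x + conv k (rp v) x"
 using conv_cong_AE[OF _ _ _ rp_add[of u v], of k] conv_add[of k "rp u" "rp v" x] by simp

lemma conv_rp_diff: "kernel k ==> conv k (rp (u - v)) x = conv k (rp u) x - conv k (rp v) x"
 using conv_rp_add[of k "u - v" v x] by simp

lemma conv_rp_scaleR: "kernel k ==> conv k (rp (c *\<^sub>R u)) x = c *\<^sub>R conv k (rp u) x"
 using conv_cong_AE[OF _ _ _ rp_scaleR[of c u], of k] conv_scaleR[of k "rp u" c x] by simp

lemma cv_norm: "kernel k ==> norm (cv k u) <= (LINT y|lborel. \<bar>k y\<bar>) * norm u"
 using conv_l2(2)[of k "rp u"] by (simp add: cv_def)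

lemma bounded_linear_cv: assumes "kernel k" shows "bounded_linear (cv k)"
proof (rule bounded_linear_intro)
 note s = conv_l2(1)[OF assms sqi_rp]
 show "cv k (u + v) = cv k u + cv k v" for u v
  unfolding cv_def cl_add[OF s s, symmetric] by (rule arg_cong[where f=cl]) (rule ext, rule conv_rp_add[OF assms])
 show "cv k (c *\<^sub>R u) = c *\<^sub>R cv k u" for c u
  unfolding cv_def cl_scaleR[OF s, symmetric] by (rule arg_cong[where f=cl]) (rule ext, rule conv_rp_scaleR[OF assms])
 show "norm (cv k u) <= norm u * (LINT y|lborel. \<bar>k y\<bar>)" for u
  using cv_norm[OF assms, of u] by (simp add: mult.commute)
qed

lemma cv_inner: "kernel k ==> cv k u \<bullet> v = u \<bullet> cv (%y. k (- y)) v"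
 using conv_inner[of k "rp u" "rp v"] by (simp add: cv_def)

abbreviation J :: "real => (real^'n::finite, 'b::euclidean_space) l2 => (real^'n, 'b) l2" where
 "J ep \<equiv> cv (moll ep)"

lemma J_inner: "ep > 0 ==> J ep u \<bullet> v = u \<bullet> J ep v"
 using cv_inner[OF moll_kernel, of ep u v] by (simp add: moll_even)

lemma J_norm: "ep > 0 ==> norm (J ep u) <= norm u"
 using cv_norm[OF moll_kernel, of ep u] by (simp add: moll_abs_integral)

text \<open>\<open>moll_rate\<close> gives convergence on smooth compactly supported functions, and
  the contraction property of \<open>J ep\<close> extends it to their closure.\<close>

lemma J_tendsto: "((%ep. J ep u) \<longlongrightarrow> u) (at_right 0)"
proof (rule tendstoI)
 fix e :: real assume e: "e > 0"
 obtain \<phi> where \<phi>: "smooth_cpt \<phi>" "norm (u - cl \<phi>) < e / 3"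
  using smooth_cpt_dense[of "e/3" u] e by auto
 have h: "h_inf \<phi>" by (rule smooth_cpt_h_inf[OF \<phi>(1)])
 define K where "K = (\<Sum>i\<in>UNIV. norm (cl (pd i \<phi>)))"
 have K0: "K >= 0" by (auto simp: K_def intro: sum_nonneg)
 have "\<forall>\<^sub>F ep in at_right 0. ep < e / (3 * (K + 1))"
  using e K0 by (intro eventually_at_right_less[THEN eventually_mono, of 0] eventually_at_rightI[of 0 "e / (3 * (K + 1))"]) auto
 moreover have "\<forall>\<^sub>F ep in at_right (0::real). ep > 0" by (simp add: eventually_at_filter)
 ultimately show "\<forall>\<^sub>F ep in at_right 0. dist (J ep u) u < e"
 proof eventually_elim
  case (elim ep)
  have "norm (J ep (cl \<phi>) - cl \<phi>) <= ep * K"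
   unfolding K_def using moll_rate[OF elim(2) h_inf_smooth[OF h], of ] h_inf_sqi[OF h, of "[]"] h_inf_sqi[OF h, of "[_]"]
   by (simp add: cv_cl moll_kernel[OF elim(2)])
  also have "ep * K <= ep * (K + 1)" using elim(2) by (intro mult_left_mono) auto
  also have "... < e / 3" using elim(1) K0 by (simp add: field_simps)
  finally have 1: "norm (J ep (cl \<phi>) - cl \<phi>) < e / 3" .
  have "J ep u - J ep (cl \<phi>) = J ep (u - cl \<phi>)"
   using bounded_linear.linear[OF bounded_linear_cv[OF moll_kernel[OF elim(2)]]] linear_diff by metis
  hence 2: "norm (J ep u - J ep (cl \<phi>)) < e / 3" using J_norm[OF elim(2), of "u - cl \<phi>"] \<phi>(2) by simp
  have "dist (J ep u) u <= dist (J ep u) (J ep (cl \<phi>)) + dist (J ep (cl \<phi>)) (cl \<phi>) + dist u (cl \<phi>)"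
   using dist_triangle[of "J ep u" u "J ep (cl \<phi>)"] dist_triangle[of "J ep (cl \<phi>)" u "cl \<phi>"]
   by (simp add: dist_commute)
  thus ?case using 1 2 \<phi>(2) unfolding dist_norm by linarith
 qed
qed

section \<open>Sobolev inequalities\<close>

text \<open>Dilation costs h^(-n/2), which is at most h^(-3/2) for h <= 1 and n <= 3. This is the
  point at which the bound on the dimension enters.\<close>

lemma dilate_l2:
 fixes g :: "real^'n::finite => 'b::euclidean_space"
 assumes g: "sqi g" and h: "0 < h" "h <= 1" and n: "CARD('n) <= 3"
 shows "sqi (%z. g (x + h *\<^sub>R z))" "norm (cl (%z. g (x + h *\<^sub>R z))) <= (1 / (h * sqrt h)) * norm (cl g)"
proof -
 note [measurable] = sqi_measurable[OF g]
 show s: "sqi (%z. g (x + h *\<^sub>R z))"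
  using lborel_integrable_affine[OF sqi_integrable[OF g], of h x] h by (simp add: sqi_def)
 have "(norm (cl g))^2 = \<bar>h\<bar> ^ CARD('n) * (norm (cl (%z. g (x + h *\<^sub>R z))))^2"
  using lborel_integral_affine[of "%z. (norm (g z))^2" h x] h by (simp add: norm_cl_sq[OF g] norm_cl_sq[OF s])
 moreover have "h ^ 3 <= h ^ CARD('n)" using h n by (intro power_decreasing) auto
 ultimately have "h ^ 3 * (norm (cl (%z. g (x + h *\<^sub>R z))))^2 <= (norm (cl g))^2"
  using h by (simp add: mult_right_mono)
 moreover have "h ^ 3 = (h * sqrt h)^2" using h by (simp add: power_mult_distrib power3_eq_cube power2_eq_square)
 ultimately have "((h * sqrt h) * norm (cl (%z. g (x + h *\<^sub>R z))))^2 <= (norm (cl g))^2"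
  by (simp only: power_mult_distrib)
 hence "(h * sqrt h) * norm (cl (%z. g (x + h *\<^sub>R z))) <= norm (cl g)"
  by (rule power2_le_imp_le) simp
 thus "norm (cl (%z. g (x + h *\<^sub>R z))) <= (1 / (h * sqrt h)) * norm (cl g)"
  using h by (simp add: field_simps)
qed

lemma kernel_pairing_bound:
 fixes g :: "real^'n::finite => 'b::euclidean_space"
 assumes k: "kernel k" and g: "sqi g" and h: "0 < h" "h <= 1" and n: "CARD('n) <= 3"
 shows "norm (LINT z|lborel. k z *\<^sub>R g (x + h *\<^sub>R z)) <= norm (cl k) * ((1 / (h * sqrt h)) * norm (cl g))"
proof -
 note d = dilate_l2[OF g h n, of x]
 have "norm (LINT z|lborel. k z *\<^sub>R g (x + h *\<^sub>R z)) <= (LINT z|lborel. norm (k z *\<^sub>R g (x + h *\<^sub>R z)))"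
  by (rule integral_norm_bound)
 also have "... <= norm (cl k) * norm (cl (%z. g (x + h *\<^sub>R z)))"
  using l2_inner_le[OF kernel_sqi[OF k] d(1)] by simp
 also have "... <= norm (cl k) * ((1 / (h * sqrt h)) * norm (cl g))"
  by (rule mult_left_mono[OF d(2)]) simp
 finally show ?thesis .
qed

text \<open>The kernel lives in a cube, so integrals over the whole space become integrals over a
  box, where differentiation under the integral sign is available.\<close>

lemma kernel_integral_cbox:
 fixes F :: "real^'n::finite => 'b::euclidean_space"
 assumes k: "test_function k" and z: "!!z. norm z >= 1 ==> k z = 0" and F: "continuous_on UNIV F"
 shows "integrable lborel (%z. k z *\<^sub>R F z)" "((%z. k z *\<^sub>R F z) has_integral (LINT z|lborel. k z *\<^sub>R F z)) (cbox (- One) One)"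
proof -
 have kc: "continuous_on UNIV k" using k by (auto simp: test_function_iff intro: smooth_continuous)
 have "compact (cball (0::real^'n) 1)" by simp
 hence "integrable lborel (%z. indicator (cball 0 1) z *\<^sub>R (k z *\<^sub>R F z))"
  by (intro borel_integrable_compact continuous_intros continuous_on_subset[OF kc] continuous_on_subset[OF F]) auto
 moreover have "indicator (cball 0 1) z *\<^sub>R (k z *\<^sub>R F z) = k z *\<^sub>R F z" for z
  using z[of z] by (cases "norm z <= 1") (auto simp: indicator_def)
 ultimately show i: "integrable lborel (%z. k z *\<^sub>R F z)" by (simp only:)
 have out: "k z = 0" if "z \<notin> cbox (- One) One" for z :: "real^'n"
 proof (rule z, rule ccontr)
  assume "\<not> 1 <= norm z"
  hence "\<bar>z \<bullet> b\<bar> <= 1" if "b \<in> Basis" for b using Basis_le_norm[OF that, of z] by simp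
  hence "z \<in> cbox (- One) One" by (auto simp: mem_box abs_le_iff minus_le_iff)
  thus False using that by simp
 qed
 have "((%z. if z \<in> cbox (- One) One then k z *\<^sub>R F z else 0) has_integral (LINT z|lborel. k z *\<^sub>R F z)) UNIV"
  by (rule has_integral_eq[OF _ has_integral_integral_lborel[OF i]]) (use out in auto)
 thus "((%z. k z *\<^sub>R F z) has_integral (LINT z|lborel. k z *\<^sub>R F z)) (cbox (- One) One)"
  by (simp only: has_integral_restrict_UNIV)
qed

text \<open>
 The average of \<open>f\<close> against \<open>bump0\<close> at scale \<open>h\<close> has \<open>h\<close>-derivative \<open>- h \<Sum>\<^sub>i \<integral> bump1 \<partial>\<^sub>i\<^sup>2 f\<close>, since
 \<open>z\<^sub>i bump0 = \<partial>\<^sub>i bump1\<close>. In dimension at most 3 this is \<open>O(h\<^bsup>-1/2\<^esup>)\<close>, hence integrable at \<open>h = 0\<close>.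
\<close>

lemma sobolev_sup_aux:
 fixes f :: "real^'n::finite => 'b::euclidean_space"
 assumes f: "h_inf f" and n: "CARD('n) <= 3"
 shows "bump_mass TYPE('n) * norm (f x) <= norm (cl (bump0 :: real^'n => real)) * norm (cl f)
  + 2 * (norm (cl (bump1 :: real^'n => real)) * (\<Sum>i\<in>UNIV. norm (cl (pd i (pd i f)))))"
proof -
 note sm = h_inf_smooth[OF f]
 define y where "y h = (LINT z|lborel. bump0 z *\<^sub>R f (x + h *\<^sub>R z))" for h
 define y' where "y' h = (LINT z|lborel. bump0 z *\<^sub>R (\<Sum>i\<in>UNIV. z $ i *\<^sub>R pd i f (x + h *\<^sub>R z)))" for h
 have b0: "bump0 z = 0" and b1: "bump1 z = 0" if "norm z >= 1" for z :: "real^'n"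
  using bump_support[OF that] by auto
 have fc: "continuous_on S f" "continuous_on S (pd i f)" "continuous_on S (pd i (pd j f))" for S i j
  by (auto intro!: smooth_continuous smooth_pd sm)
 have c1: "continuous_on UNIV (%z. f (x + h *\<^sub>R z))" for h
  by (intro continuous_on_compose2[OF fc(1)[of UNIV]] continuous_intros) auto
 have c2: "continuous_on UNIV (%z. \<Sum>i\<in>UNIV. z $ i *\<^sub>R pd i f (x + h *\<^sub>R z))" for h
  by (intro continuous_intros continuous_on_compose2[OF fc(2)[of UNIV]]) auto
 have yd: "(y has_vector_derivative y' h) (at h within {0..1})" if h: "h \<in> {0..1}" for h
 proof -
  have "((%h. integral (cbox (- One) One) (%z. bump0 z *\<^sub>R f (x + h *\<^sub>R z))) has_vector_derivative
    integral (cbox (- One) One) (%z. bump0 z *\<^sub>R (\<Sum>i\<in>UNIV. z $ i *\<^sub>R pd i f (x + h *\<^sub>R z)))) (at h within {0..1})"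
  proof (rule leibniz_rule_vector_derivative)
   show "((%h. bump0 z *\<^sub>R f (x + h *\<^sub>R z)) has_vector_derivative bump0 z *\<^sub>R (\<Sum>i\<in>UNIV. z $ i *\<^sub>R pd i f (x + h *\<^sub>R z))) (at h within {0..1})" for h z
    using bounded_linear.has_vector_derivative[OF bounded_linear_scaleR_right smooth_line[OF sm, of x z h "{0..1}"]] by simp
   show "(%z. bump0 z *\<^sub>R f (x + h *\<^sub>R z)) integrable_on cbox (- One) One" for h
    by (rule has_integral_integrable[OF kernel_integral_cbox(2)[OF test_bump0 b0 c1[of h]]])
   have bc: "continuous_on UNIV (bump0 :: real^'n => real)" by (rule smooth_continuous[OF smooth_bump0])
   have 1: "continuous_on A (%p. bump0 (snd p :: real^'n))" for A :: "(real \<times> (real^'n)) set"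
    by (rule continuous_on_compose2[OF bc continuous_on_snd[OF continuous_on_id]]) simp
   have 2: "continuous_on A (%p. pd i f (x + fst p *\<^sub>R snd p))" for A :: "(real \<times> (real^'n)) set" and i
    by (rule continuous_on_compose2[OF fc(2)[of UNIV]]) (auto intro!: continuous_intros)
   show "continuous_on ({0..1} \<times> cbox (- One) One) (%(h, z). bump0 z *\<^sub>R (\<Sum>i\<in>UNIV. z $ i *\<^sub>R pd i f (x + h *\<^sub>R z)))"
    unfolding case_prod_unfold
    by (intro continuous_on_scaleR continuous_on_sum 1 2 continuous_intros)
  qed (use h in auto)
  moreover have "(%h. integral (cbox (- One) One) (%z. bump0 z *\<^sub>R f (x + h *\<^sub>R z))) = y"
   unfolding y_def by (rule ext) (rule integral_unique[OF kernel_integral_cbox(2)[OF test_bump0 b0 c1]])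
  moreover have "integral (cbox (- One) One) (%z. bump0 z *\<^sub>R (\<Sum>i\<in>UNIV. z $ i *\<^sub>R pd i f (x + h *\<^sub>R z))) = y' h"
   unfolding y'_def by (rule integral_unique[OF kernel_integral_cbox(2)[OF test_bump0 b0 c2]])
  ultimately show ?thesis by (simp only:)
 qed
 have pdi: "sqi (pd i (pd i f))" for i using h_inf_sqi[OF f, of "[i,i]"] by simp
 let ?S = "\<Sum>i\<in>UNIV. norm (cl (pd i (pd i f)))" and ?b = "norm (cl (bump1 :: real^'n => real))"
 have y'eq: "y' h = - (\<Sum>i\<in>UNIV. h *\<^sub>R (LINT z|lborel. bump1 z *\<^sub>R pd i (pd i f) (x + h *\<^sub>R z)))" if h: "h \<in> {0<..1}" for h
 proof -
  have eqi: "(LINT z|lborel. (z $ i * bump0 z) *\<^sub>R pd i f (x + h *\<^sub>R z)) = - (h *\<^sub>R (LINT z|lborel. bump1 z *\<^sub>R pd i (pd i f) (x + h *\<^sub>R z)))" for i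
  proof -
   have pdf: "smooth (pd i f)" by (rule smooth_pd[OF sm])
   let ?g = "%z. pd i f (h *\<^sub>R z + x)"
   have pg: "pd i ?g = (%z. h *\<^sub>R pd i (pd i f) (h *\<^sub>R z + x))"
    using D_affine[OF pdf, of "[i]" h x] by simp
   have s: "sqi (%z. g (h *\<^sub>R z + x))" if "sqi g" for g :: "real^'n => 'b"
    using dilate_l2(1)[OF that _ _ n, of h x] h by (simp add: add.commute)
   have sq: "sqi ?g" "sqi (pd i ?g)"
    using s[OF h_inf_sqi[OF f, of "[i]"]] sqi_scaleR[OF s[OF pdi[of i]]] unfolding pg by auto
   have "(LINT z|lborel. bump1 z *\<^sub>R pd i ?g z) = - (LINT z|lborel. pd i bump1 z *\<^sub>R ?g z)"
    using test_bump1 test_function_pd[OF test_bump1]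
    by (intro integral_by_parts[OF bounded_bilinear_scaleR] smooth_affine pdf sq kernel_sqi test_function_kernel)
     (auto simp: test_function_iff)
   moreover have "(LINT z|lborel. bump1 z *\<^sub>R pd i ?g z) = h *\<^sub>R (LINT z|lborel. bump1 z *\<^sub>R pd i (pd i f) (x + h *\<^sub>R z))"
    unfolding pg by (subst integral_scaleR_right[symmetric]) (simp only: add.commute[of x] scaleR_left_commute)
   ultimately have "- (LINT z|lborel. (z $ i * bump0 z) *\<^sub>R pd i f (x + h *\<^sub>R z)) = h *\<^sub>R (LINT z|lborel. bump1 z *\<^sub>R pd i (pd i f) (x + h *\<^sub>R z))"
    by (simp add: pd_bump1 add.commute)
   from arg_cong[OF this, of uminus] show ?thesis by simp
  qed
  have ti: "test_function (%z::real^'n. z $ i * bump0 z)" for i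
   using test_function_pd[OF test_bump1, of i] by (simp add: pd_bump1[abs_def])
  have ii: "integrable lborel (%z. (z $ i * bump0 z) *\<^sub>R pd i f (x + h *\<^sub>R z))" for i
   by (rule kernel_integral_cbox(1)[OF ti]) (auto simp: b0 intro!: continuous_on_compose2[OF fc(2)[of UNIV]] continuous_intros)
  have "y' h = (LINT z|lborel. (\<Sum>i\<in>UNIV. (z $ i * bump0 z) *\<^sub>R pd i f (x + h *\<^sub>R z)))"
   unfolding y'_def by (simp add: scaleR_sum_right mult.commute)
  also have "... = (\<Sum>i\<in>UNIV. LINT z|lborel. (z $ i * bump0 z) *\<^sub>R pd i f (x + h *\<^sub>R z))"
   by (rule Bochner_Integration.integral_sum) (rule ii)
  finally show ?thesis by (simp add: eqi sum_negf)
 qed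
 \<comment> \<open>At h = 0 the bound below reads norm (y' 0) <= 0, since 1 / sqrt 0 is 0; it holds
   because z_i \<open>bump0\<close> is a derivative of \<open>bump1\<close> and has integral
   0.\<close>
 have y'0: "y' 0 = 0"
 proof -
  have "(LINT z|lborel. z $ i * bump0 (z :: real^'n)) = 0" for i
  proof -
   have "(LINT z|lborel. pd i bump1 (z :: real^'n)) = 0"
    using test_bump1 test_function_pd[OF test_bump1]
    by (intro integral_pd_zero kernel_integrable test_function_kernel) (auto simp: test_function_iff)
   thus ?thesis by (simp add: pd_bump1)
  qed
  moreover have int: "integrable lborel (%z::real^'n. z $ i * bump0 z)" for i
   using kernel_integrable[OF test_function_kernel[OF test_function_pd[OF test_bump1, of i]]]
   by (simp add: pd_bump1[abs_def])
  moreover have "(LINT z|lborel. (z $ i * bump0 z) *\<^sub>R pd i f x) = (LINT z|lborel. z $ i * bump0 (z :: real^'n)) *\<^sub>R pd i f x" for i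
   by (rule integral_scaleR_left) (rule int)
  ultimately show ?thesis unfolding y'_def
   by (simp add: scaleR_sum_right mult.commute[of "bump0 _"] Bochner_Integration.integral_sum integrable_scaleR_left)
 qed
 have y'b: "norm (y' h) <= (?b * ?S) * (1 / sqrt h)" if h: "h \<in> {0..1}" for h
 proof (cases "h = 0")
  case False
  hence h': "0 < h" "h <= 1" using h by auto
  have k: "kernel (bump1 :: real^'n => real)" by (rule test_function_kernel[OF test_bump1])
  have "norm (y' h) <= (\<Sum>i\<in>UNIV. h * (?b * ((1 / (h * sqrt h)) * norm (cl (pd i (pd i f))))))"
  proof -
   have h'': "h \<in> {0<..1}" using h' by simp
   show ?thesis
    unfolding y'eq[OF h''] norm_minus_cancel
   proof (rule order_trans[OF norm_sum sum_mono])
    fix i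
    have "norm (h *\<^sub>R (LINT z|lborel. bump1 z *\<^sub>R pd i (pd i f) (x + h *\<^sub>R z))) = h * norm (LINT z|lborel. bump1 z *\<^sub>R pd i (pd i f) (x + h *\<^sub>R z))"
     using h' by simp
    also have "... <= h * (?b * ((1 / (h * sqrt h)) * norm (cl (pd i (pd i f)))))"
     by (rule mult_left_mono[OF kernel_pairing_bound[OF k pdi h' n]]) (use h' in simp)
    finally show "norm (h *\<^sub>R (LINT z|lborel. bump1 z *\<^sub>R pd i (pd i f) (x + h *\<^sub>R z))) <= h * (?b * ((1 / (h * sqrt h)) * norm (cl (pd i (pd i f)))))" .
   qed
  qed
  also have "... = (?b * ?S) * (1 / sqrt h)"
   using h' by (simp add: sum_distrib_left sum_divide_distrib)
  finally show ?thesis .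
 qed (simp add: y'0)
 have I1: "(y' has_integral (y 1 - y 0)) {0..1}"
  by (rule fundamental_theorem_of_calculus) (use yd in auto)
 have I2: "((%h. (?b * ?S) * (1 / sqrt h)) has_integral ((?b * ?S) * (2 * sqrt 1) - (?b * ?S) * (2 * sqrt 0))) {0..1}"
 proof (rule fundamental_theorem_of_calculus_interior)
  show "continuous_on {0..1} (%h. (?b * ?S) * (2 * sqrt h))" by (intro continuous_intros)
  show "((%h. (?b * ?S) * (2 * sqrt h)) has_vector_derivative (?b * ?S) * (1 / sqrt h)) (at h)" if "h \<in> {0<..<1}" for h
   using that unfolding has_real_derivative_iff_has_vector_derivative[symmetric]
   by (auto intro!: derivative_eq_intros simp: inverse_eq_divide)
 qed simp
 have "norm (integral {0..1} y') <= integral {0..1} (%h. (?b * ?S) * (1 / sqrt h))"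
  by (rule integral_norm_bound_integral[OF has_integral_integrable[OF I1] has_integral_integrable[OF I2] y'b])
 hence d: "norm (y 1 - y 0) <= 2 * (?b * ?S)"
  using integral_unique[OF I1] integral_unique[OF I2] by simp
 have "y 0 = bump_mass TYPE('n) *\<^sub>R f x"
 proof -
  have "integrable lborel (bump0 :: real^'n => real)" by (rule kernel_integrable[OF test_function_kernel[OF test_bump0]])
  thus ?thesis by (simp add: y_def bump_mass_def)
 qed
 hence "bump_mass TYPE('n) * norm (f x) = norm (y 0)" using bump_mass_pos[where 'n='n] by simp
 also have "... <= norm (y 1) + norm (y 1 - y 0)" using norm_triangle_ineq4[of "y 1" "y 1 - y 0"] by simp
 also have "norm (y 1) <= norm (cl (bump0 :: real^'n => real)) * norm (cl f)"
  using kernel_pairing_bound[OF test_function_kernel[OF test_bump0] _ _ _ n, of f 1 x] h_inf_sqi[OF f, of "[]"]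
  by (simp add: y_def)
 finally show ?thesis using d by simp
qed

section \<open>Sobolev norms of smooth functions and product estimates\<close>

definition lists_le :: "nat => 'n::finite list set" where
 "lists_le k = {is. length is <= k}"

lemma mem_lists_le [simp]: "is \<in> lists_le k \<longleftrightarrow> length is <= k"
 by (simp add: lists_le_def)

lemma finite_lists_le [simp]: "finite (lists_le k :: 'n::finite list set)"
 using finite_lists_length_le[of "UNIV :: 'n set" k] by (simp add: lists_le_def)

definition hn :: "nat => (real^'n::finite => 'b::euclidean_space) => real" where
 "hn k f = sqrt (\<Sum>is\<in>lists_le k. (norm (cl (D is f)))^2)"

lemma hn_nonneg [simp]: "hn k f >= 0"
 by (auto simp: hn_def intro: sum_nonneg)

lemma hn_sq: "(hn k f)^2 = (\<Sum>is\<in>lists_le k. (norm (cl (D is f)))^2)"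
 by (auto simp: hn_def intro: sum_nonneg)

lemma norm_le_hn: assumes "length is <= k" shows "norm (cl (D is f)) <= hn k f"
proof (rule power2_le_imp_le)
 have "(\<Sum>js\<in>{is}. (norm (cl (D js f)))^2) <= (hn k f)^2"
  unfolding hn_sq by (rule sum_mono2) (use assms in auto)
 thus "(norm (cl (D is f)))^2 <= (hn k f)^2" by simp
qed simp

lemma hn_D_le: "hn k (D a f) <= hn (k + length a) f"
proof (rule power2_le_imp_le)
 have inj: "inj_on (%is. is @ a) (lists_le k)" by (auto simp: inj_on_def)
 have "(hn k (D a f))^2 = (\<Sum>is\<in>(%is. is @ a) ` lists_le k. (norm (cl (D is f)))^2)"
  unfolding hn_sq by (subst sum.reindex[OF inj]) (simp add: D_append)
 also have "... <= (hn (k + length a) f)^2"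
  unfolding hn_sq by (rule sum_mono2) auto
 finally show "(hn k (D a f))^2 <= (hn (k + length a) f)^2" .
qed simp

lemma hn_mono: assumes "k <= l" shows "hn k f <= hn l f"
proof (rule power2_le_imp_le)
 show "(hn k f)^2 <= (hn l f)^2"
  unfolding hn_sq by (rule sum_mono2) (use assms in auto)
qed simp

text \<open>The quotient is the constant of \<open>sobolev_sup_aux\<close> with every L^2 norm
  replaced by the full one; the added 1 makes it at least 1, so it may be inserted as a factor in
  upper bounds.\<close>

definition sob_const :: "'n::finite itself => real" where
 "sob_const _ = 1 + (norm (cl (bump0 :: real^'n => real)) + 2 * (norm (cl (bump1 :: real^'n => real)) * real CARD('n))) / bump_mass TYPE('n)"

lemma sob_const_ge: "sob_const TYPE('n::finite) >= 1"
 unfolding sob_const_def using bump_mass_pos[where 'n='n] by (simp add: divide_nonneg_pos)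

lemma sobolev_sup:
 fixes f :: "real^'n::finite => 'b::euclidean_space"
 assumes f: "h_inf f" and n: "CARD('n) <= 3" and a: "length a + 2 <= k"
 shows "norm (D a f x) <= sob_const TYPE('n) * hn k f"
proof -
 let ?M = "bump_mass TYPE('n)" and ?b0 = "norm (cl (bump0 :: real^'n => real))" and ?b1 = "norm (cl (bump1 :: real^'n => real))"
 have M: "?M > 0" by (rule bump_mass_pos)
 have "?M * norm (D a f x) <= ?b0 * norm (cl (D a f)) + 2 * (?b1 * (\<Sum>i\<in>UNIV. norm (cl (pd i (pd i (D a f))))))"
  by (rule sobolev_sup_aux[OF h_inf_D[OF f] n])
 also have "... <= ?b0 * hn k f + 2 * (?b1 * (\<Sum>i\<in>(UNIV::'n set). hn k f))"
  using norm_le_hn[of a k f] norm_le_hn[of "_ # _ # a" k f] a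
  by (intro add_mono mult_left_mono sum_mono) auto
 also have "... = (?b0 + 2 * (?b1 * real CARD('n))) * hn k f" by (simp add: algebra_simps)
 finally have "norm (D a f x) <= (?b0 + 2 * (?b1 * real CARD('n))) * hn k f / ?M"
  using M by (simp add: pos_le_divide_eq mult.commute)
 also have "... <= sob_const TYPE('n) * hn k f"
  by (simp add: sob_const_def algebra_simps)
 finally show ?thesis .
qed

lemma sqi_mult_bounded:
 fixes f :: "'a::euclidean_space => 'b::euclidean_space" and g :: "'a => 'c::euclidean_space"
  and \<beta> :: "'b => 'c => 'd::euclidean_space"
 assumes b: "bounded_bilinear \<beta>" and K: "!!a b. norm (\<beta> a b) <= norm a * norm b * K" "K >= 0"
  and m: "bmeas f" and B: "AE x in lborel. norm (f x) <= B" "B >= 0" and g: "sqi g"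
 shows "sqi (%x. \<beta> (f x) (g x))" "norm (cl (%x. \<beta> (f x) (g x))) <= (B * K) * norm (cl g)"
proof -
 note [measurable] = m sqi_measurable[OF g]
 have meas: "bmeas (%x. \<beta> (f x) (g x))"
  by (intro borel_measurable_continuous_Pair[where H=\<beta>] bounded_bilinear.continuous_on[OF b] continuous_intros) simp_all
 have le: "AE x in lborel. norm (\<beta> (f x) (g x)) <= (B * K) * norm (g x)"
  using B(1)
 proof eventually_elim
  case (elim x)
  have "norm (\<beta> (f x) (g x)) <= norm (f x) * (norm (g x) * K)" using K(1)[of "f x" "g x"] by (simp add: mult.assoc)
  also have "... <= B * (norm (g x) * K)" using elim K(2) by (intro mult_right_mono) auto
  finally show ?case by (simp add: mult_ac)
 qed
 show "sqi (%x. \<beta> (f x) (g x))" "norm (cl (%x. \<beta> (f x) (g x))) <= (B * K) * norm (cl g)"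
  using norm_cl_le[OF meas g _ le] B(2) K(2) by auto
qed

lemma bounded_bilinear_flip: "bounded_bilinear \<beta> ==> bounded_bilinear (%a b. \<beta> b a)"
 by (rule bounded_bilinear.flip)

text \<open>Gagliardo-Nirenberg by parts: with p the derivative of g, the integral of |p|^4 is minus
  that of g paired with the derivative of |p|^2 p, hence at most 3 sup |g| times the integral of
  |p|^2 |p'|. Cauchy-Schwarz and division by the L^2 norm of |p|^2 finish.\<close>

lemma l4_bound:
 fixes g :: "real^'n::finite => 'b::euclidean_space"
 assumes g: "h_inf g" and n: "CARD('n) <= 3"
 shows "sqi (%x. (norm (pd i g x))^2)" "norm (cl (%x. (norm (pd i g x))^2)) <= 3 * sob_const TYPE('n) * (hn 2 g)^2"
proof -
 define p q where "p = pd i g" and "q = pd i p"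
 have sm: "smooth g" "smooth p" "smooth q" unfolding p_def q_def by (intro smooth_pd h_inf_smooth g)+
 have sq: "sqi g" "sqi p" "sqi q" using h_inf_sqi[OF g, of "[]"] h_inf_sqi[OF g, of "[i]"] h_inf_sqi[OF g, of "[i,i]"]
  by (auto simp: p_def q_def)
 note [measurable] = sqi_measurable[OF sq(1)] sqi_measurable[OF sq(2)] sqi_measurable[OF sq(3)]
 define B where "B = sob_const TYPE('n) * hn 2 g"
 \<comment> \<open>Three derivatives are used here only to secure square-integrability of |p|^2 and
   of \<open>F\<close>; the final constant contains \<open>B\<close>, which needs two.\<close>
 define B' where "B' = sob_const TYPE('n) * hn 3 g"
 have B0: "B >= 0" "B' >= 0" using sob_const_ge[where 'n='n] by (auto simp: B_def B'_def)
 have gb: "norm (g x) <= B" for x using sobolev_sup[OF g n, of "[]" 2 x] by (simp add: B_def)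
 have pb: "norm (p x) <= B'" for x using sobolev_sup[OF g n, of "[i]" 3 x] by (simp add: B'_def p_def)
 have p2: "sqi (%x. (norm (p x))^2)"
  by (rule sqi_dominated[OF _ sq(2), where c=B']) (use pb in "auto simp: power2_eq_square mult_right_mono")
 thus "sqi (%x. (norm (pd i g x))^2)" by (simp add: p_def)
 define F where "F x = (p x \<bullet> p x) *\<^sub>R p x" for x
 have smF: "smooth F" unfolding F_def
  by (intro smooth_bilinear[OF bounded_bilinear_scaleR] smooth_bilinear[OF bounded_bilinear_inner] sm)
 have pdF: "pd i F x = (p x \<bullet> p x) *\<^sub>R q x + (2 * (p x \<bullet> q x)) *\<^sub>R p x" for x
 proof -
  have d: "p differentiable (at x)" by (rule smooth_differentiable[OF sm(2)])
  have d2: "(%x. p x \<bullet> p x) differentiable (at x)" by (rule bilinear_differentiable[OF bounded_bilinear_inner d d])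
  show ?thesis unfolding F_def
   by (subst pd_bilinear[OF bounded_bilinear_scaleR d2 d], subst pd_bilinear[OF bounded_bilinear_inner d d])
    (simp add: q_def inner_commute[of "pd i p x"])
 qed
 have nF: "norm (F x) = (norm (p x))^2 * norm (p x)" for x by (simp add: F_def power2_norm_eq_inner)
 have p2B: "(norm (p x))^2 <= B'^2" for x using pb by (intro power_mono) auto
 have sqF: "sqi F"
  by (rule sqi_dominated[OF smooth_measurable[OF smF] sq(2), where c="B'^2"]) (use p2B in "auto simp: nF intro!: mult_right_mono")
 have npF: "norm (pd i F x) <= 3 * ((norm (p x))^2 * norm (q x))" for x
 proof -
  have "norm (pd i F x) <= norm ((p x \<bullet> p x) *\<^sub>R q x) + norm ((2 * (p x \<bullet> q x)) *\<^sub>R p x)"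
   unfolding pdF by (rule norm_triangle_ineq)
  also have "norm ((p x \<bullet> p x) *\<^sub>R q x) = (norm (p x))^2 * norm (q x)" by (simp add: power2_norm_eq_inner)
  also have "norm ((2 * (p x \<bullet> q x)) *\<^sub>R p x) <= 2 * (norm (p x) * norm (q x)) * norm (p x)"
   using mult_right_mono[OF Cauchy_Schwarz_ineq2[of "p x" "q x"] norm_ge_zero[of "p x"]] by (simp add: abs_mult mult.assoc)
  finally show ?thesis by (simp add: power2_eq_square mult_ac)
 qed
 have sqpF: "sqi (pd i F)"
 proof (rule sqi_dominated[OF smooth_measurable[OF smooth_pd[OF smF]] sq(3), where c="3 * B'^2"], rule AE_I2)
  fix x
  have "norm (pd i F x) <= 3 * ((norm (p x))^2 * norm (q x))" by (rule npF)
  also have "... <= 3 * (B'^2 * norm (q x))" using p2B by (intro mult_left_mono mult_right_mono) auto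
  finally show "norm (pd i F x) <= 3 * B'^2 * norm (q x)" by simp
 qed
 define X where "X = norm (cl (%x. (norm (p x))^2))"
 have "X^2 = (LINT x|lborel. p x \<bullet> F x)"
  unfolding X_def norm_cl_sq[OF p2] by (simp add: F_def dot_square_norm power2_eq_square)
 also have "... = - (LINT x|lborel. g x \<bullet> pd i F x)"
  using integral_by_parts[OF bounded_bilinear_inner sm(1) smF sq(1) _ sqF sqpF] sq(2) by (simp add: p_def)
 also have "... <= (LINT x|lborel. (3 * B) * (norm (norm (p x) ^ 2) * norm (q x)))"
  unfolding Bochner_Integration.integral_minus[symmetric]
 proof (rule integral_mono)
  show "integrable lborel (%x. - (g x \<bullet> pd i F x))" using sqi_inner_integrable[OF sq(1) sqpF] by simp
  show "integrable lborel (%x. (3 * B) * (norm (norm (p x) ^ 2) * norm (q x)))"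
   using sqi_prod_integrable[OF p2 sq(3)] by (intro integrable_mult_right)
  fix x
  have "- (g x \<bullet> pd i F x) <= norm (g x) * norm (pd i F x)"
   using Cauchy_Schwarz_ineq2[of "g x" "pd i F x"] by linarith
  also have "... <= B * (3 * ((norm (p x))^2 * norm (q x)))"
   using gb npF B0 by (intro mult_mono) auto
  finally show "- (g x \<bullet> pd i F x) <= (3 * B) * (norm (norm (p x) ^ 2) * norm (q x))" by simp
 qed
 also have "... = (3 * B) * (LINT x|lborel. norm (norm (p x) ^ 2) * norm (q x))" by (rule integral_mult_right_zero)
 also have "... <= (3 * B) * (X * norm (cl q))"
  unfolding X_def using l2_inner_le[OF p2 sq(3)] B0 by (intro mult_left_mono) auto
 finally have "X * X <= X * ((3 * B) * norm (cl q))" by (simp add: power2_eq_square mult_ac)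
 moreover have "X >= 0" by (simp add: X_def)
 ultimately have "X <= (3 * B) * norm (cl q)"
  using B0 by (cases "X = 0") (auto simp: mult_le_cancel_left)
 also have "norm (cl q) <= hn 2 g" using norm_le_hn[of "[i,i]" 2 g] by (simp add: q_def p_def)
 hence "(3 * B) * norm (cl q) <= (3 * B) * hn 2 g" using B0 by (intro mult_left_mono) auto
 finally show "norm (cl (%x. (norm (pd i g x))^2)) <= 3 * sob_const TYPE('n) * (hn 2 g)^2"
  by (simp add: X_def p_def B_def power2_eq_square mult_ac)
qed

text \<open>The three Hoelder pairings sup with L^2, L^2 with sup, and L^4 with L^4. A sup norm
  costs two derivatives more than the L^2 norm, the L^4 norm of a derivative one more.\<close>

definition prod_ok :: "nat => nat => nat => nat => bool" where
 "prod_ok a b p q \<longleftrightarrow> (a + 2 <= p & b <= q) \<or> (a <= p & b + 2 <= q) \<or> (1 <= a & 1 <= b & a + 1 <= p & b + 1 <= q)"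

lemma product_est:
 fixes f :: "real^'n::finite => 'b::euclidean_space" and g :: "real^'n => 'c::euclidean_space"
  and \<beta> :: "'b => 'c => 'd::euclidean_space"
 assumes b: "bounded_bilinear \<beta>" and K: "!!a b. norm (\<beta> a b) <= norm a * norm b * K" "K >= 0"
  and n: "CARD('n) <= 3" and f: "h_inf f" and g: "h_inf g"
  and ok: "prod_ok (length a) (length b) p q"
 shows "sqi (%x. \<beta> (D a f x) (D b g x))"
  "norm (cl (%x. \<beta> (D a f x) (D b g x))) <= (3 * sob_const TYPE('n) * K) * hn p f * hn q g"
proof -
 let ?C = "sob_const TYPE('n)"
 have C: "?C >= 1" by (rule sob_const_ge)
 note sa = h_inf_sqi[OF f, of a] and sb = h_inf_sqi[OF g, of b]
 have "sqi (%x. \<beta> (D a f x) (D b g x)) &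
  norm (cl (%x. \<beta> (D a f x) (D b g x))) <= (3 * ?C * K) * hn p f * hn q g"
  using ok unfolding prod_ok_def
 proof (elim disjE conjE)
  assume 1: "length a + 2 <= p" "length b <= q"
  note s = sqi_mult_bounded[OF b K sqi_measurable[OF sa] AE_I2[OF sobolev_sup[OF f n 1(1)]] _ sb]
  have "norm (cl (%x. \<beta> (D a f x) (D b g x))) <= (?C * hn p f * K) * norm (cl (D b g))"
   by (rule s(2)) (use C in simp)
  also have "... <= (3 * (?C * hn p f * K)) * hn q g"
   by (rule mult_mono) (use C K(2) 1 in "auto intro!: norm_le_hn")
  finally show ?thesis using s(1) C by (simp add: mult_ac)
 next
  assume 1: "length a <= p" "length b + 2 <= q"
  have K': "norm (\<beta> a b) <= norm b * norm a * K" for a b using K(1)[of a b] by (simp add: mult_ac)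
  note s = sqi_mult_bounded[OF bounded_bilinear_flip[OF b] K' K(2) sqi_measurable[OF sb] AE_I2[OF sobolev_sup[OF g n 1(2)]] _ sa]
  have "norm (cl (%x. \<beta> (D a f x) (D b g x))) <= (?C * hn q g * K) * norm (cl (D a f))"
   by (rule s(2)) (use C in simp)
  also have "... <= (3 * (?C * hn q g * K)) * hn p f"
   by (rule mult_mono) (use C K(2) 1 in "auto intro!: norm_le_hn")
  finally show ?thesis using s(1) C by (simp add: mult_ac)
 next
  assume 1: "1 <= length a" "1 <= length b" "length a + 1 <= p" "length b + 1 <= q"
  \<comment> \<open>With one direction split off, the L^4 norm of \<open>D a f\<close> is controlled
    by the H^2 norm of \<open>D a' f\<close>, that is by length a + 1 derivatives of
    \<open>f\<close>.\<close>
  obtain i a' where a: "a = i # a'" using 1(1) by (cases a) auto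
  obtain j b' where b': "b = j # b'" using 1(2) by (cases b) auto
  note la = l4_bound[OF h_inf_D[OF f, of a'] n, of i] and lb = l4_bound[OF h_inf_D[OF g, of b'] n, of j]
  have ha: "hn 2 (D a' f) <= hn p f" by (rule order_trans[OF hn_D_le hn_mono]) (use 1(3) a in simp)
  have hb: "hn 2 (D b' g) <= hn q g" by (rule order_trans[OF hn_D_le hn_mono]) (use 1(4) b' in simp)
  let ?u = "%x. (norm (D a f x))^2" and ?v = "%x. (norm (D b g x))^2"
  have u: "sqi ?u" "norm (cl ?u) <= (3 * ?C) * (hn p f)^2"
  proof -
   show "sqi ?u" using la(1) by (simp add: a)
   have "norm (cl ?u) <= (3 * ?C) * (hn 2 (D a' f))^2" using la(2) by (simp add: a)
   also have "... <= (3 * ?C) * (hn p f)^2" using ha C by (intro mult_left_mono power_mono) auto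
   finally show "norm (cl ?u) <= (3 * ?C) * (hn p f)^2" .
  qed
  have v: "sqi ?v" "norm (cl ?v) <= (3 * ?C) * (hn q g)^2"
  proof -
   show "sqi ?v" using lb(1) by (simp add: b')
   have "norm (cl ?v) <= (3 * ?C) * (hn 2 (D b' g))^2" using lb(2) by (simp add: b')
   also have "... <= (3 * ?C) * (hn q g)^2" using hb C by (intro mult_left_mono power_mono) auto
   finally show "norm (cl ?v) <= (3 * ?C) * (hn q g)^2" .
  qed
  note [measurable] = sqi_measurable[OF sa] sqi_measurable[OF sb]
  have meas [measurable]: "bmeas (%x. \<beta> (D a f x) (D b g x))"
   by (intro borel_measurable_continuous_Pair[where H=\<beta>] bounded_bilinear.continuous_on[OF b] continuous_intros) simp_all
  have pt: "(norm (\<beta> (D a f x) (D b g x)))^2 <= K^2 * (norm (?u x) * norm (?v x))" for x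
   using power_mono[OF K(1)[of "D a f x" "D b g x"] norm_ge_zero, of 2] by (simp add: power_mult_distrib mult_ac)
  have int: "integrable lborel (%x. K^2 * (norm (?u x) * norm (?v x)))"
   by (intro integrable_mult_right sqi_prod_integrable u v)
  have s: "sqi (%x. \<beta> (D a f x) (D b g x))"
   unfolding sqi_def
  proof
   show "integrable lborel (%x. (norm (\<beta> (D a f x) (D b g x)))^2)"
   proof (rule Bochner_Integration.integrable_bound[OF int _ AE_I2])
    show "norm ((norm (\<beta> (D a f x) (D b g x)))^2) <= norm (K^2 * (norm (?u x) * norm (?v x)))" for x
     using pt[of x] by simp
   qed measurable
  qed (rule meas)
  have "(norm (cl (%x. \<beta> (D a f x) (D b g x))))^2 <= (LINT x|lborel. K^2 * (norm (?u x) * norm (?v x)))"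
   unfolding norm_cl_sq[OF s] by (intro integral_mono sqi_integrable s int pt)
  also have "... = K^2 * (LINT x|lborel. norm (?u x) * norm (?v x))" by (rule integral_mult_right_zero)
  also have "... <= K^2 * (norm (cl ?u) * norm (cl ?v))"
   by (intro mult_left_mono l2_inner_le u v) simp
  also have "... <= K^2 * (((3 * ?C) * (hn p f)^2) * ((3 * ?C) * (hn q g)^2))"
   using u(2) v(2) C by (intro mult_left_mono mult_mono) auto
  also have "... = ((3 * ?C * K) * hn p f * hn q g)^2" by (simp add: power2_eq_square mult_ac)
  finally have "norm (cl (%x. \<beta> (D a f x) (D b g x))) <= (3 * ?C * K) * hn p f * hn q g"
   by (rule power2_le_imp_le) (use C K in auto)
  thus ?thesis using s by blast
 qed
 thus "sqi (%x. \<beta> (D a f x) (D b g x))"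
  "norm (cl (%x. \<beta> (D a f x) (D b g x))) <= (3 * ?C * K) * hn p f * hn q g" by auto
qed

section \<open>The energy estimate\<close>

definition L2b :: "('a::euclidean_space => 'b::euclidean_space) => real => bool" where
 "L2b f c \<longleftrightarrow> sqi f & norm (cl f) <= c"

lemma L2b_add: "L2b f c ==> L2b g d ==> L2b (%x. f x + g x) (c + d)"
 unfolding L2b_def using norm_triangle_ineq[of "cl f" "cl g"] by (simp add: cl_add)

lemma L2b_mono: "L2b f c ==> c <= d ==> L2b f d"
 by (auto simp: L2b_def)

lemma L2b_zero: "0 <= c ==> L2b (%x. 0) c"
 by (simp add: L2b_def cl_zero)

lemma L2b_sum_list: "(!!p. p \<in> set ps ==> L2b (f p) c) ==> L2b (%x. sum_list (map (%p. f p x) ps)) (real (length ps) * c)"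
proof (induction ps)
 case (Cons p ps)
 have "L2b (%x. f p x + sum_list (map (%p. f p x) ps)) (c + real (length ps) * c)"
  by (rule L2b_add) (use Cons in auto)
 thus ?case by (simp add: algebra_simps)
qed (simp add: L2b_zero)

lemma L2b_sum: "(!!j. j \<in> A ==> L2b (f j) c) ==> L2b (%x. \<Sum>j\<in>A. f j x) (real (card A) * c)"
proof (induction A rule: infinite_finite_induct)
 case (insert j A)
 have "L2b (%x. f j x + (\<Sum>j\<in>A. f j x)) (c + real (card A) * c)"
  by (rule L2b_add) (use insert in auto)
 thus ?case using insert by (simp add: algebra_simps)
qed (simp_all add: L2b_zero)

lemma splits_card: "length (splits xs) = 2 ^ length xs"
 by (induction xs) auto

text \<open>The class of background states, which are bounded but do not decay. A bilinear product
  with a member of \<open>h_inf\<close> is again in \<open>h_inf\<close>.\<close>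

definition b_inf :: "(real^'n::finite => 'b::euclidean_space) => bool" where
 "b_inf f \<longleftrightarrow> smooth f & (ALL is. EX B. ALL x. norm (D is f x) <= B)"

lemma b_inf_smooth: "b_inf f ==> smooth f" by (simp add: b_inf_def)
lemma b_inf_D: "b_inf f ==> b_inf (D is f)" by (simp add: b_inf_def smooth_D D_append[symmetric])
lemma b_inf_bounded: assumes "b_inf f" obtains B where "B >= 0" "!!x. norm (f x) <= B"
proof -
 from assms have "EX B. ALL x. norm (D [] f x) <= B" unfolding b_inf_def by blast
 then obtain B where B: "!!x. norm (f x) <= B" by auto
 moreover have "B >= 0" using B[of 0] norm_ge_zero order_trans by blast
 ultimately show ?thesis using that by blast
qed

lemma h_inf_b_inf: "h_inf f ==> CARD('n) <= 3 ==> b_inf (f :: real^'n::finite => 'b::euclidean_space)"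
 unfolding b_inf_def using h_inf_smooth sobolev_sup by blast

lemma b_inf_add: assumes "b_inf f" "b_inf g" shows "b_inf (%x. f x + g x)"
 unfolding b_inf_def D_add[OF b_inf_smooth[OF assms(1)] b_inf_smooth[OF assms(2)]]
proof (intro conjI allI)
 show "smooth (%x. f x + g x)" using assms by (simp add: b_inf_smooth)
 fix "is"
 obtain A where "!!x. norm (D is f x) <= A" using b_inf_bounded[OF b_inf_D[OF assms(1)]] by metis
 moreover obtain B where "!!x. norm (D is g x) <= B" using b_inf_bounded[OF b_inf_D[OF assms(2)]] by metis
 ultimately show "EX B. ALL x. norm (D is f x + D is g x) <= B"
  by (meson add_mono norm_triangle_ineq order_trans)
qed

lemma b_inf_const: "b_inf (%x. c)"
 by (auto simp: b_inf_def D_const)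

lemma sqi_b_inf_bilinear:
 assumes b: "bounded_bilinear \<beta>" and f: "b_inf f" and g: "sqi g"
 shows "sqi (%x. \<beta> (f x) (g x) :: 'd::euclidean_space)"
proof -
 obtain K where K: "!!a b. norm (\<beta> a b) <= norm a * norm b * K" "K > 0" using bounded_bilinear.pos_bounded[OF b] by blast
 obtain B where "B >= 0" "!!x. norm (f x) <= B" using b_inf_bounded[OF f] by blast
 thus ?thesis using sqi_mult_bounded(1)[OF b K(1) _ smooth_measurable[OF b_inf_smooth[OF f]] _ _ g, of B] K(2) by auto
qed

lemma sqi_sum_list: "(!!p. p \<in> set ps ==> sqi (f p)) ==> sqi (%x. sum_list (map (%p. f p x) ps))"
 by (induction ps) auto

lemma h_inf_bilinear:
 assumes b: "bounded_bilinear \<beta>" and f: "b_inf f" and g: "h_inf g"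
 shows "h_inf (%x. \<beta> (f x) (g x) :: 'd::euclidean_space)"
 unfolding h_inf_def D_bilinear[OF b b_inf_smooth[OF f] h_inf_smooth[OF g]]
 using f g by (auto intro!: smooth_bilinear[OF b] sqi_sum_list sqi_b_inf_bilinear[OF b] b_inf_D
   simp: case_prod_unfold h_inf_smooth b_inf_smooth h_inf_sqi)

lemma h_inf_add: "h_inf f ==> h_inf g ==> h_inf (%x. f x + g x)"
 by (simp add: h_inf_def D_add)

lemma h_inf_sum: "(!!j. j \<in> A ==> h_inf (f j)) ==> h_inf (%x. \<Sum>j\<in>A. f j x)"
 by (simp add: h_inf_def D_sum smooth_sum)

lemma h_inf_linear: "bounded_linear L ==> h_inf f ==> h_inf (%x. L (f x) :: 'd::euclidean_space)"
 by (simp add: h_inf_def D_linear smooth_linear sqi_bounded_linear)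

lemma h_inf_pd: "h_inf f ==> h_inf (pd j f)"
 using h_inf_D[of f "[j]"] by simp

lemma b_inf_pd: "b_inf f ==> b_inf (pd j f)"
 using b_inf_D[of f "[j]"] by simp

text \<open>Bilinearity of \<open>S\<close> makes each difference of nonlinear terms a sum of
  products linear in one difference, and symmetry lets the top-order term be integrated by parts
  onto the coefficient.\<close>

locale sym_system =
 fixes S :: "'n::finite => 'b::euclidean_space => 'b => 'b" and G :: "'b => 'b"
 assumes S_bil: "!!j. bounded_bilinear (S j)"
  and S_sym: "!!j u v w. S j u v \<bullet> w = v \<bullet> S j u w"
  and G_lin: "bounded_linear G" and G_skew: "!!v. v \<bullet> G v = 0"
  and dim: "CARD('n) <= 3"
begin

definition KS :: real where
 "KS = (SOME K. K >= 0 & (ALL j a b. norm (S j a b) <= norm a * norm b * K))"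

lemma KS: "KS >= 0" "norm (S j a b) <= norm a * norm b * KS"
proof -
 have "ALL j. EX K>0. ALL a b. norm (S j a b) <= norm a * norm b * K"
  using bounded_bilinear.pos_bounded[OF S_bil] by blast
 then obtain k where k: "!!j. k j > 0" "!!j a b. norm (S j a b) <= norm a * norm b * k j" by metis
 have s0: "(\<Sum>j\<in>UNIV. k j) >= 0" by (intro sum_nonneg less_imp_le k)
 have sj: "k j <= (\<Sum>j\<in>UNIV. k j)" for j by (rule member_le_sum) (auto intro: less_imp_le k)
 have "norm (S j a b) <= norm a * norm b * (\<Sum>j\<in>UNIV. k j)" for j a b
  using order_trans[OF k(2)[of j a b] mult_left_mono[OF sj[of j], of "norm a * norm b"]] by simp
 hence "EX K. K >= 0 & (ALL j a b. norm (S j a b) <= norm a * norm b * K)" using s0 by blast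
 from someI_ex[OF this] show "KS >= 0" "norm (S j a b) <= norm a * norm b * KS"
  unfolding KS_def by auto
qed

text \<open>The bound of \<open>G\<close> is kept apart: skewness removes \<open>G\<close>, which carries the factor \<open>1/\<delta>\<close>, from the energy estimates.\<close>

definition KG :: real where "KG = onorm G"

lemma KG: "KG >= 0" "norm (G a) <= norm a * KG"
 using onorm_pos_le[OF G_lin] onorm[OF G_lin, of a] by (simp_all add: KG_def mult.commute)

definition Ffun :: "(real^'n => 'b) => (real^'n => 'b) => real^'n => 'b" where
 "Ffun E W x = (\<Sum>j\<in>UNIV. S j (W x + E x) (pd j W x) + S j (W x) (pd j E x)) + G (W x)"

lemma h_inf_Ffun: assumes E: "b_inf E" and W: "h_inf W" shows "h_inf (Ffun E W)"
 unfolding Ffun_def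
 by (intro h_inf_add h_inf_sum h_inf_linear[OF G_lin] h_inf_bilinear[OF S_bil] b_inf_add E W h_inf_b_inf[OF W dim] h_inf_pd
   h_inf_bilinear[OF bounded_bilinear_flip[OF S_bil]] b_inf_pd)

lemma D_Ffun:
 assumes E: "b_inf E" and W: "h_inf W"
 shows "D is (Ffun E W) x = (\<Sum>j\<in>UNIV. sum_list (map (%(a, b). S j (D a W x + D a E x) (D (b @ [j]) W x)) (splits is))
  + sum_list (map (%(a, b). S j (D a W x) (D (b @ [j]) E x)) (splits is))) + G (D is W x)"
proof -
 have sm: "smooth W" "smooth E" "smooth (pd j W)" "smooth (pd j E)" for j
  using E W by (auto simp: b_inf_smooth h_inf_smooth intro: smooth_pd)
 have s1: "smooth (%x. S j (W x + E x) (pd j W x))" "smooth (%x. S j (W x) (pd j E x))" for j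
  by (intro smooth_bilinear[OF S_bil] smooth_add sm)+
 have "D is (Ffun E W) = (%x. (\<Sum>j\<in>UNIV. D is (%x. S j (W x + E x) (pd j W x)) x + D is (%x. S j (W x) (pd j E x)) x) + G (D is W x))"
  unfolding Ffun_def[abs_def]
  by (subst D_add) (auto simp: D_sum D_add D_linear[OF G_lin] s1 sm intro!: smooth_sum smooth_linear[OF G_lin] smooth_add)
 moreover have "D is (%x. S j (W x + E x) (pd j W x)) x = sum_list (map (%(a, b). S j (D a W x + D a E x) (D (b @ [j]) W x)) (splits is))" for j
  by (simp add: D_bilinear[OF S_bil smooth_add[OF sm(1,2)] sm(3)] D_add[OF sm(1,2)] D_append)
 moreover have "D is (%x. S j (W x) (pd j E x)) x = sum_list (map (%(a, b). S j (D a W x) (D (b @ [j]) E x)) (splits is))" for j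
  by (simp add: D_bilinear[OF S_bil sm(1) sm(4)] D_append)
 ultimately show ?thesis by simp
qed

text \<open>Integration by parts and symmetry give 2 <w, S(U) d_j w> = - <w, S(d_j U) w>. The
  derivative leaves w, and only the gradient of \<open>U\<close>, not its size, enters the
  bound.\<close>

lemma skew_pairing:
 fixes U w :: "real^'n => 'b"
 assumes U: "b_inf U" and L: "!!j x. norm (pd j U x) <= L" and w: "h_inf w"
 shows "sqi (%x. \<Sum>j\<in>UNIV. S j (U x) (pd j w x))"
  "\<bar>cl w \<bullet> cl (%x. \<Sum>j\<in>UNIV. S j (U x) (pd j w x))\<bar> <= real CARD('n) * (KS * L) * (norm (cl w))^2"
proof -
 have L0: "L >= 0" using L[of undefined 0] norm_ge_zero order_trans by blast
 have sw: "sqi w" "sqi (pd j w)" for j using h_inf_sqi[OF w, of "[]"] h_inf_sqi[OF w, of "[j]"] by auto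
 have s1: "sqi (%x. S j (U x) (pd j w x))" "sqi (%x. S j (U x) (w x))" "sqi (%x. S j (pd j U x) (w x))" for j
  by (intro sqi_b_inf_bilinear[OF S_bil] U b_inf_pd sw)+
 show "sqi (%x. \<Sum>j\<in>UNIV. S j (U x) (pd j w x))" by (intro sqi_sum s1)
 have each: "\<bar>cl w \<bullet> cl (%x. S j (U x) (pd j w x))\<bar> <= (KS * L) * (norm (cl w))^2" for j
 proof -
  let ?g = "%x. S j (U x) (w x)"
  have pg: "pd j ?g = (%x. S j (U x) (pd j w x) + S j (pd j U x) (w x))"
   by (intro ext pd_bilinear[OF S_bil] smooth_differentiable b_inf_smooth[OF U] h_inf_smooth[OF w])
  have "(LINT x|lborel. w x \<bullet> pd j ?g x) = - (LINT x|lborel. pd j w x \<bullet> ?g x)"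
   by (intro integral_by_parts[OF bounded_bilinear_inner] h_inf_smooth[OF w] smooth_bilinear[OF S_bil] b_inf_smooth[OF U] sw s1)
    (unfold pg, intro sqi_add s1)
  moreover have "pd j w x \<bullet> ?g x = w x \<bullet> S j (U x) (pd j w x)" for x
   by (metis S_sym inner_commute)
  moreover have "(LINT x|lborel. w x \<bullet> pd j ?g x) = (LINT x|lborel. w x \<bullet> S j (U x) (pd j w x)) + (LINT x|lborel. w x \<bullet> S j (pd j U x) (w x))"
   unfolding pg inner_add_right by (intro Bochner_Integration.integral_add sqi_inner_integrable sw s1)
  ultimately have "2 * (cl w \<bullet> cl (%x. S j (U x) (pd j w x))) = - (cl w \<bullet> cl (%x. S j (pd j U x) (w x)))"
   by (simp add: inner_cl sw s1)
  moreover have "\<bar>cl w \<bullet> cl (%x. S j (pd j U x) (w x))\<bar> <= norm (cl w) * ((L * KS) * norm (cl w))"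
   by (rule order_trans[OF Cauchy_Schwarz_ineq2 mult_left_mono])
    (use sqi_mult_bounded(2)[OF S_bil KS(2) KS(1) smooth_measurable[OF smooth_pd[OF b_inf_smooth[OF U]]] AE_I2[OF L] L0 sw(1)] in auto)
  ultimately have "\<bar>2 * (cl w \<bullet> cl (%x. S j (U x) (pd j w x)))\<bar> <= (KS * L) * (norm (cl w))^2"
   by (simp add: power2_eq_square mult_ac)
  moreover have "\<bar>cl w \<bullet> cl (%x. S j (U x) (pd j w x))\<bar> <= \<bar>2 * (cl w \<bullet> cl (%x. S j (U x) (pd j w x)))\<bar>" by simp
  ultimately show ?thesis by linarith
 qed
 have "cl w \<bullet> cl (%x. \<Sum>j\<in>UNIV. S j (U x) (pd j w x)) = (\<Sum>j\<in>UNIV. cl w \<bullet> cl (%x. S j (U x) (pd j w x)))"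
  by (simp add: cl_sum s1 inner_sum_right)
 also have "\<bar>...\<bar> <= (\<Sum>j\<in>(UNIV::'n set). (KS * L) * (norm (cl w))^2)"
  by (rule order_trans[OF sum_abs sum_mono]) (rule each)
 finally show "\<bar>cl w \<bullet> cl (%x. \<Sum>j\<in>UNIV. S j (U x) (pd j w x))\<bar> <= real CARD('n) * (KS * L) * (norm (cl w))^2"
  by simp
qed

text \<open>A common upper bound for the constant of products with a bounded factor and for that of
  \<open>product_est\<close>.\<close>

definition Kc :: real where "Kc = (3 * sob_const TYPE('n) + 1) * KS"

lemma Kc_ge: "Kc >= 0" "KS <= Kc" "3 * sob_const TYPE('n) * KS <= Kc"
proof -
 have s: "sob_const TYPE('n) >= 1" by (rule sob_const_ge)
 show "Kc >= 0" using s KS(1) by (simp add: Kc_def)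
 have "1 * KS <= (3 * sob_const TYPE('n) + 1) * KS" using s KS(1) by (intro mult_right_mono) auto
 thus "KS <= Kc" by (simp add: Kc_def)
 show "3 * sob_const TYPE('n) * KS <= Kc" unfolding Kc_def by (rule mult_right_mono[OF _ KS(1)]) simp
qed

lemma S_E_bound:
 assumes e: "bmeas e" and M: "!!x. norm (e x) <= M" and w: "sqi w" "norm (cl w) <= N"
 shows "L2b (%x. S j (e x) (w x)) (Kc * M * N)" "L2b (%x. S j (w x) (e x)) (Kc * M * N)"
proof -
 have M0: "M >= 0" using M[of 0] norm_ge_zero order_trans by blast
 have "(M * KS) * norm (cl w) <= (M * Kc) * N"
  by (rule mult_mono[OF mult_left_mono[OF Kc_ge(2) M0] w(2)]) (use M0 Kc_ge(1) in auto)
 hence le: "(M * KS) * norm (cl w) <= Kc * M * N" by (simp add: mult.commute)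
 have K': "norm (S j b a) <= norm a * norm b * KS" for a b using KS(2)[of j b a] by (simp add: mult_ac)
 show "L2b (%x. S j (e x) (w x)) (Kc * M * N)"
  using sqi_mult_bounded[OF S_bil KS(2) KS(1) e AE_I2[OF M] M0 w(1), of j] le by (auto simp: L2b_def intro: order_trans)
 show "L2b (%x. S j (w x) (e x)) (Kc * M * N)"
  using sqi_mult_bounded[OF bounded_bilinear_flip[OF S_bil] K' KS(1) e AE_I2[OF M] M0 w(1)] le by (auto simp: L2b_def intro: order_trans)
qed

text \<open>Once the top-order term and \<open>G\<close> are subtracted, each remaining term either
  has a derivative on the coefficient W + E or contains a derivative of \<open>E\<close> as
  differentiated state. So \<open>E\<close> never occurs undifferentiated, and no derivative of
  \<open>W\<close> exceeds order \<open>m\<close>.\<close>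

lemma commutator_bound:
 assumes m: "m >= 3" and E: "b_inf E" and M: "!!is x. 1 <= length is ==> length is <= m + 1 ==> norm (D is E x) <= M"
  and W: "h_inf W" and len: "length is <= m"
 shows "L2b (%x. D is (Ffun E W) x - (\<Sum>j\<in>UNIV. S j (W x + E x) (pd j (D is W) x)) - G (D is W x))
  (real CARD('n) * (3 * 2 ^ m * (Kc * (M + hn m W) * hn m W)))"
proof -
 obtain r where r: "splits is = ([], is) # r" "\<forall>(a, b)\<in>set r. a ~= []" using splits_Cons by blast
 let ?N = "hn m W" and ?B = "Kc * (M + hn m W) * hn m W"
 have M0: "M >= 0"
  using M[of "[undefined]" 0] m norm_ge_zero[of "D [undefined] E 0"] by (simp del: norm_ge_zero)
 have B0: "?B >= 0" using M0 Kc_ge(1) by simp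
 have Wm: "bmeas W" "bmeas E" using smooth_measurable h_inf_smooth[OF W] b_inf_smooth[OF E] by auto
 have Dm: "bmeas (D a W)" "bmeas (D a E)" for a
  by (intro smooth_measurable smooth_D h_inf_smooth[OF W] b_inf_smooth[OF E])+
 have NN: "Kc * M * ?N + Kc * ?N * ?N <= ?B" "Kc * M * ?N <= ?B"
  using Kc_ge(1) by (auto simp: algebra_simps)
 have t1: "L2b (%x. S j (D a W x) (D (b @ [j]) W x)) (Kc * ?N * ?N)" if "(a, b) \<in> set r" for a b j
 proof -
  have ab: "a ~= []" "length a + length b = length is" using r that splits_length[of a b "is"] by auto
  \<comment> \<open>If a has at most m - 2 entries, the first factor takes the sup norm; with m - 1
    entries both factors take L^4; with m entries b is empty and the second factor takes the sup
    norm. The last case asks for 1 + 2 <= m, hence m >= 3.\<close>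
  have ok: "prod_ok (length a) (length (b @ [j])) m m"
  proof -
   have "1 <= length a" using ab(1) by (cases a) auto
   thus ?thesis using ab(2) len m unfolding prod_ok_def length_append length_Cons list.size by presburger
  qed
  note p = product_est[OF S_bil KS(2) KS(1) dim W W ok, of j]
  have "3 * sob_const TYPE('n) * KS * ?N * ?N <= Kc * ?N * ?N"
   by (intro mult_right_mono Kc_ge(3)) auto
  thus ?thesis using p by (auto simp: L2b_def)
 qed
 have t2: "L2b (%x. S j (D a E x) (D (b @ [j]) W x)) (Kc * M * ?N)" if "(a, b) \<in> set r" for a b j
 proof -
  have ab: "a ~= []" "length a + length b = length is" using r that splits_length[of a b "is"] by auto
  hence l: "1 <= length a" "length a <= m + 1" "length (b @ [j]) <= m" using len by (cases a; auto)+
  show ?thesis by (rule S_E_bound(1)[OF Dm(2) M[OF l(1,2)] h_inf_sqi[OF W] norm_le_hn[OF l(3)]])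
 qed
 have t3: "L2b (%x. S j (D a W x) (D (b @ [j]) E x)) (Kc * M * ?N)" if "(a, b) \<in> set (splits is)" for a b j
 proof -
  have l: "1 <= length (b @ [j])" "length (b @ [j]) <= m + 1" "length a <= m" using splits_length[OF that] len by auto
  show ?thesis by (rule S_E_bound(2)[OF Dm(2) M[OF l(1,2)] h_inf_sqi[OF W] norm_le_hn[OF l(3)]])
 qed
 have t12: "L2b (%x. S j (D a W x + D a E x) (D (b @ [j]) W x)) ?B" if "(a, b) \<in> set r" for a b j
  using L2b_mono[OF L2b_add[OF t1[OF that, of j] t2[OF that, of j]]] NN(1)
  by (simp add: bounded_bilinear.add_left[OF S_bil] add.commute)
 let ?R1 = "%j x. sum_list (map (%p. S j (D (fst p) W x + D (fst p) E x) (D (snd p @ [j]) W x)) r)"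
 let ?R2 = "%j x. sum_list (map (%p. S j (D (fst p) W x) (D (snd p @ [j]) E x)) (splits is))"
 have lr: "real (length r) <= 2 ^ m" "real (length (splits is)) <= 2 ^ m"
 proof -
  have "real (length (splits is)) = 2 ^ length is" by (simp add: splits_card)
  also have "... <= 2 ^ m" using len by (intro power_increasing) auto
  finally show "real (length (splits is)) <= 2 ^ m" .
  moreover have "real (length r) <= real (length (splits is))" by (simp add: r)
  ultimately show "real (length r) <= 2 ^ m" by linarith
 qed
 have b1: "L2b (?R1 j) (2 ^ m * ?B)" for j
  by (rule L2b_mono[OF L2b_sum_list[where c="?B"] mult_right_mono[OF lr(1) B0]]) (use t12 in auto)
 have b2: "L2b (?R2 j) (2 ^ m * ?B)" for j
  by (rule L2b_mono[OF L2b_sum_list[where c="?B"] mult_right_mono[OF lr(2) B0]]) (use L2b_mono[OF t3 NN(2)] in auto)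
 have b: "L2b (%x. \<Sum>j\<in>UNIV. ?R1 j x + ?R2 j x) (real CARD('n) * (3 * 2 ^ m * ?B))"
 proof (rule L2b_sum, rule L2b_mono[OF L2b_add[OF b1 b2]])
  have "0 <= 2 ^ m * ?B" by (intro mult_nonneg_nonneg B0) simp
  thus "2 ^ m * ?B + 2 ^ m * ?B <= 3 * 2 ^ m * ?B" unfolding mult.assoc[of 3] by linarith
 qed
 have eq: "D is (Ffun E W) x - (\<Sum>j\<in>UNIV. S j (W x + E x) (pd j (D is W) x)) - G (D is W x) = (\<Sum>j\<in>UNIV. ?R1 j x + ?R2 j x)" for x
 proof -
  have c: "D (is @ [j]) W = pd j (D is W)" for j
   by (simp add: D_append D_pd_commute[OF h_inf_smooth[OF W]])
  have "D is (Ffun E W) x = (\<Sum>j\<in>UNIV. S j (W x + E x) (pd j (D is W) x) + (?R1 j x + ?R2 j x)) + G (D is W x)"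
   unfolding D_Ffun[OF E W] case_prod_unfold by (simp add: r c add.assoc)
  thus ?thesis by (simp add: sum.distrib)
 qed
 show ?thesis unfolding eq using b by (simp only: mult.assoc)
qed

text \<open>Built from constants of \<open>S\<close> and of the Sobolev inequality only: neither
  \<open>KG\<close> nor a bound of \<open>E\<close> occurs.\<close>

definition Cen :: "nat => real" where
 "Cen m = real (card (lists_le m :: 'n list set)) * (real CARD('n) * (3 * 2 ^ m * Kc) + real CARD('n) * (KS * sob_const TYPE('n)))"

lemma Cen_nonneg: "Cen m >= 0"
 unfolding Cen_def using Kc_ge(1) KS(1) sob_const_ge[where 'n='n]
 by (intro mult_nonneg_nonneg add_nonneg_nonneg) auto

text \<open>For each list of derivatives the commutator is bounded in L^2, the top-order term is
  paired as in \<open>skew_pairing\<close>, and \<open>G\<close>, which commutes with derivatives,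
  vanishes by skewness.\<close>

theorem energy_estimate:
 assumes m: "m >= 3" and E: "b_inf E" and M: "!!is x. 1 <= length is ==> length is <= m + 1 ==> norm (D is E x) <= M"
  and W: "h_inf W"
 shows "\<bar>\<Sum>is\<in>lists_le m. cl (D is W) \<bullet> cl (D is (Ffun E W))\<bar> <= Cen m * (M + hn m W) * (hn m W)^2"
proof -
 let ?N = "hn m W" and ?C = "sob_const TYPE('n)"
 have C1: "?C >= 1" by (rule sob_const_ge)
 have M0: "M >= 0"
  using M[of "[undefined]" 0] m norm_ge_zero[of "D [undefined] E 0"] by (simp del: norm_ge_zero)
 let ?K = "real CARD('n) * (3 * 2 ^ m * Kc) + real CARD('n) * (KS * ?C)"
 have U: "b_inf (%x. W x + E x)" by (intro b_inf_add E h_inf_b_inf[OF W dim])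
 have L: "norm (pd j (%x. W x + E x) x) <= ?C * (M + ?N)" for j x
 proof -
  have "pd j (%x. W x + E x) x = pd j W x + pd j E x"
   by (intro pd_add smooth_differentiable h_inf_smooth[OF W] b_inf_smooth[OF E])
  also have "norm ... <= ?C * ?N + M"
   using sobolev_sup[OF W dim, of "[j]" m x] M[of "[j]" x] m by (intro order_trans[OF norm_triangle_ineq add_mono]) auto
  also have "M <= ?C * M" using C1 M0 mult_right_mono[of 1 ?C M] by simp
  finally show ?thesis by (simp add: algebra_simps)
 qed
 have each: "\<bar>cl (D is W) \<bullet> cl (D is (Ffun E W))\<bar> <= ?K * (M + ?N) * ?N^2" if len: "length is <= m" for "is"
 proof -
  let ?w = "D is W"
  have hw: "h_inf ?w" by (rule h_inf_D[OF W])
  have sw: "sqi ?w" by (rule h_inf_sqi[OF W])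
  have nw: "norm (cl ?w) <= ?N" by (rule norm_le_hn[OF len])
  let ?R = "%x. D is (Ffun E W) x - (\<Sum>j\<in>UNIV. S j (W x + E x) (pd j ?w x)) - G (?w x)"
  let ?T = "%x. \<Sum>j\<in>UNIV. S j (W x + E x) (pd j ?w x)"
  note R = commutator_bound[OF m E M W len, unfolded L2b_def]
  note T = skew_pairing[OF U L hw]
  have sG: "sqi (%x. G (?w x))" by (rule sqi_bounded_linear[OF G_lin sw])
  have "cl (D is (Ffun E W)) = cl (%x. (?R x + ?T x) + G (?w x))" by simp
  also have "... = cl ?R + cl ?T + cl (%x. G (?w x))"
   using R T(1) sG by (subst cl_add[OF sqi_add], simp_all only: cl_add)
  finally have "cl ?w \<bullet> cl (D is (Ffun E W)) = cl ?w \<bullet> cl ?R + cl ?w \<bullet> cl ?T + cl ?w \<bullet> cl (%x. G (?w x))"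
   by (simp only: inner_add_right)
  moreover have "cl ?w \<bullet> cl (%x. G (?w x)) = 0"
   by (simp add: inner_cl sw sG G_skew)
  moreover have "\<bar>cl ?w \<bullet> cl ?R\<bar> <= ?N * (real CARD('n) * (3 * 2 ^ m * (Kc * (M + ?N) * ?N)))"
   using R by (intro order_trans[OF Cauchy_Schwarz_ineq2] mult_mono nw) auto
  moreover have "\<bar>cl ?w \<bullet> cl ?T\<bar> <= real CARD('n) * (KS * (?C * (M + ?N))) * ?N^2"
   by (rule order_trans[OF T(2) mult_left_mono[OF power_mono[OF nw]]]) (use KS(1) C1 M0 in auto)
  moreover have "?N * (real CARD('n) * (3 * 2 ^ m * (Kc * (M + ?N) * ?N))) + real CARD('n) * (KS * (?C * (M + ?N))) * ?N^2
   = ?K * (M + ?N) * ?N^2" by (simp add: algebra_simps power2_eq_square)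
  ultimately show ?thesis by linarith
 qed
 have "\<bar>\<Sum>is\<in>lists_le m. cl (D is W) \<bullet> cl (D is (Ffun E W))\<bar> <= (\<Sum>is\<in>(lists_le m :: 'n list set). ?K * (M + ?N) * ?N^2)"
  by (rule order_trans[OF sum_abs sum_mono]) (use each in auto)
 thus ?thesis by (simp add: Cen_def mult.assoc)
qed

end

section \<open>Weak derivatives in the Hilbert space\<close>

text \<open>
 \<open>wd is u v\<close>: \<open>v\<close> is the weak derivative of \<open>u\<close>. Testing with the translates of one family of mollifiers suffices.
\<close>

definition wd :: "'n::finite list => (real^'n, 'b::euclidean_space) l2 => (real^'n, 'b) l2 => bool" where
 "wd is u v \<longleftrightarrow> (\<forall>ep>0. cv (D is (moll ep)) u = J ep v)"

lemma kernel_D_moll: "ep > 0 ==> kernel (D is (moll ep))"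
 by (rule test_function_kernel[OF test_function_D[OF moll_test]])

lemma eventually_pos_at_right: "\<forall>\<^sub>F ep in at_right (0::real). ep > 0"
 by (simp add: eventually_at_filter)

lemma wd_unique: assumes "wd is u v" "wd is u w" shows "v = w"
proof (rule tendsto_unique[OF _ J_tendsto[of v]])
 have "\<forall>\<^sub>F ep in at_right 0. J ep w = J ep v"
  using eventually_pos_at_right by eventually_elim (use assms in "auto simp: wd_def")
 thus "((%ep. J ep v) \<longlongrightarrow> w) (at_right 0)" using J_tendsto[of w] by (simp cong: tendsto_cong)
qed simp

lemma wd_Nil: "wd [] u u" by (simp add: wd_def)

lemma linear_cv: "kernel k ==> linear (cv k)"
 by (rule bounded_linear.linear[OF bounded_linear_cv])

lemma wd_diff: "wd is u v ==> wd is u' v' ==> wd is (u - u') (v - v')"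
 by (simp add: wd_def linear_diff[OF linear_cv[OF kernel_D_moll]] linear_diff[OF linear_cv[OF moll_kernel]])

lemma wd_h_inf: assumes "h_inf f" shows "wd is (cl f) (cl (D is f))"
 unfolding wd_def
proof (intro allI impI)
 fix ep :: real assume e: "ep > 0"
 show "cv (D is (moll ep)) (cl f) = J ep (cl (D is f))"
  using h_inf_sqi[OF assms, of "[]"] h_inf_sqi[OF assms, of "is"] conv_D[OF moll_test[OF e] assms, of "is"]
  by (simp add: cv_cl kernel_D_moll[OF e] moll_kernel[OF e])
qed

text \<open>Moving \<open>J ep\<close> to the other side of the inner product leaves only weak
  convergence of the derivatives to be used.\<close>

lemma wd_weak_limit:
 assumes u: "U \<longlonglongrightarrow> u" and v: "!!x. (%k::nat. V k \<bullet> x) \<longlonglongrightarrow> v \<bullet> x" and wd: "!!k. wd is (U k) (V k)"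
 shows "wd is u v"
 unfolding wd_def
proof (intro allI impI)
 fix ep :: real assume e: "ep > 0"
 have "cv (D is (moll ep)) u \<bullet> x = J ep v \<bullet> x" for x
 proof -
  have "(%k. cv (D is (moll ep)) (U k) \<bullet> x) \<longlonglongrightarrow> cv (D is (moll ep)) u \<bullet> x"
   by (intro tendsto_intros bounded_linear.tendsto[OF bounded_linear_cv[OF kernel_D_moll[OF e]] u])
  moreover have "cv (D is (moll ep)) (U k) \<bullet> x = V k \<bullet> J ep x" for k
   using wd[of k] e by (simp add: wd_def J_inner[OF e])
  moreover have "(%k. V k \<bullet> J ep x) \<longlonglongrightarrow> v \<bullet> J ep x" by (rule v)
  ultimately show ?thesis using LIMSEQ_unique by (simp add: J_inner[OF e])
 qed
 hence "(cv (D is (moll ep)) u - J ep v) \<bullet> (cv (D is (moll ep)) u - J ep v) = 0"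
  by (simp add: inner_diff_left)
 thus "cv (D is (moll ep)) u = J ep v" by simp
qed

definition Hs :: "nat => (real^'n::finite, 'b::euclidean_space) l2 => bool" where
 "Hs m u \<longleftrightarrow> (ALL is. length is <= m --> (EX v. wd is u v))"

definition dv :: "'n::finite list => (real^'n, 'b::euclidean_space) l2 => (real^'n, 'b) l2" where
 "dv is u = (THE v. wd is u v)"

definition Nm :: "nat => (real^'n::finite, 'b::euclidean_space) l2 => real" where
 "Nm m u = sqrt (\<Sum>is\<in>lists_le m. (norm (dv is u))^2)"

lemma dv_eqI: "wd is u v ==> dv is u = v"
 unfolding dv_def by (rule the_equality) (auto intro: wd_unique)

lemma dv_Nil [simp]: "dv [] u = u"
 by (rule dv_eqI[OF wd_Nil])

lemma Hs_wd: "Hs m u ==> length is <= m ==> wd is u (dv is u)"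
 unfolding Hs_def using dv_eqI by metis

lemma Hs_mono: "Hs m u ==> k <= m ==> Hs k u"
 by (auto simp: Hs_def)

lemma Nm_nonneg [simp]: "Nm m u >= 0" by (auto simp: Nm_def intro: sum_nonneg)

lemma Nm_sq: "(Nm m u)^2 = (\<Sum>is\<in>lists_le m. (norm (dv is u))^2)"
 by (auto simp: Nm_def intro: sum_nonneg)

lemma norm_le_Nm: assumes "length is <= m" shows "norm (dv is u) <= Nm m u"
proof (rule power2_le_imp_le)
 have "(\<Sum>js\<in>{is}. (norm (dv js u))^2) <= (Nm m u)^2"
  unfolding Nm_sq by (rule sum_mono2) (use assms in auto)
 thus "(norm (dv is u))^2 <= (Nm m u)^2" by simp
qed simp

lemma norm_le_Nm0: "norm u <= Nm m u"
 using norm_le_Nm[of "[]" m u] by simp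

lemma Hs_diff: "Hs m u ==> Hs m v ==> Hs m (u - v)"
 unfolding Hs_def using wd_diff by blast

lemma dv_diff: "Hs m u ==> Hs m v ==> length is <= m ==> dv is (u - v) = dv is u - dv is v"
 by (rule dv_eqI[OF wd_diff]) (auto intro: Hs_wd)

lemma Hs_h_inf: "h_inf f ==> Hs m (cl f)"
 unfolding Hs_def using wd_h_inf by blast

lemma dv_h_inf: "h_inf f ==> dv is (cl f) = cl (D is f)"
 by (rule dv_eqI[OF wd_h_inf])

lemma Nm_h_inf: "h_inf f ==> Nm m (cl f) = hn m f"
 by (simp add: Nm_def hn_def dv_h_inf)

text \<open>The smooth representative of \<open>J ep u\<close>, to which classical derivatives
  apply; \<open>rp (J ep u)\<close> agrees with it only almost everywhere.\<close>

definition Jf :: "real => (real^'n::finite, 'b::euclidean_space) l2 => real^'n => 'b" where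
 "Jf ep u = conv (moll ep) (rp u)"

lemma J_eq_Jf: "J ep u = cl (Jf ep u)" by (simp add: cv_def Jf_def)

lemma h_inf_Jf: "ep > 0 ==> h_inf (Jf ep u)"
 unfolding Jf_def by (rule h_inf_conv[OF moll_test]) auto

lemma cl_D_Jf: "ep > 0 ==> cl (D is (Jf ep u)) = cv (D is (moll ep)) u"
 by (simp add: Jf_def D_conv[OF moll_test] cv_def)

lemma dv_J: "ep > 0 ==> dv is (J ep u) = cv (D is (moll ep)) u"
 by (simp add: J_eq_Jf dv_h_inf h_inf_Jf cl_D_Jf)

lemma Hs_J: "ep > 0 ==> Hs m (J ep u)"
 by (simp add: J_eq_Jf Hs_h_inf h_inf_Jf)

lemma dv_J_Hs: "ep > 0 ==> Hs m u ==> length is <= m ==> dv is (J ep u) = J ep (dv is u)"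
 using Hs_wd[of m u "is"] by (simp add: dv_J wd_def)

lemma Nm_J_le: assumes e: "ep > 0" and u: "Hs m u" shows "Nm m (J ep u) <= Nm m u"
 unfolding Nm_def
 by (intro real_sqrt_le_mono sum_mono power_mono) (auto simp: dv_J_Hs[OF e u] J_norm[OF e])

lemma hn_Jf_le: assumes "ep > 0" "Hs m u" shows "hn m (Jf ep u) <= Nm m u"
 using Nm_J_le[OF assms] by (simp add: J_eq_Jf Nm_h_inf h_inf_Jf assms)

text \<open>The excess max 0 (|v| - B) is at most |v - V k| almost everywhere, for every k, so its
  L^2 norm is 0.\<close>

lemma AE_bound_limit:
 fixes v :: "('a::euclidean_space, 'b::euclidean_space) l2"
 assumes lim: "V \<longlonglongrightarrow> v" and B: "B >= 0" "!!k::nat. AE x in lborel. norm (rp (V k) x) <= B"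
 shows "AE x in lborel. norm (rp v x) <= B"
proof -
 let ?p = "%x. max 0 (norm (rp v x) - B)"
 have le: "AE x in lborel. norm (?p x) <= 1 * norm (rp (v - V k) x)" for k
  using B(2)[of k] rp_diff[of v "V k"]
 proof eventually_elim
  case (elim x)
  have "norm (rp v x) <= norm (rp (V k) x) + norm (rp v x - rp (V k) x)"
   by (rule norm_triangle_sub)
  thus ?case using elim by simp
 qed
 have m: "bmeas ?p" by measurable
 have s: "sqi ?p" using norm_cl_le(1)[OF m sqi_rp _ le[of 0]] by simp
 have "norm (cl ?p) <= norm (v - V k)" for k
  using norm_cl_le(2)[OF m sqi_rp _ le[of k]] by simp
 moreover have "(%k. norm (v - V k)) \<longlonglongrightarrow> norm (v - v)" by (intro tendsto_intros lim)
 ultimately have "norm (cl ?p) <= 0" by (intro LIMSEQ_le_const[of "%k. norm (v - V k)"]) auto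
 hence "cl ?p = 0" by simp
 hence "AE x in lborel. rp (0 :: ('a, real) l2) x = ?p x" using rp_cl[OF s] by simp
 moreover have "AE x in lborel. rp (0 :: ('a, real) l2) x = 0" by (rule rp_zero)
 ultimately have "AE x in lborel. ?p x = 0" by eventually_elim simp
 thus ?thesis by eventually_elim (simp add: max_def split: if_splits)
qed

definition eps :: "nat => real" where "eps k = 1 / real (Suc k)"

lemma eps_pos [simp]: "eps k > 0" by (simp add: eps_def)

lemma eps_tendsto: "eps \<longlonglongrightarrow> 0"
 unfolding eps_def[abs_def] using LIMSEQ_inverse_real_of_nat by (simp add: inverse_eq_divide)

lemma eps_at_right: "filterlim eps (at_right 0) sequentially"
 using eps_tendsto by (simp add: filterlim_at eps_def)

lemma J_eps_tendsto: "(%k. J (eps k) u) \<longlonglongrightarrow> u"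
 by (rule filterlim_compose[OF J_tendsto eps_at_right])

lemma Hs_sup:
 fixes u :: "(real^'n::finite, 'b::euclidean_space) l2"
 assumes u: "Hs m u" and a: "length a + 2 <= m" and n: "CARD('n) <= 3"
 shows "AE x in lborel. norm (rp (dv a u) x) <= sob_const TYPE('n) * Nm m u"
proof (rule AE_bound_limit[OF J_eps_tendsto[of "dv a u"]])
 show "sob_const TYPE('n) * Nm m u >= 0" using sob_const_ge[where 'n='n] by simp
 fix k
 have h: "h_inf (Jf (eps k) u)" by (rule h_inf_Jf) simp
 have b: "norm (D a (Jf (eps k) u) x) <= sob_const TYPE('n) * Nm m u" for x
  by (rule order_trans[OF sobolev_sup[OF h n a] mult_left_mono[OF hn_Jf_le[OF eps_pos u]]])
   (use sob_const_ge[where 'n='n] in simp)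
 have "J (eps k) (dv a u) = cl (D a (Jf (eps k) u))"
  using dv_J_Hs[OF eps_pos u, of a k] a by (simp add: J_eq_Jf[of "eps k" u] dv_h_inf[OF h])
 thus "AE x in lborel. norm (rp (J (eps k) (dv a u)) x) <= sob_const TYPE('n) * Nm m u"
  using rp_cl[OF h_inf_sqi[OF h, of a]] b by (auto elim: eventually_mono)
qed

lemma Hs_rate:
 fixes u :: "(real^'n::finite, 'b::euclidean_space) l2"
 assumes e: "ep > 0" and u: "Hs 1 u"
 shows "norm (J ep u - u) <= ep * (\<Sum>j\<in>UNIV. norm (dv [j] u))"
proof (rule LIMSEQ_le_const2)
 show "(%k. norm (J ep (J (eps k) u) - J (eps k) u)) \<longlonglongrightarrow> norm (J ep u - u)"
  by (intro tendsto_intros J_eps_tendsto bounded_linear.tendsto[OF bounded_linear_cv[OF moll_kernel[OF e]] J_eps_tendsto])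
 have "norm (J ep (J (eps k) u) - J (eps k) u) <= ep * (\<Sum>j\<in>UNIV. norm (dv [j] u))" for k
 proof -
  let ?f = "Jf (eps k) u"
  have h: "h_inf ?f" by (rule h_inf_Jf) simp
  have s: "sqi ?f" "sqi (pd j ?f)" for j using h_inf_sqi[OF h, of "[]"] h_inf_sqi[OF h, of "[j]"] by auto
  have "norm (J ep (cl ?f) - cl ?f) <= ep * (\<Sum>j\<in>UNIV. norm (cl (pd j ?f)))"
   using moll_rate[OF e h_inf_smooth[OF h] s] by (simp add: cv_cl moll_kernel[OF e] s)
  also have "... <= ep * (\<Sum>j\<in>UNIV. norm (dv [j] u))"
  proof (intro mult_left_mono sum_mono)
   fix j
   have "cl (pd j ?f) = J (eps k) (dv [j] u)"
    using dv_J_Hs[OF eps_pos u, of "[j]" k] by (simp add: J_eq_Jf[of "eps k" u] dv_h_inf[OF h])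
   thus "norm (cl (pd j ?f)) <= norm (dv [j] u)" by (simp add: J_norm)
  qed (use e in simp)
  finally show ?thesis by (simp only: J_eq_Jf[of "eps k" u])
 qed
 thus "EX N. \<forall>k\<ge>N. norm (J ep (J (eps k) u) - J (eps k) u) <= ep * (\<Sum>j\<in>UNIV. norm (dv [j] u))" by blast
qed

text \<open>Integration by parts for the mollifications, then the limit. Its purpose is to turn L^2
  convergence with bounded second derivatives into convergence of first derivatives.\<close>

lemma Hs_interpolate:
 fixes u :: "(real^'n::finite, 'b::euclidean_space) l2"
 assumes u: "Hs 2 u" shows "(norm (dv [j] u))^2 <= norm u * norm (dv [j, j] u)"
proof (rule LIMSEQ_le_const2)
 show "(%k. (norm (J (eps k) (dv [j] u)))^2) \<longlonglongrightarrow> (norm (dv [j] u))^2"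
  by (intro tendsto_intros J_eps_tendsto)
 have "(norm (J (eps k) (dv [j] u)))^2 <= norm u * norm (dv [j, j] u)" for k
 proof -
  let ?f = "Jf (eps k) u"
  have h: "h_inf ?f" by (rule h_inf_Jf) simp
  have s: "sqi ?f" "sqi (pd j ?f)" "sqi (pd j (pd j ?f))"
   using h_inf_sqi[OF h, of "[]"] h_inf_sqi[OF h, of "[j]"] h_inf_sqi[OF h, of "[j,j]"] by auto
  have d: "cl (pd j ?f) = J (eps k) (dv [j] u)" "cl (pd j (pd j ?f)) = J (eps k) (dv [j,j] u)"
   using dv_J_Hs[OF eps_pos u, of "[j]" k] dv_J_Hs[OF eps_pos u, of "[j,j]" k]
   by (auto simp: J_eq_Jf[of "eps k" u] dv_h_inf[OF h])
  have "(norm (cl (pd j ?f)))^2 = (LINT x|lborel. pd j ?f x \<bullet> pd j ?f x)"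
   by (simp add: power2_norm_eq_inner inner_cl s)
  also have "... = - (LINT x|lborel. ?f x \<bullet> pd j (pd j ?f) x)"
   using integral_by_parts[OF bounded_bilinear_inner h_inf_smooth[OF h] smooth_pd[OF h_inf_smooth[OF h]] s(1,2,2,3)] by simp
  also have "... = - (cl ?f \<bullet> cl (pd j (pd j ?f)))" by (simp add: inner_cl s)
  also have "... <= norm (cl ?f) * norm (cl (pd j (pd j ?f)))"
   using Cauchy_Schwarz_ineq2[of "cl ?f" "cl (pd j (pd j ?f))"] by linarith
  also have "... <= norm u * norm (dv [j, j] u)"
   unfolding d(2) J_eq_Jf[symmetric] by (intro mult_mono J_norm) auto
  finally show ?thesis unfolding d(1) .
 qed
 thus "EX N. \<forall>k\<ge>N. (norm (J (eps k) (dv [j] u)))^2 <= norm u * norm (dv [j, j] u)" by blast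
qed

lemma J_range_dense: "e > 0 ==> \<exists>d\<in>{J ep x | ep x. ep > 0}. norm (u - d) < e"
proof -
 assume e: "e > 0"
 have "(%k. norm (u - J (eps k) u)) \<longlonglongrightarrow> norm (u - u)" by (intro tendsto_intros J_eps_tendsto)
 hence "\<forall>\<^sub>F k in sequentially. norm (u - J (eps k) u) < e" using e by (intro order_tendstoD(2)[where y=0]) auto
 then obtain k where "norm (u - J (eps k) u) < e" by (auto simp: eventually_sequentially)
 thus ?thesis using eps_pos[of k] by blast
qed

text \<open>Against vectors \<open>J ep x\<close> a derivative moves onto the kernel, so the pairing
  converges by strong L^2 convergence. These vectors are dense, so \<open>weak_limit_exists\<close>
  gives weak convergence of every derivative, and lower semicontinuity gives the norm bound.\<close>

lemma Hs_weak_compact: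
 fixes u :: "(real^'n::finite, 'b::euclidean_space) l2"
 assumes lim: "U \<longlonglongrightarrow> u" and H: "!!k::nat. Hs m (U k)" and bd: "!!k. (Nm m (U k))^2 <= c"
 shows "Hs m u" "(Nm m u)^2 <= c" "length is <= m ==> (%k. dv is (U k) \<bullet> x) \<longlonglongrightarrow> dv is u \<bullet> x"
proof -
 have c0: "c >= 0" using bd[of 0] zero_le_power2 order_trans by blast
 have ex: "EX v. wd is u v & (ALL x. (%k. dv is (U k) \<bullet> x) \<longlonglongrightarrow> v \<bullet> x)" if len: "length is <= m" for "is"
 proof -
  have "EX w. norm w <= sqrt c & (ALL x. (%k. dv is (U k) \<bullet> x) \<longlonglongrightarrow> w \<bullet> x)"
  proof (rule weak_limit_exists[OF _ J_range_dense])
   show "norm (dv is (U k)) <= sqrt c" for k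
    using order_trans[OF norm_le_Nm[OF len] real_le_rsqrt[OF bd]] .
   fix d :: "(real^'n, 'b) l2" assume "d \<in> {J ep x | ep x. ep > 0}"
   then obtain ep x where d: "d = J ep x" "ep > 0" by blast
   have "dv is (U k) \<bullet> d = cv (D is (moll ep)) (U k) \<bullet> x" for k
    using Hs_wd[OF H len, of k] d by (simp add: wd_def J_inner[symmetric])
   moreover have "(%k. cv (D is (moll ep)) (U k) \<bullet> x) \<longlonglongrightarrow> cv (D is (moll ep)) u \<bullet> x"
    by (intro tendsto_intros bounded_linear.tendsto[OF bounded_linear_cv[OF kernel_D_moll[OF d(2)]] lim])
   ultimately show "convergent (%k. dv is (U k) \<bullet> d)" by (auto simp: convergent_def)
  qed
  thus ?thesis using wd_weak_limit[OF lim _ Hs_wd[OF H len]] by blast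
 qed
 thus Hu: "Hs m u" unfolding Hs_def by blast
 have wl: "(%k. dv is (U k) \<bullet> x) \<longlonglongrightarrow> dv is u \<bullet> x" if "length is <= m" for "is" x
  using ex[OF that] dv_eqI by metis
 thus "length is <= m ==> (%k. dv is (U k) \<bullet> x) \<longlonglongrightarrow> dv is u \<bullet> x" .
 \<comment> \<open>Lower semicontinuity of the full norm: 2 <a_k, a> <= |a_k|^2 + |a|^2, summed over
   all lists, has left side tending to 2 |a|^2.\<close>
 have "(%k. \<Sum>is\<in>lists_le m. 2 * (dv is (U k) \<bullet> dv is u)) \<longlonglongrightarrow> (\<Sum>is\<in>lists_le m. 2 * (dv is u \<bullet> dv is u))"
  by (intro tendsto_intros wl) auto
 hence "(\<Sum>is\<in>lists_le m. 2 * (dv is u \<bullet> dv is u)) <= c + (Nm m u)^2"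
 proof (rule LIMSEQ_le_const2)
  have "(\<Sum>is\<in>lists_le m. 2 * (dv is (U k) \<bullet> dv is u)) <= c + (Nm m u)^2" for k
  proof -
   have "(\<Sum>is\<in>lists_le m. 2 * (dv is (U k) \<bullet> dv is u)) <= (\<Sum>is\<in>lists_le m. (norm (dv is (U k)))^2 + (norm (dv is u))^2)"
   proof (rule sum_mono)
    fix "is"
    have "0 <= (norm (dv is (U k) - dv is u))^2" by simp
    thus "2 * (dv is (U k) \<bullet> dv is u) <= (norm (dv is (U k)))^2 + (norm (dv is u))^2"
     by (simp add: power2_norm_eq_inner inner_diff inner_commute)
   qed
   also have "... = (Nm m (U k))^2 + (Nm m u)^2" by (simp add: Nm_sq sum.distrib)
   finally show ?thesis using bd[of k] by simp
  qed
  thus "EX N. \<forall>k\<ge>N. (\<Sum>is\<in>lists_le m. 2 * (dv is (U k) \<bullet> dv is u)) <= c + (Nm m u)^2" by blast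
 qed
 thus "(Nm m u)^2 <= c" by (simp add: Nm_sq sum_distrib_left[symmetric] power2_norm_eq_inner)
qed

section \<open>The nonlinearity in the Hilbert space\<close>

context sym_system
begin

text \<open>States and their derivatives are separate arguments, because weak derivatives are
  functions in their own right and not computed from the chosen representative.\<close>

definition FFf :: "(real^'n => 'b) => ('n => real^'n => 'b) => (real^'n => 'b) => ('n => real^'n => 'b) => real^'n => 'b" where
 "FFf E e f g x = (\<Sum>j\<in>UNIV. S j (f x + E x) (g j x) + S j (f x) (e j x)) + G (f x)"

definition FF :: "(real^'n => 'b) => ('n => real^'n => 'b) => (real^'n, 'b) l2 => (real^'n, 'b) l2" where
 "FF E e v = cl (FFf E e (rp v) (%j. rp (dv [j] v)))"

lemma S_meas:
 assumes "bmeas f" "bmeas g"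
 shows "bmeas (%x. S j (f x) (g x))"
 by (intro borel_measurable_continuous_Pair[where H="S j"] bounded_bilinear.continuous_on[OF S_bil] continuous_intros)
  (use assms in simp_all)

lemma G_meas: "f \<in> borel_measurable borel ==> bmeas (%x. G (f x))"
 using borel_measurable_continuous_onI[OF linear_continuous_on[OF G_lin]] by measurable

lemma FFf_meas:
 assumes [measurable]: "bmeas E" "!!j. bmeas (e j)"
  "bmeas f" "!!j. bmeas (g j)"
 shows "bmeas (FFf E e f g)"
 unfolding FFf_def by (intro borel_measurable_add borel_measurable_sum S_meas G_meas) auto

lemma FF_h_inf:
 assumes E: "b_inf E" and W: "h_inf W"
 shows "FF E (%j. pd j E) (cl W) = cl (Ffun E W)"
 unfolding FF_def
proof (rule cl_cong)
 have s: "sqi W" "sqi (pd j W)" for j using h_inf_sqi[OF W, of "[]"] h_inf_sqi[OF W, of "[j]"] by auto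
 have "AE x in lborel. ALL j. rp (dv [j] (cl W)) x = pd j W x"
  using rp_cl[OF s(2)] by (simp add: dv_h_inf[OF W] eventually_all_finite)
 with rp_cl[OF s(1)] show eq: "AE x in lborel. FFf E (%j. pd j E) (rp (cl W)) (%j. rp (dv [j] (cl W))) x = Ffun E W x"
  by eventually_elim (simp add: FFf_def Ffun_def)
 show F: "sqi (Ffun E W)" using h_inf_sqi[OF h_inf_Ffun[OF E W], of "[]"] by simp
 show "sqi (FFf E (%j. pd j E) (rp (cl W)) (%j. rp (dv [j] (cl W))))"
 proof (rule sqi_cong_AE[OF F])
  show "bmeas (FFf E (%j. pd j E) (rp (cl W)) (%j. rp (dv [j] (cl W))))"
   by (rule FFf_meas) (auto intro: smooth_measurable smooth_pd b_inf_smooth[OF E])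
  show "AE x in lborel. Ffun E W x = FFf E (%j. pd j E) (rp (cl W)) (%j. rp (dv [j] (cl W))) x"
   using eq by eventually_elim simp
 qed
qed

lemma S_AE:
 assumes e: "bmeas e" "AE x in lborel. norm (e x) <= M" "M >= 0" and w: "sqi w"
 shows "L2b (%x. S j (e x) (w x)) (KS * M * norm (cl w))" "L2b (%x. S j (w x) (e x)) (KS * M * norm (cl w))"
proof -
 have K': "norm (S j b a) <= norm a * norm b * KS" for a b using KS(2)[of j b a] by (simp add: mult_ac)
 show "L2b (%x. S j (e x) (w x)) (KS * M * norm (cl w))"
  using sqi_mult_bounded[OF S_bil KS(2) KS(1) e w, of j] by (simp add: L2b_def mult_ac)
 show "L2b (%x. S j (w x) (e x)) (KS * M * norm (cl w))"
  using sqi_mult_bounded[OF bounded_bilinear_flip[OF S_bil] K' KS(1) e w] by (simp add: L2b_def mult_ac)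
qed

lemma G_L2b: "sqi w ==> L2b (%x. G (w x)) (KG * norm (cl w))"
proof -
 assume w: "sqi w"
 have "norm (G (w x)) <= KG * norm (w x)" for x using KG(2)[of "w x"] by (simp add: mult.commute)
 hence "norm (cl (%x. G (w x))) <= KG * norm (cl w)"
  by (intro norm_cl_le(2)[OF G_meas[OF sqi_measurable[OF w]] w KG(1)]) auto
 thus ?thesis using sqi_bounded_linear[OF G_lin w] by (simp add: L2b_def)
qed

lemma FFf_sqi:
 assumes E: "bmeas E" "AE x in lborel. norm (E x) <= b"
  and e: "!!j. bmeas (e j)" "!!j. AE x in lborel. norm (e j x) <= b" and b: "b >= 0"
  and f: "sqi f" and g: "!!j. sqi (g j)"
  and fg: "(AE x in lborel. norm (f x) <= b) \<or> (ALL j. AE x in lborel. norm (g j x) <= b)"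
 shows "sqi (FFf E e f g)"
proof -
 have 1: "sqi (%x. S j (f x) (g j x))" for j
  using fg S_AE(1)[OF sqi_measurable[OF f] _ b g, of j j] S_AE(2)[OF sqi_measurable[OF g] _ b f, of j j]
  by (auto simp: L2b_def)
 have 2: "sqi (%x. S j (E x) (g j x))" "sqi (%x. S j (f x) (e j x))" for j
  using S_AE(1)[OF E b g] S_AE(2)[OF e b f] by (auto simp: L2b_def)
 have "sqi (%x. (\<Sum>j\<in>UNIV. (S j (f x) (g j x) + S j (E x) (g j x)) + S j (f x) (e j x)) + G (f x))"
  using G_L2b[OF f] by (intro sqi_add sqi_sum 1 2) (auto simp: L2b_def)
 thus ?thesis by (simp add: FFf_def[abs_def] bounded_bilinear.add_left[OF S_bil])
qed

text \<open>Telescoped so that the differentiated difference g1 - g2 is multiplied by the first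
  state, which is smooth where stability is proved. The other terms contain only the
  undifferentiated difference f1 - f2 or differences of the background data.\<close>

lemma FFf_diff_eq:
 "FFf E1 e1 f1 g1 x - FFf E2 e2 f2 g2 x =
  (\<Sum>j\<in>UNIV. S j (f1 x + E1 x) (g1 j x - g2 j x)) +
  (\<Sum>j\<in>UNIV. (S j (f1 x - f2 x) (g2 j x) + S j (E1 x - E2 x) (g2 j x)) +
   (S j (f1 x - f2 x) (e1 j x) + S j (f2 x) (e1 j x - e2 j x))) + G (f1 x - f2 x)"
proof -
 have "S j (f1 x + E1 x) (g1 j x) + S j (f1 x) (e1 j x) - (S j (f2 x + E2 x) (g2 j x) + S j (f2 x) (e2 j x)) =
   S j (f1 x + E1 x) (g1 j x - g2 j x) + ((S j (f1 x - f2 x) (g2 j x) + S j (E1 x - E2 x) (g2 j x)) +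
   (S j (f1 x - f2 x) (e1 j x) + S j (f2 x) (e1 j x - e2 j x)))" for j
  by (simp add: bounded_bilinear.add_left[OF S_bil] bounded_bilinear.diff_left[OF S_bil] bounded_bilinear.diff_right[OF S_bil])
 hence "(\<Sum>j\<in>UNIV. S j (f1 x + E1 x) (g1 j x) + S j (f1 x) (e1 j x)) - (\<Sum>j\<in>UNIV. S j (f2 x + E2 x) (g2 j x) + S j (f2 x) (e2 j x))
  = (\<Sum>j\<in>UNIV. S j (f1 x + E1 x) (g1 j x - g2 j x)) + (\<Sum>j\<in>UNIV. (S j (f1 x - f2 x) (g2 j x) + S j (E1 x - E2 x) (g2 j x)) +
   (S j (f1 x - f2 x) (e1 j x) + S j (f2 x) (e1 j x - e2 j x)))"
  by (simp add: sum_subtractf[symmetric] sum.distrib[symmetric])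
 thus ?thesis
  by (simp add: FFf_def bounded_linear.linear[OF G_lin, THEN linear_diff] algebra_simps)
qed

lemma FFf_rest_L2b:
 assumes E: "bmeas E1" "bmeas E2" "AE x in lborel. norm (E1 x - E2 x) <= \<eta>"
  and e1: "!!j. bmeas (e1 j)" "!!j. AE x in lborel. norm (e1 j x) <= b"
  and e2: "!!j. bmeas (e2 j)" "!!j. AE x in lborel. norm (e1 j x - e2 j x) <= \<eta>"
  and b: "b >= 0" "\<eta> >= 0" and f: "sqi f1" "sqi f2" and g: "!!j. sqi (g2 j)" "!!j. AE x in lborel. norm (g2 j x) <= b"
  and N: "!!j. norm (cl (g2 j)) <= N" "norm (cl f2) <= N"
 shows "L2b (%x. \<Sum>j\<in>UNIV. (S j (f1 x - f2 x) (g2 j x) + S j (E1 x - E2 x) (g2 j x)) +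
   (S j (f1 x - f2 x) (e1 j x) + S j (f2 x) (e1 j x - e2 j x)))
  (real CARD('n) * (2 * KS * b * norm (cl (%x. f1 x - f2 x)) + 2 * KS * \<eta> * N))"
proof -
 have d: "sqi (%x. f1 x - f2 x)" using f by simp
 have m: "bmeas (%x. E1 x - E2 x)" "bmeas (%x. e1 j x - e2 j x)" for j
  using E e1 e2 by auto
 have N': "KS * \<eta> * norm (cl (g2 j)) <= KS * \<eta> * N" "KS * \<eta> * norm (cl f2) <= KS * \<eta> * N" for j
  using KS(1) b N by (auto intro!: mult_left_mono)
 show ?thesis
 proof (rule L2b_sum, rule L2b_mono)
  fix j :: 'n
  show "L2b (%x. (S j (f1 x - f2 x) (g2 j x) + S j (E1 x - E2 x) (g2 j x)) +
   (S j (f1 x - f2 x) (e1 j x) + S j (f2 x) (e1 j x - e2 j x)))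
   ((KS * b * norm (cl (%x. f1 x - f2 x)) + KS * \<eta> * norm (cl (g2 j))) + (KS * b * norm (cl (%x. f1 x - f2 x)) + KS * \<eta> * norm (cl f2)))"
   by (rule L2b_add[OF
      L2b_add[OF S_AE(2)[OF sqi_measurable[OF g(1)] g(2) b(1) d] S_AE(1)[OF m(1) E(3) b(2) g(1)]]
      L2b_add[OF S_AE(2)[OF e1 b(1) d] S_AE(2)[OF m(2) e2(2) b(2) f(2)]]])
  show "(KS * b * norm (cl (%x. f1 x - f2 x)) + KS * \<eta> * norm (cl (g2 j))) + (KS * b * norm (cl (%x. f1 x - f2 x)) + KS * \<eta> * norm (cl f2))
   <= 2 * KS * b * norm (cl (%x. f1 x - f2 x)) + 2 * KS * \<eta> * N"
   using N'(1)[of j] N'(2) by simp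
 qed
qed

lemma rp_diff_cl: "cl (%x. rp u x - rp v x) = u - v"
 by (simp add: cl_diff)

text \<open>This bound loses a derivative and estimates \<open>G\<close> by its norm, so it cannot
  close an energy argument. It serves for Lipschitz bounds at fixed \<open>ep\<close>, for residuals
  and for passing to the limit.\<close>

lemma FF_diff:
 assumes E1: "bmeas E1" "AE x in lborel. norm (E1 x) <= b"
  and E2: "bmeas E2" "AE x in lborel. norm (E2 x) <= b"
  and EE: "AE x in lborel. norm (E1 x - E2 x) <= \<eta>"
  and e1: "!!j. bmeas (e1 j)" "!!j. AE x in lborel. norm (e1 j x) <= b"
  and e2: "!!j. bmeas (e2 j)" "!!j. AE x in lborel. norm (e2 j x) <= b"
  and ee: "!!j. AE x in lborel. norm (e1 j x - e2 j x) <= \<eta>"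
  and b: "b >= 0" "\<eta> >= 0"
  and v1: "AE x in lborel. norm (rp v1 x) <= b" and w2: "!!j. AE x in lborel. norm (rp (dv [j] v2) x) <= b"
  and N: "!!j. norm (dv [j] v2) <= N" "norm v2 <= N"
 shows "norm (FF E1 e1 v1 - FF E2 e2 v2) <=
  KS * (2 * b) * (\<Sum>j\<in>UNIV. norm (dv [j] v1 - dv [j] v2))
  + (real CARD('n) * (2 * KS * b * norm (v1 - v2) + 2 * KS * \<eta> * N) + KG * norm (v1 - v2))"
proof -
 let ?f1 = "FFf E1 e1 (rp v1) (%j. rp (dv [j] v1))" and ?f2 = "FFf E2 e2 (rp v2) (%j. rp (dv [j] v2))"
 have s1: "sqi ?f1" by (rule FFf_sqi[OF E1 e1 b(1) sqi_rp sqi_rp]) (use v1 in blast)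
 have s2: "sqi ?f2" by (rule FFf_sqi[OF E2 e2 b(1) sqi_rp sqi_rp]) (use w2 in blast)
 have vE: "AE x in lborel. norm (rp v1 x + E1 x) <= 2 * b"
  using v1 E1(2) by eventually_elim (rule order_trans[OF norm_triangle_ineq], simp)
 have vEm: "bmeas (%x. rp v1 x + E1 x)" using E1(1) by measurable
 have T: "L2b (%x. S j (rp v1 x + E1 x) (rp (dv [j] v1) x - rp (dv [j] v2) x)) (KS * (2 * b) * norm (dv [j] v1 - dv [j] v2))" for j
  using S_AE(1)[OF vEm vE _ sqi_diff[OF sqi_rp sqi_rp], of j "dv [j] v1" "dv [j] v2"] b by (simp add: rp_diff_cl)
 have "L2b (%x. \<Sum>j\<in>A. S j (rp v1 x + E1 x) (rp (dv [j] v1) x - rp (dv [j] v2) x)) (\<Sum>j\<in>A. KS * (2 * b) * norm (dv [j] v1 - dv [j] v2))" for A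
  by (induction A rule: infinite_finite_induct) (auto intro: L2b_add T L2b_zero)
 moreover have "L2b (%x. \<Sum>j\<in>UNIV. (S j (rp v1 x - rp v2 x) (rp (dv [j] v2) x) + S j (E1 x - E2 x) (rp (dv [j] v2) x)) +
   (S j (rp v1 x - rp v2 x) (e1 j x) + S j (rp v2 x) (e1 j x - e2 j x)))
  (real CARD('n) * (2 * KS * b * norm (cl (%x. rp v1 x - rp v2 x)) + 2 * KS * \<eta> * N))"
  by (rule FFf_rest_L2b[OF E1(1) E2(1) EE e1 e2(1) ee b sqi_rp sqi_rp sqi_rp w2]) (use N in auto)
 moreover have "L2b (%x. G (rp v1 x - rp v2 x)) (KG * norm (cl (%x. rp v1 x - rp v2 x)))"
  by (rule G_L2b) simp
 ultimately have "L2b (%x. ?f1 x - ?f2 x) ((\<Sum>j\<in>UNIV. KS * (2 * b) * norm (dv [j] v1 - dv [j] v2))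
  + (real CARD('n) * (2 * KS * b * norm (cl (%x. rp v1 x - rp v2 x)) + 2 * KS * \<eta> * N)) + KG * norm (cl (%x. rp v1 x - rp v2 x)))"
  unfolding FFf_diff_eq by (intro L2b_add)
 thus ?thesis
  unfolding FF_def cl_diff[OF s1 s2, symmetric] rp_diff_cl L2b_def by (simp add: sum_distrib_left add.assoc)
qed

text \<open>\<open>skew_pairing\<close> for the mollifications of \<open>u\<close>, passed to the
  limit: since \<open>U\<close> is bounded, each \<open>T j\<close> is continuous on L^2.\<close>

lemma weak_skew_pairing:
 assumes U: "b_inf U" and L: "!!j x. norm (pd j U x) <= L" and u: "Hs 1 u"
 shows "\<bar>u \<bullet> cl (%x. \<Sum>j\<in>UNIV. S j (U x) (rp (dv [j] u) x))\<bar> <= real CARD('n) * (KS * L) * (norm u)^2"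
proof -
 obtain B where B: "B >= 0" "!!x. norm (U x) <= B" using b_inf_bounded[OF U] by blast
 have Um: "bmeas U" by (rule smooth_measurable[OF b_inf_smooth[OF U]])
 have sS: "L2b (%x. S j (U x) (w x)) (KS * B * norm (cl w))" if "sqi w" for w j
  by (rule S_AE(1)[OF Um _ B(1) that]) (use B in auto)
 define T where "T j v = cl (%x. S j (U x) (rp v x))" for j and v :: "(real^'n, 'b) l2"
 have Tcl: "T j (cl w) = cl (%x. S j (U x) (w x))" if w: "sqi w" for j w
  unfolding T_def using sS[OF w, of j] sS[OF sqi_rp[of "cl w"], of j] rp_cl[OF w]
  by (intro cl_cong) (auto simp: L2b_def elim: eventually_mono)
 have Tb: "norm (T j v - T j v') <= KS * B * norm (v - v')" for j v v'
 proof -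
  have "T j v - T j v' = cl (%x. S j (U x) (rp v x - rp v' x))"
   unfolding T_def bounded_bilinear.diff_right[OF S_bil]
   using sS[OF sqi_rp[of v], of j] sS[OF sqi_rp[of v'], of j] by (subst cl_diff) (auto simp: L2b_def)
  thus ?thesis using sS[of "%x. rp v x - rp v' x" j] by (simp add: L2b_def rp_diff_cl)
 qed
 have Tlim: "(%k. T j (V k)) \<longlonglongrightarrow> T j v" if "V \<longlonglongrightarrow> v" for j V v
 proof (rule LIM_zero_cancel, rule Lim_null_comparison)
  show "\<forall>\<^sub>F k in sequentially. norm (T j (V k) - T j v) <= KS * B * norm (V k - v)" using Tb by simp
  have "(%k. KS * B * norm (V k - v)) \<longlonglongrightarrow> KS * B * norm (v - v)" by (intro tendsto_intros that)
  thus "(%k. KS * B * norm (V k - v)) \<longlonglongrightarrow> 0" by simp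
 qed
 have eqT: "cl (%x. \<Sum>j\<in>UNIV. S j (U x) (rp (dv [j] u) x)) = (\<Sum>j\<in>UNIV. T j (dv [j] u))"
  unfolding T_def using sS[OF sqi_rp] by (intro cl_sum) (auto simp: L2b_def)
 have "\<bar>u \<bullet> (\<Sum>j\<in>UNIV. T j (dv [j] u))\<bar> <= real CARD('n) * (KS * L) * (norm u)^2"
 proof (rule LIMSEQ_le)
  show "(%k. \<bar>J (eps k) u \<bullet> (\<Sum>j\<in>UNIV. T j (J (eps k) (dv [j] u)))\<bar>) \<longlonglongrightarrow> \<bar>u \<bullet> (\<Sum>j\<in>UNIV. T j (dv [j] u))\<bar>"
   by (intro tendsto_intros Tlim J_eps_tendsto)
  show "(%k. real CARD('n) * (KS * L) * (norm (J (eps k) u))^2) \<longlonglongrightarrow> real CARD('n) * (KS * L) * (norm u)^2"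
   by (intro tendsto_intros J_eps_tendsto)
  have "\<bar>J (eps k) u \<bullet> (\<Sum>j\<in>UNIV. T j (J (eps k) (dv [j] u)))\<bar> <= real CARD('n) * (KS * L) * (norm (J (eps k) u))^2" for k
  proof -
   let ?w = "Jf (eps k) u"
   have h: "h_inf ?w" by (rule h_inf_Jf) simp
   have s: "sqi (pd j ?w)" for j using h_inf_sqi[OF h, of "[j]"] by simp
   have "J (eps k) (dv [j] u) = cl (pd j ?w)" for j
    using dv_J_Hs[OF eps_pos u, of "[j]" k] by (simp add: J_eq_Jf[of "eps k" u] dv_h_inf[OF h])
   hence "(\<Sum>j\<in>UNIV. T j (J (eps k) (dv [j] u))) = cl (%x. \<Sum>j\<in>UNIV. S j (U x) (pd j ?w x))"
    using sS[OF s] by (simp add: Tcl[OF s] cl_sum L2b_def)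
   thus ?thesis using skew_pairing(2)[OF U L h] by (simp add: J_eq_Jf[of "eps k" u])
  qed
  thus "EX N. \<forall>k\<ge>N. \<bar>J (eps k) u \<bullet> (\<Sum>j\<in>UNIV. T j (J (eps k) (dv [j] u)))\<bar> <= real CARD('n) * (KS * L) * (norm (J (eps k) u))^2" by blast
 qed
 thus ?thesis unfolding eqT .
qed

text \<open>Only one of the two states is smooth, together with its background; it supplies the
  coefficient of the top-order term, so that the difference, which has only one weak derivative, can
  be paired by \<open>weak_skew_pairing\<close>. \<open>G\<close> drops out by skewness.\<close>

lemma stability_estimate:
 assumes V: "h_inf V" and E1: "b_inf E1" and L: "!!j x. norm (pd j (%x. V x + E1 x) x) <= b" "!!j x. norm (pd j E1 x) <= b"
  and E1b: "!!x. norm (E1 x) <= B"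
  and E2: "bmeas E2" "AE x in lborel. norm (E2 x) <= B" and EE: "AE x in lborel. norm (E1 x - E2 x) <= \<eta>"
  and e2: "!!j. bmeas (e2 j)" "!!j. AE x in lborel. norm (e2 j x) <= B"
  and ee: "!!j. AE x in lborel. norm (pd j E1 x - e2 j x) <= \<eta>" and b: "b >= 0" "\<eta> >= 0"
  and v: "Hs 1 v" "!!j. AE x in lborel. norm (rp (dv [j] v) x) <= b"
  and N: "!!j. norm (dv [j] v) <= N" "norm v <= N"
 shows "\<bar>(cl V - v) \<bullet> (FF E1 (%j. pd j E1) (cl V) - FF E2 e2 v)\<bar>
  <= real CARD('n) * (3 * KS * b) * (norm (cl V - v))^2 + real CARD('n) * (2 * KS * \<eta> * N) * norm (cl V - v)"
proof -
 let ?u = "cl V - v" and ?e1 = "%j. pd j E1"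
 have U: "b_inf (%x. V x + E1 x)" by (intro b_inf_add E1 h_inf_b_inf[OF V dim])
 have sV: "sqi V" using h_inf_sqi[OF V, of "[]"] by simp
 have spV: "sqi (pd j V)" for j using h_inf_sqi[OF V, of "[j]"] by simp
 have HV: "Hs 1 (cl V)" by (rule Hs_h_inf[OF V])
 have Hu: "Hs 1 ?u" by (rule Hs_diff[OF HV v(1)])
 have dvu: "dv [j] ?u = dv [j] (cl V) - dv [j] v" for j by (rule dv_diff[OF HV v(1)]) simp
 obtain BV where BV: "BV >= 0" "!!x. norm (V x) <= BV" using b_inf_bounded[OF h_inf_b_inf[OF V dim]] by blast
 \<comment> \<open>Only for square-integrability of the terms that are split off; the final bound
   contains \<open>b\<close>, \<eta> and \<open>N\<close>.\<close>
 define B' where "B' = max (max b (max B BV)) 0"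
 have B': "B' >= 0" "b <= B'" "B <= B'" "BV <= B'" by (auto simp: B'_def)
 have E1m: "bmeas E1" by (rule smooth_measurable[OF b_inf_smooth[OF E1]])
 have e1m: "bmeas (pd j E1)" for j by (rule smooth_measurable[OF smooth_pd[OF b_inf_smooth[OF E1]]])
 let ?f1 = "FFf E1 ?e1 (rp (cl V)) (%j. rp (dv [j] (cl V)))" and ?f2 = "FFf E2 e2 (rp v) (%j. rp (dv [j] v))"
 have s1: "sqi ?f1"
 proof (rule FFf_sqi[where b=B', OF E1m _ e1m _ B'(1) sqi_rp sqi_rp], goal_cases)
  case 1 show ?case using order_trans[OF E1b B'(3)] by simp
  case (2 j) show ?case using order_trans[OF L(2) B'(2)] by simp
  case 3 show ?case using rp_cl[OF sV] order_trans[OF BV(2) B'(4)] by (auto elim: eventually_mono)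
 qed
 have s2: "sqi ?f2"
 proof (rule FFf_sqi[where b=B', OF E2(1) _ e2(1) _ B'(1) sqi_rp sqi_rp], goal_cases)
  case 1 show ?case using E2(2) by eventually_elim (use B' in auto)
  case (2 j) show ?case using e2(2)[of j] by eventually_elim (use B' in auto)
  case 3
  have "AE x in lborel. norm (rp (dv [j] v) x) <= B'" for j
   using v(2)[of j] by eventually_elim (use B' in auto)
  thus ?case by blast
 qed
 let ?R = "%x. \<Sum>j\<in>UNIV. (S j (rp (cl V) x - rp v x) (rp (dv [j] v) x) + S j (E1 x - E2 x) (rp (dv [j] v) x)) +
   (S j (rp (cl V) x - rp v x) (pd j E1 x) + S j (rp v x) (pd j E1 x - e2 j x))"
 have R: "L2b ?R (real CARD('n) * (2 * KS * b * norm (cl (%x. rp (cl V) x - rp v x)) + 2 * KS * \<eta> * N))"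
  by (rule FFf_rest_L2b[OF E1m E2(1) EE e1m _ e2(1) ee b sqi_rp sqi_rp sqi_rp v(2)]) (use N L(2) in auto)
 let ?T = "%x. \<Sum>j\<in>UNIV. S j (V x + E1 x) (rp (dv [j] ?u) x)"
 have UB: "AE x in lborel. norm (V x + E1 x) <= 2 * B'"
 proof (rule AE_I2)
  fix x show "norm (V x + E1 x) <= 2 * B'"
   using norm_triangle_ineq[of "V x" "E1 x"] BV(2)[of x] E1b[of x] B' by linarith
 qed
 have Um: "bmeas (%x. V x + E1 x)" by (rule smooth_measurable[OF b_inf_smooth[OF U]])
 have sT: "sqi ?T" using S_AE(1)[OF Um UB _ sqi_rp] B'(1) by (intro sqi_sum) (auto simp: L2b_def)
 let ?G = "%x. G (rp ?u x)"
 have sG: "sqi ?G" using G_L2b[of "rp ?u"] by (simp add: L2b_def)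
 have aeT: "AE x in lborel. ALL j. rp (dv [j] ?u) x = rp (dv [j] (cl V)) x - rp (dv [j] v) x"
  unfolding dvu by (intro eventually_all_finite rp_diff)
 have eq: "AE x in lborel. ?f1 x - ?f2 x = ?T x + ?R x + ?G x"
  using aeT rp_diff[of "cl V" v] rp_cl[OF sV]
 proof eventually_elim
  case (elim x)
  show ?case unfolding FFf_diff_eq elim(2) elim(3) elim(1)[rule_format] by (rule refl)
 qed
 have "FF E1 ?e1 (cl V) - FF E2 e2 v = cl (%x. ?T x + ?R x + ?G x)"
  unfolding FF_def cl_diff[OF s1 s2, symmetric] using eq s1 s2 sT R sG
  by (intro cl_cong sqi_diff sqi_add) (auto simp: L2b_def)
 also have "... = cl ?T + cl ?R + cl ?G"
  using sT R sG by (subst cl_add[OF sqi_add], simp_all only: cl_add L2b_def)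
 finally have "?u \<bullet> (FF E1 ?e1 (cl V) - FF E2 e2 v) = ?u \<bullet> cl ?T + ?u \<bullet> cl ?R + ?u \<bullet> cl ?G"
  by (simp only: inner_add_right)
 moreover have "?u \<bullet> cl ?G = 0"
  using inner_cl[OF sqi_rp sG, of ?u] by (simp add: G_skew)
 moreover have "\<bar>?u \<bullet> cl ?T\<bar> <= real CARD('n) * (KS * b) * (norm ?u)^2"
  by (rule weak_skew_pairing[OF U L(1) Hu])
 moreover have "\<bar>?u \<bullet> cl ?R\<bar> <= norm ?u * (real CARD('n) * (2 * KS * b * norm ?u + 2 * KS * \<eta> * N))"
  by (rule order_trans[OF Cauchy_Schwarz_ineq2 mult_left_mono]) (use R in "auto simp: L2b_def rp_diff_cl")
 moreover have "real CARD('n) * (KS * b) * (norm ?u)^2 + norm ?u * (real CARD('n) * (2 * KS * b * norm ?u + 2 * KS * \<eta> * N))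
  = real CARD('n) * (3 * KS * b) * (norm ?u)^2 + real CARD('n) * (2 * KS * \<eta> * N) * norm ?u"
  by (simp add: algebra_simps power2_eq_square)
 ultimately show ?thesis by linarith
qed

end

section \<open>Approximate solutions\<close>

lemma cv_AE: assumes "kernel k" shows "AE x in lborel. norm (rp (cv k u) x) <= norm (cl k) * norm u"
 using rp_cl[OF conv_l2(1)[OF assms sqi_rp[of u]]] unfolding cv_def
 by eventually_elim (use conv_sup[OF assms sqi_rp[of u]] in simp)

lemma wd_zero: "wd is 0 0"
 by (simp add: wd_def linear_0[OF linear_cv[OF kernel_D_moll]] linear_0[OF linear_cv[OF moll_kernel]])

lemma dv_zero [simp]: "dv is 0 = 0"
 by (rule dv_eqI[OF wd_zero])

lemma J_cv_commute:
 assumes e: "ep > 0" shows "J ep (cv (D is (moll ep)) u) = cv (D is (moll ep)) (J ep u)"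
proof -
 have h: "h_inf (Jf ep u)" by (rule h_inf_Jf[OF e])
 have "cv (D is (moll ep)) (J ep u) = cl (conv (D is (moll ep)) (Jf ep u))"
  using h_inf_sqi[OF h, of "[]"] by (simp add: J_eq_Jf cv_cl kernel_D_moll[OF e])
 also have "... = cl (conv (moll ep) (D is (Jf ep u)))" by (simp add: conv_D[OF moll_test[OF e] h])
 also have "... = J ep (cl (D is (Jf ep u)))" by (simp add: cv_cl moll_kernel[OF e] h_inf_sqi[OF h])
 finally show ?thesis by (simp add: cl_D_Jf[OF e])
qed

text \<open>Radial retraction onto the ball of radius \<open>R\<close>. Composed with it, the
  quadratic field of the approximate equation becomes globally Lipschitz.\<close>

definition retr :: "real => 'h::real_normed_vector => 'h" where
 "retr R z = (R / max R (norm z)) *\<^sub>R z"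

lemma retr_norm: "R > 0 ==> norm (retr R z) <= R"
 by (auto simp: retr_def max_def field_simps)

lemma retr_id: "R > 0 ==> norm z <= R ==> retr R z = z"
 by (simp add: retr_def max_def)

lemma retr_lipschitz: assumes R: "R > 0" shows "norm (retr R x - retr R y) <= 2 * norm (x - y)"
proof -
 define a b where "a = max R (norm x)" and "b = max R (norm y)"
 have ab: "R <= a" "R <= b" "norm x <= a" "norm y <= b" "a > 0" "b > 0" using R by (auto simp: a_def b_def)
 have d: "\<bar>b - a\<bar> <= norm (x - y)" unfolding a_def b_def using norm_triangle_ineq3[of x y] by auto
 have "retr R x - retr R y = (R / a) *\<^sub>R (x - y) + (R / a - R / b) *\<^sub>R y"
  by (simp add: retr_def a_def b_def algebra_simps)
 also have "norm ... <= (R / a) * norm (x - y) + \<bar>R / a - R / b\<bar> * norm y"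
  using R ab by (intro order_trans[OF norm_triangle_ineq]) simp
 also have "(R / a) * norm (x - y) <= 1 * norm (x - y)"
  using R ab by (intro mult_right_mono) auto
 also have "\<bar>R / a - R / b\<bar> * norm y = (R / a) * (norm y / b) * \<bar>b - a\<bar>"
  using R ab by (simp add: divide_simps abs_mult) (simp add: abs_if algebra_simps)
 also have "... <= 1 * 1 * \<bar>b - a\<bar>"
  using R ab by (intro mult_mono) auto
 finally show ?thesis using d by simp
qed

lemma has_vector_derivative_weak:
 fixes V :: "real => 'h::real_inner"
 assumes "!!t. t \<in> {0..T} ==> (V has_vector_derivative f t) (at t within {0..T})"
 shows "weak_deriv_on T V f \<psi>"
 unfolding weak_deriv_on_def has_real_derivative_iff_has_vector_derivative
 using bounded_linear.has_vector_derivative[OF bounded_linear_inner_left assms] by blast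

context sym_system
begin

lemma FF_zero:
 assumes m: "bmeas E" "!!j. bmeas (e j)"
 shows "FF E e 0 = 0"
proof -
 have z: "AE x in lborel. rp (0 :: (real^'n, 'b) l2) x = 0" by (rule rp_zero)
 have eq: "AE x in lborel. FFf E e (rp 0) (%j. rp (dv [j] 0)) x = 0"
  using z by eventually_elim
   (simp add: FFf_def bounded_bilinear.zero_left[OF S_bil] bounded_bilinear.zero_right[OF S_bil]
    linear_0[OF bounded_linear.linear[OF G_lin]])
 have meas: "bmeas (FFf E e (rp 0) (%j. rp (dv [j] 0)))"
  by (rule FFf_meas[OF m]) auto
 have eq': "AE x in lborel. 0 = FFf E e (rp 0) (%j. rp (dv [j] 0)) x" using eq by eventually_elim simp
 have s: "sqi (FFf E e (rp 0) (%j. rp (dv [j] 0)))"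
  by (rule sqi_cong_AE[OF sqi_zero meas eq'])
 have "FF E e 0 = cl (%x. 0)" unfolding FF_def by (rule cl_cong[OF s sqi_zero eq])
 thus ?thesis by (simp add: cl_zero)
qed

lemma FF_norm:
 assumes E: "bmeas E" "AE x in lborel. norm (E x) <= b"
  and e: "!!j. bmeas (e j)" "!!j. AE x in lborel. norm (e j x) <= b"
  and b: "b >= 0" and v: "AE x in lborel. norm (rp v x) <= b"
 shows "norm (FF E e v) <= KS * (2 * b) * (\<Sum>j\<in>UNIV. norm (dv [j] v)) + (real CARD('n) * (2 * KS * b * norm v) + KG * norm v)"
proof -
 have z: "AE x in lborel. norm (rp (dv [j] (0 :: (real^'n, 'b) l2)) x) <= b" for j
 proof -
  have "AE x in lborel. rp (0 :: (real^'n, 'b) l2) x = 0" by (rule rp_zero)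
  thus ?thesis by eventually_elim (simp add: b)
 qed
 have "norm (FF E e v - FF E e 0) <= KS * (2 * b) * (\<Sum>j\<in>UNIV. norm (dv [j] v - dv [j] 0))
  + (real CARD('n) * (2 * KS * b * norm (v - 0) + 2 * KS * 0 * 0) + KG * norm (v - 0))"
  by (rule FF_diff[OF E E _ e e _ b _ v z]) auto
 thus ?thesis by (simp add: FF_zero[OF E(1) e(1)])
qed

text \<open>
 While the squared \<open>H\<^sup>m\<close> norm is at most \<open>R\<^sup>2 + 1\<close> it grows at rate at most \<open>growth\<close>; hence, started below \<open>R\<^sup>2\<close>,
 it stays below \<open>R\<^sup>2 + 1\<close> up to time \<open>life\<close>. Neither constant involves \<open>G\<close> or a bound of \<open>E\<close> itself.
\<close>

definition growth :: "nat => real => real => real" where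
 "growth m M R = 2 * (Cen m * (M + sqrt (R^2 + 1)) * (R^2 + 1))"

definition life :: "nat => real => real => real" where
 "life m M R = 1 / (2 * (growth m M R + 1))"

lemma growth_nonneg: "M >= 0 ==> growth m M R >= 0"
 unfolding growth_def by (intro mult_nonneg_nonneg add_nonneg_nonneg Cen_nonneg) auto

lemma life_pos: "M >= 0 ==> life m M R > 0"
 using growth_nonneg[of M m R] by (simp add: life_def)

lemma growth_life: assumes "M >= 0" shows "growth m M R * life m M R < 1"
 using growth_nonneg[OF assms, of m R] by (simp add: life_def field_simps)

text \<open>One mollifier moves across the pairing by symmetry, so l times the sum is the energy
  pairing of W = J J w with F(E, W). The bound of that pairing is at least quadratic in norms that
  are at most l times that of \<open>J ep u\<close>, and l <= 1, so the factor l can be divided out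
  again.\<close>

lemma mollified_energy:
 assumes m: "m >= 3" and E: "b_inf E" and M: "!!is x. 1 <= length is ==> length is <= m + 1 ==> norm (D is E x) <= M"
  and e: "ep > 0" and l: "0 < l" "l <= 1" and w: "w = l *\<^sub>R u"
 shows "\<bar>\<Sum>is\<in>lists_le m. cv (D is (moll ep)) u \<bullet> cv (D is (moll ep)) (FF E (%j. pd j E) (J ep (J ep w)))\<bar>
  <= Cen m * (M + Nm m (J ep u)) * (Nm m (J ep u))^2"
  and "Nm m (J ep (J ep w)) <= l * Nm m (J ep u)"
proof -
 have M0: "M >= 0"
  using M[of "[undefined]" 0] m norm_ge_zero[of "D [undefined] E 0"] by (simp del: norm_ge_zero)
 define W where "W = Jf ep (J ep w)"
 have h: "h_inf W" unfolding W_def by (rule h_inf_Jf[OF e])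
 have JW: "J ep (J ep w) = cl W" by (simp only: W_def J_eq_Jf[of ep "J ep w"])
 have F: "FF E (%j. pd j E) (J ep (J ep w)) = cl (Ffun E W)" unfolding JW by (rule FF_h_inf[OF E h])
 have hF: "h_inf (Ffun E W)" by (rule h_inf_Ffun[OF E h])
 have cF: "cv (D is (moll ep)) (cl (Ffun E W)) = J ep (cl (D is (Ffun E W)))" for "is"
  using h_inf_sqi[OF hF, of "[]"] by (simp add: cv_cl kernel_D_moll[OF e] moll_kernel[OF e] conv_D[OF moll_test[OF e] hF] h_inf_sqi[OF hF])
 have cW: "l *\<^sub>R J ep (cv (D is (moll ep)) u) = cl (D is W)" for "is"
 proof -
  have "cl (D is W) = J ep (cv (D is (moll ep)) w)"
   by (simp add: W_def cl_D_Jf[OF e] J_cv_commute[OF e])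
  thus ?thesis
   by (simp add: w linear_cmul[OF linear_cv[OF kernel_D_moll[OF e]]] linear_cmul[OF linear_cv[OF moll_kernel[OF e]]])
 qed
 let ?N = "Nm m (J ep u)"
 have NW: "hn m W <= l * ?N"
 proof -
  have "hn m W = Nm m (J ep (J ep w))" by (simp add: JW Nm_h_inf[OF h])
  also have "... <= Nm m (J ep w)" by (rule Nm_J_le[OF e Hs_J[OF e]])
  also have "... = l * ?N"
   unfolding Nm_def dv_J[OF e] w
   using l by (simp add: linear_cmul[OF linear_cv[OF kernel_D_moll[OF e]]] power_mult_distrib sum_distrib_left[symmetric] real_sqrt_mult)
  finally show ?thesis .
 qed
 thus "Nm m (J ep (J ep w)) <= l * Nm m (J ep u)" by (simp add: JW Nm_h_inf[OF h])
 let ?X = "\<Sum>is\<in>lists_le m. cv (D is (moll ep)) u \<bullet> cv (D is (moll ep)) (FF E (%j. pd j E) (J ep (J ep w)))"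
 have "l * ?X = (\<Sum>is\<in>lists_le m. cl (D is W) \<bullet> cl (D is (Ffun E W)))"
  unfolding sum_distrib_left F cF cW[symmetric] by (simp add: J_inner[OF e])
 hence "l * \<bar>?X\<bar> = \<bar>\<Sum>is\<in>lists_le m. cl (D is W) \<bullet> cl (D is (Ffun E W))\<bar>"
 proof -
  have "l * \<bar>?X\<bar> = \<bar>l * ?X\<bar>" using l(1) by (simp only: abs_mult abs_of_pos)
  thus ?thesis using \<open>l * ?X = _\<close> by (simp only:)
 qed
 also have "... <= Cen m * (M + hn m W) * (hn m W)^2" by (rule energy_estimate[OF m E M h])
 also have "... <= Cen m * (M + ?N) * (l * ?N^2)"
 proof (rule mult_mono)
  have "l * ?N <= 1 * ?N" using l by (intro mult_right_mono) auto
  hence "hn m W <= ?N" using NW by simp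
  thus "Cen m * (M + hn m W) <= Cen m * (M + ?N)" by (intro mult_left_mono Cen_nonneg) simp
  have "(hn m W)^2 <= (l * ?N)^2" using NW by (intro power_mono) auto
  also have "... = l * (l * ?N^2)" by (simp add: power2_eq_square)
  also have "... <= 1 * (l * ?N^2)" using l by (intro mult_right_mono) auto
  finally show "(hn m W)^2 <= l * ?N^2" by simp
  show "0 <= Cen m * (M + ?N)" using M0 by (intro mult_nonneg_nonneg Cen_nonneg) auto
 qed simp
 finally have "l * \<bar>?X\<bar> <= l * (Cen m * (M + ?N) * ?N^2)" by (simp add: mult_ac)
 thus "\<bar>?X\<bar> <= Cen m * (M + ?N) * ?N^2" using l by (simp only: mult_le_cancel_left_pos)
qed

text \<open>Mollified first derivatives are bounded operators on L^2, so the retracted field is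
  Lipschitz and Picard iteration applies. The Lipschitz constant depends on \<open>ep\<close>; the
  bounds that survive the limit come from the energy estimate.\<close>

lemma approx_exists:
 fixes E :: "real => real^'n => 'b"
 assumes m: "m >= 3" and E: "!!t. b_inf (E t)"
  and M: "!!t is x. 1 <= length is ==> length is <= m + 1 ==> norm (D is (E t) x) <= M"
  and B: "!!t x. norm (E t x) <= B"
  and cont: "!!t r. r > 0 ==> EX d>0. ALL s. \<bar>s - t\<bar> < d --> (ALL x. norm (E s x - E t x) <= r & (ALL j. norm (pd j (E s) x - pd j (E t) x) <= r))"
  and v0: "Hs m v0" "Nm m v0 <= R" and e: "ep > 0" and T: "T = life m M R"
 shows "EX z. z 0 = v0 & (\<forall>t\<in>{0..T}. (z has_vector_derivative - FF (E t) (%j. pd j (E t)) (J ep (J ep (z t)))) (at t within {0..T})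
   & (Nm m (J ep (z t)))^2 <= (Nm m v0)^2 + growth m M R * t)"
proof -
 have M0: "M >= 0"
  using M[of "[undefined]" 0 0] m norm_ge_zero[of "D [undefined] (E 0) 0"] by (simp del: norm_ge_zero)
 have B0: "B >= 0" using B[of 0 0] norm_ge_zero order_trans by blast
 have T0: "T > 0" unfolding T by (rule life_pos[OF M0])
 let ?e = "%t j. pd j (E t)"
 define b where "b = R^2 + 1"
 have b1: "b >= 1" by (simp add: b_def)
 have Em: "bmeas (E t)" "bmeas (?e t j)" for t j
  by (intro smooth_measurable smooth_pd b_inf_smooth E)+
 have eM: "norm (?e t j x) <= M" for t j x using M[of "[j]" t x] by simp
 let ?sob = "sob_const TYPE('n)"
 have sob1: "?sob >= 1" by (rule sob_const_ge)
 define bb where "bb = max (max B M) (?sob * sqrt b)"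
 have bb: "B <= bb" "M <= bb" "?sob * sqrt b <= bb" "bb >= 0" using B0 by (auto simp: bb_def)
 \<comment> \<open>Bounds the field wherever the squared H^m norm is at most \<open>b\<close>. It
   does not involve the retraction radius, which can therefore be chosen afterwards.\<close>
 define K where "K = KS * (2 * bb) * (real CARD('n) * sqrt b) + (real CARD('n) * (2 * KS * bb * sqrt b) + KG * sqrt b)"
 have K0: "K >= 0" unfolding K_def using KS(1) KG(1) bb b1 by (intro add_nonneg_nonneg mult_nonneg_nonneg) auto
 have FK: "norm (FF (E t) (?e t) v) <= K" if v: "Hs m v" "Nm m v <= sqrt b" for t v
 proof -
  have "AE x in lborel. norm (rp (dv [] v) x) <= ?sob * Nm m v" by (rule Hs_sup[OF v(1) _ dim]) (use m in simp)
  hence vb: "AE x in lborel. norm (rp v x) <= bb"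
   using v(2) sob1 order_trans[OF mult_left_mono[OF v(2), of ?sob] bb(3)] by (auto elim!: eventually_mono)
  have "norm (FF (E t) (?e t) v) <= KS * (2 * bb) * (\<Sum>j\<in>UNIV. norm (dv [j] v)) + (real CARD('n) * (2 * KS * bb * norm v) + KG * norm v)"
   by (rule FF_norm[OF Em(1) _ Em(2) _ bb(4) vb]) (use order_trans[OF B bb(1)] order_trans[OF eM bb(2)] in auto)
  also have "... <= K"
  proof -
   have "norm (dv [j] v) <= sqrt b" for j using order_trans[OF norm_le_Nm[of "[j]" m v] v(2)] m by simp
   hence "(\<Sum>j\<in>UNIV. norm (dv [j] v)) <= real CARD('n) * sqrt b"
    using sum_mono[of UNIV "%j. norm (dv [j] v)" "%_. sqrt b"] by simp
   moreover have "norm v <= sqrt b" using norm_le_Nm0 v(2) order_trans by blast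
   ultimately show ?thesis unfolding K_def
    using KS(1) KG(1) bb(4) by (intro add_mono mult_left_mono) auto
  qed
  finally show ?thesis .
 qed
 \<comment> \<open>In time \<open>T\<close> the solution moves at most K T away from
   \<open>v0\<close>, so it stays inside this ball and the retraction is inactive along it.\<close>
 define Rz where "Rz = norm v0 + K * T + 1"
 have Rz: "Rz > 0" using K0 T0 by (auto simp: Rz_def intro!: add_nonneg_pos)
 define f where "f t x = - FF (E t) (?e t) (J ep (J ep (retr Rz x)))" for t x
 have k: "kernel (moll ep :: real^'n => real)" "kernel (D is (moll ep) :: real^'n => real)" for "is"
  by (rule moll_kernel[OF e]) (rule kernel_D_moll[OF e])
 define c0 where "c0 = norm (cl (moll ep :: real^'n => real))"
 define c1 where "c1 j = norm (cl (D [j] (moll ep) :: real^'n => real))" for j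
 define c2 where "c2 j = (LINT y|lborel. \<bar>D [j] (moll ep) (y :: real^'n)\<bar>)" for j
 define b2 where "b2 = max (max B M) ((c0 + (\<Sum>j\<in>UNIV. c1 j)) * Rz)"
 have c1le: "c1 j <= c0 + (\<Sum>j\<in>UNIV. c1 j)" "c0 <= c0 + (\<Sum>j\<in>UNIV. c1 j)" for j
  using member_le_sum[of j UNIV c1] by (auto simp: c1_def c0_def intro!: sum_nonneg add_increasing)
 have b2: "B <= b2" "M <= b2" "b2 >= 0" "c0 * Rz <= b2" "c1 j * Rz <= b2" for j
  using B0 Rz by (auto simp: b2_def intro!: max.coboundedI2 mult_right_mono c1le)
 have vb: "AE x in lborel. norm (rp (J ep (J ep (retr Rz z))) x) <= b2"
  "AE x in lborel. norm (rp (dv [j] (J ep (J ep (retr Rz z)))) x) <= b2" for z :: "(real^'n,'b) l2" and j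
 proof -
  have r: "norm (J ep (retr Rz z)) <= Rz" using order_trans[OF J_norm[OF e] retr_norm[OF Rz]] .
  show "AE x in lborel. norm (rp (J ep (J ep (retr Rz z))) x) <= b2"
   using cv_AE[OF k(1), of "J ep (retr Rz z)"] order_trans[OF mult_left_mono[OF r, of c0] b2(4)]
   by (auto elim!: eventually_mono simp: c0_def)
  show "AE x in lborel. norm (rp (dv [j] (J ep (J ep (retr Rz z)))) x) <= b2"
   using cv_AE[OF k(2), of "[j]" "J ep (retr Rz z)"] order_trans[OF mult_left_mono[OF r, of "c1 j"] b2(5)]
   unfolding dv_J[OF e] by (auto elim!: eventually_mono simp: c1_def)
 qed
 define L where "L = 2 * (KS * (2 * b2) * (\<Sum>j\<in>UNIV. c2 j) + (real CARD('n) * (2 * KS * b2) + KG))"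
 have lip: "norm (f t x - f t y) <= L * norm (x - y)" for t x y
 proof -
  let ?x = "retr Rz x" and ?y = "retr Rz y"
  let ?Ny = "(\<Sum>j\<in>UNIV. norm (dv [j] (J ep (J ep ?y)))) + norm (J ep (J ep ?y))"
  have lin: "J ep (J ep ?x) - J ep (J ep ?y) = J ep (J ep (?x - ?y))"
   by (simp add: linear_diff[OF linear_cv[OF k(1)]])
  have d0: "norm (J ep (J ep ?x) - J ep (J ep ?y)) <= norm (?x - ?y)"
   unfolding lin by (rule order_trans[OF J_norm[OF e] J_norm[OF e]])
  have d1: "norm (dv [j] (J ep (J ep ?x)) - dv [j] (J ep (J ep ?y))) <= c2 j * norm (?x - ?y)" for j
  proof -
   have "dv [j] (J ep (J ep ?x)) - dv [j] (J ep (J ep ?y)) = cv (D [j] (moll ep)) (J ep (?x - ?y))"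
    unfolding dv_J[OF e] by (simp add: linear_diff[OF linear_cv[OF k(1)]] linear_diff[OF linear_cv[OF k(2)[of "[j]"], simplified]])
   also have "norm ... <= c2 j * norm (J ep (?x - ?y))" unfolding c2_def by (rule cv_norm[OF k(2)])
   also have "... <= c2 j * norm (?x - ?y)" by (intro mult_left_mono J_norm[OF e]) (simp add: c2_def)
   finally show ?thesis .
  qed
  have "norm (FF (E t) (?e t) (J ep (J ep ?x)) - FF (E t) (?e t) (J ep (J ep ?y))) <=
   KS * (2 * b2) * (\<Sum>j\<in>UNIV. norm (dv [j] (J ep (J ep ?x)) - dv [j] (J ep (J ep ?y))))
   + (real CARD('n) * (2 * KS * b2 * norm (J ep (J ep ?x) - J ep (J ep ?y)) + 2 * KS * 0 * ?Ny) + KG * norm (J ep (J ep ?x) - J ep (J ep ?y)))"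
  proof (rule FF_diff[OF Em(1) _ Em(1) _ _ Em(2) _ Em(2) _ _ b2(3) _ vb(1) vb(2)], goal_cases)
   case (8 j) show ?case by (rule add_increasing2, simp, rule member_le_sum) auto
  qed (use order_trans[OF B b2(1)] order_trans[OF eM b2(2)] in "auto intro: sum_nonneg")
  also have "... <= KS * (2 * b2) * ((\<Sum>j\<in>UNIV. c2 j) * norm (?x - ?y)) + (real CARD('n) * (2 * KS * b2 * norm (?x - ?y) + 2 * KS * 0 * ?Ny) + KG * norm (?x - ?y))"
   unfolding sum_distrib_right using KS(1) KG(1) b2(3)
   by (intro add_mono mult_left_mono sum_mono d0 d1) auto
  also have "... = (L / 2) * norm (?x - ?y)" by (simp add: L_def algebra_simps)
  also have "... <= (L / 2) * (2 * norm (x - y))"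
   using KS(1) KG(1) b2(3) unfolding L_def
   by (intro mult_left_mono retr_lipschitz[OF Rz]) (auto intro!: add_nonneg_nonneg mult_nonneg_nonneg sum_nonneg simp: c2_def)
  finally show ?thesis
   unfolding f_def by (simp add: norm_minus_commute)
 qed
 have fcont: "continuous_on {0..T} (%t. f t x)" for x
  unfolding continuous_on_iff
 proof (intro ballI allI impI)
  fix t q :: real assume q: "q > 0"
  let ?v = "J ep (J ep (retr Rz x))"
  define N where "N = (\<Sum>j\<in>UNIV. norm (dv [j] ?v)) + norm ?v"
  have N: "norm (dv [j] ?v) <= N" "norm ?v <= N" "N >= 0" for j
  proof -
   have "norm (dv [j] ?v) <= (\<Sum>j\<in>UNIV. norm (dv [j] ?v))" by (rule member_le_sum) auto
   thus "norm (dv [j] ?v) <= N" by (simp add: N_def add_increasing2)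
   show "norm ?v <= N" "N >= 0" by (auto simp: N_def intro!: sum_nonneg add_nonneg_nonneg)
  qed
  define c where "c = real CARD('n) * (2 * KS * N) + 1"
  have c: "c > 0" unfolding c_def using KS(1) KG(1) N(3) by (intro add_nonneg_pos mult_nonneg_nonneg) auto
  obtain d where d: "d > 0" "!!s. \<bar>s - t\<bar> < d ==> (ALL x. norm (E s x - E t x) <= q / (2 * c) & (ALL j. norm (pd j (E s) x - pd j (E t) x) <= q / (2 * c)))"
   using cont[of "q / (2 * c)" t] q c by auto
  show "EX d>0. \<forall>s\<in>{0..T}. dist s t < d --> dist (f s x) (f t x) < q"
  proof (intro exI conjI ballI impI)
   fix s assume "dist s t < d"
   hence st: "!!x. norm (E s x - E t x) <= q / (2 * c)" "!!x j. norm (pd j (E s) x - pd j (E t) x) <= q / (2 * c)"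
    using d(2)[of s] by (auto simp: dist_real_def)
   have "norm (FF (E s) (?e s) ?v - FF (E t) (?e t) ?v) <=
    KS * (2 * b2) * (\<Sum>j\<in>UNIV. norm (dv [j] ?v - dv [j] ?v))
    + (real CARD('n) * (2 * KS * b2 * norm (?v - ?v) + 2 * KS * (q / (2 * c)) * N) + KG * norm (?v - ?v))"
    by (rule FF_diff[OF Em(1) _ Em(1) _ _ Em(2) _ Em(2) _ _ b2(3) _ vb(1) vb(2) N(1,2)])
     (use order_trans[OF B b2(1)] order_trans[OF eM b2(2)] st q c in auto)
   also have "... = (c - 1) * (q / (2 * c))" by (simp add: c_def algebra_simps)
   also have "... <= c * (q / (2 * c))" using q c by (intro mult_right_mono) auto
   also have "... = q / 2" using c by simp
   also have "... < q" using q by simp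
   finally show "dist (f s x) (f t x) < q" unfolding f_def dist_norm by (simp add: norm_minus_commute)
  qed (rule d(1))
 qed
 obtain z where z: "z 0 = v0" "!!t. t \<in> {0..T} ==> (z has_vector_derivative f t (z t)) (at t within {0..T})"
  using picard_lindeloef_global[OF lip fcont, of v0] T0 by auto
 \<comment> \<open>The retraction multiplies by a factor in (0, 1], as
   \<open>mollified_energy\<close> requires; so the energy bound holds before the retraction is
   known to be inactive.\<close>
 define l where "l t = Rz / max Rz (norm (z t))" for t
 have l: "0 < l t" "l t <= 1" for t using Rz by (auto simp: l_def divide_simps)
 have rl: "retr Rz (z t) = l t *\<^sub>R z t" for t by (simp add: retr_def l_def)
 note en = mollified_energy[OF m E M e l rl]
 define y where "y t = (Nm m (J ep (z t)))^2" for t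
 define y' where "y' t = (\<Sum>is\<in>lists_le m. 2 * (cv (D is (moll ep)) (z t) \<bullet> cv (D is (moll ep)) (f t (z t))))" for t
 have yd: "(y has_real_derivative y' t) (at t within {0..T})" if t: "t \<in> {0..T}" for t
 proof -
  have "((%t. cv (D is (moll ep)) (z t) \<bullet> cv (D is (moll ep)) (z t)) has_real_derivative
   2 * (cv (D is (moll ep)) (z t) \<bullet> cv (D is (moll ep)) (f t (z t)))) (at t within {0..T})" for "is"
  proof -
   have "((%t. cv (D is (moll ep)) (z t)) has_vector_derivative cv (D is (moll ep)) (f t (z t))) (at t within {0..T})"
    by (rule bounded_linear.has_vector_derivative[OF bounded_linear_cv[OF k(2)] z(2)[OF t]])
   from bounded_bilinear.has_vector_derivative[OF bounded_bilinear_inner this this]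
   show ?thesis by (simp add: has_real_derivative_iff_has_vector_derivative inner_commute)
  qed
  hence "((%t. \<Sum>is\<in>lists_le m. cv (D is (moll ep)) (z t) \<bullet> cv (D is (moll ep)) (z t)) has_real_derivative y' t) (at t within {0..T})"
   unfolding y'_def by (intro DERIV_sum)
  moreover have "y = (%t. \<Sum>is\<in>lists_le m. cv (D is (moll ep)) (z t) \<bullet> cv (D is (moll ep)) (z t))"
   by (rule ext) (simp only: y_def Nm_sq dv_J[OF e] power2_norm_eq_inner)
  ultimately show ?thesis by simp
 qed
 have y'le: "y' t <= growth m M R" if "y t <= b" for t
 proof -
  let ?N = "Nm m (J ep (z t))"
  have N: "?N^2 <= b" "?N <= sqrt b" using that by (auto simp: y_def intro: real_le_rsqrt)
  have "y' t = - (2 * (\<Sum>is\<in>lists_le m. cv (D is (moll ep)) (z t) \<bullet> cv (D is (moll ep)) (FF (E t) (?e t) (J ep (J ep (retr Rz (z t)))))))"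
   unfolding y'_def f_def by (simp add: linear_neg[OF linear_cv[OF k(2)]] sum_distrib_left sum_negf)
  also have "... <= 2 * (Cen m * (M + ?N) * ?N^2)"    proof -
   have "\<bar>\<Sum>is\<in>lists_le m. cv (D is (moll ep)) (z t) \<bullet> cv (D is (moll ep)) (FF (E t) (?e t) (J ep (J ep (retr Rz (z t)))))\<bar>
    <= Cen m * (M + ?N) * ?N^2" by (rule en(1))
   thus ?thesis by (simp add: abs_le_iff mult.assoc)
  qed
  also have "... <= growth m M R" unfolding growth_def b_def[symmetric]
   using N M0 Cen_nonneg[of m] b1 by (intro mult_left_mono mult_mono mult_nonneg_nonneg) auto
  finally show ?thesis .
 qed
 have y0: "y 0 <= (Nm m v0)^2" unfolding y_def z(1) by (intro power_mono Nm_J_le[OF e v0(1)]) auto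
 have v0R: "(Nm m v0)^2 <= R^2" using v0(2) by (intro power_mono) auto
 have gl: "growth m M R * T < 1" unfolding T by (rule growth_life[OF M0])
 have g0: "growth m M R >= 0" by (rule growth_nonneg[OF M0])
 have yb: "y t <= y 0 + growth m M R * t" if t: "t \<in> {0..T}" for t
  by (rule riccati_bound[where y'=y' and b=b, OF yd]) (use y'le g0 t y0 v0R gl in "auto simp: b_def")
 have yle: "y t <= b" if t: "t \<in> {0..T}" for t
 proof -
  have "growth m M R * t <= growth m M R * T" using t g0 by (intro mult_left_mono) auto
  thus ?thesis using yb[OF t] y0 v0R gl by (simp add: b_def)
 qed
 have fK: "norm (f t (z t)) <= K" if t: "t \<in> {0..T}" for t
 proof -
  have "Nm m (J ep (z t)) <= sqrt b" using yle[OF t] by (auto simp: y_def intro: real_le_rsqrt)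
  moreover have "l t * Nm m (J ep (z t)) <= 1 * Nm m (J ep (z t))" using l by (intro mult_right_mono) auto
  ultimately have "Nm m (J ep (J ep (retr Rz (z t)))) <= sqrt b" using en(2)[of t] by simp
  from FK[OF Hs_J[OF e] this, of t] show ?thesis by (simp add: f_def)
 qed
 have zb: "norm (z t) <= Rz" if t: "t \<in> {0..T}" for t
 proof -
  have "norm (z t - z 0) <= K * \<bar>t - 0\<bar>"
  proof (rule weak_deriv_lipschitz[where D=UNIV])
   show "weak_deriv_on T z (%t. f t (z t)) d" for d by (rule has_vector_derivative_weak[OF z(2)])
   show "\<exists>d\<in>UNIV. norm (x - d) < e" if "e > 0" for x :: "(real^'n, 'b) l2" and e
    using that by (intro bexI[of _ x]) auto
  qed (use fK t T0 in auto)
  also have "... <= K * T" using t K0 by (intro mult_left_mono) auto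
  finally show ?thesis using norm_triangle_sub[of "z t" v0] by (simp add: z(1) Rz_def)
 qed
 show ?thesis
 proof (intro exI conjI ballI)
  show "z 0 = v0" by (rule z(1))
  fix t assume t: "t \<in> {0..T}"
  show "(z has_vector_derivative - FF (E t) (?e t) (J ep (J ep (z t)))) (at t within {0..T})"
   using z(2)[OF t] by (simp add: f_def retr_id[OF Rz zb[OF t]])
  show "(Nm m (J ep (z t)))^2 <= (Nm m v0)^2 + growth m M R * t"
   using order_trans[OF yb[OF t] add_right_mono[OF y0]] by (simp only: y_def)
 qed
qed

text \<open>v = J z solves the exact equation up to F(v) - J F(J v), split into F(v) - F(J v) and
  F(J v) - J F(J v). Each part uses one derivative beyond those in F to gain a factor
  \<open>ep\<close>, so second derivatives of the states are enough, and m >= 3 bounds everything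
  uniformly in \<open>ep\<close>.\<close>

lemma residual_bound:
 assumes m: "m >= 3" and s: "s >= 0" and M0: "M >= 0" and B0: "B >= 0"
 shows "\<exists>Kr\<ge>0. ALL E ep u. b_inf E --> (ALL is x. 1 <= length is --> length is <= m + 1 --> norm (D is E x) <= M) -->
  (ALL x. norm (E x) <= B) --> ep > 0 --> Nm m (J ep u) <= s -->
  norm (FF E (%j. pd j E) (J ep u) - J ep (FF E (%j. pd j E) (J ep (J ep u)))) <= Kr * ep"
proof -
 let ?sob = "sob_const TYPE('n)" and ?n = "real CARD('n)"
 have sob1: "?sob >= 1" by (rule sob_const_ge)
 define bb where "bb = max (max B M) (?sob * s)"
 have bb: "B <= bb" "M <= bb" "?sob * s <= bb" "bb >= 0" using B0 by (auto simp: bb_def)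
 define K1 where "K1 = KS * (2 * bb) * (?n * (?n * s)) + (?n * (2 * KS * bb * (?n * s)) + KG * (?n * s))"
 define K2 where "K2 = ?n * (?n * (3 * 2 ^ m * (Kc * (M + s) * s)) + ?n * (KS * (2 * bb) * s) + KG * s)"
 have K0: "K1 >= 0" "K2 >= 0" unfolding K1_def K2_def using KS(1) KG(1) Kc_ge(1) bb(4) s M0
  by (auto intro!: add_nonneg_nonneg mult_nonneg_nonneg)
 have "norm (FF E (%j. pd j E) (J ep u) - J ep (FF E (%j. pd j E) (J ep (J ep u)))) <= (K1 + K2) * ep"
  if E: "b_inf E" and M: "ALL is x. 1 <= length is --> length is <= m + 1 --> norm (D is E x) <= M"
   and B: "ALL x. norm (E x) <= B" and e: "ep > 0" and N: "Nm m (J ep u) <= s" for E ep u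
 proof -
  let ?e = "%j. pd j E"
  define v where "v = J ep u"
  have Em: "bmeas E" "bmeas (?e j)" for j
   by (intro smooth_measurable smooth_pd b_inf_smooth E)+
  have Hv: "Hs k v" for k unfolding v_def by (rule Hs_J[OF e])
  have Nv: "Nm m v <= s" using N by (simp add: v_def)
  have HJv: "Hs k (J ep v)" for k by (rule Hs_J[OF e])
  have NJv: "Nm m (J ep v) <= s" using order_trans[OF Nm_J_le[OF e Hv] Nv] .
  have AEb: "AE x in lborel. norm (rp (dv a w) x) <= bb" if "Hs m w" "Nm m w <= s" "length a <= 1" for w :: "(real^'n, 'b) l2" and a
  proof -
   have le: "?sob * Nm m w <= bb" using order_trans[OF mult_left_mono[OF that(2), of ?sob] bb(3)] sob1 by simp
   have "AE x in lborel. norm (rp (dv a w) x) <= ?sob * Nm m w" by (rule Hs_sup[OF that(1) _ dim]) (use that(3) m in simp)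
   thus ?thesis using le by (auto elim!: eventually_mono)
  qed
  have h: "h_inf (Jf ep u)" by (rule h_inf_Jf[OF e])
  have v_cl: "v = cl (Jf ep u)" by (simp add: v_def J_eq_Jf)
  have rate: "norm (dv a v - J ep (dv a v)) <= ep * (?n * s)" if "length a <= 1" for a
  proof -
   have da: "dv a v = cl (D a (Jf ep u))" by (simp add: v_cl dv_h_inf[OF h])
   have H1: "Hs 1 (dv a v)" unfolding da by (rule Hs_h_inf[OF h_inf_D[OF h]])
   have "norm (J ep (dv a v) - dv a v) <= ep * (\<Sum>j\<in>UNIV. norm (dv [j] (dv a v)))" by (rule Hs_rate[OF e H1])
   also have "... <= ep * (\<Sum>j\<in>(UNIV::'n set). s)"
   proof (intro mult_left_mono sum_mono)
    fix j
    have "dv [j] (dv a v) = dv (j # a) v" unfolding da by (simp add: v_cl dv_h_inf[OF h] dv_h_inf[OF h_inf_D[OF h]])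
    also have "norm ... <= s" by (rule order_trans[OF norm_le_Nm Nv]) (use that m in simp)
    finally show "norm (dv [j] (dv a v)) <= s" .
   qed (use e in simp)
   finally show ?thesis by (simp add: norm_minus_commute)
  qed
  have eb: "norm (pd j E x) <= bb" for j x using M[rule_format, of "[j]" x] bb(2) by simp
  have part1: "norm (FF E ?e v - FF E ?e (J ep v)) <= K1 * ep"
  proof -
   have d: "norm (dv [j] v - dv [j] (J ep v)) <= ep * (?n * s)" for j
    using rate[of "[j]"] dv_J_Hs[OF e Hv[of 1], of "[j]"] by simp
   have d0: "norm (v - J ep v) <= ep * (?n * s)" using rate[of "[]"] by simp
   have "norm (FF E ?e v - FF E ?e (J ep v)) <= KS * (2 * bb) * (\<Sum>j\<in>UNIV. norm (dv [j] v - dv [j] (J ep v)))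
    + (?n * (2 * KS * bb * norm (v - J ep v) + 2 * KS * 0 * s) + KG * norm (v - J ep v))"
   proof (rule FF_diff[OF Em(1) _ Em(1) _ _ Em(2) _ Em(2) _ _ bb(4)], goal_cases)
    case 8 show ?case using AEb[OF Hv Nv, of "[]"] by simp
    case (9 j) show ?case by (rule AEb[OF HJv NJv]) simp
    case (10 j) show ?case by (rule order_trans[OF norm_le_Nm NJv]) (use m in simp)
    case 11 show ?case by (rule order_trans[OF norm_le_Nm0 NJv])
   qed (use B eb bb in "auto intro: order_trans")
   also have "... <= KS * (2 * bb) * (\<Sum>j\<in>(UNIV::'n set). ep * (?n * s)) + (?n * (2 * KS * bb * (ep * (?n * s)) + 2 * KS * 0 * s) + KG * (ep * (?n * s)))"
    using KS(1) KG(1) bb(4) by (intro add_mono mult_left_mono sum_mono d d0) auto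
   also have "... = K1 * ep" by (simp add: K1_def algebra_simps)
   finally show ?thesis .
  qed
  define W where "W = Jf ep v"
  have hW: "h_inf W" unfolding W_def by (rule h_inf_Jf[OF e])
  have JW: "J ep v = cl W" by (simp add: W_def J_eq_Jf)
  have nW: "hn m W <= s" using NJv by (simp add: JW Nm_h_inf[OF hW])
  have hF: "h_inf (Ffun E W)" by (rule h_inf_Ffun[OF E hW])
  have FW: "FF E ?e (J ep v) = cl (Ffun E W)" unfolding JW by (rule FF_h_inf[OF E hW])
  have DF: "norm (cl (D [j] (Ffun E W))) <= ?n * (3 * 2 ^ m * (Kc * (M + s) * s)) + ?n * (KS * (2 * bb) * s) + KG * s" for j
  proof -
   let ?w = "D [j] W"
   have c: "L2b (%x. D [j] (Ffun E W) x - (\<Sum>i\<in>UNIV. S i (W x + E x) (pd i ?w x)) - G (?w x)) (?n * (3 * 2 ^ m * (Kc * (M + s) * s)))"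
   proof (rule L2b_mono[OF commutator_bound[OF m E _ hW]])
    show "?n * (3 * 2 ^ m * (Kc * (M + hn m W) * hn m W)) <= ?n * (3 * 2 ^ m * (Kc * (M + s) * s))"
     using nW M0 Kc_ge(1) s by (intro mult_left_mono mult_mono mult_nonneg_nonneg) auto
   qed (use M m in auto)
   have Um: "bmeas (%x. W x + E x)" using Em(1) smooth_measurable[OF h_inf_smooth[OF hW]] by measurable
   have Ub: "AE x in lborel. norm (W x + E x) <= 2 * bb"
   proof (rule AE_I2)
    fix x
    have "norm (D [] W x) <= ?sob * hn m W" by (rule sobolev_sup[OF hW dim]) (use m in simp)
    also have "... <= bb" using order_trans[OF mult_left_mono[OF nW, of ?sob] bb(3)] sob1 by simp
    finally have "norm (W x) <= bb" by simp
    moreover have "norm (E x) <= bb" using B bb(1) order_trans by blast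
    ultimately show "norm (W x + E x) <= 2 * bb" using norm_triangle_ineq[of "W x" "E x"] by linarith
   qed
   have t: "L2b (%x. S i (W x + E x) (pd i ?w x)) (KS * (2 * bb) * s)" for i
   proof -
    have sq: "sqi (pd i ?w)" using h_inf_sqi[OF hW, of "[i, j]"] by simp
    have "norm (cl (pd i ?w)) <= s" using order_trans[OF norm_le_hn[of "[i,j]" m W] nW] m by simp
    thus ?thesis using bb(4) KS(1)
     by (intro L2b_mono[OF S_AE(1)[OF Um Ub _ sq]] mult_left_mono) auto
   qed
   have g: "L2b (%x. G (?w x)) (KG * s)"
    by (rule L2b_mono[OF G_L2b[OF h_inf_sqi[OF hW]]], rule mult_left_mono[OF order_trans[OF norm_le_hn nW] KG(1)]) (use m in simp)
   have s: "L2b (%x. \<Sum>i\<in>UNIV. S i (W x + E x) (pd i ?w x)) (?n * (KS * (2 * bb) * s))"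
    by (rule L2b_sum) (rule t)
   from L2b_add[OF L2b_add[OF c s] g] show ?thesis by (simp add: L2b_def)
  qed
  have part2: "norm (FF E ?e (J ep v) - J ep (FF E ?e (J ep v))) <= K2 * ep"
  proof -
   have "norm (J ep (cl (Ffun E W)) - cl (Ffun E W)) <= ep * (\<Sum>j\<in>UNIV. norm (dv [j] (cl (Ffun E W))))"
    by (rule Hs_rate[OF e Hs_h_inf[OF hF]])
   also have "... <= ep * (\<Sum>j\<in>(UNIV::'n set). ?n * (3 * 2 ^ m * (Kc * (M + s) * s)) + ?n * (KS * (2 * bb) * s) + KG * s)"
    unfolding dv_h_inf[OF hF] using e by (intro mult_left_mono sum_mono DF) auto
   also have "... = K2 * ep" unfolding K2_def by simp
   finally show ?thesis unfolding FW by (simp add: norm_minus_commute)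
  qed
  have "FF E ?e v - J ep (FF E ?e (J ep v)) = (FF E ?e v - FF E ?e (J ep v)) + (FF E ?e (J ep v) - J ep (FF E ?e (J ep v)))" by simp
  also have "norm ... <= K1 * ep + K2 * ep" by (rule order_trans[OF norm_triangle_ineq add_mono[OF part1 part2]])
  finally show ?thesis by (simp add: v_def distrib_right)
 qed
 thus ?thesis using K0 by (intro exI[of _ "K1 + K2"]) auto
qed

end

text \<open>Uniform convergence of the time derivatives makes the limit differentiable in the L^2
  norm, so the constructed solution satisfies its equation strongly in L^2.\<close>

lemma vector_derivative_limit:
 fixes f :: "nat => real => 'h::banach"
 assumes der: "!!k t. t \<in> {0..T} ==> (f k has_vector_derivative f' k t) (at t within {0..T})"
  and c: "c \<longlonglongrightarrow> 0" "!!k t. t \<in> {0..T} ==> norm (f' k t - g' t) <= c k"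
  and lim: "!!t. t \<in> {0..T} ==> (%k. f k t) \<longlonglongrightarrow> g t" and t: "t \<in> {0..T}"
 shows "(g has_vector_derivative g' t) (at t within {0..T})"
proof -
 have "EX h. \<forall>x\<in>{0..T}. (%k. f k x) \<longlonglongrightarrow> h x & (h has_derivative (%r. r *\<^sub>R g' x)) (at x within {0..T})"
 proof (rule has_derivative_sequence[where f=f and f'="%k t r. r *\<^sub>R f' k t", OF _ _ _ t lim[OF t]])
  show "(f k has_derivative (%r. r *\<^sub>R f' k x)) (at x within {0..T})" if "x \<in> {0..T}" for k x
   using der[OF that] by (simp add: has_vector_derivative_def)
  fix e :: real assume "e > 0"
  with c(1) have "\<forall>\<^sub>F k in sequentially. c k < e" by (rule order_tendstoD)
  thus "\<forall>\<^sub>F k in sequentially. \<forall>x\<in>{0..T}. ALL h. norm (h *\<^sub>R f' k x - h *\<^sub>R g' x) <= e * norm h"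
  proof eventually_elim
   case (elim k)
   have "norm (h *\<^sub>R f' k x - h *\<^sub>R g' x) <= e * norm h" if "x \<in> {0..T}" for x h
   proof -
    have "norm (h *\<^sub>R f' k x - h *\<^sub>R g' x) = \<bar>h\<bar> * norm (f' k x - g' x)"
     by (simp add: scaleR_diff_right[symmetric])
    also have "... <= \<bar>h\<bar> * e" using c(2)[OF that, of k] elim by (intro mult_left_mono) auto
    finally show ?thesis by (simp add: mult.commute)
   qed
   thus ?case by blast
  qed
 qed simp
 then obtain h where h: "!!x. x \<in> {0..T} ==> (%k. f k x) \<longlonglongrightarrow> h x"
  "(h has_derivative (%r. r *\<^sub>R g' t)) (at t within {0..T})" using t by blast
 have eq: "g x = h x" if "x \<in> {0..T}" for x by (rule LIMSEQ_unique[OF lim[OF that] h(1)[OF that]])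
 show ?thesis unfolding has_vector_derivative_def
  by (rule has_derivative_transform[OF t eq h(2)])
qed

lemma weak_deriv_on_subset: "weak_deriv_on T V f \<psi> ==> T' <= T ==> weak_deriv_on T' V f \<psi>"
 unfolding weak_deriv_on_def by (metis DERIV_subset atLeastAtMost_iff atLeastatMost_subset_iff order_refl order_trans)

lemma weak_deriv_on_diff: "weak_deriv_on T V f \<psi> ==> weak_deriv_on T W g \<psi> ==> weak_deriv_on T (%t. V t - W t) (%t. f t - g t) \<psi>"
 unfolding weak_deriv_on_def inner_diff_left by (auto intro!: DERIV_diff)

section \<open>Background states\<close>

text \<open>\<open>M\<close> bounds the derivatives of orders 1 to m + 1 and enters the existence
  time; \<open>B\<close> bounds \<open>E\<close> itself, which is of size 1/\<delta>. Continuity in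
  time is uniform in space for \<open>E\<close> and its first derivatives, as the Picard iteration
  asks. All real times are included, so that time shifts and reversals stay within the
  notion.\<close>

definition smooth_background :: "nat => real => real => (real => real^'n::finite => 'b::euclidean_space) => bool" where
 "smooth_background m M B E \<longleftrightarrow> (ALL t. b_inf (E t)
  & (ALL is x. 1 <= length is --> length is <= m + 1 --> norm (D is (E t) x) <= M) & (ALL x. norm (E t x) <= B)
  & (\<forall>r>0. EX d>0. ALL s. \<bar>s - t\<bar> < d --> (ALL x. norm (E s x - E t x) <= r & (ALL j. norm (pd j (E s) x - pd j (E t) x) <= r))))"

text \<open>The lifted planar solution is not smooth; it and its gradient are uniform limits of
  smooth backgrounds with the same \<open>M\<close> and \<open>B\<close>. The gradient
  \<open>e\<close> is carried as separate data, since it is only a weak derivative.\<close>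

definition background :: "nat => real => real => (real => real^'n::finite => 'b::euclidean_space) => (real => 'n => real^'n => 'b) => bool" where
 "background m M B E e \<longleftrightarrow> (ALL t. E t \<in> borel_measurable borel & (ALL j. e t j \<in> borel_measurable borel)) &
  (\<exists>Ek \<eta>. \<eta> \<longlonglongrightarrow> 0 & (ALL k. \<eta> k >= 0 & smooth_background m M B (Ek k) &
    (ALL t. (AE x in lborel. norm (Ek k t x - E t x) <= \<eta> k) & (ALL j. AE x in lborel. norm (pd j (Ek k t) x - e t j x) <= \<eta> k))))"

text \<open>The signs \<sigma> = 1 and \<sigma> = -1 are restarts at time \<open>t0\<close> forwards
  and backwards.\<close>

lemma smooth_background_reparam:
 assumes "\<bar>\<sigma>\<bar> = 1" "smooth_background m M B E" shows "smooth_background m M B (%s. E (t0 + \<sigma> * s))"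
proof -
 have a: "\<bar>t0 + \<sigma> * s - (t0 + \<sigma> * t)\<bar> = \<bar>s - t\<bar>" for s t
  using assms(1) by (simp add: right_diff_distrib[symmetric] abs_mult)
 show ?thesis using assms(2) unfolding smooth_background_def
  by (intro allI conjI) (blast, blast, blast, metis a)
qed

lemma background_reparam:
 assumes "\<bar>\<sigma>\<bar> = 1" "background m M B E e" shows "background m M B (%s. E (t0 + \<sigma> * s)) (%s. e (t0 + \<sigma> * s))"
proof -
 obtain Ek \<eta> where "\<eta> \<longlonglongrightarrow> 0" "!!k. \<eta> k >= 0" "!!k. smooth_background m M B (Ek k)"
  "!!k t. AE x in lborel. norm (Ek k t x - E t x) <= \<eta> k" "!!k t j. AE x in lborel. norm (pd j (Ek k t) x - e t j x) <= \<eta> k"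
  using assms(2) unfolding background_def by blast
 thus ?thesis using assms(2) smooth_background_reparam[OF assms(1)] unfolding background_def
  by (intro conjI exI[of _ "%k s. Ek k (t0 + \<sigma> * s)"] exI[of _ \<eta>] allI) blast+
qed

lemma AE_norm_limit:
 fixes f :: "nat => 'a::euclidean_space => 'b::euclidean_space"
 assumes "\<eta> \<longlonglongrightarrow> 0" "!!k x. norm (f k x) <= B" "!!k. AE x in lborel. norm (f k x - g x) <= \<eta> k"
 shows "AE x in lborel. norm (g x) <= B"
proof -
 have "AE x in lborel. ALL k. norm (f k x - g x) <= \<eta> k" using assms(3) by (simp add: AE_all_countable)
 thus ?thesis
 proof eventually_elim
  case (elim x)
  have "norm (g x) <= B + \<eta> k" for k
   using elim[rule_format, of k] assms(2)[of k x] norm_triangle_sub[of "g x" "f k x"] by (simp add: norm_minus_commute)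
  moreover have "(%k. B + \<eta> k) \<longlonglongrightarrow> B + 0" by (intro tendsto_intros assms)
  ultimately show ?case by (intro LIMSEQ_le_const[of "%k. B + \<eta> k" B]) auto
 qed
qed

lemma smooth_background_pd: "smooth_background m M B E ==> norm (pd j (E t) x) <= M"
proof -
 assume "smooth_background m M B E"
 hence "norm (D [j] (E t) x) <= M" unfolding smooth_background_def by (metis One_nat_def le_add2 length_Cons list.size(3) order_refl)
 thus ?thesis by simp
qed

lemma background_bounds:
 assumes "background m M B E e"
 shows "AE x in lborel. norm (E t x) <= B" "AE x in lborel. norm (e t j x) <= M" "M >= 0" "B >= 0"
proof -
 obtain Ek \<eta> where e: "\<eta> \<longlonglongrightarrow> 0" "!!k. \<eta> k >= 0" "!!k. smooth_background m M B (Ek k)"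
  "!!k t. AE x in lborel. norm (Ek k t x - E t x) <= \<eta> k" "!!k t j. AE x in lborel. norm (pd j (Ek k t) x - e t j x) <= \<eta> k"
  using assms unfolding background_def by blast
 have b: "norm (Ek k t x) <= B" "norm (pd j (Ek k t) x) <= M" for k t x j
  using e(3)[of k] smooth_background_pd[OF e(3)] by (auto simp: smooth_background_def)
 show "AE x in lborel. norm (E t x) <= B" by (rule AE_norm_limit[OF e(1) b(1) e(4)])
 show "AE x in lborel. norm (e t j x) <= M" by (rule AE_norm_limit[OF e(1) b(2) e(5)])
 show "M >= 0" "B >= 0" using order_trans[OF norm_ge_zero b(1)] order_trans[OF norm_ge_zero b(2)] by auto
qed

lemma exp_factor_mono:
 fixes C t T y b :: real
 assumes "0 <= C" "0 <= t" "t <= T" "0 <= y" "0 <= b"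
 shows "exp (C * t) * (y + b * t) <= exp (C * T) * (y + b * T)"
proof (rule mult_mono)
 show "exp (C * t) <= exp (C * T)" using mult_left_mono[OF assms(3,1)] by simp
 show "y + b * t <= y + b * T" using mult_left_mono[OF assms(3,5)] by simp
qed (use assms in auto)

lemma background_le:
 assumes bg: "background m M B E e" and b: "B <= b" "M <= b"
 shows "bmeas (E t)" "AE x in lborel. norm (E t x) <= b"
  "bmeas (e t j)" "AE x in lborel. norm (e t j x) <= b"
proof -
 show "bmeas (E t)" "bmeas (e t j)" using bg by (auto simp: background_def)
 show "AE x in lborel. norm (E t x) <= b" "AE x in lborel. norm (e t j x) <= b"
  by (rule eventually_mono[OF background_bounds(1)[OF bg, of t]], use b in linarith)
   (rule eventually_mono[OF background_bounds(2)[OF bg, of t j]], use b in linarith)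
qed

context sym_system
begin

lemma FF_norm_Nm:
 assumes m: "m >= 3" and v: "Hs m v" "Nm m v <= s"
  and E: "bmeas E" "AE x in lborel. norm (E x) <= b"
  and e: "!!j. bmeas (e j)" "!!j. AE x in lborel. norm (e j x) <= b"
  and b: "sob_const TYPE('n) * s <= b" and s: "s >= 0"
 shows "norm (FF E e v) <= KS * (2 * b) * (real CARD('n) * s) + (real CARD('n) * (2 * KS * b * s) + KG * s)"
  "AE x in lborel. norm (rp v x) <= b" "AE x in lborel. norm (rp (dv [j] v) x) <= b"
proof -
 have sob: "sob_const TYPE('n) >= 1" by (rule sob_const_ge)
 have le: "sob_const TYPE('n) * Nm m v <= b" using order_trans[OF mult_left_mono[OF v(2)] b] sob by simp
 have b0: "b >= 0" using order_trans[OF mult_nonneg_nonneg b] sob s by simp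
 have "AE x in lborel. norm (rp (dv a v) x) <= b" if "length a <= 1" for a
 proof -
  have "AE x in lborel. norm (rp (dv a v) x) <= sob_const TYPE('n) * Nm m v"
   by (rule Hs_sup[OF v(1) _ dim]) (use m that in simp)
  thus ?thesis by eventually_elim (use le in simp)
 qed
 from this[of "[]"] this[of "[j]"] show vb: "AE x in lborel. norm (rp v x) <= b" "AE x in lborel. norm (rp (dv [j] v) x) <= b" by simp_all
 have d: "norm (dv [j] v) <= s" for j using order_trans[OF norm_le_Nm[of "[j]" m v] v(2)] m by simp
 have "norm (FF E e v) <= KS * (2 * b) * (\<Sum>j\<in>UNIV. norm (dv [j] v)) + (real CARD('n) * (2 * KS * b * norm v) + KG * norm v)"
  by (rule FF_norm[OF E e b0 vb(1)])
 also have "... <= KS * (2 * b) * (\<Sum>j\<in>(UNIV::'n set). s) + (real CARD('n) * (2 * KS * b * s) + KG * s)"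
  using KS(1) KG(1) b0 order_trans[OF norm_le_Nm0 v(2)] by (intro add_mono mult_left_mono sum_mono d) auto
 finally show "norm (FF E e v) <= KS * (2 * b) * (real CARD('n) * s) + (real CARD('n) * (2 * KS * b * s) + KG * s)" by simp
qed

text \<open>The stability estimate with residuals \<rho>1, \<rho>2 and background error \<eta>,
  closed by Gronwall. The rate contains \<open>B\<close>, hence 1/\<delta> in the application; this
  is admissible because the estimate yields convergence and uniqueness only.\<close>

lemma compare:
 assumes m: "m >= 3" and s: "s >= 0" and E1: "smooth_background m M B E1"
  and E2: "!!t. bmeas (E2 t)" "!!t. AE x in lborel. norm (E2 t x) <= B" "!!t. AE x in lborel. norm (E1 t x - E2 t x) <= \<eta>"
  and e2: "!!t j. bmeas (e2 t j)" "!!t j. AE x in lborel. norm (e2 t j x) <= M" "!!t j. AE x in lborel. norm (pd j (E1 t) x - e2 t j x) <= \<eta>"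
  and \<eta>: "\<eta> >= 0" and W: "!!t. t \<in> {0..T} ==> h_inf (W t)" "!!t. t \<in> {0..T} ==> hn m (W t) <= s"
  and V: "!!t. t \<in> {0..T} ==> Hs m (V t)" "!!t. t \<in> {0..T} ==> Nm m (V t) <= s"
  and f: "!!\<psi>. weak_deriv_on T (%t. cl (W t)) f1 \<psi>" "!!\<psi>. weak_deriv_on T V f2 \<psi>"
  and r: "!!t. t \<in> {0..T} ==> norm (f1 t + FF (E1 t) (%j. pd j (E1 t)) (cl (W t))) <= \<rho>1"
   "!!t. t \<in> {0..T} ==> norm (f2 t + FF (E2 t) (e2 t) (V t)) <= \<rho>2"
  and t: "t \<in> {0..T}"
 shows "(norm (cl (W t) - V t))^2 <= exp (2 * (real CARD('n) * (3 * KS * (sob_const TYPE('n) * s + M + B))) * T) *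
  ((norm (cl (W 0) - V 0))^2 + 4 * s * (real CARD('n) * (2 * KS * \<eta> * s) + \<rho>1 + \<rho>2) * T)"
proof -
 define b where "b = sob_const TYPE('n) * s + M + B"
 have B0: "B >= 0" and E1b: "norm (E1 t x) <= B" and M0: "M >= 0" and b1: "b_inf (E1 t)" for t x
  using E1 order_trans[OF norm_ge_zero, of "E1 0 0" B] order_trans[OF norm_ge_zero smooth_background_pd[OF E1]]
  by (auto simp: smooth_background_def)
 note e1b = smooth_background_pd[OF E1]
 have ss: "sob_const TYPE('n) * s >= 0" using s sob_const_ge[where 'n='n] by (intro mult_nonneg_nonneg) auto
 have b: "b >= 0" "M <= b" "B <= b" "sob_const TYPE('n) * s <= b" using ss M0 B0 by (auto simp: b_def)
 have \<rho>: "\<rho>1 >= 0" "\<rho>2 >= 0" using order_trans[OF norm_ge_zero r(1)[OF t]] order_trans[OF norm_ge_zero r(2)[OF t]] by auto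
 have me: "bmeas (E1 t)" "bmeas (pd j (E1 t))" for t j
  by (intro smooth_measurable smooth_pd b_inf_smooth b1)+
 define u where "u t = cl (W t) - V t" for t
 have Nu: "norm (u t) <= 2 * s" if "t \<in> {0..T}" for t
  using norm_triangle_ineq4[of "cl (W t)" "V t"] order_trans[OF norm_le_Nm0 V(2)[OF that]] W(2)[OF that] norm_le_Nm0[of "cl (W t)" m]
  by (simp add: u_def Nm_h_inf[OF W(1)[OF that]])
 define F1 where "F1 t = FF (E1 t) (%j. pd j (E1 t)) (cl (W t))" for t
 define F2 where "F2 t = FF (E2 t) (e2 t) (V t)" for t
 let ?KF = "KS * (2 * b) * (real CARD('n) * s) + (real CARD('n) * (2 * KS * b * s) + KG * s)"
 have F: "norm (F1 t) <= ?KF" "norm (F2 t) <= ?KF" if t: "t \<in> {0..T}" for t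
  unfolding F1_def F2_def
 proof -
  show "norm (FF (E1 t) (%j. pd j (E1 t)) (cl (W t))) <= ?KF"
   by (rule FF_norm_Nm(1)[OF m Hs_h_inf[OF W(1)[OF t]] _ me(1) _ me(2) _ b(4) s])
    (use W(2)[OF t] Nm_h_inf[OF W(1)[OF t]] order_trans[OF E1b b(3)] order_trans[OF e1b b(2)] in auto)
  have "AE x in lborel. norm (E2 t x) <= b" "AE x in lborel. norm (e2 t j x) <= b" for j
   by (rule eventually_mono[OF E2(2)[of t]], use b in linarith) (rule eventually_mono[OF e2(2)[of t j]], use b in linarith)
  thus "norm (FF (E2 t) (e2 t) (V t)) <= ?KF"
   by (intro FF_norm_Nm(1)[OF m V(1)[OF t] V(2)[OF t] E2(1) _ e2(1) _ b(4) s])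
 qed
 have fb: "norm (f1 t - f2 t) <= (\<rho>1 + ?KF) + (\<rho>2 + ?KF)" if t: "t \<in> {0..T}" for t
  using norm_triangle_ineq4[of "f1 t" "f2 t"] norm_triangle_ineq4[of "f1 t + F1 t" "F1 t"] norm_triangle_ineq4[of "f2 t + F2 t" "F2 t"]
   r[OF t] F[OF t] unfolding F1_def F2_def add_diff_cancel_right' by linarith
 have wd: "weak_deriv_on T u (%t. f1 t - f2 t) \<psi>" for \<psi>
  unfolding u_def by (rule weak_deriv_on_diff[OF f])
 let ?C = "2 * (real CARD('n) * (3 * KS * b))" and ?b = "4 * s * (real CARD('n) * (2 * KS * \<eta> * s) + \<rho>1 + \<rho>2)"
 have der: "2 * ((f1 t - f2 t) \<bullet> u t) <= ?C * (norm (u t))^2 + ?b" if t: "t \<in> {0..T}" for t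
 proof -
  have hV: "norm (pd j (%x. W t x + E1 t x) x) <= b" for j x
  proof -
   have "pd j (%x. W t x + E1 t x) x = pd j (W t) x + pd j (E1 t) x"
    using D_add[OF h_inf_smooth[OF W(1)[OF t]] b_inf_smooth[OF b1[of t]], of "[j]"] by simp
   moreover have "norm (pd j (W t) x) <= sob_const TYPE('n) * hn m (W t)"
    using sobolev_sup[OF W(1)[OF t] dim, of "[j]" m x] m by simp
   moreover have "... <= sob_const TYPE('n) * s" using W(2)[OF t] sob_const_ge[where 'n='n] by (intro mult_left_mono) auto
   ultimately show ?thesis using norm_triangle_ineq[of "pd j (W t) x" "pd j (E1 t) x"] e1b[of j t x] B0 by (simp add: b_def)
  qed
  have N: "norm (dv [j] (V t)) <= s" "norm (V t) <= s" for j
   using order_trans[OF norm_le_Nm[of "[j]" m "V t"] V(2)[OF t]] order_trans[OF norm_le_Nm0 V(2)[OF t]] m by auto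
  have E2b: "AE x in lborel. norm (E2 t x) <= b" "AE x in lborel. norm (e2 t j x) <= b" for j
   by (rule eventually_mono[OF E2(2)[of t]], use b in linarith) (rule eventually_mono[OF e2(2)[of t j]], use b in linarith)
  have "\<bar>u t \<bullet> (F1 t - F2 t)\<bar> <= real CARD('n) * (3 * KS * b) * (norm (u t))^2 + real CARD('n) * (2 * KS * \<eta> * s) * norm (u t)"
   unfolding u_def F1_def F2_def
   by (rule stability_estimate[OF W(1)[OF t] b1 hV _ _ E2(1) E2b(1) E2(3) e2(1) E2b(2) e2(3) b(1) \<eta> Hs_mono[OF V(1)[OF t]]
      FF_norm_Nm(3)[OF m V(1)[OF t] V(2)[OF t] E2(1) E2b(1) e2(1) E2b(2) b(4) s] N])
    (use order_trans[OF E1b b(3)] order_trans[OF e1b b(2)] m in auto)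
  also have "... <= real CARD('n) * (3 * KS * b) * (norm (u t))^2 + real CARD('n) * (2 * KS * \<eta> * s) * (2 * s)"
   using KS(1) KG(1) \<eta> s Nu[OF t] by (intro add_left_mono mult_left_mono) auto
  finally have 1: "- (u t \<bullet> (F1 t - F2 t)) <= real CARD('n) * (3 * KS * b) * (norm (u t))^2 + real CARD('n) * (2 * KS * \<eta> * s) * (2 * s)" by linarith
  have "norm ((f1 t + F1 t) - (f2 t + F2 t)) <= \<rho>1 + \<rho>2"
   using r[OF t] norm_triangle_ineq4[of "f1 t + F1 t" "f2 t + F2 t"] by (simp add: F1_def F2_def)
  hence "u t \<bullet> ((f1 t + F1 t) - (f2 t + F2 t)) <= 2 * s * (\<rho>1 + \<rho>2)"
   by (intro order_trans[OF norm_cauchy_schwarz mult_mono]) (use Nu[OF t] s in auto)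
  moreover have "(f1 t - f2 t) \<bullet> u t = u t \<bullet> ((f1 t + F1 t) - (f2 t + F2 t)) - u t \<bullet> (F1 t - F2 t)"
   by (simp add: inner_diff_right inner_add_right inner_diff_left inner_commute[of "u t"])
  ultimately show ?thesis using 1 by (simp add: algebra_simps)
 qed
 have T0: "T >= 0" and t0: "0 <= t" "t <= T" using t by auto
 have C0: "?C >= 0" "?b >= 0" using KS(1) KG(1) b(1) s \<eta> \<rho> by (auto intro!: mult_nonneg_nonneg add_nonneg_nonneg)
 have "(norm (u t))^2 <= exp (?C * t) * ((norm (u 0))^2 + ?b * t)"
  by (rule gronwall[OF weak_deriv_norm_sq[OF wd fb] der C0 t])
 also have "... <= exp (?C * T) * ((norm (u 0))^2 + ?b * T)"
  by (rule exp_factor_mono[OF C0(1) t0 _ C0(2)]) simp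
 finally show ?thesis by (simp add: u_def b_def)
qed

text \<open>Uniqueness on shorter intervals and the growth bound in terms of the initial norm are
  part of the conclusion: together they later give the growth bound for every solution, on which
  continuity in H^m rests.\<close>

theorem local_existence:
 fixes E :: "real => real^'n => 'b"
 assumes m: "m >= 3" and bg: "background m M B E e" and v0: "Hs m v0" "Nm m v0 <= R" and T: "T = life m M R"
 shows "EX V. V 0 = v0 & (\<forall>t\<in>{0..T}. Hs m (V t) & (Nm m (V t))^2 <= (Nm m v0)^2 + growth m M R * t
   & (V has_vector_derivative - FF (E t) (e t) (V t)) (at t within {0..T})) &
  (ALL s T' V'. T' <= T --> V' 0 = v0 --> (\<forall>t\<in>{0..T'}. Hs m (V' t) & Nm m (V' t) <= s) -->
   (\<forall>\<psi>. weak_deriv_on T' V' (%t. - FF (E t) (e t) (V' t)) \<psi>) --> (\<forall>t\<in>{0..T'}. V' t = V t))"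
proof -
 note bd = background_bounds[OF bg]
 obtain Ek \<eta> where \<eta>: "\<eta> \<longlonglongrightarrow> 0" "!!k. \<eta> k >= 0" and Ek: "!!k. smooth_background m M B (Ek k)"
  and Ed: "!!k t. AE x in lborel. norm (Ek k t x - E t x) <= \<eta> k" "!!k t j. AE x in lborel. norm (pd j (Ek k t) x - e t j x) <= \<eta> k"
  using bg unfolding background_def by blast
 have Em: "bmeas (E t)" "bmeas (e t j)" for t j using bg by (auto simp: background_def)
 have Ekb: "b_inf (Ek k t)" "norm (Ek k t x) <= B" "norm (pd j (Ek k t) x) <= M" for k t x j
  using Ek[of k] smooth_background_pd[OF Ek] by (auto simp: smooth_background_def)
 have Ekm: "bmeas (Ek k t)" "bmeas (pd j (Ek k t))" for k t j
  by (intro smooth_measurable smooth_pd b_inf_smooth Ekb)+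
 have T0: "T > 0" unfolding T by (rule life_pos[OF bd(3)])
 define s where "s = sqrt (R^2 + 1)"
 have s0: "s >= 0" by (simp add: s_def)
 have v0s: "(Nm m v0)^2 + growth m M R * t <= s^2" if "t \<in> {0..T}" for t
 proof -
  have "(Nm m v0)^2 <= R^2" using v0(2) by (intro power_mono) auto
  moreover have "growth m M R * t <= growth m M R * T" using that growth_nonneg[OF bd(3)] by (intro mult_left_mono) auto
  ultimately show ?thesis using growth_life[OF bd(3), of m R] T by (simp add: s_def)
 qed
 have "EX z. ALL k. z k 0 = v0 & (\<forall>t\<in>{0..T}. (z k has_vector_derivative - FF (Ek k t) (%j. pd j (Ek k t)) (J (eps k) (J (eps k) (z k t)))) (at t within {0..T})
   & (Nm m (J (eps k) (z k t)))^2 <= (Nm m v0)^2 + growth m M R * t)"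
  by (rule choice, rule allI, rule approx_exists[OF m Ekb(1) _ Ekb(2) _ v0 _ T]) (use Ek in "auto simp: smooth_background_def")
 then obtain z where z: "!!k. z k 0 = v0"
  "!!k t. t \<in> {0..T} ==> (z k has_vector_derivative - FF (Ek k t) (%j. pd j (Ek k t)) (J (eps k) (J (eps k) (z k t)))) (at t within {0..T})"
  "!!k t. t \<in> {0..T} ==> (Nm m (J (eps k) (z k t)))^2 <= (Nm m v0)^2 + growth m M R * t" by blast
 define V where "V k t = J (eps k) (z k t)" for k t
 define W where "W k t = Jf (eps k) (z k t)" for k t
 have VW: "V k t = cl (W k t)" and hW: "h_inf (W k t)" for k t by (simp_all add: V_def W_def J_eq_Jf h_inf_Jf)
 have HV: "Hs n (V k t)" for n k t unfolding V_def by (rule Hs_J[OF eps_pos])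
 have NV: "Nm m (V k t) <= s" if "t \<in> {0..T}" for k t
  using order_trans[OF z(3)[OF that] v0s[OF that], of k] s0 by (auto simp: V_def intro: power2_le_imp_le)
 have NW: "hn m (W k t) <= s" if "t \<in> {0..T}" for k t using NV[OF that, of k] by (simp add: VW Nm_h_inf[OF hW])
 define f where "f k t = - J (eps k) (FF (Ek k t) (%j. pd j (Ek k t)) (J (eps k) (V k t)))" for k t
 have Vd: "(V k has_vector_derivative f k t) (at t within {0..T})" if "t \<in> {0..T}" for k t
  using bounded_linear.has_vector_derivative[OF bounded_linear_cv[OF moll_kernel[OF eps_pos[of k]]] z(2)[OF that, of k]]
  by (simp add: V_def[abs_def] f_def linear_neg[OF linear_cv[OF moll_kernel[OF eps_pos]]])
 obtain Kr where Kr: "Kr >= 0" "!!k t. t \<in> {0..T} ==> norm (FF (Ek k t) (%j. pd j (Ek k t)) (V k t) + f k t) <= Kr * eps k"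
 proof -
  obtain Kr where K0: "Kr >= 0" and K: "ALL E ep u. b_inf E --> (ALL is x. 1 <= length is --> length is <= m + 1 --> norm (D is E x) <= M) -->
   (ALL x. norm (E x) <= B) --> ep > 0 --> Nm m (J ep u) <= s -->
   norm (FF E (%j. pd j E) (J ep u) - J ep (FF E (%j. pd j E) (J ep (J ep u)))) <= Kr * ep"
   using residual_bound[OF m s0 bd(3,4)] by blast
  show ?thesis
  proof (rule that[OF K0])
   fix k t assume t: "t \<in> {0..T}"
   show "norm (FF (Ek k t) (%j. pd j (Ek k t)) (V k t) + f k t) <= Kr * eps k"
    using K[rule_format, of "Ek k t" "eps k" "z k t"] Ek[of k] NV[OF t, of k] by (simp add: smooth_background_def V_def f_def)
  qed
 qed
 define C where "C s' = exp (2 * (real CARD('n) * (3 * KS * (sob_const TYPE('n) * s' + M + B))) * T)" for s'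
 \<comment> \<open>The initial distance of two approximations is at most 2 s and at most the sum of
   their errors, so its square is linear in these errors; all other errors are linear as well. One
   null sequence \<omega> therefore controls everything.\<close>
 define c where "c s' = 2 * s + 4 * s' * (real CARD('n) * (2 * KS * s') + Kr) * T" for s'
 define \<omega> where "\<omega> k = norm (J (eps k) v0 - v0) + \<eta> k + eps k" for k
 have \<omega>: "\<omega> \<longlonglongrightarrow> 0"
  unfolding \<omega>_def using tendsto_add[OF tendsto_add[OF tendsto_norm_zero[OF LIM_zero[OF J_eps_tendsto]] \<eta>(1)] eps_tendsto] by simp
 have bound: "4 * s' * (real CARD('n) * (2 * KS * h * s') + Kr * p + Kr * q) * T + 2 * s * (a + d) <= c s' * (a + d + h + p + q)"
  if "s' >= 0" "h >= 0" "p >= 0" "q >= 0" "a >= 0" "d >= 0" for s' h p q a d :: real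
 proof -
  have "0 <= 2 * s * (h + p + q) + 4 * s' * T * (real CARD('n) * (2 * KS * s') * (a + d + p + q) + Kr * (a + d + h))"
   using that s0 T0 KS(1) Kr(1) by (intro add_nonneg_nonneg mult_nonneg_nonneg) auto
  thus ?thesis by (simp add: c_def algebra_simps)
 qed
 have Cpos: "C s' > 0" for s' by (simp add: C_def)
 have init: "norm (J (eps k) v0) <= s" for k using NV[of 0 k] T0 norm_le_Nm0[of "V k 0" m] by (simp add: V_def z(1))
 have cauchy: "(norm (V k t - V l t))^2 <= C s * (c s * (\<omega> k + \<omega> l))" if t: "t \<in> {0..T}" for k l t
 proof -
  \<comment> \<open>The first place of \<open>compare\<close> asks for a smooth state and a smooth
    background, the second only for H^m regularity; approximation k takes the first, l the
    second.\<close>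
  have "(norm (cl (W k t) - V l t))^2 <= C s * ((norm (cl (W k 0) - V l 0))^2 + 4 * s * (real CARD('n) * (2 * KS * (\<eta> k + \<eta> l) * s) + Kr * eps k + Kr * eps l) * T)"
   unfolding C_def
  proof (rule compare[OF m s0 Ek[of k], of "Ek l" "\<eta> k + \<eta> l" "%t j. pd j (Ek l t)" T "W k" "V l" "f k" "f l"])
   show "AE x in lborel. norm (Ek k t x - Ek l t x) <= \<eta> k + \<eta> l" for t
    using Ed(1)[of k t] Ed(1)[of l t]
   proof eventually_elim
    case (elim x) thus ?case using norm_triangle_ineq4[of "Ek k t x - E t x" "Ek l t x - E t x"] by simp
   qed
   show "AE x in lborel. norm (pd j (Ek k t) x - pd j (Ek l t) x) <= \<eta> k + \<eta> l" for t j
    using Ed(2)[of j k t] Ed(2)[of j l t]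
   proof eventually_elim
    case (elim x) thus ?case using norm_triangle_ineq4[of "pd j (Ek k t) x - e t j x" "pd j (Ek l t) x - e t j x"] by simp
   qed
   show "weak_deriv_on T (%t. cl (W k t)) (f k) \<psi>" "weak_deriv_on T (V l) (f l) \<psi>" for \<psi>
    unfolding VW[symmetric] by (rule has_vector_derivative_weak, erule Vd)+
  qed (use Ekb Ekm \<eta>(2) hW NW HV NV Kr(2) t in "simp_all add: VW add.commute")
  also have "... <= C s * (c s * (\<omega> k + \<omega> l))"
  proof (intro mult_left_mono)
   let ?a = "norm (J (eps k) v0 - v0)" and ?d = "norm (J (eps l) v0 - v0)" and ?n = "norm (J (eps k) v0 - J (eps l) v0)"
   have "?n <= ?a + ?d" using norm_triangle_ineq4[of "J (eps k) v0 - v0" "J (eps l) v0 - v0"] by simp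
   moreover have "?n <= 2 * s" using norm_triangle_ineq4[of "J (eps k) v0" "J (eps l) v0"] init[of k] init[of l] by linarith
   ultimately have "?n^2 <= 2 * s * (?a + ?d)" unfolding power2_eq_square by (intro mult_mono) (use s0 in auto)
   moreover have "cl (W k 0) - V l 0 = J (eps k) v0 - J (eps l) v0" by (simp add: VW[symmetric] V_def z(1))
   ultimately show "(norm (cl (W k 0) - V l 0))^2 + 4 * s * (real CARD('n) * (2 * KS * (\<eta> k + \<eta> l) * s) + Kr * eps k + Kr * eps l) * T <= c s * (\<omega> k + \<omega> l)"
    using bound[OF s0, of "\<eta> k + \<eta> l" "eps k" "eps l" ?a ?d] \<eta>(2)
    by (simp add: \<omega>_def less_imp_le add_ac)
  qed (use Cpos[of s] in simp)
  finally show ?thesis by (simp add: VW)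
 qed
 have conv: "convergent (%k. V k t)" if t: "t \<in> {0..T}" for t
 proof -
  have "Cauchy (%k. V k t)"
  proof (rule metric_CauchyI)
   fix r :: real assume r: "r > 0"
   have "(%k. C s * (c s * (\<omega> k + \<omega> k))) \<longlonglongrightarrow> C s * (c s * (0 + 0))" by (intro tendsto_intros \<omega>)
   have "(%k. C s * (c s * \<omega> k)) \<longlonglongrightarrow> C s * (c s * 0)" by (intro tendsto_intros \<omega>)
   hence "\<forall>\<^sub>F k in sequentially. C s * (c s * \<omega> k) < r^2 / 2" using r by (intro order_tendstoD) auto
   then obtain N where N: "!!k. k >= N ==> C s * (c s * \<omega> k) < r^2 / 2" unfolding eventually_sequentially by blast
   have "dist (V k t) (V l t) < r" if "k >= N" "l >= N" for k l
   proof -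
    have "(norm (V k t - V l t))^2 < r^2" using cauchy[OF t, of k l] N[OF that(1)] N[OF that(2)] by (simp add: distrib_left)
    thus ?thesis using r by (simp add: dist_norm power2_less_imp_less)
   qed
   thus "EX N. \<forall>k\<ge>N. \<forall>l\<ge>N. dist (V k t) (V l t) < r" by blast
  qed
  thus ?thesis by (rule Cauchy_convergent)
 qed
 define U where "U t = lim (%k. V k t)" for t
 have U: "(%k. V k t) \<longlonglongrightarrow> U t" if "t \<in> {0..T}" for t using conv[OF that] by (simp add: U_def convergent_LIMSEQ_iff)
 define \<tau> where "\<tau> k = sqrt (C s * (c s * \<omega> k))" for k
 have \<tau>: "\<tau> \<longlonglongrightarrow> 0"
 proof -
  have "\<tau> \<longlonglongrightarrow> sqrt (C s * (c s * 0))" unfolding \<tau>_def by (intro tendsto_intros \<omega>)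
  thus ?thesis by simp
 qed
 have VU: "norm (V k t - U t) <= \<tau> k" if t: "t \<in> {0..T}" for k t
 proof -
  have "(%l. (norm (V k t - V l t))^2) \<longlonglongrightarrow> (norm (V k t - U t))^2" by (intro tendsto_intros U t)
  moreover have "(%l. C s * (c s * (\<omega> k + \<omega> l))) \<longlonglongrightarrow> C s * (c s * (\<omega> k + 0))" by (intro tendsto_intros \<omega>)
  ultimately have "(norm (V k t - U t))^2 <= C s * (c s * (\<omega> k + 0))"
   by (rule LIMSEQ_le) (use cauchy[OF t] in blast)
  thus ?thesis unfolding \<tau>_def by (intro real_le_rsqrt) simp
 qed
 have HU: "Hs m (U t)" and NU2: "(Nm m (U t))^2 <= (Nm m v0)^2 + growth m M R * t" if t: "t \<in> {0..T}" for t
  using Hs_weak_compact(1,2)[OF U[OF t] HV z(3)[OF t, folded V_def]] by auto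
 have NU: "Nm m (U t) <= s" if t: "t \<in> {0..T}" for t
  using order_trans[OF NU2[OF t] v0s[OF t]] s0 by (rule power2_le_imp_le)
 define b where "b = max (max B M) (sob_const TYPE('n) * s)"
 have b: "B <= b" "M <= b" "sob_const TYPE('n) * s <= b" "b >= 0" using bd(4) by (auto simp: b_def)
 note Eb = background_le[OF bg b(1,2)]
 \<comment> \<open>The square root comes from interpolation: first derivatives of V k - U are
   controlled by the L^2 distance times bounded second derivatives.\<close>
 define q where "q k = KS * (2 * b) * (real CARD('n) * sqrt (\<tau> k * (2 * s))) + (real CARD('n) * (2 * KS * b * \<tau> k + 2 * KS * \<eta> k * s) + KG * \<tau> k)" for k
 have q: "q \<longlonglongrightarrow> 0"
 proof -
  have "q \<longlonglongrightarrow> KS * (2 * b) * (real CARD('n) * sqrt (0 * (2 * s))) + (real CARD('n) * (2 * KS * b * 0 + 2 * KS * 0 * s) + KG * 0)"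
   unfolding q_def by (intro tendsto_intros \<tau> \<eta>(1))
  thus ?thesis by simp
 qed
 have FU: "norm (FF (Ek k t) (%j. pd j (Ek k t)) (V k t) - FF (E t) (e t) (U t)) <= q k" if t: "t \<in> {0..T}" for k t
 proof -
  have dd: "norm (dv [j] (V k t) - dv [j] (U t)) <= sqrt (\<tau> k * (2 * s))" for j
  proof (rule real_le_rsqrt)
   have H: "Hs 2 (V k t)" "Hs 2 (U t)" using Hs_mono[OF HU[OF t]] HV m by auto
   have "norm (dv [j,j] (V k t - U t)) <= norm (dv [j,j] (V k t)) + norm (dv [j,j] (U t))"
    using dv_diff[OF H, of "[j,j]"] norm_triangle_ineq4 by simp
   also have "... <= 2 * s"
    using order_trans[OF norm_le_Nm[of "[j,j]" m] NV[OF t, of k]] order_trans[OF norm_le_Nm[of "[j,j]" m] NU[OF t]] m by simp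
   finally have "norm (dv [j,j] (V k t - U t)) <= 2 * s" .
   hence "norm (V k t - U t) * norm (dv [j,j] (V k t - U t)) <= \<tau> k * (2 * s)"
    by (intro mult_mono[OF VU[OF t]]) (use order_trans[OF norm_ge_zero VU[OF t, of k]] in auto)
   thus "(norm (dv [j] (V k t) - dv [j] (U t)))^2 <= \<tau> k * (2 * s)"
    using Hs_interpolate[OF Hs_diff[OF H], of j] dv_diff[OF H, of "[j]"] by simp
  qed
  have "norm (FF (Ek k t) (%j. pd j (Ek k t)) (V k t) - FF (E t) (e t) (U t)) <=
   KS * (2 * b) * (\<Sum>j\<in>UNIV. norm (dv [j] (V k t) - dv [j] (U t)))
   + (real CARD('n) * (2 * KS * b * norm (V k t - U t) + 2 * KS * \<eta> k * s) + KG * norm (V k t - U t))"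
   by (rule FF_diff[OF Ekm(1) _ Eb(1,2) Ed(1) Ekm(2) _ Eb(3,4) Ed(2) b(4) \<eta>(2)
      FF_norm_Nm(2)[OF m HV NV[OF t] Eb b(3) s0] FF_norm_Nm(3)[OF m HU[OF t] NU[OF t] Eb b(3) s0]])
    (use order_trans[OF Ekb(2) b(1)] order_trans[OF Ekb(3) b(2)] order_trans[OF norm_le_Nm NU[OF t]] order_trans[OF norm_le_Nm0 NU[OF t]] m in auto)
  also have "... <= KS * (2 * b) * (\<Sum>j\<in>(UNIV::'n set). sqrt (\<tau> k * (2 * s)))
   + (real CARD('n) * (2 * KS * b * \<tau> k + 2 * KS * \<eta> k * s) + KG * \<tau> k)"
   using KS(1) KG(1) b(4) by (intro add_mono mult_left_mono sum_mono dd VU[OF t] order_refl) auto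
  finally show ?thesis by (simp add: q_def)
 qed
 have U0: "U 0 = v0"
 proof -
  have "(%k. V k 0) \<longlonglongrightarrow> v0" unfolding V_def z(1) by (rule J_eps_tendsto)
  thus ?thesis using LIMSEQ_unique U[of 0] T0 by auto
 qed
 have Ud: "(U has_vector_derivative - FF (E t) (e t) (U t)) (at t within {0..T})" if t: "t \<in> {0..T}" for t
 proof (rule vector_derivative_limit[OF Vd _ _ U t])
  have "(%k. Kr * eps k + q k) \<longlonglongrightarrow> Kr * 0 + 0" by (intro tendsto_intros q eps_tendsto)
  thus "(%k. Kr * eps k + q k) \<longlonglongrightarrow> 0" by simp
  fix k t assume t: "t \<in> {0..T}"
  show "norm (f k t - - FF (E t) (e t) (U t)) <= Kr * eps k + q k"
   using norm_triangle_ineq4[of "FF (Ek k t) (%j. pd j (Ek k t)) (V k t) + f k t" "FF (Ek k t) (%j. pd j (Ek k t)) (V k t) - FF (E t) (e t) (U t)"]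
    Kr(2)[OF t, of k] FU[OF t, of k] by (simp add: algebra_simps)
 qed
 \<comment> \<open>The competitor is compared with the smooth approximations and not with
   \<open>U\<close>, which lacks the smoothness required in the first place of
   \<open>compare\<close>; then k tends to infinity.\<close>
 have uniq: "V' t = U t" if T': "T' <= T" and V0: "V' 0 = v0" and V': "\<forall>t\<in>{0..T'}. Hs m (V' t) & Nm m (V' t) <= s1"
  and wd: "\<forall>\<psi>. weak_deriv_on T' V' (%t. - FF (E t) (e t) (V' t)) \<psi>" and t: "t \<in> {0..T'}" for s1 T' V' t
 proof -
  define s' where "s' = max s s1"
  have s': "s <= s'" "s1 <= s'" "0 <= s'" using s0 by (auto simp: s'_def)
  have V's: "\<forall>t\<in>{0..T'}. Hs m (V' t) & Nm m (V' t) <= s'" using V' s'(2) by force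
  have sub: "x \<in> {0..T}" if "x \<in> {0..T'}" for x using that T' by auto
  have "(norm (V k t - V' t))^2 <= C s' * (c s' * \<omega> k)" for k
  proof -
   have "(norm (cl (W k t) - V' t))^2 <= exp (2 * (real CARD('n) * (3 * KS * (sob_const TYPE('n) * s' + M + B))) * T') *
    ((norm (cl (W k 0) - V' 0))^2 + 4 * s' * (real CARD('n) * (2 * KS * \<eta> k * s') + Kr * eps k + 0) * T')"
   proof (rule compare[OF m s'(3) Ek[of k] Em(1) bd(1) Ed(1) Em(2) bd(2) Ed(2) \<eta>(2), of T' "W k" V' "f k" "%t. - FF (E t) (e t) (V' t)"])
    show "weak_deriv_on T' (%t. cl (W k t)) (f k) \<psi>" for \<psi>
     unfolding VW[symmetric] by (rule weak_deriv_on_subset[OF has_vector_derivative_weak T'], erule Vd)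
    show "norm (f k t + FF (Ek k t) (%j. pd j (Ek k t)) (cl (W k t))) <= Kr * eps k" if "t \<in> {0..T'}" for t
     using Kr(2)[OF sub[OF that], of k] by (simp add: VW add.commute)
    show "hn m (W k t) <= s'" if "t \<in> {0..T'}" for t using NW[OF sub[OF that], of k] s' by simp
   qed (use wd V's s' hW t in auto)
   also have "... <= C s' * ((norm (cl (W k 0) - V' 0))^2 + 4 * s' * (real CARD('n) * (2 * KS * \<eta> k * s') + Kr * eps k + 0) * T)"
    unfolding C_def
   proof (rule exp_factor_mono[OF _ _ T'])
    have "0 <= sob_const TYPE('n) * s' + M + B" using s'(3) bd(3,4) order_trans[OF zero_le_one sob_const_ge[where 'n='n]] by simp
    thus "0 <= 2 * (real CARD('n) * (3 * KS * (sob_const TYPE('n) * s' + M + B)))" using KS(1) KG(1) by simp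
    have "0 <= KS * \<eta> k * s'" "0 <= Kr * eps k" using KS(1) KG(1) \<eta>(2)[of k] s'(3) Kr(1) by (simp_all add: less_imp_le)
    thus "0 <= 4 * s' * (real CARD('n) * (2 * KS * \<eta> k * s') + Kr * eps k + 0)" using s'(3) by (simp add: mult.assoc)
   qed (use t in auto)
   also have "... <= C s' * (c s' * \<omega> k)"
   proof (intro mult_left_mono)
    let ?a = "norm (J (eps k) v0 - v0)"
    have "?a <= 2 * s" using norm_triangle_ineq4[of "J (eps k) v0" v0] init[of k] NU[of 0] U0 T0 norm_le_Nm0[of v0 m] by simp
    hence "?a^2 <= 2 * s * ?a" unfolding power2_eq_square by (intro mult_right_mono) auto
    moreover have "cl (W k 0) - V' 0 = J (eps k) v0 - v0" by (simp add: VW[symmetric] V_def z(1) V0)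
    ultimately show "(norm (cl (W k 0) - V' 0))^2 + 4 * s' * (real CARD('n) * (2 * KS * \<eta> k * s') + Kr * eps k + 0) * T <= c s' * \<omega> k"
     using bound[OF s'(3), of "\<eta> k" "eps k" 0 ?a 0] \<eta>(2)
     by (simp add: \<omega>_def less_imp_le add_ac)
   qed (use Cpos[of s'] in simp)
   finally show ?thesis by (simp add: VW)
  qed
  moreover have "(%k. C s' * (c s' * \<omega> k)) \<longlonglongrightarrow> C s' * (c s' * 0)" by (intro tendsto_intros \<omega>)
  moreover have "(%k. (norm (V k t - V' t))^2) \<longlonglongrightarrow> (norm (U t - V' t))^2" by (intro tendsto_intros U sub t)
  ultimately have "(norm (U t - V' t))^2 <= C s' * (c s' * 0)" by (intro LIMSEQ_le) auto
  thus ?thesis by simp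
 qed
 show ?thesis using U0 HU NU2 Ud uniq by (intro exI[of _ U] conjI ballI allI impI) blast+
qed

end

section \<open>Growth of the norm, time reversal and continuity in the Sobolev norm\<close>

context sym_system
begin

text \<open>The construction gives the bound for one solution, and uniqueness identifies every other
  solution with it.\<close>

lemma solution_growth:
 assumes m: "m >= 3" and bg: "background m M B E e" and R: "Nm m (V 0) <= R" and T: "0 <= T" "T <= life m M R"
  and H: "!!t. t \<in> {0..T} ==> Hs m (V t) & Nm m (V t) <= s"
  and wd: "!!\<psi>. weak_deriv_on T V (%t. - FF (E t) (e t) (V t)) \<psi>" and t: "t \<in> {0..T}"
 shows "(Nm m (V t))^2 <= (Nm m (V 0))^2 + growth m M R * t"
proof -
 have "Hs m (V 0)" using H[of 0] T by simp
 from local_existence[OF m bg this R refl] obtain U where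
  "\<forall>t\<in>{0..life m M R}. (Nm m (U t))^2 <= (Nm m (V 0))^2 + growth m M R * t"
  "\<forall>t\<in>{0..T}. V t = U t" using T H wd by blast
 thus ?thesis using t T by auto
qed

text \<open>Reversing time replaces F by -F, which has the same structure; so the growth bound also
  holds backwards in time.\<close>

lemma reversed_system: "sym_system (%j a b. - S j a b) (%a. - G a)"
proof (rule sym_system.intro)
 show "bounded_bilinear (%a b. - S j a b)" for j
  by (intro bounded_bilinear.intro)
   (auto simp: bounded_bilinear.add_left[OF S_bil] bounded_bilinear.add_right[OF S_bil]
    bounded_bilinear.scaleR_left[OF S_bil] bounded_bilinear.scaleR_right[OF S_bil]
    intro: bounded_bilinear.bounded[OF S_bil[of j]])
 show "(- S j u v) \<bullet> w = v \<bullet> (- S j u w)" for j u v w using S_sym[of j u v w] by simp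
 show "bounded_linear (%a. - G a)" by (rule bounded_linear_minus[OF G_lin])
 show "v \<bullet> - G v = 0" for v using G_skew[of v] by simp
qed (rule dim)

lemma FF_sqi:
 assumes bg: "background m M B E e" and v: "Hs m v" "m >= 3"
 shows "sqi (FFf (E t) (e t) (rp v) (%j. rp (dv [j] v)))"
proof -
 define b where "b = max (max B M) (sob_const TYPE('n) * Nm m v)"
 have b: "B <= b" "M <= b" "sob_const TYPE('n) * Nm m v <= b" "b >= 0" using background_bounds(4)[OF bg] by (auto simp: b_def)
 note E = background_le[OF bg b(1,2)]
 show ?thesis
  by (rule FFf_sqi[OF E b(4)]) (use FF_norm_Nm(2)[OF v(2,1) order_refl E b(3)] in auto)
qed

lemma FF_reversed:
 assumes bg: "background m M B E e" and v: "Hs m v" "m >= 3"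
 shows "sym_system.FF (%j a b. - S j a b) (%a. - G a) (E t) (e t) v = - FF (E t) (e t) v"
proof -
 have "sym_system.FFf (%j a b. - S j a b) (%a. - G a) (E t) (e t) (rp v) (%j. rp (dv [j] v)) =
   (%x. - FFf (E t) (e t) (rp v) (%j. rp (dv [j] v)) x)"
  by (rule ext) (simp add: sym_system.FFf_def[OF reversed_system] FFf_def sum_negf[symmetric])
 thus ?thesis using FF_sqi[OF assms] by (simp add: sym_system.FF_def[OF reversed_system] FF_def cl_minus)
qed

lemma vector_derivative_reparam:
 fixes V :: "real => 'h::real_normed_vector"
 assumes der: "!!t. t \<in> {0..T} ==> (V has_vector_derivative f t) (at t within {0..T})"
  and s: "s \<in> {0..T'}" and sub: "!!s. s \<in> {0..T'} ==> t0 + \<sigma> * s \<in> {0..T}"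
 shows "((%s. V (t0 + \<sigma> * s)) has_vector_derivative \<sigma> *\<^sub>R f (t0 + \<sigma> * s)) (at s within {0..T'})"
proof -
 have "((%s. t0 + \<sigma> * s) has_vector_derivative \<sigma>) (at s within {0..T'})"
  by (auto intro!: derivative_eq_intros simp flip: has_real_derivative_iff_has_vector_derivative)
 moreover have "(V has_vector_derivative f (t0 + \<sigma> * s)) (at (t0 + \<sigma> * s) within (%s. t0 + \<sigma> * s) ` {0..T'})"
  by (rule has_vector_derivative_within_subset[OF der[OF sub[OF s]]]) (use sub in auto)
 ultimately show ?thesis using vector_diff_chain_within by (fastforce simp: o_def)
qed

theorem well_posed:
 fixes E :: "real => real^'n => 'b"
 assumes m: "m >= 3" and bg: "background m M B E e" and v0: "Hs m v0" "Nm m v0 <= R" and T: "0 < T" "T <= life m M R"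
 shows "EX V. V 0 = v0 & (\<forall>t\<in>{0..T}. Hs m (V t) & (Nm m (V t))^2 <= R^2 + 1
   & (V has_vector_derivative - FF (E t) (e t) (V t)) (at t within {0..T})
   & ((%s. Nm m (V s - V t)) \<longlongrightarrow> 0) (at t within {0..T})) &
  (ALL s V'. V' 0 = v0 --> (\<forall>t\<in>{0..T}. Hs m (V' t) & Nm m (V' t) <= s) -->
   (\<forall>\<psi>. weak_deriv_on T V' (%t. - FF (E t) (e t) (V' t)) \<psi>) --> (\<forall>t\<in>{0..T}. V' t = V t))"
proof -
 note M0 = background_bounds(3)[OF bg]
 interpret rev: sym_system "%j a b. - S j a b" "%a. - G a" by (rule reversed_system)
 obtain V where V0: "V 0 = v0" and V': "\<forall>t\<in>{0..life m M R}. Hs m (V t) & (Nm m (V t))^2 <= (Nm m v0)^2 + growth m M R * t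
   & (V has_vector_derivative - FF (E t) (e t) (V t)) (at t within {0..life m M R})"
  and uniq: "ALL s T' V'. T' <= life m M R --> V' 0 = v0 --> (\<forall>t\<in>{0..T'}. Hs m (V' t) & Nm m (V' t) <= s) -->
   (\<forall>\<psi>. weak_deriv_on T' V' (%t. - FF (E t) (e t) (V' t)) \<psi>) --> (\<forall>t\<in>{0..T'}. V' t = V t)"
  using local_existence[OF m bg v0 refl] by blast
 have V: "Hs m (V t)" "(Nm m (V t))^2 <= R^2 + 1" "(V has_vector_derivative - FF (E t) (e t) (V t)) (at t within {0..T})" if t: "t \<in> {0..T}" for t
 proof -
  have t': "t \<in> {0..life m M R}" using t T by auto
  show "Hs m (V t)" using V' t' by blast
  show "(V has_vector_derivative - FF (E t) (e t) (V t)) (at t within {0..T})"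
   by (rule has_vector_derivative_within_subset[of V _ t "{0..life m M R}"]) (use V' t' T in auto)
  have "(Nm m v0)^2 <= R^2" using v0(2) by (intro power_mono) auto
  moreover have "growth m M R * t <= growth m M R * life m M R" using t' growth_nonneg[OF M0] by (intro mult_left_mono) auto
  ultimately show "(Nm m (V t))^2 <= R^2 + 1" using V' t' growth_life[OF M0, of m R] by fastforce
 qed
 define R' where "R' = sqrt (R^2 + 1)"
 have VR: "Nm m (V t) <= R'" if "t \<in> {0..T}" for t using V(2)[OF that] by (simp add: R'_def real_le_rsqrt)
 \<comment> \<open>The norm is at most R' at all times, so this one step length serves for restarts
   from every time and in both directions.\<close>
 define d where "d = min (life m M R') (rev.life m M R')"
 have d: "d > 0" "d <= life m M R'" "d <= rev.life m M R'" using life_pos[OF M0] rev.life_pos[OF M0] by (auto simp: d_def)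
 define g where "g = max (growth m M R') (rev.growth m M R')"
 have near: "(Nm m (V s))^2 <= (Nm m (V t))^2 + g * \<bar>s - t\<bar>" if s: "s \<in> {0..T}" and t: "t \<in> {0..T}" and st: "\<bar>s - t\<bar> <= d" for s t
 proof (cases "t <= s")
  case True
  have sub: "t + 1 * r \<in> {0..T}" if "r \<in> {0..s - t}" for r using that s t by auto
  have "(Nm m (V (t + 1 * (s - t))))^2 <= (Nm m (V (t + 1 * 0)))^2 + growth m M R' * (s - t)"
  proof (rule solution_growth[OF m background_reparam[OF _ bg, of 1 t], where V="%r. V (t + 1 * r)" and T="s - t"])
   show "weak_deriv_on (s - t) (%r. V (t + 1 * r)) (%r. - FF (E (t + 1 * r)) (e (t + 1 * r)) (V (t + 1 * r))) \<psi>" for \<psi>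
    by (rule has_vector_derivative_weak)
     (use vector_derivative_reparam[OF V(3) _ sub] in "simp only: scaleR_one")
  qed (use VR[OF sub] VR[OF t] V(1)[OF sub] True st d in auto)
  moreover have "growth m M R' * (s - t) <= g * (s - t)" using True by (intro mult_right_mono) (auto simp: g_def)
  ultimately show ?thesis using True by simp
 next
  case False
  have sub: "t + (-1) * r \<in> {0..T}" if "r \<in> {0..t - s}" for r using that s t by auto
  have "(Nm m (V (t + (-1) * (t - s))))^2 <= (Nm m (V (t + (-1) * 0)))^2 + rev.growth m M R' * (t - s)"
  proof (rule rev.solution_growth[OF m background_reparam[OF _ bg, of "-1" t], where V="%r. V (t + (-1) * r)" and T="t - s"])
   show "weak_deriv_on (t - s) (%r. V (t + (-1) * r)) (%r. - rev.FF (E (t + (-1) * r)) (e (t + (-1) * r)) (V (t + (-1) * r))) \<psi>" for \<psi>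
   proof (rule has_vector_derivative_weak)
    fix r assume r: "r \<in> {0..t - s}"
    show "((%r. V (t + (-1) * r)) has_vector_derivative - rev.FF (E (t + (-1) * r)) (e (t + (-1) * r)) (V (t + (-1) * r))) (at r within {0..t - s})"
     using vector_derivative_reparam[OF V(3) r sub] unfolding FF_reversed[OF bg V(1)[OF sub[OF r]] m] by simp
   qed
  qed (use VR[OF sub] VR[OF t] V(1)[OF sub] False st d in auto)
  moreover have "rev.growth m M R' * (t - s) <= g * (t - s)" using False by (intro mult_right_mono) (auto simp: g_def)
  moreover have "t + (-1) * (t - s) = s" "t + (-1) * 0 = t" "\<bar>s - t\<bar> = t - s" using False by auto
  ultimately show ?thesis by (simp only:)
 qed
 have cont: "((%s. Nm m (V s - V t)) \<longlongrightarrow> 0) (at t within {0..T})" if t: "t \<in> {0..T}" for t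
  unfolding tendsto_at_iff_sequentially
 proof (intro allI impI)
  fix X assume X: "ALL i. X i \<in> {0..T} - {t}" "X \<longlonglongrightarrow> t"
  have Xi: "X i \<in> {0..T}" for i using X(1) by blast
  have "(V \<longlongrightarrow> V t) (at t within {0..T})"
   using has_vector_derivative_continuous[OF V(3)[OF t]] by (simp add: continuous_within)
  hence VX: "(%i. V (X i)) \<longlonglongrightarrow> V t" using X unfolding tendsto_at_iff_sequentially o_def by blast
  have w: "(%i. dv is (V (X i)) \<bullet> x) \<longlonglongrightarrow> dv is (V t) \<bullet> x" if "length is <= m" for "is" x
   by (rule Hs_weak_compact(3)[OF VX V(1)[OF Xi] V(2)[OF Xi] that])
  have expand: "(Nm m (V (X i) - V t))^2 = (Nm m (V (X i)))^2 + (Nm m (V t))^2 - 2 * (\<Sum>is\<in>lists_le m. dv is (V (X i)) \<bullet> dv is (V t))" for i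
  proof -
   have "(norm (dv is (V (X i) - V t)))^2 = (norm (dv is (V (X i))))^2 + (norm (dv is (V t)))^2 - 2 * (dv is (V (X i)) \<bullet> dv is (V t))" if "is \<in> lists_le m" for "is"
    using dv_diff[OF V(1)[OF Xi] V(1)[OF t], of "is" i] that dot_norm_neg[of "dv is (V (X i))" "dv is (V t)"]
    by (simp add: lists_le_def)
   thus ?thesis by (simp add: Nm_sq sum.distrib sum_subtractf sum_distrib_left)
  qed
  \<comment> \<open>\<open>near\<close> bounds the norm at \<open>X i\<close> from above by the norm
    at t and a small error, and the mixed terms converge weakly; the right side tends to 2 |V t|^2 -
    2 |V t|^2 = 0.\<close>
  have le: "\<forall>\<^sub>F i in sequentially. (Nm m (V (X i) - V t))^2 <= 2 * (Nm m (V t))^2 + g * \<bar>X i - t\<bar> - 2 * (\<Sum>is\<in>lists_le m. dv is (V (X i)) \<bullet> dv is (V t))"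
  proof -
   have "\<forall>\<^sub>F i in sequentially. dist (X i) t < d" using X(2) d(1) by (rule tendstoD)
   thus ?thesis by eventually_elim (use near[OF Xi t] in "simp add: expand dist_real_def")
  qed
  have "(%i. 2 * (Nm m (V t))^2 + g * \<bar>X i - t\<bar> - 2 * (\<Sum>is\<in>lists_le m. dv is (V (X i)) \<bullet> dv is (V t)))
   \<longlonglongrightarrow> 2 * (Nm m (V t))^2 + g * \<bar>t - t\<bar> - 2 * (\<Sum>is\<in>lists_le m. dv is (V t) \<bullet> dv is (V t))"
   by (intro tendsto_intros X w) (simp add: lists_le_def)
  hence lim: "(%i. 2 * (Nm m (V t))^2 + g * \<bar>X i - t\<bar> - 2 * (\<Sum>is\<in>lists_le m. dv is (V (X i)) \<bullet> dv is (V t))) \<longlonglongrightarrow> 0"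
   by (simp add: Nm_sq power2_norm_eq_inner)
  have "(%i. (Nm m (V (X i) - V t))^2) \<longlonglongrightarrow> 0" by (rule tendsto_sandwich[OF _ le tendsto_const lim]) simp
  hence "(%i. sqrt ((Nm m (V (X i) - V t))^2)) \<longlonglongrightarrow> sqrt 0" by (rule tendsto_real_sqrt)
  thus "((%s. Nm m (V s - V t)) \<circ> X) \<longlonglongrightarrow> 0" by (simp add: o_def)
 qed
 show ?thesis using V0 V cont uniq T(2) by (intro exI[of _ V] conjI ballI allI impI) blast+
qed

end

section \<open>Sobolev functions and their classes\<close>

text \<open>The link between the functions of the statement and their classes; \<open>f\<close> may
  be merely Lebesgue measurable.\<close>

definition rep :: "('a::euclidean_space => 'b::euclidean_space) => ('a, 'b) l2 => bool" where
 "rep f u \<longleftrightarrow> (AE x in lebesgue. f x = rp u x)"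

lemma rep_rp [simp]: "rep (rp u) u" by (simp add: rep_def)

lemma rep_lborel: "rep f u \<longleftrightarrow> (AE x in lborel. f x = rp u x)" by (simp add: rep_def AE_completion_iff)

lemma rep_cl: "sqi f ==> rep f (cl f)" using rp_cl[of f] by (simp add: rep_lborel eq_commute)

lemma rep_unique: "rep f u ==> rep f v ==> u = v"
 unfolding rep_lborel by (rule l2_eqI) (auto elim: eventually_elim2)

lemma rep_diff: assumes "rep f u" "rep g v" shows "rep (%x. f x - g x) (u - v)"
 using assms rp_diff[of u v] unfolding rep_lborel by eventually_elim simp

lemma rep_cong: assumes "rep f u" "AE x in lebesgue. f x = g x" shows "rep g u"
 using assms unfolding rep_def by eventually_elim simp

lemma lebesgue_measurable_rp [measurable]: "rp u \<in> borel_measurable lebesgue"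
 by (rule measurable_completion) simp

lemma rep_measurable: "rep f u ==> f \<in> borel_measurable lebesgue"
 unfolding rep_def by (rule borel_measurable_AE[OF lebesgue_measurable_rp]) (auto elim: eventually_mono)

lemma borel_representative:
 fixes f :: "'a::euclidean_space => 'b::euclidean_space"
 assumes f: "f \<in> borel_measurable lebesgue"
 shows "\<exists>g\<in>borel_measurable borel. AE x in lborel. f x = g x"
proof -
 have "ALL b. \<exists>g\<in>borel_measurable lborel. AE x in lborel. f x \<bullet> b = g x"
  using f by (intro allI completion_ex_borel_measurable_real borel_measurable_inner) auto
 then obtain g where g: "!!b. g b \<in> borel_measurable lborel" "!!b. AE x in lborel. f x \<bullet> b = g b x" by metis
 have "AE x in lborel. \<forall>b\<in>Basis. f x \<bullet> b = g b x" by (rule AE_finite_allI) (use g in auto)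
 hence "AE x in lborel. f x = (\<Sum>b\<in>Basis. g b x *\<^sub>R b)"
 proof eventually_elim
  case (elim x)
  hence "(\<Sum>b\<in>Basis. g b x *\<^sub>R b) = (\<Sum>b\<in>Basis. (f x \<bullet> b) *\<^sub>R b)" by (intro sum.cong) auto
  thus ?case by (simp only: euclidean_representation)
 qed
 moreover have "bmeas (%x. \<Sum>b\<in>Basis. g b x *\<^sub>R b)"
  using g(1) by (intro borel_measurable_sum borel_measurable_scaleR borel_measurable_const) simp
 ultimately show ?thesis by (rule bexI[where x="%x. \<Sum>b\<in>Basis. g b x *\<^sub>R b"])
qed

lemma square_integrable_rep: "square_integrable f \<longleftrightarrow> (EX u. rep f u)"
proof
 assume f: "square_integrable f"
 then obtain g where [measurable]: "bmeas g" and g: "AE x in lborel. f x = g x"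
  using borel_representative unfolding square_integrable_def by blast
 have ae: "AE x in lebesgue. (norm (f x))^2 = (norm (g x))^2" using AE_completion[OF g] by eventually_elim simp
 have "integrable lebesgue (%x. (norm (g x))^2)"
  by (rule integrable_cong_AE_imp[OF conjunct2[OF f[unfolded square_integrable_def]] _ ae]) (simp add: measurable_completion)
 hence "sqi g" by (simp add: sqi_def integrable_completion)
 from g rp_cl[OF this] have "AE x in lborel. f x = rp (cl g) x" by eventually_elim simp
 thus "EX u. rep f u" unfolding rep_lborel by blast
next
 assume "EX u. rep f u"
 then obtain u where u: "rep f u" by blast
 have "integrable lebesgue (%x. (norm (rp u x))^2)" using sqi_rp[of u] by (simp add: sqi_def integrable_completion)
 hence "integrable lebesgue (%x. (norm (f x))^2)"
  by (rule integrable_cong_AE_imp) (use u rep_measurable[OF u] in "auto simp: rep_def elim!: eventually_mono")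
 thus "square_integrable f" using rep_measurable[OF u] by (simp add: square_integrable_def)
qed

lemma locally_integrable_cong:
 assumes "locally_integrable f" "AE x in lebesgue. f x = g x" shows "locally_integrable g"
 unfolding locally_integrable_def set_integrable_def
proof (intro allI impI)
 fix K :: "(real^'a) set" assume "compact K"
 hence i: "integrable lebesgue (%x. indicator K x *\<^sub>R f x)" using assms(1) by (auto simp: locally_integrable_def set_integrable_def)
 have ae: "AE x in lebesgue. indicator K x *\<^sub>R f x = indicator K x *\<^sub>R g x" using assms(2) by eventually_elim simp
 show "integrable lebesgue (%x. indicator K x *\<^sub>R g x)"
  by (rule integrable_cong_AE_imp[OF i borel_measurable_AE[OF borel_measurable_integrable[OF i] ae]]) (use ae in "auto elim: eventually_mono")
qed

lemma locally_integrable_linear: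
 assumes L: "bounded_linear L" and f: "locally_integrable f" shows "locally_integrable (%x. L (f x))"
 using f integrable_bounded_linear[OF L] unfolding locally_integrable_def set_integrable_def
 by (fastforce simp: linear_cmul[OF bounded_linear.linear[OF L]])

lemma locally_integrable_add:
 "locally_integrable f ==> locally_integrable g ==> locally_integrable (%x. f x + g x)"
 by (simp add: locally_integrable_def set_integral_add(1))

lemma locally_integrable_rep: assumes u: "rep f u" shows "locally_integrable f"
proof (rule locally_integrable_cong)
 show "AE x in lebesgue. rp u x = f x" using u by (auto simp: rep_def elim: eventually_mono)
 show "locally_integrable (rp u)" unfolding locally_integrable_def set_integrable_def
 proof (intro allI impI)
  fix K :: "(real^'a) set" assume K: "compact K"
  obtain r where r: "!!x. x \<in> K ==> norm x <= r" using compact_imp_bounded[OF K] by (auto simp: bounded_iff)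
  have [measurable]: "K \<in> sets borel" using K by (simp add: compact_imp_closed borel_closed)
  have "sqi (%x. indicator K x :: real)" by (rule cpt_bounded_sqi[of _ 1 r]) (use r in "force simp: indicator_def")+
  from sqi_bilinear_integrable[OF bounded_bilinear_scaleR this sqi_rp]
  show "integrable lebesgue (%x. indicator K x *\<^sub>R rp u x)" by (subst integrable_completion) auto
 qed
qed

lemma locally_integrable_measurable: assumes f: "locally_integrable f" shows "f \<in> borel_measurable lebesgue"
proof (rule borel_measurable_LIMSEQ_metric)
 fix n :: nat
 show "(%x. indicator (cball 0 (real n)) x *\<^sub>R f x) \<in> borel_measurable lebesgue"
  using f by (intro borel_measurable_integrable) (auto simp: locally_integrable_def set_integrable_def)
next
 fix x :: "real^'a"
 obtain N where N: "norm x <= real N" using real_arch_simple by blast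
 show "(%n. indicator (cball 0 (real n)) x *\<^sub>R f x) \<longlonglongrightarrow> f x"
  by (rule tendsto_eventually) (use N in "auto simp: eventually_sequentially indicator_def intro!: exI[of _ N] order_trans[OF N]")
qed

section \<open>Test functions and weak derivatives of Lebesgue measurable functions\<close>

lemma test_function_sqi: "test_function \<phi> ==> sqi \<phi>"
 by (intro kernel_sqi test_function_kernel)

lemma test_integrable:
 assumes \<phi>: "test_function \<phi>" and f: "locally_integrable f" shows "integrable lebesgue (%x. \<phi> x *\<^sub>R f x)"
proof -
 obtain r where r: "!!x. norm x > r ==> \<phi> x = 0" using test_function_radius[OF \<phi>] by blast
 obtain B where B: "!!x. \<bar>\<phi> x\<bar> <= B" using test_function_kernel[OF \<phi>] by (auto simp: kernel_def)
 have i: "integrable lebesgue (%x. B *\<^sub>R (indicator (cball 0 r) x *\<^sub>R f x))"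
  using f by (intro integrable_scaleR_right) (auto simp: locally_integrable_def set_integrable_def)
 show ?thesis
 proof (rule Bochner_Integration.integrable_bound[OF i])
  have "\<phi> \<in> borel_measurable lebesgue" by (rule measurable_completion) (use sqi_measurable[OF test_function_sqi[OF \<phi>]] in simp)
  thus "(%x. \<phi> x *\<^sub>R f x) \<in> borel_measurable lebesgue" using locally_integrable_measurable[OF f] by measurable
  have "norm (\<phi> x *\<^sub>R f x) <= norm (B *\<^sub>R (indicator (cball 0 r) x *\<^sub>R f x))" for x
   using r[of x] B[of x] by (cases "norm x <= r") (auto simp: indicator_def intro!: mult_right_mono)
  thus "AE x in lebesgue. norm (\<phi> x *\<^sub>R f x) <= norm (B *\<^sub>R (indicator (cball 0 r) x *\<^sub>R f x))" by simp
 qed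
qed

lemma test_integral_cong:
 assumes "locally_integrable f" "AE x in lebesgue. f x = g x" "test_function \<phi>"
 shows "(LINT x|lebesgue. \<phi> x *\<^sub>R f x) = (LINT x|lebesgue. \<phi> x *\<^sub>R g x)"
 by (rule integral_cong_AE)
  (use assms(2) borel_measurable_integrable[OF test_integrable[OF assms(3)]] assms(1) locally_integrable_cong[OF assms(1,2)] in "auto elim: eventually_mono")

lemma foldr_partial_deriv: "foldr partial_deriv is \<phi> = D is \<phi>"
 by (simp add: D_def partial_deriv_eq_pd)

definition pr :: "('a::euclidean_space => real) => ('a, 'b::euclidean_space) l2 => 'b" where
 "pr \<phi> u = (LINT x|lborel. \<phi> x *\<^sub>R rp u x)"

lemma pr_inner: assumes "sqi \<phi>" shows "pr \<phi> u \<bullet> c = u \<bullet> cl (%x. \<phi> x *\<^sub>R c)"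
proof -
 have s: "sqi (%x. \<phi> x *\<^sub>R c)" by (rule sqi_bounded_linear[OF bounded_linear_scaleR_left assms])
 have "pr \<phi> u \<bullet> c = (LINT x|lborel. (\<phi> x *\<^sub>R rp u x) \<bullet> c)" unfolding pr_def
  by (rule integral_inner_left[symmetric]) (rule sqi_bilinear_integrable[OF bounded_bilinear_scaleR assms sqi_rp])
 also have "... = (LINT x|lborel. rp u x \<bullet> (\<phi> x *\<^sub>R c))" by simp
 also have "... = cl (rp u) \<bullet> cl (%x. \<phi> x *\<^sub>R c)" by (rule inner_cl[symmetric, OF sqi_rp s])
 finally show ?thesis by simp
qed

lemma bounded_linear_pr: fixes \<phi> :: "'a::euclidean_space => real" assumes \<phi>: "sqi \<phi>" shows "bounded_linear (pr \<phi> :: ('a, 'b::euclidean_space) l2 => 'b)"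
proof (rule bounded_linear_intro[where K="norm (cl \<phi>)"])
 fix u v :: "('a, 'b) l2" and r :: real
 show "pr \<phi> (u + v) = pr \<phi> u + pr \<phi> v" "pr \<phi> (r *\<^sub>R u) = r *\<^sub>R pr \<phi> u"
  by (rule vector_eq_rdot[THEN iffD1], simp add: pr_inner[OF \<phi>] inner_add_left)+
 have "norm (pr \<phi> u) <= (LINT x|lborel. norm (\<phi> x) * norm (rp u x))"
  unfolding pr_def using integral_norm_bound[of lborel "%x. \<phi> x *\<^sub>R rp u x"] by simp
 also have "... <= norm (cl \<phi>) * norm u" using l2_inner_le[OF \<phi> sqi_rp[of u]] by simp
 finally show "norm (pr \<phi> u) <= norm u * norm (cl \<phi>)" by (simp add: mult.commute)
qed

lemma test_integral_pr:
 assumes u: "rep f u" and \<phi>: "test_function \<phi>" shows "(LINT x|lebesgue. \<phi> x *\<^sub>R f x) = pr \<phi> u"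
proof -
 have [measurable]: "bmeas \<phi>" by (rule sqi_measurable[OF test_function_sqi[OF \<phi>]])
 have "(LINT x|lebesgue. \<phi> x *\<^sub>R f x) = (LINT x|lebesgue. \<phi> x *\<^sub>R rp u x)"
  by (rule test_integral_cong[OF locally_integrable_rep[OF u] _ \<phi>]) (use u in "simp add: rep_def")
 thus ?thesis unfolding pr_def by (simp add: integral_completion)
qed

lemma integral_by_parts_list:
 fixes f :: "real^'n::finite => 'b::euclidean_space"
 assumes \<phi>: "test_function \<phi>"
 shows "h_inf f ==> (LINT x|lborel. D is \<phi> x *\<^sub>R f x) = (-1) ^ length is *\<^sub>R (LINT x|lborel. \<phi> x *\<^sub>R D is f x)"
proof (induction "is" arbitrary: f)
 case (Cons i js)
 have t: "test_function (D js \<phi>)" "test_function (pd i (D js \<phi>))" by (intro test_function_pd test_function_D \<phi>)+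
 have "(LINT x|lborel. D js \<phi> x *\<^sub>R pd i f x) = - (LINT x|lborel. pd i (D js \<phi>) x *\<^sub>R f x)"
  using h_inf_sqi[OF Cons.prems, of "[]"] h_inf_sqi[OF Cons.prems, of "[i]"] t h_inf_smooth[OF Cons.prems]
  by (intro integral_by_parts[OF bounded_bilinear_scaleR]) (auto simp: test_function_iff test_function_sqi)
 thus ?case using Cons.IH[OF h_inf_pd[OF Cons.prems, of i]] by (simp add: D_pd_commute[OF h_inf_smooth[OF Cons.prems]])
qed simp

lemma wd_pr:
 assumes w: "wd is u v" and \<phi>: "test_function \<phi>" shows "pr (D is \<phi>) u = (-1) ^ length is *\<^sub>R pr \<phi> v"
proof -
 have s: "sqi \<phi>" "sqi (D is \<phi>)" by (intro test_function_sqi test_function_D \<phi>)+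
 have eq: "pr (D is \<phi>) (J (eps k) u) = (-1) ^ length is *\<^sub>R pr \<phi> (J (eps k) v)" for k
 proof -
  have h: "h_inf (Jf (eps k) u)" by (rule h_inf_Jf) simp
  have "J (eps k) v = cl (D is (Jf (eps k) u))" using w by (simp add: wd_def cl_D_Jf)
  moreover have "pr \<psi> (cl g) = (LINT x|lborel. \<psi> x *\<^sub>R g x)" if "sqi g" "sqi \<psi>" for \<psi> :: "real^'a => real" and g :: "real^'a => 'b"
   unfolding pr_def by (rule integral_cong_AE)
    (use that rp_cl[OF that(1)] sqi_measurable[OF that(1)] sqi_measurable[OF that(2)] in "auto elim: eventually_mono")
  ultimately show ?thesis using integral_by_parts_list[OF \<phi> h, of "is"] h_inf_sqi[OF h, of "[]"] h_inf_sqi[OF h, of "is"] s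
   by (simp add: J_eq_Jf)
 qed
 have "(%k. pr (D is \<phi>) (J (eps k) u)) \<longlonglongrightarrow> pr (D is \<phi>) u"
  by (rule bounded_linear.tendsto[OF bounded_linear_pr[OF s(2)] J_eps_tendsto])
 moreover have "(%k. (-1) ^ length is *\<^sub>R pr \<phi> (J (eps k) v)) \<longlonglongrightarrow> (-1) ^ length is *\<^sub>R pr \<phi> v"
  by (intro tendsto_intros bounded_linear.tendsto[OF bounded_linear_pr[OF s(1)] J_eps_tendsto])
 ultimately show ?thesis unfolding eq by (rule LIMSEQ_unique)
qed

text \<open>From weak derivatives to \<open>wd\<close>, the test functions are y -> moll ep (x - y);
  their reflection contributes (-1)^length, which cancels the sign in the definition of weak
  derivatives. The converse is integration by parts for mollifications, in the limit
  (\<open>wd_pr\<close>).\<close>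

lemma has_weak_deriv_wd: assumes f: "rep f u" and g: "rep g v" shows "has_weak_deriv is f g \<longleftrightarrow> wd is u v"
proof
 assume w: "has_weak_deriv is f g"
 show "wd is u v" unfolding wd_def
 proof (intro allI impI)
  fix ep :: real assume e: "ep > 0"
  have "conv (D is (moll ep)) (rp u) x = conv (moll ep) (rp v) x" for x
  proof -
   let ?\<phi> = "%y. moll ep ((-1) *\<^sub>R y + x)"
   have t: "test_function ?\<phi>" by (rule test_function_affine[OF moll_test[OF e]]) simp
   have "pr (D is ?\<phi>) u = (-1) ^ length is *\<^sub>R pr ?\<phi> v"
    using w[unfolded has_weak_deriv_def foldr_partial_deriv, THEN conjunct2, THEN conjunct2, rule_format, OF t]
    unfolding test_integral_pr[OF f test_function_D[OF t]] test_integral_pr[OF g t] .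
   moreover have "pr (D is ?\<phi>) u = (-1) ^ length is *\<^sub>R conv (D is (moll ep)) (rp u) x"
   proof -
    have "D is ?\<phi> = (%y. (-1) ^ length is *\<^sub>R D is (moll ep) ((-1) *\<^sub>R y + x))"
     using moll_test[OF e, where 'n='a] by (intro D_affine) (simp add: test_function_iff)
    thus ?thesis unfolding pr_def conv_def by (simp only:) (simp flip: scaleR_scaleR)
   qed
   moreover have "pr ?\<phi> v = conv (moll ep) (rp v) x" by (simp add: pr_def conv_def)
   ultimately show ?thesis by simp
  qed
  hence "conv (D is (moll ep)) (rp u) = conv (moll ep) (rp v)" by blast
  thus "cv (D is (moll ep)) u = J ep v" by (simp add: cv_def)
 qed
next
 assume "wd is u v"
 thus "has_weak_deriv is f g" unfolding has_weak_deriv_def foldr_partial_deriv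
  using locally_integrable_rep[OF f] locally_integrable_rep[OF g]
  by (auto simp: test_integral_pr[OF f test_function_D] test_integral_pr[OF g] wd_pr)
qed

lemma locally_integrable_zero:
 fixes f :: "real^'n::finite => 'b::euclidean_space"
 assumes f: "locally_integrable f" and zero: "!!\<phi>. test_function \<phi> ==> (LINT x|lebesgue. \<phi> x *\<^sub>R f x) = 0"
 shows "AE x in lebesgue. f x = 0"
proof -
 obtain g where [measurable]: "bmeas g" and g: "AE x in lborel. f x = g x"
  using borel_representative[OF locally_integrable_measurable[OF f]] by blast
 have fg: "AE x in lebesgue. f x = g x" using g by (rule AE_completion)
 have "AE x in lborel. g x \<bullet> b = 0" for b
 proof (rule fundamental_lemma_real)
  have li: "locally_integrable (%x. g x \<bullet> b)"
   by (rule locally_integrable_linear[OF bounded_linear_inner_left locally_integrable_cong[OF f fg]])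
  have [measurable]: "cball 0 r \<in> sets borel" "bmeas (%x. g x \<bullet> b)" for r by simp_all
  show "integrable lborel (%x. indicator (cball 0 r) x * (g x \<bullet> b))" for r
   using li[unfolded locally_integrable_def set_integrable_def, rule_format, OF compact_cball[of 0 r]]
   by (subst integrable_completion[symmetric]) auto
  fix \<phi> :: "real^'n => real" assume \<phi>: "test_function \<phi>"
  have [measurable]: "bmeas \<phi>" by (rule sqi_measurable[OF test_function_sqi[OF \<phi>]])
  have "(LINT x|lborel. \<phi> x * (g x \<bullet> b)) = (LINT x|lebesgue. (\<phi> x *\<^sub>R g x) \<bullet> b)"
   by (subst integral_completion) auto
  also have "... = (LINT x|lebesgue. \<phi> x *\<^sub>R g x) \<bullet> b"
   by (rule integral_inner_left[OF test_integrable[OF \<phi> locally_integrable_cong[OF f fg]]])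
  also have "... = 0" using zero[OF \<phi>] test_integral_cong[OF f fg \<phi>] by simp
  finally show "(LINT x|lborel. \<phi> x * (g x \<bullet> b)) = 0" .
 qed simp
 hence "AE x in lborel. \<forall>b\<in>Basis. g x \<bullet> b = 0" by (intro AE_finite_allI) auto
 hence "AE x in lebesgue. \<forall>b\<in>Basis. g x \<bullet> b = 0" by (rule AE_completion)
 with fg show ?thesis by eventually_elim (simp add: euclidean_all_zero_iff)
qed

lemma has_weak_deriv_unique:
 assumes "has_weak_deriv is f g" "has_weak_deriv is f h" shows "AE x in lebesgue. g x = h x"
proof -
 have l: "locally_integrable g" "locally_integrable h" using assms by (auto simp: has_weak_deriv_def)
 have "AE x in lebesgue. g x - h x = 0"
 proof (rule locally_integrable_zero)
  show "locally_integrable (%x. g x - h x)" using l by (simp add: locally_integrable_def set_integral_diff(1))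
  fix \<phi> :: "real^'a => real" assume \<phi>: "test_function \<phi>"
  have "(-1) ^ length is *\<^sub>R (LINT x|lebesgue. \<phi> x *\<^sub>R g x) = (-1) ^ length is *\<^sub>R (LINT x|lebesgue. \<phi> x *\<^sub>R h x)"
   using assms \<phi> by (simp add: has_weak_deriv_def)
  thus "(LINT x|lebesgue. \<phi> x *\<^sub>R (g x - h x)) = 0"
   using test_integrable[OF \<phi> l(1)] test_integrable[OF \<phi> l(2)] by (simp add: scaleR_diff_right)
 qed
 thus ?thesis by eventually_elim simp
qed

lemma weak_deriv_AE: assumes "has_weak_deriv is f g" shows "AE x in lebesgue. weak_deriv is f x = g x"
 by (rule has_weak_deriv_unique[OF _ assms]) (unfold weak_deriv_def, rule someI[of "has_weak_deriv is f"], rule assms)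

lemma has_weak_deriv_cong:
 assumes "has_weak_deriv is f g" "AE x in lebesgue. f x = f' x" "AE x in lebesgue. g x = g' x" shows "has_weak_deriv is f' g'"
proof -
 have l: "locally_integrable f" "locally_integrable g" using assms by (auto simp: has_weak_deriv_def)
 show ?thesis using assms(1) locally_integrable_cong[OF l(1) assms(2)] locally_integrable_cong[OF l(2) assms(3)]
  unfolding has_weak_deriv_def foldr_partial_deriv
  by (simp add: test_function_D test_integral_cong[OF l(1) assms(2), symmetric] test_integral_cong[OF l(2) assms(3), symmetric])
qed

lemma has_weak_deriv_linear:
 fixes f :: "real^'n::finite => 'b::euclidean_space" and L :: "'b => 'c::euclidean_space"
 assumes L: "bounded_linear L" and w: "has_weak_deriv is f g" shows "has_weak_deriv is (%x. L (f x)) (%x. L (g x))"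
proof -
 have l: "locally_integrable f" "locally_integrable g" using w by (auto simp: has_weak_deriv_def)
 have i: "(LINT x|lebesgue. \<phi> x *\<^sub>R L (h x)) = L (LINT x|lebesgue. \<phi> x *\<^sub>R h x)" if "test_function \<phi>" "locally_integrable h" for \<phi> and h :: "real^'n => 'b"
  using integral_bounded_linear[OF L test_integrable[OF that]] by (simp add: linear_cmul[OF bounded_linear.linear[OF L]])
 show ?thesis using w locally_integrable_linear[OF L] unfolding has_weak_deriv_def foldr_partial_deriv
  by (auto simp: test_function_D i[OF _ l(1)] i[OF _ l(2)] linear_cmul[OF bounded_linear.linear[OF L]])
qed

lemma has_weak_deriv_add:
 assumes "has_weak_deriv is f g" "has_weak_deriv is f' g'" shows "has_weak_deriv is (%x. f x + f' x) (%x. g x + g' x)"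
proof -
 have l: "locally_integrable f" "locally_integrable g" "locally_integrable f'" "locally_integrable g'" using assms by (auto simp: has_weak_deriv_def)
 show ?thesis using assms locally_integrable_add l unfolding has_weak_deriv_def foldr_partial_deriv
  by (auto simp: scaleR_add_right test_integrable test_function_D)
qed

lemma sobolev_rep: "f \<in> sobolev m \<longleftrightarrow> (EX u. rep f u & Hs m u)"
proof
 assume f: "f \<in> sobolev m"
 \<comment> \<open>The empty list supplies square-integrability of \<open>f\<close> itself, since a
   derivative of order 0 equals \<open>f\<close> almost everywhere.\<close>
 hence "EX g. has_weak_deriv [] f g & square_integrable g" unfolding sobolev_def by (auto dest: spec[of _ "[]"])
 then obtain g where g: "has_weak_deriv [] f g" "square_integrable g" by blast
 have "has_weak_deriv [] f f" using g(1) by (auto simp: has_weak_deriv_def)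
 from has_weak_deriv_unique[OF g(1) this] obtain u where u: "rep f u" using g(2) unfolding square_integrable_rep by (auto intro: rep_cong)
 have "EX v. wd is u v" if "length is <= m" for "is"
  using f that has_weak_deriv_wd[OF u] unfolding sobolev_def square_integrable_rep by blast
 thus "EX u. rep f u & Hs m u" using u by (auto simp: Hs_def)
next
 assume "EX u. rep f u & Hs m u"
 then obtain u where u: "rep f u" "Hs m u" by blast
 show "f \<in> sobolev m" unfolding sobolev_def square_integrable_rep
  using Hs_wd[OF u(2)] has_weak_deriv_wd[OF u(1) rep_rp] rep_rp by blast
qed

lemma weak_deriv_rep: "rep f u ==> wd is u v ==> rep (weak_deriv is f) v"
 using weak_deriv_AE[of "is" f "rp v"] has_weak_deriv_wd[of f u "rp v" v "is"] by (simp add: rep_def)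

lemma sobolev_norm_rep: assumes u: "rep f u" "Hs m u" shows "sobolev_norm m f = Nm m u"
proof -
 have "(LINT x|lebesgue. (norm (weak_deriv is f x))^2) = (norm (dv is u))^2" if "length is <= m" for "is"
 proof -
  have w: "rep (weak_deriv is f) (dv is u)" by (rule weak_deriv_rep[OF u(1) Hs_wd[OF u(2) that]])
  have "(LINT x|lebesgue. (norm (weak_deriv is f x))^2) = (LINT x|lebesgue. (norm (rp (dv is u) x))^2)"
   by (rule integral_cong_AE) (use w rep_measurable[OF w] in "auto simp: rep_def elim: eventually_mono")
  also have "... = (LINT x|lborel. (norm (rp (dv is u) x))^2)" by (rule integral_completion) measurable
  finally show ?thesis by (simp add: norm_l2_sq)
 qed
 thus ?thesis unfolding sobolev_norm_def Nm_def by (intro arg_cong[where f=sqrt] sum.cong) (auto simp: lists_le_def)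
qed

lemma Nm_triangle: assumes "Hs m u" "Hs m v" shows "Nm m u <= Nm m v + Nm m (u - v)"
proof -
 have N: "Nm m w = L2_set (%is. norm (dv is w)) (lists_le m)" for w :: "(real^'a, 'b) l2" by (simp add: Nm_def L2_set_def)
 have "L2_set (%is. norm (dv is u)) (lists_le m) <= L2_set (%is. norm (dv is v) + norm (dv is (u - v))) (lists_le m)"
  by (rule L2_set_mono) (auto simp: dv_diff[OF assms] lists_le_def norm_triangle_sub)
 also have "... <= Nm m v + Nm m (u - v)" unfolding N by (rule L2_set_triangle_ineq)
 finally show ?thesis by (simp add: N)
qed

text \<open>Compactness of the time interval turns continuity into a bound uniform in time, which
  the uniqueness statement asks for.\<close>

lemma continuous_in_sobolev_rep:
 assumes c: "continuous_in_sobolev T m f"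
 obtains V s where "!!t. t \<in> {0..T} ==> rep (f t) (V t) & Hs m (V t) & Nm m (V t) <= s"
  "!!t. t \<in> {0..T} ==> ((%s. Nm m (V s - V t)) \<longlongrightarrow> 0) (at t within {0..T})"
proof -
 have "\<forall>t\<in>{0..T}. EX u. rep (f t) u & Hs m u" using c unfolding continuous_in_sobolev_def sobolev_rep by blast
 then obtain V where V: "!!t. t \<in> {0..T} ==> rep (f t) (V t)" "!!t. t \<in> {0..T} ==> Hs m (V t)" by metis
 have lim: "((%s. Nm m (V s - V t)) \<longlongrightarrow> 0) (at t within {0..T})" if t: "t \<in> {0..T}" for t
 proof (rule Lim_transform_eventually)
  show "((%s. sobolev_norm m (%x. f s x - f t x)) \<longlongrightarrow> 0) (at t within {0..T})" using c t by (simp add: continuous_in_sobolev_def)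
  show "\<forall>\<^sub>F s in at t within {0..T}. sobolev_norm m (%x. f s x - f t x) = Nm m (V s - V t)"
   unfolding eventually_at_filter by (intro always_eventually allI impI sobolev_norm_rep rep_diff Hs_diff V t)
 qed
 have "continuous_on {0..T} (%t. Nm m (V t))" unfolding continuous_on_def
 proof
  fix t assume t: "t \<in> {0..T}"
  show "((%t. Nm m (V t)) \<longlongrightarrow> Nm m (V t)) (at t within {0..T})"
  proof (rule LIM_zero_cancel, rule Lim_null_comparison[OF _ lim[OF t]])
   have "norm (Nm m (V s) - Nm m (V t)) <= Nm m (V s - V t)" if s: "s \<in> {0..T}" for s
   proof -
    have "Nm m (V t - V s) = Nm m (V s - V t)"
     unfolding Nm_def by (intro arg_cong[where f=sqrt] sum.cong) (auto simp: dv_diff[OF V(2)[OF s] V(2)[OF t]] dv_diff[OF V(2)[OF t] V(2)[OF s]] lists_le_def norm_minus_commute)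
    thus ?thesis using Nm_triangle[OF V(2)[OF s] V(2)[OF t]] Nm_triangle[OF V(2)[OF t] V(2)[OF s]] by simp
   qed
   thus "\<forall>\<^sub>F s in at t within {0..T}. norm (Nm m (V s) - Nm m (V t)) <= Nm m (V s - V t)"
    unfolding eventually_at_filter by (auto intro: always_eventually)
  qed
 qed
 hence "bounded ((%t. Nm m (V t)) ` {0..T})" by (intro compact_imp_bounded compact_continuous_image) auto
 then obtain s where "!!t. t \<in> {0..T} ==> Nm m (V t) <= s" unfolding bounded_iff by force
 thus ?thesis using that V lim by blast
qed

lemma continuous_in_sobolevI:
 assumes V: "!!t. t \<in> {0..T} ==> Hs m (V t)" "!!t. t \<in> {0..T} ==> ((%s. Nm m (V s - V t)) \<longlongrightarrow> 0) (at t within {0..T})"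
 shows "continuous_in_sobolev T m (%t. rp (V t))"
 unfolding continuous_in_sobolev_def
proof (intro ballI conjI)
 fix t assume t: "t \<in> {0..T}"
 show "rp (V t) \<in> sobolev m" unfolding sobolev_rep using V(1)[OF t] rep_rp by blast
 show "((%s. sobolev_norm m (%x. rp (V s) x - rp (V t) x)) \<longlongrightarrow> 0) (at t within {0..T})"
 proof (rule Lim_transform_eventually[OF V(2)[OF t]])
  show "\<forall>\<^sub>F s in at t within {0..T}. Nm m (V s - V t) = sobolev_norm m (%x. rp (V s) x - rp (V t) x)"
   unfolding eventually_at_filter by (intro always_eventually allI impI sobolev_norm_rep[symmetric] rep_diff rep_rp Hs_diff V(1) t)
 qed
qed

lemma smooth_cpt_component: assumes "smooth_cpt \<psi>" shows "test_function (%x. \<psi> x \<bullet> b)"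
proof -
 obtain r where "smooth \<psi>" "!!x. norm x > r ==> \<psi> x = 0" using assms unfolding smooth_cpt_def by blast
 thus ?thesis by (intro test_functionI[of _ r] smooth_linear[OF bounded_linear_inner_left]) auto
qed

text \<open>Scalar test functions give the equation for each component of a vector-valued one; the
  classes of these are dense, so \<open>weak_deriv_dense\<close> extends the equation to all of
  L^2.\<close>

lemma solves_ivp_weak_deriv_on:
 fixes f :: "real => real^'n::finite => 'b::euclidean_space"
 assumes sol: "solves_ivp T F f0 f" and V: "!!t. t \<in> {0..T} ==> rep (f t) (V t)"
  and g: "!!t. t \<in> {0..T} ==> rep (F t (f t)) (g t)" "!!t. t \<in> {0..T} ==> norm (g t) <= K"
 shows "weak_deriv_on T V (%t. - g t) \<psi>"
proof (rule weak_deriv_dense[where D="{cl \<phi> | \<phi>. smooth_cpt \<phi>}" and K=K])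
 show "\<exists>d\<in>{cl \<phi> | \<phi>. smooth_cpt \<phi>}. norm (x - d) < e" if "e > 0" for x :: "(real^'n, 'b) l2" and e
  using smooth_cpt_dense[OF that, of x] by blast
 fix d :: "(real^'n, 'b) l2" assume "d \<in> {cl \<phi> | \<phi>. smooth_cpt \<phi>}"
 then obtain \<phi> where \<phi>: "smooth_cpt \<phi>" "d = cl \<phi>" by blast
 note t = smooth_cpt_component[OF \<phi>(1)]
 have split: "u \<bullet> d = (\<Sum>b\<in>Basis. pr (%x. \<phi> x \<bullet> b) u \<bullet> b)" for u
 proof -
  have "d = (\<Sum>b\<in>Basis. cl (%x. (\<phi> x \<bullet> b) *\<^sub>R b))"
   unfolding \<phi>(2) by (subst cl_sum[symmetric]) (auto simp: euclidean_representation intro!: sqi_bounded_linear[OF bounded_linear_scaleR_left] test_function_sqi t)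
  thus ?thesis by (simp add: inner_sum_right pr_inner[OF test_function_sqi[OF t]])
 qed
 show "weak_deriv_on T V (%t. - g t) d" unfolding weak_deriv_on_def split
 proof (intro ballI DERIV_sum)
  fix r b assume r: "r \<in> {0..T}"
  let ?\<phi> = "%x. \<phi> x \<bullet> b"
  have "((%s. LINT x|lebesgue. ?\<phi> x *\<^sub>R f s x) has_vector_derivative - (LINT x|lebesgue. ?\<phi> x *\<^sub>R F r (f r) x)) (at r within {0..T})"
   using sol r t unfolding solves_ivp_def by blast
  hence d: "((%s. LINT x|lebesgue. ?\<phi> x *\<^sub>R f s x) has_vector_derivative - pr ?\<phi> (g r)) (at r within {0..T})"
   unfolding test_integral_pr[OF g(1)[OF r] t] .
  have "((%s. pr ?\<phi> (V s)) has_vector_derivative - pr ?\<phi> (g r)) (at r within {0..T})"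
   by (rule has_vector_derivative_transform[OF r _ d]) (rule test_integral_pr[OF V t, symmetric])
  from bounded_linear.has_vector_derivative[OF bounded_linear_inner_left this]
  show "((%s. pr ?\<phi> (V s) \<bullet> b) has_real_derivative pr ?\<phi> (- g r) \<bullet> b) (at r within {0..T})"
   by (simp add: has_real_derivative_iff_has_vector_derivative linear_neg[OF bounded_linear.linear[OF bounded_linear_pr[OF test_function_sqi[OF t]]]])
 qed
qed (use g(2) in simp)

lemma solves_ivp_initial: "solves_ivp T F f0 f ==> T >= 0 ==> rep (f 0) u ==> rep f0 v ==> u = v"
 unfolding solves_ivp_def using rep_cong rep_unique by blast

section \<open>Functions of the horizontal variable\<close>

definition emb :: "2 => 3" where "emb j = (if j = 1 then 1 else 2)"

lemma emb_simps [simp]: "emb 1 = 1" "emb 2 = 2" by (simp_all add: emb_def)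

lemma horiz_nth: "horiz x $ j = x $ emb j"
 using exhaust_2[of j] by (auto simp: horiz_def)

lemma horiz_join3 [simp]: "horiz (join3 h z) = h" "join3 h z $ 3 = z" "join3 h z $ emb j = h $ j"
 using exhaust_2[of j] by (auto simp: vec_eq_iff forall_2 horiz_nth join3_def)

lemma bounded_linear_horiz: "bounded_linear horiz"
 unfolding linear_conv_bounded_linear[symmetric] by (rule linearI) (simp_all add: vec_eq_iff horiz_nth)

lemma horiz_measurable [measurable]: "bmeas horiz"
 using bounded_linear_horiz by (intro borel_measurable_continuous_onI linear_continuous_on)

lemma prod_Basis_cart: "(\<Prod>b\<in>(Basis :: (real^'n::finite) set). f b) = (\<Prod>i\<in>UNIV. f (axis i 1))"
proof -
 have B: "(Basis :: (real^'n) set) = (%i. axis i 1) ` UNIV" by (auto simp: Basis_vec_def)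
 have i: "inj (%i::'n. axis i (1::real))" by (auto simp: inj_on_def axis_eq_axis)
 show ?thesis unfolding B prod.reindex[OF i] by simp
qed

lemma join3_measurable [measurable]: "(%(h, z). join3 h z) \<in> borel_measurable (lborel \<Otimes>\<^sub>M lborel)"
proof -
 have "(%(h, z). join3 h z) = (%p. fst p $ 1 *\<^sub>R axis 1 1 + fst p $ 2 *\<^sub>R axis 2 1 + snd p *\<^sub>R axis 3 1)"
  by (auto simp: fun_eq_iff vec_eq_iff forall_3 join3_def axis_def)
 also have "bmeas ..."
  by (intro borel_measurable_continuous_onI continuous_intros)
 finally show ?thesis by (simp add: lborel_prod)
qed

text \<open>Both measures agree on boxes. This provides Fubini's theorem in the horizontal and the
  vertical variable.\<close>

lemma lborel3: "(lborel :: (real^3) measure) = distr (lborel \<Otimes>\<^sub>M lborel) borel (%(h, z). join3 h z)"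
proof (rule lborel_eqI)
 fix l u :: "real^3" assume le: "!!b. b \<in> Basis ==> l \<bullet> b <= u \<bullet> b"
 have le': "l $ i <= u $ i" for i using le[of "axis i 1"] by (simp add: inner_axis)
 have e: "(\<Prod>b\<in>Basis. (u - l) \<bullet> b) = (u $ 1 - l $ 1) * (u $ 2 - l $ 2) * (u $ 3 - l $ 3)"
  unfolding prod_Basis_cart UNIV_3 by (simp add: inner_axis)
 have hb: "horiz l \<bullet> b <= horiz u \<bullet> b" if "b \<in> Basis" for b
  using that le' by (auto simp: Basis_vec_def inner_axis horiz_nth)
 have "(%(h, z). join3 h z) -` box l u \<inter> space (lborel \<Otimes>\<^sub>M lborel) = box (horiz l) (horiz u) \<times> box (l $ 3) (u $ 3)"
  by (auto simp: mem_box_cart forall_3 forall_2 horiz_nth join3_def space_pair_measure)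
 hence "emeasure (distr (lborel \<Otimes>\<^sub>M lborel) borel (%(h, z). join3 h z)) (box l u)
   = emeasure (lborel \<Otimes>\<^sub>M lborel) (box (horiz l) (horiz u) \<times> box (l $ 3) (u $ 3))"
  by (subst emeasure_distr) auto
 also have "... = emeasure lborel (box (horiz l) (horiz u)) * emeasure lborel (box (l $ 3) (u $ 3))"
  by (rule lborel.emeasure_pair_measure_Times) auto
 also have "emeasure lborel (box (horiz l) (horiz u)) = ennreal ((u $ 1 - l $ 1) * (u $ 2 - l $ 2))"
  using emeasure_lborel_box[of "horiz l" "horiz u", OF hb] by (simp add: prod_Basis_cart inner_axis UNIV_2 horiz_nth)
 also have "emeasure lborel (box (l $ 3) (u $ 3)) = ennreal (u $ 3 - l $ 3)" using le' by (simp add: box_real)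
 also have "ennreal ((u $ 1 - l $ 1) * (u $ 2 - l $ 2)) * ennreal (u $ 3 - l $ 3) = ennreal ((u $ 1 - l $ 1) * (u $ 2 - l $ 2) * (u $ 3 - l $ 3))"
  by (rule ennreal_mult[symmetric]) (simp_all add: le')
 finally show "emeasure (distr (lborel \<Otimes>\<^sub>M lborel) borel (%(h, z). join3 h z)) (box l u) = ennreal (\<Prod>b\<in>Basis. (u - l) \<bullet> b)"
  by (simp only: e)
qed simp

lemma nn_integral_lift:
 assumes [measurable]: "bmeas f" "bmeas g"
 shows "(\<integral>\<^sup>+x. f (horiz x) * g (x $ 3) \<partial>lborel) = (\<integral>\<^sup>+h. f h \<partial>lborel) * (\<integral>\<^sup>+z. g z \<partial>lborel)"
proof -
 have "(\<integral>\<^sup>+x. f (horiz x) * g (x $ 3) \<partial>lborel) = (\<integral>\<^sup>+p. f (fst p) * g (snd p) \<partial>(lborel \<Otimes>\<^sub>M lborel))"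
  by (subst lborel3, subst nn_integral_distr) (auto simp: case_prod_beta)
 also have "... = (\<integral>\<^sup>+h. \<integral>\<^sup>+z. f h * g z \<partial>lborel \<partial>lborel)"
  by (subst lborel.nn_integral_fst[symmetric]) auto
 finally show ?thesis by (simp add: nn_integral_cmult nn_integral_multc)
qed

text \<open>The cylinder over a null set is null: its measure is 0 times the infinite length of the
  vertical line, and this product is 0 in \<open>ennreal\<close>.\<close>

lemma AE_lift: assumes "AE h in lborel. P h" shows "AE x in lborel. P (horiz x)"
proof -
 obtain N where N: "{h \<in> space lborel. \<not> P h} \<subseteq> N" "emeasure lborel N = 0" "N \<in> sets lborel" using AE_E[OF assms] by blast
 have [measurable]: "N \<in> sets borel" using N(3) by simp
 have "emeasure lborel (horiz -` N) = (\<integral>\<^sup>+x. indicator N (horiz x) * 1 \<partial>lborel)"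
 proof -
  have "(\<integral>\<^sup>+x. indicator N (horiz x) * 1 \<partial>lborel) = (\<integral>\<^sup>+x. indicator (horiz -` N) x \<partial>lborel)"
   by (intro nn_integral_cong) (simp add: indicator_def)
  also have "... = emeasure lborel (horiz -` N)"
   by (rule nn_integral_indicator) (simp add: measurable_sets_borel[OF horiz_measurable])
  finally show ?thesis by simp
 qed
 also have "... = 0" by (subst nn_integral_lift) (auto simp: N(2))
 finally show ?thesis using N(1)
  by (intro AE_I[where N="horiz -` N"]) (auto simp: measurable_sets_borel[OF horiz_measurable])
qed

lemma lift_cong: "AE h in lebesgue. f h = g h ==> AE x in lebesgue. lift3 f x = lift3 g x"
 unfolding AE_completion_iff lift3_def by (rule AE_lift)

lemma lift_measurable [measurable]: "f \<in> borel_measurable borel ==> bmeas (lift3 f)"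
 unfolding lift3_def using measurable_compose[OF horiz_measurable] by simp

text \<open>
 A function of \<open>x\<^sub>h\<close> is not square-integrable on \<open>\<real>\<^sup>3\<close>; against a test function only its restriction to a slab matters.
\<close>

definition slab :: "real => (real^2 => 'b::euclidean_space) => real^3 => 'b" where
 "slab r f x = indicator {-r..r} (x $ 3) *\<^sub>R lift3 f x"

lemma slab_sqi:
 assumes f: "sqi f" and r: "r >= 0" shows "sqi (slab r f)" "norm (cl (slab r f)) <= sqrt (2 * r) * norm (cl f)"
proof -
 note [measurable] = sqi_measurable[OF f]
 have m: "bmeas (slab r f)" unfolding slab_def[abs_def] by measurable
 have "(\<integral>\<^sup>+x. ennreal ((norm (slab r f x))^2) \<partial>lborel) = (\<integral>\<^sup>+x. ennreal ((norm (f (horiz x)))^2) * indicator {-r..r} (x $ 3) \<partial>lborel)"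
  by (intro nn_integral_cong) (auto simp: slab_def lift3_def indicator_def)
 also have "... = (\<integral>\<^sup>+h. ennreal ((norm (f h))^2) \<partial>lborel) * ennreal (2 * r)"
  using r by (subst nn_integral_lift) auto
 also have "(\<integral>\<^sup>+h. ennreal ((norm (f h))^2) \<partial>lborel) = ennreal ((norm (cl f))^2)"
  using f by (subst nn_integral_eq_integral) (auto simp: norm_cl_sq sqi_def)
 also have "ennreal ((norm (cl f))^2) * ennreal (2 * r) = ennreal ((sqrt (2 * r) * norm (cl f))^2)"
  using r by (simp add: ennreal_mult[symmetric] power_mult_distrib mult.commute)
 finally have "(\<integral>\<^sup>+x. ennreal ((norm (slab r f x))^2) \<partial>lborel) <= ennreal ((sqrt (2 * r) * norm (cl f))^2)" by simp
 from sqi_nn_integralI[OF m _ this] r show "sqi (slab r f)" "norm (cl (slab r f)) <= sqrt (2 * r) * norm (cl f)" by auto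
qed

definition cut :: "real => (real^2, 'b::euclidean_space) l2 => (real^3, 'b) l2" where
 "cut r u = cl (slab r (rp u))"

lemma cut_cl: assumes "sqi f" "r >= 0" shows "cut r (cl f) = cl (slab r f)"
 unfolding cut_def
proof (rule cl_cong[OF slab_sqi(1)[OF sqi_rp assms(2)] slab_sqi(1)[OF assms]])
 show "AE x in lborel. slab r (rp (cl f)) x = slab r f x"
  using AE_lift[OF rp_cl[OF assms(1)]] by eventually_elim (simp add: slab_def lift3_def)
qed

lemma bounded_linear_cut: assumes r: "r >= 0" shows "bounded_linear (cut r :: (real^2, 'b::euclidean_space) l2 => _)"
proof (rule bounded_linear_intro[where K="sqrt (2 * r)"])
 fix u v :: "(real^2, 'b) l2" and c :: real
 have "cut r (cl (%x. rp u x + rp v x)) = cut r (cl (rp u)) + cut r (cl (rp v))"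
  by (simp only: cut_cl[OF sqi_add[OF sqi_rp sqi_rp] r] cut_cl[OF sqi_rp r] cl_add[OF slab_sqi(1)[OF sqi_rp r] slab_sqi(1)[OF sqi_rp r], symmetric])
   (simp add: slab_def[abs_def] lift3_def scaleR_add_right)
 thus "cut r (u + v) = cut r u + cut r v" by (simp add: cl_add)
 have "cut r (cl (%x. c *\<^sub>R rp u x)) = c *\<^sub>R cut r (cl (rp u))"
  by (simp only: cut_cl[OF sqi_scaleR[OF sqi_rp] r] cut_cl[OF sqi_rp r] cl_scaleR[OF slab_sqi(1)[OF sqi_rp r], symmetric])
   (simp add: slab_def[abs_def] lift3_def mult.commute)
 thus "cut r (c *\<^sub>R u) = c *\<^sub>R cut r u" by (simp add: cl_scaleR)
 show "norm (cut r u) <= norm u * sqrt (2 * r)"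
  using slab_sqi(2)[OF sqi_rp[of u] r] by (simp add: cut_def mult.commute)
qed

lemma locally_integrable_lift: assumes f: "rep f u" shows "locally_integrable (lift3 f)"
proof (rule locally_integrable_cong)
 show "AE x in lebesgue. lift3 (rp u) x = lift3 f x" by (rule lift_cong) (use f in "auto simp: rep_def elim: eventually_mono")
 show "locally_integrable (lift3 (rp u))" unfolding locally_integrable_def set_integrable_def
 proof (intro allI impI)
  fix K :: "(real^3) set" assume K: "compact K"
  obtain r where r: "!!x. x \<in> K ==> norm x <= r" "r >= 0"
   using compact_imp_bounded[OF K] unfolding bounded_pos by force
  have "rep (slab r (rp u)) (cut r u)" unfolding cut_def by (rule rep_cl[OF slab_sqi(1)[OF sqi_rp r(2)]])
  from locally_integrable_rep[OF this] K have "integrable lebesgue (%x. indicator K x *\<^sub>R slab r (rp u) x)"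
   by (simp add: locally_integrable_def set_integrable_def)
  moreover have "\<bar>x $ 3\<bar> <= r" if "x \<in> K" for x using r(1)[OF that] component_le_norm_cart order_trans by blast
  hence "indicator K x *\<^sub>R slab r (rp u) x = indicator K x *\<^sub>R lift3 (rp u) x" for x
   by (force simp: slab_def indicator_def abs_le_iff)
  ultimately show "integrable lebesgue (%x. indicator K x *\<^sub>R lift3 (rp u) x)" by simp
 qed
qed

lemma test_integral_lift:
 assumes f: "rep f u" and \<phi>: "test_function \<phi>" and r: "r >= 0" "!!x. norm x > r ==> \<phi> x = 0"
 shows "(LINT x|lebesgue. \<phi> x *\<^sub>R lift3 f x) = pr \<phi> (cut r u)"
proof -
 have eq: "\<phi> x *\<^sub>R lift3 f x = \<phi> x *\<^sub>R slab r f x" for x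
 proof (cases "norm x <= r")
  case True
  hence "\<bar>x $ 3\<bar> <= r" using component_le_norm_cart order_trans by blast
  thus ?thesis by (auto simp: slab_def indicator_def abs_le_iff)
 qed (use r in simp)
 have "rep (slab r f) (cut r u)"
 proof (rule rep_cong)
  show "rep (slab r (rp u)) (cut r u)" unfolding cut_def by (rule rep_cl[OF slab_sqi(1)[OF sqi_rp r(1)]])
  have "AE x in lebesgue. lift3 (rp u) x = lift3 f x" by (rule lift_cong) (use f in "auto simp: rep_def elim: eventually_mono")
  thus "AE x in lebesgue. slab r (rp u) x = slab r f x" by eventually_elim (simp add: slab_def)
 qed
 from test_integral_pr[OF this \<phi>] show ?thesis by (simp only: eq)
qed

lemma lift_has_derivative:
 assumes "smooth f" shows "(lift3 f has_derivative (%h. frechet_derivative f (at (horiz x)) (horiz h))) (at x)"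
 unfolding lift3_def[abs_def]
 by (rule has_derivative_compose[OF bounded_linear_imp_has_derivative[OF bounded_linear_horiz] smooth_has_derivative[OF assms]])

lemma pd_lift: assumes "smooth f" shows "pd (emb j) (lift3 f) = lift3 (pd j f)" "pd 3 (lift3 f) = (%x. 0)"
proof -
 have "horiz (axis (emb j) 1) = axis j 1" "horiz (axis 3 1) = 0"
  using exhaust_2[of j] by (auto simp: vec_eq_iff forall_2 horiz_nth axis_def)
 moreover have "frechet_derivative f (at y) 0 = 0" for y
  using linear_0[OF bounded_linear.linear[OF has_derivative_bounded_linear[OF smooth_has_derivative[OF assms]]]] .
 ultimately show "pd (emb j) (lift3 f) = lift3 (pd j f)" "pd 3 (lift3 f) = (%x. 0)"
  by (auto simp: fun_eq_iff pd_eqI[OF lift_has_derivative[OF assms]] lift3_def pd_def[of j f])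
qed

lemma emb_cases: obtains "i = 3" | j where "i = emb j"
 using exhaust_3[of i] emb_simps by metis

lemma smooth_lift: assumes "smooth f" shows "smooth (lift3 f)"
proof (rule smooth_family[where P="%g. EX f. smooth f & g = lift3 f"])
 show "EX h. smooth h & lift3 f = lift3 h" using assms by blast
 fix g assume "EX f. smooth f & g = lift3 f"
 then obtain h where h: "smooth h" "g = lift3 h" by blast
 have "EX f. smooth f & pd i g = lift3 f" for i
 proof (cases i rule: emb_cases)
  case 1
  thus ?thesis using pd_lift(2)[OF h(1)] h(2) by (intro exI[of _ "%x. 0"]) (auto simp: lift3_def)
 next
  case (2 j)
  thus ?thesis using pd_lift(1)[OF h(1)] h smooth_pd by blast
 qed
 thus "(ALL x. g differentiable (at x)) & (ALL i. EX f. smooth f & pd i g = lift3 f)"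
  using lift_has_derivative[OF h(1)] h(2) unfolding differentiable_def by blast
qed

text \<open>Direction 3 annihilates a lifted function and the other directions commute with lifting;
  sup bounds of derivatives thereby reduce to the plane.\<close>

lemma D_lift:
 assumes f: "smooth f"
 shows "D is (lift3 f) = (%x. 0) \<or> (EX js. length js = length is & D is (lift3 f) = lift3 (D js f))"
proof (induction "is")
 case (Cons i "is")
 thus ?case
 proof
  assume "EX js. length js = length is & D is (lift3 f) = lift3 (D js f)"
  then obtain js where js: "length js = length is" "D is (lift3 f) = lift3 (D js f)" by blast
  show ?case
  proof (cases i rule: emb_cases)
   case 1 thus ?thesis using pd_lift(2)[OF smooth_D[OF f]] js by simp
  next
   case (2 j) thus ?thesis using pd_lift(1)[OF smooth_D[OF f]] js by (intro disjI2 exI[of _ "j # js"]) simp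
  qed
 qed simp
qed auto

text \<open>Compact support of \<phi> makes all products integrable, so no decay of \<open>g\<close>
  is asked for.\<close>

lemma test_lift_by_parts:
 fixes g :: "real^3 => 'b::euclidean_space"
 assumes \<phi>: "test_function \<phi>" and g: "smooth g"
 shows "(LINT x|lborel. pd i \<phi> x *\<^sub>R g x) = - (LINT x|lborel. \<phi> x *\<^sub>R pd i g x)"
proof -
 have s: "smooth \<phi>" using \<phi> by (simp add: test_function_iff)
 obtain r where r: "!!x. norm x > r ==> \<phi> x = 0" by (rule test_function_radius[OF \<phi>]) auto
 have int: "integrable lborel (%x. \<psi> x *\<^sub>R h x)" if "smooth \<psi>" "!!x. norm x > r ==> \<psi> x = 0" "smooth h" for \<psi> and h :: "real^3 => 'b"
 proof -
  have p: "smooth (%x. \<psi> x *\<^sub>R h x)" by (rule smooth_bilinear[OF bounded_bilinear_scaleR that(1,3)])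
  note z = that(2)
  obtain B where B: "!!x. norm (\<psi> x *\<^sub>R h x) <= B" using smooth_compact_bounded[OF p, of r] z by auto
  have "integrable lborel (%x::real^3. indicator (cball 0 r) x *\<^sub>R B)"
   using emeasure_lborel_cball_finite[of "0::real^3" r] by (intro integrable_scaleR_left integrable_real_indicator) simp_all
  thus ?thesis
  proof (rule Bochner_Integration.integrable_bound)
   show "AE x in lborel. norm (\<psi> x *\<^sub>R h x) <= norm (indicator (cball 0 r) x *\<^sub>R B)"
    using z by (auto simp: indicator_def intro!: AE_I2 order_trans[OF B abs_ge_self, simplified])
  qed (use smooth_measurable[OF p] in simp)
 qed
 have a: "integrable lborel (%x. \<phi> x *\<^sub>R pd i g x)" by (rule int[OF s r smooth_pd[OF g]])
 have b: "integrable lborel (%x. pd i \<phi> x *\<^sub>R g x)" by (rule int[OF smooth_pd[OF s] pd_zero_outside[OF r] g])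
 have e: "pd i (%x. \<phi> x *\<^sub>R g x) = (%x. \<phi> x *\<^sub>R pd i g x + pd i \<phi> x *\<^sub>R g x)"
  by (rule ext) (rule pd_bilinear[OF bounded_bilinear_scaleR smooth_differentiable[OF s] smooth_differentiable[OF g]])
 have "(LINT x|lborel. pd i (%x. \<phi> x *\<^sub>R g x) x) = 0"
  by (rule integral_pd_zero[OF smooth_bilinear[OF bounded_bilinear_scaleR s g] int[OF s _ g]]) (use r a b in "simp_all add: e")
 thus ?thesis using a b by (simp add: e add_eq_0_iff)
qed

text \<open>For planar mollifications the lift is smooth and integration by parts applies; against a
  fixed test function the limit is taken through the bounded map \<open>cut\<close>.\<close>

lemma lift_weak_deriv:
 assumes w: "wd [j] u v"
 shows "has_weak_deriv [emb j] (lift3 (rp u)) (lift3 (rp v))" "has_weak_deriv [3] (lift3 (rp u)) (%x. 0)"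
proof -
 have l: "locally_integrable (lift3 (rp u))" "locally_integrable (lift3 (rp v))" by (rule locally_integrable_lift[OF rep_rp])+
 have key: "(LINT x|lebesgue. pd (emb j) \<phi> x *\<^sub>R lift3 (rp u) x) = - (LINT x|lebesgue. \<phi> x *\<^sub>R lift3 (rp v) x)"
  "(LINT x|lebesgue. pd 3 \<phi> x *\<^sub>R lift3 (rp u) x) = 0" if \<phi>: "test_function \<phi>" for \<phi>
 proof -
  obtain r where r: "r >= 0" "!!x. norm x > r ==> \<phi> x = 0" using test_function_radius[OF \<phi>] by blast
  have t: "test_function (pd i \<phi>)" for i by (rule test_function_pd[OF \<phi>])
  have z: "pd i \<phi> x = 0" if "norm x > r" for i x by (rule pd_zero_outside[OF r(2) that])
  have P: "pr \<psi> (cut r (J (eps k) u)) = (LINT x|lborel. \<psi> x *\<^sub>R lift3 (Jf (eps k) u) x)"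
   if "test_function \<psi>" "!!x. norm x > r ==> \<psi> x = 0" for \<psi> and u :: "(real^2, 'a) l2" and k
  proof -
   have h: "h_inf (Jf (eps k) u)" by (rule h_inf_Jf) simp
   have "pr \<psi> (cut r (J (eps k) u)) = (LINT x|lebesgue. \<psi> x *\<^sub>R lift3 (Jf (eps k) u) x)"
    unfolding J_eq_Jf by (rule test_integral_lift[OF rep_cl that(1) r(1) that(2), symmetric]) (use h_inf_sqi[OF h, of "[]"] in simp)
   also have "... = (LINT x|lborel. \<psi> x *\<^sub>R lift3 (Jf (eps k) u) x)"
    using sqi_measurable[OF test_function_sqi[OF that(1)]] smooth_measurable[OF smooth_lift[OF h_inf_smooth[OF h]]]
    by (intro integral_completion) simp
   finally show ?thesis .
  qed
  have lim: "(%k. pr \<psi> (cut r (J (eps k) u))) \<longlonglongrightarrow> pr \<psi> (cut r u)" if "test_function \<psi>" for \<psi> and u :: "(real^2, 'a) l2"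
   by (rule bounded_linear.tendsto[OF bounded_linear_pr[OF test_function_sqi[OF that]] bounded_linear.tendsto[OF bounded_linear_cut[OF r(1)] J_eps_tendsto]])
  have Jv: "cut r (J (eps k) v) = cut r (cl (pd j (Jf (eps k) u)))" for k
   using w cl_D_Jf[of "eps k" "[j]" u] by (simp add: wd_def)
  have "pr (pd (emb j) \<phi>) (cut r (J (eps k) u)) = - pr \<phi> (cut r (J (eps k) v))" for k
  proof -
   have h: "h_inf (Jf (eps k) u)" by (rule h_inf_Jf) simp
   have "pr \<phi> (cut r (J (eps k) v)) = (LINT x|lebesgue. \<phi> x *\<^sub>R lift3 (pd j (Jf (eps k) u)) x)"
    unfolding Jv by (rule test_integral_lift[OF rep_cl \<phi> r, symmetric]) (use h_inf_sqi[OF h, of "[j]"] in simp)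
   also have "... = (LINT x|lborel. \<phi> x *\<^sub>R lift3 (pd j (Jf (eps k) u)) x)"
    using sqi_measurable[OF test_function_sqi[OF \<phi>]] smooth_measurable[OF smooth_lift[OF smooth_pd[OF h_inf_smooth[OF h]]]]
    by (intro integral_completion) simp
   finally show ?thesis
    by (simp add: P[OF t z] test_lift_by_parts[OF \<phi> smooth_lift[OF h_inf_smooth[OF h]]] pd_lift(1)[OF h_inf_smooth[OF h]])
  qed
  hence "(%k. - pr \<phi> (cut r (J (eps k) v))) \<longlonglongrightarrow> pr (pd (emb j) \<phi>) (cut r u)" using lim[OF t, of "emb j" u] by simp
  from LIMSEQ_unique[OF this tendsto_minus[OF lim[OF \<phi>]]]
  show "(LINT x|lebesgue. pd (emb j) \<phi> x *\<^sub>R lift3 (rp u) x) = - (LINT x|lebesgue. \<phi> x *\<^sub>R lift3 (rp v) x)"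
   by (simp add: test_integral_lift[OF rep_rp t r(1) z] test_integral_lift[OF rep_rp \<phi> r])
  have "pr (pd 3 \<phi>) (cut r (J (eps k) u)) = 0" for k
   using pd_lift(2)[OF h_inf_smooth[OF h_inf_Jf[of "eps k" u]]]
   by (simp add: P[OF t z] test_lift_by_parts[OF \<phi> smooth_lift[OF h_inf_smooth[OF h_inf_Jf]]])
  hence "(%k. 0) \<longlonglongrightarrow> pr (pd 3 \<phi>) (cut r u)" using lim[OF t, of 3 u] by simp
  from LIMSEQ_unique[OF this tendsto_const]
  show "(LINT x|lebesgue. pd 3 \<phi> x *\<^sub>R lift3 (rp u) x) = 0" by (simp add: test_integral_lift[OF rep_rp t r(1) z])
 qed
 have "locally_integrable (%x::real^3. 0::'a)" by (simp add: locally_integrable_def set_integrable_def)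
 thus "has_weak_deriv [emb j] (lift3 (rp u)) (lift3 (rp v))" "has_weak_deriv [3] (lift3 (rp u)) (%x. 0)"
  using l key by (simp_all add: has_weak_deriv_def partial_deriv_eq_pd)
qed

section \<open>The equations as symmetric systems\<close>

context sym_system
begin

text \<open>The equations contain \<open>weak_deriv\<close>, a choice among almost everywhere equal
  functions, so agreement with \<open>FFf\<close> can hold only almost everywhere.\<close>

definition represents :: "nat => real => (real => real^'n => 'b) => (real => 'n => real^'n => 'b) => (real => (real^'n => 'b) => real^'n => 'b) => bool" where
 "represents m T E e F \<longleftrightarrow> (\<forall>t\<in>{0..T}. ALL f u. rep f u --> Hs m u -->
  (AE x in lebesgue. F t f x = FFf (E t) (e t) (rp u) (%j. rp (dv [j] u)) x))"

lemma representsD: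
 assumes "represents m T E e F" "background m M B E e" "m >= 3" "t \<in> {0..T}" "rep f u" "Hs m u"
 shows "rep (F t f) (FF (E t) (e t) u)"
proof (rule rep_cong)
 show "rep (FFf (E t) (e t) (rp u) (%j. rp (dv [j] u))) (FF (E t) (e t) u)"
  unfolding FF_def by (rule rep_cl[OF FF_sqi[OF assms(2,6,3)]])
 have "AE x in lebesgue. F t f x = FFf (E t) (e t) (rp u) (%j. rp (dv [j] u)) x"
  using assms unfolding represents_def by blast
 thus "AE x in lebesgue. FFf (E t) (e t) (rp u) (%j. rp (dv [j] u)) x = F t f x" by (auto elim: eventually_mono)
qed

text \<open>Uniqueness is stated for every operator representing the same background, because a
  competing pair solves the perturbation system formed with its own planar part, which equals the
  constructed one only almost everywhere.\<close>

theorem well_posed_functions: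
 assumes m: "m >= 3" and bg: "background m M B E e" and v0: "rep f0 v0" "Hs m v0" "Nm m v0 <= R" and T: "0 < T" "T <= life m M R"
  and F: "represents m T E e F"
 shows "EX V. (\<forall>t\<in>{0..T}. Hs m (V t) & Nm m (V t) <= sqrt (R^2 + 1)
   & (V has_vector_derivative - FF (E t) (e t) (V t)) (at t within {0..T})
   & ((%s. Nm m (V s - V t)) \<longlongrightarrow> 0) (at t within {0..T}))
  & solves_ivp T F f0 (%t. rp (V t)) & rep f0 (V 0)
  & (ALL F f. represents m T E e F --> continuous_in_sobolev T m f --> solves_ivp T F f0 f --> (\<forall>t\<in>{0..T}. rep (f t) (V t)))"
proof -
 obtain V where V0: "V 0 = v0" and V: "!!t. t \<in> {0..T} ==> Hs m (V t)" "!!t. t \<in> {0..T} ==> (Nm m (V t))^2 <= R^2 + 1"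
   "!!t. t \<in> {0..T} ==> (V has_vector_derivative - FF (E t) (e t) (V t)) (at t within {0..T})"
   "!!t. t \<in> {0..T} ==> ((%s. Nm m (V s - V t)) \<longlongrightarrow> 0) (at t within {0..T})"
  and uniq: "!!s V'. V' 0 = v0 ==> (\<forall>t\<in>{0..T}. Hs m (V' t) & Nm m (V' t) <= s) ==>
   (\<forall>\<psi>. weak_deriv_on T V' (%t. - FF (E t) (e t) (V' t)) \<psi>) ==> (\<forall>t\<in>{0..T}. V' t = V t)"
  using well_posed[OF m bg v0(2,3) T] by blast
 have sol: "solves_ivp T F f0 (%t. rp (V t))" unfolding solves_ivp_def
 proof (intro conjI ballI allI impI)
  show "AE x in lebesgue. rp (V 0) x = f0 x" using v0(1) V0 by (auto simp: rep_def elim: eventually_mono)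
  fix t assume t: "t \<in> {0..T}"
  note r = representsD[OF F bg m t rep_rp V(1)[OF t]]
  show "EX g. has_weak_deriv [i] (rp (V t)) g" for i
   using has_weak_deriv_wd[OF rep_rp rep_rp] Hs_wd[OF V(1)[OF t], of "[i]"] m by fastforce
  show "locally_integrable (F t (rp (V t)))" by (rule locally_integrable_rep[OF r])
  fix \<phi> :: "real^'n => real" assume \<phi>: "test_function \<phi>"
  note bl = bounded_linear_pr[OF test_function_sqi[OF \<phi>]]
  show "((%s. LINT x|lebesgue. \<phi> x *\<^sub>R rp (V s) x) has_vector_derivative - (LINT x|lebesgue. \<phi> x *\<^sub>R F t (rp (V t)) x)) (at t within {0..T})"
   unfolding test_integral_pr[OF rep_rp \<phi>] test_integral_pr[OF r \<phi>]
   using bounded_linear.has_vector_derivative[OF bl V(3)[OF t]] by (simp add: linear_neg[OF bounded_linear.linear[OF bl]])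
 qed
 have "\<forall>t\<in>{0..T}. rep (f t) (V t)" if F: "represents m T E e F" and c: "continuous_in_sobolev T m f" and s: "solves_ivp T F f0 f" for F f
 proof -
  obtain W b where W: "!!t. t \<in> {0..T} ==> rep (f t) (W t) & Hs m (W t) & Nm m (W t) <= b"
   by (rule continuous_in_sobolev_rep[OF c]) blast
  have b0: "b >= 0" using W[of 0] T Nm_nonneg[of m "W 0"] by (simp del: Nm_nonneg)
  define B' where "B' = max (max B M) (sob_const TYPE('n) * b)"
  have B': "B <= B'" "M <= B'" "sob_const TYPE('n) * b <= B'" by (auto simp: B'_def)
  have wd: "weak_deriv_on T W (%t. - FF (E t) (e t) (W t)) \<psi>" for \<psi>
  proof (rule solves_ivp_weak_deriv_on[OF s])
   fix t assume t: "t \<in> {0..T}"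
   show "rep (f t) (W t)" using W[OF t] by blast
   show "rep (F t (f t)) (FF (E t) (e t) (W t))" by (rule representsD[OF F bg m t]) (use W[OF t] in auto)
   show "norm (FF (E t) (e t) (W t)) <= KS * (2 * B') * (real CARD('n) * b) + (real CARD('n) * (2 * KS * B' * b) + KG * b)"
    by (rule FF_norm_Nm(1)[OF m _ _ background_le[OF bg B'(1,2)] B'(3) b0]) (use W[OF t] in auto)
  qed
  have "W 0 = v0" by (rule solves_ivp_initial[OF s _ _ v0(1)]) (use W[of 0] T in auto)
  hence "\<forall>t\<in>{0..T}. W t = V t" by (rule uniq[of W b]) (use W wd in blast)+
  thus ?thesis using W by auto
 qed
 moreover have "Nm m (V t) <= sqrt (R^2 + 1)" if "t \<in> {0..T}" for t using V(2)[OF that] by (rule real_le_rsqrt)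
 ultimately show ?thesis using V sol V0 v0(1) by (intro exI[of _ V]) blast
qed

end

text \<open>Transport and pressure terms in direction i, with coefficient state \<open>p\<close> and
  differentiated state \<open>q\<close>; the common factor g in both pressure terms makes the matrix
  symmetric. At p = (1/\<delta>, 0) it yields exactly the singular divergence and gradient
  terms.\<close>

definition Sst :: "real => 3 => state => state => state" where
 "Sst g i p q = (snd p $ i * fst q + g * fst p * snd q $ i, (snd p $ i) *\<^sub>R snd q + (g * fst p * fst q) *\<^sub>R axis i 1)"

definition Gst :: "real => state => state" where
 "Gst c q = (0, c *\<^sub>R cross3 (axis 3 1) (snd q))"

lemma bounded_bilinear_Sst: "bounded_bilinear (Sst g i)"
 unfolding bilinear_conv_bounded_bilinear[symmetric] bilinear_def
 by (intro conjI allI linearI) (simp_all add: Sst_def prod_eq_iff algebra_simps vec_eq_iff)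

lemma bounded_linear_Gst: "bounded_linear (Gst c)"
 unfolding linear_conv_bounded_linear[symmetric]
 by (rule linearI) (simp_all add: Gst_def prod_eq_iff cross_add_right cross_mult_right algebra_simps)

lemma sym_system_Sst: "CARD('n::finite) <= 3 ==> sym_system (%j::'n. Sst g (\<iota> j)) (Gst c)"
proof (rule sym_system.intro)
 show "Sst g (\<iota> j) u v \<bullet> w = v \<bullet> Sst g (\<iota> j) u w" for j :: 'n and u v w
  by (simp add: Sst_def inner_prod_def inner_add_left inner_add_right inner_axis inner_axis' algebra_simps)
 show "v \<bullet> Gst c v = 0" for v by (simp add: Gst_def inner_prod_def dot_cross_self)
qed (rule bounded_bilinear_Sst bounded_linear_Gst | assumption)+

interpretation planar: sym_system "%j. Sst g (emb j)" "Gst c" for g c by (rule sym_system_Sst) simp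

interpretation spatial: sym_system "Sst g" "Gst c" for g c using sym_system_Sst[of g "%i. i" c] by simp

text \<open>In the equations components are taken inside \<open>weak_deriv\<close>, in the matrix
  form outside. Both choices agree almost everywhere, for the finitely many directions at
  once.\<close>

lemma weak_deriv_linear_AE:
 fixes f :: "real^'n::finite => 'b::euclidean_space" and L :: "'n => 'b => 'c::euclidean_space"
 assumes "!!i. bounded_linear (L i)" "!!i. has_weak_deriv [i] f (g i)"
 shows "AE x in lebesgue. ALL i. weak_deriv [i] (%y. L i (f y)) x = L i (g i x)"
 using AE_finite_allI[of UNIV, OF finite weak_deriv_AE[OF has_weak_deriv_linear[OF assms]]] by simp

lemmas bounded_linear_state = bounded_linear_compose[OF bounded_linear_vec_nth bounded_linear_snd]
 bounded_linear_compose[OF bounded_linear_horiz bounded_linear_snd]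

lemma full_system_AE:
 assumes g: "!!i. has_weak_deriv [i] U (g i)"
 shows "AE x in lebesgue. full_system gb \<nu> \<delta> U x = (\<Sum>i\<in>UNIV. Sst gb i (U x + (1 / \<delta>, 0)) (g i x)) + Gst (gb / \<delta> * \<nu>) (U x)"
 using weak_deriv_linear_AE[of "%i. fst", OF bounded_linear_fst g] weak_deriv_linear_AE[of "%i. snd", OF bounded_linear_snd g]
  weak_deriv_linear_AE[of "%i q. snd q $ i", OF bounded_linear_state(1) g]
proof eventually_elim
 case (elim x)
 have "grad (%y. fst (U y)) x = (\<Sum>i\<in>UNIV. fst (g i x) *\<^sub>R axis i 1)"
  using elim(1) by (simp add: grad_def vec_eq_iff axis_def if_distrib cong: if_cong)
 thus ?case using elim
  by (simp add: full_system_def op_L_def op_N_def Let_def divergence_def advect_def Sst_def Gst_def prod_eq_iff sum.distrib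
    fst_sum snd_sum scaleR_add_right scaleR_add_left sum_distrib_left scaleR_sum_right algebra_simps)
qed

lemma perturbation_system_AE:
 assumes V: "!!i. has_weak_deriv [i] V (g i)" and A: "!!i. has_weak_deriv [i] (lift3 A) (h i)"
 shows "AE x in lebesgue. perturbation_system gb \<nu> \<delta> A V x =
  (\<Sum>i\<in>UNIV. Sst gb i (V x + ((1 / \<delta>, 0) + lift3 A x)) (g i x) + Sst gb i (V x) (h i x)) + Gst (gb / \<delta> * \<nu>) (V x)"
 using full_system_AE[OF V, of gb \<nu> \<delta>] weak_deriv_linear_AE[of "%i. fst", OF bounded_linear_fst V]
  weak_deriv_linear_AE[of "%i. snd", OF bounded_linear_snd V] weak_deriv_linear_AE[of "%i q. snd q $ i", OF bounded_linear_state(1) V]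
  weak_deriv_linear_AE[of "%i. fst", OF bounded_linear_fst A] weak_deriv_linear_AE[of "%i. snd", OF bounded_linear_snd A]
  weak_deriv_linear_AE[of "%i q. snd q $ i", OF bounded_linear_state(1) A]
proof eventually_elim
 case (elim x)
 have l: "lift3 (%y. fst (A y)) = (%x. fst (lift3 A x))" "lift3 (%y. snd (A y)) = (%x. snd (lift3 A x))" by (auto simp: lift3_def)
 have gr: "grad (%y. fst (V y)) x = (\<Sum>i\<in>UNIV. fst (g i x) *\<^sub>R axis i 1)" "grad (%x. fst (lift3 A x)) x = (\<Sum>i\<in>UNIV. fst (h i x) *\<^sub>R axis i 1)"
  using elim(2,5) by (simp_all add: grad_def vec_eq_iff axis_def if_distrib cong: if_cong)
 have "coupling gb A V x = - (\<Sum>i\<in>UNIV. Sst gb i (lift3 A x) (g i x) + Sst gb i (V x) (h i x))"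
  unfolding coupling_def l Let_def gr using elim(2-)
  by (simp add: divergence_def advect_def Sst_def prod_eq_iff sum.distrib
    fst_sum snd_sum sum_distrib_left scaleR_sum_right algebra_simps)
 moreover have "Sst gb i (V x + ((1 / \<delta>, 0) + lift3 A x)) (g i x) = Sst gb i (V x + (1 / \<delta>, 0)) (g i x) + Sst gb i (lift3 A x) (g i x)" for i
  by (simp add: bounded_bilinear.add_left[OF bounded_bilinear_Sst] add.assoc)
 ultimately show ?case using elim(1) by (simp add: perturbation_system_def sum.distrib)
qed

lemma planar_system_AE:
 assumes g: "!!j. has_weak_deriv [j] A (g j)"
 shows "AE x in lebesgue. planar_system gb \<nu> \<delta> A x = (\<Sum>j\<in>UNIV. Sst gb (emb j) (A x + (1 / \<delta>, 0)) (g j x)) + Gst (gb / \<delta> * \<nu>) (A x)"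
 using weak_deriv_linear_AE[of "%i. fst", OF bounded_linear_fst g]
  weak_deriv_linear_AE[of "%i q. horiz (snd q)", OF bounded_linear_state(2) g]
  weak_deriv_linear_AE[of "%i q. snd q $ 3", OF bounded_linear_state(1) g]
  weak_deriv_linear_AE[of "%i q. snd q $ emb i", OF bounded_linear_state(1) g]
proof eventually_elim
 case (elim x)
 thus ?case using spec[OF elim(4), of 1] spec[OF elim(4), of 2]
  by (simp add: planar_system_def Let_def divergence_def advect_def grad_def perp_def horiz_nth Sst_def Gst_def prod_eq_iff
    vec_eq_iff forall_3 join3_def sum_2 axis_def cross3_def algebra_simps)
qed

section \<open>The background state of the perturbation\<close>

abbreviation sob2 :: real where "sob2 \<equiv> sob_const TYPE(2)"

lemma J_rate:
 fixes u :: "(real^'n::finite, 'b::euclidean_space) l2"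
 assumes e: "ep > 0" and u: "Hs (Suc k) u" and len: "length is <= k"
 shows "norm (J ep (dv is u) - dv is u) <= ep * (real CARD('n) * Nm (Suc k) u)"
proof (rule LIMSEQ_le_const2)
 have "(%i. J (eps i) (dv is u)) \<longlonglongrightarrow> dv is u" by (rule J_eps_tendsto)
 thus "(%i. norm (J ep (J (eps i) (dv is u)) - J (eps i) (dv is u))) \<longlonglongrightarrow> norm (J ep (dv is u) - dv is u)"
  by (intro tendsto_intros bounded_linear.tendsto[OF bounded_linear_cv[OF moll_kernel[OF e]]])
 have "norm (J ep (J (eps i) (dv is u)) - J (eps i) (dv is u)) <= ep * (real CARD('n) * Nm (Suc k) u)" for i
 proof -
  let ?f = "Jf (eps i) u"
  have h: "h_inf ?f" by (rule h_inf_Jf) simp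
  have d: "J (eps i) (dv js u) = cl (D js ?f)" if "length js <= Suc k" for js
   using dv_J_Hs[OF eps_pos u that] dv_J[OF eps_pos] cl_D_Jf[OF eps_pos] by metis
  have "J ep (cl (D is ?f)) = cl (conv (moll ep) (D is ?f))" by (rule cv_cl[OF moll_kernel[OF e] h_inf_sqi[OF h]])
  hence "norm (J ep (cl (D is ?f)) - cl (D is ?f)) <= ep * (\<Sum>j\<in>UNIV. norm (cl (pd j (D is ?f))))"
   using moll_rate[OF e h_inf_smooth[OF h_inf_D[OF h]] h_inf_sqi[OF h], of "is"] h_inf_sqi[OF h, of "_ # is"] by simp
  also have "... <= ep * (\<Sum>j\<in>(UNIV :: 'n set). Nm (Suc k) u)"
  proof (intro mult_left_mono sum_mono)
   fix j
   have "cl (pd j (D is ?f)) = J (eps i) (dv (j # is) u)" using d[of "j # is"] len by simp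
   thus "norm (cl (pd j (D is ?f))) <= Nm (Suc k) u"
    using J_norm[OF eps_pos, of i "dv (j # is) u"] norm_le_Nm[of "j # is" "Suc k" u] len by simp
  qed (use e in simp)
  finally show ?thesis using d[of "is"] len by simp
 qed
 thus "EX N. \<forall>i\<ge>N. norm (J ep (J (eps i) (dv is u)) - J (eps i) (dv is u)) <= ep * (real CARD('n) * Nm (Suc k) u)" by blast
qed

text \<open>Each derivative of J u - u of order at most 3 is bounded by \<open>ep\<close> times 2 R,
  where 2 is the dimension and \<open>R\<close> bounds the norm of order 4. The square root sums
  over the lists, and \<open>sob2\<close> passes to sup norms of orders 0 and 1.\<close>

definition rate :: "real => real" where
 "rate R = sob2 * (sqrt (real (card (lists_le 3 :: 2 list set))) * (2 * R))"

lemma Jf_AE: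
 fixes u :: "(real^2, 'b::euclidean_space) l2"
 assumes e: "ep > 0" and u: "Hs 4 u" "Nm 4 u <= R" and a: "length a <= 1"
 shows "AE h in lborel. norm (D a (Jf ep u) h - rp (dv a u) h) <= ep * rate R"
proof -
 define w where "w = J ep u - u"
 have H: "Hs 3 u" "Hs 3 (J ep u)" using Hs_mono[OF u(1)] Hs_J[OF e] by auto
 have Hw: "Hs 3 w" unfolding w_def by (rule Hs_diff[OF H(2,1)])
 have dw: "norm (dv is w) <= ep * (2 * R)" if "length is <= 3" for "is"
 proof -
  have "norm (dv is w) <= ep * (2 * Nm 4 u)"
   using J_rate[OF e, of 3 u "is"] u(1) that dv_diff[OF H(2,1) that] dv_J_Hs[OF e H(1) that] by (simp add: w_def)
  also have "... <= ep * (2 * R)" using u(2) e by (intro mult_left_mono) auto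
  finally show ?thesis .
 qed
 have R0: "R >= 0" using order_trans[OF Nm_nonneg u(2)] .
 have "(Nm 3 w)^2 <= (\<Sum>is\<in>(lists_le 3 :: 2 list set). (ep * (2 * R))^2)"
  unfolding Nm_sq by (intro sum_mono power_mono dw) (auto simp: lists_le_def)
 hence "(Nm 3 w)^2 <= (sqrt (real (card (lists_le 3 :: 2 list set))) * (ep * (2 * R)))^2" by (simp add: power_mult_distrib)
 hence "Nm 3 w <= sqrt (real (card (lists_le 3 :: 2 list set))) * (ep * (2 * R))"
  by (rule power2_le_imp_le) (use e R0 in simp)
 hence le: "sob2 * Nm 3 w <= ep * rate R"
  using mult_left_mono[of "Nm 3 w" _ sob2] sob_const_ge[where 'n=2] by (fastforce simp: rate_def algebra_simps)
 have "AE h in lborel. norm (rp (dv a w) h) <= sob2 * Nm 3 w" by (rule Hs_sup[OF Hw]) (use a in simp_all)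
 moreover have "dv a w = cl (D a (Jf ep u)) - dv a u"
  using dv_diff[OF H(2,1), of a] a by (simp add: w_def dv_J[OF e] cl_D_Jf[OF e])
 hence "AE h in lborel. rp (dv a w) h = rp (cl (D a (Jf ep u))) h - rp (dv a u) h" using rp_diff by metis
 moreover note rp_cl[OF h_inf_sqi[OF h_inf_Jf[OF e]], of a u]
 ultimately show ?thesis by eventually_elim (use le in simp)
qed

text \<open>The planar Sobolev inequality costs two derivatives. With a bound of order m + 3 it
  reaches order m + 1, exactly what \<open>smooth_background\<close> demands.\<close>

lemma lift_bound:
 fixes u :: "(real^2, 'b::euclidean_space) l2"
 assumes e: "ep > 0" and u: "Hs m u" "Nm m u <= R" and len: "length is + 2 <= m"
 shows "norm (D is (lift3 (Jf ep u)) x) <= sob2 * R"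
proof -
 have h: "h_inf (Jf ep u)" by (rule h_inf_Jf[OF e])
 have s: "sob2 >= 0" using sob_const_ge[where 'n=2] by simp
 have R0: "R >= 0" using order_trans[OF Nm_nonneg u(2)] .
 show ?thesis using D_lift[OF h_inf_smooth[OF h], of "is"]
 proof
  assume "EX js. length js = length is & D is (lift3 (Jf ep u)) = lift3 (D js (Jf ep u))"
  then obtain js where js: "length js = length is" "D is (lift3 (Jf ep u)) = lift3 (D js (Jf ep u))" by blast
  have "norm (D js (Jf ep u) (horiz x)) <= sob2 * hn m (Jf ep u)" by (rule sobolev_sup[OF h]) (use len js in simp_all)
  also have "... <= sob2 * R" using hn_Jf_le[OF e u(1)] u(2) s by (intro mult_left_mono) auto
  finally show ?thesis by (simp add: js(2) lift3_def)
 qed (use s R0 in simp)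
qed

text \<open>\<open>background\<close> is a condition at all real times, while the planar solution is
  controlled on [0, T] only; clipping extends it constantly and does not enlarge time
  differences.\<close>

definition clip :: "real => real => real" where "clip T t = max 0 (min T t)"

lemma clip: "T >= 0 ==> clip T t \<in> {0..T}" "t \<in> {0..T} ==> clip T t = t" "\<bar>clip T s - clip T t\<bar> <= \<bar>s - t\<bar>"
 by (auto simp: clip_def)

definition proj :: "3 => 2" where "proj i = (if i = 1 then 1 else 2)"

lemma proj_emb [simp]: "proj (emb j) = j" "emb j ~= 3"
 using exhaust_2[of j] by (auto simp: proj_def)

definition bgr :: "real => real => (real => (real^2, state) l2) => real => real^3 => state" where
 "bgr \<delta> T A t x = (1 / \<delta>, 0) + lift3 (rp (A (clip T t))) x"

definition bgr_d :: "real => (real => (real^2, state) l2) => real => 3 => real^3 => state" where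
 "bgr_d T A t i = (if i = 3 then (%x. 0) else lift3 (rp (dv [proj i] (A (clip T t)))))"

text \<open>Mollified planar states are the smooth approximations: they converge uniformly with
  first derivatives by the norm of order 4, and depend continuously on time because \<open>A\<close>
  is strongly continuous in the norm of order m + 3. So strong continuity of the planar solution has
  to precede the perturbation problem.\<close>

lemma background_bgr:
 assumes m: "m >= 3" and T: "T >= 0" and \<delta>: "\<delta> > 0" and A: "!!t. t \<in> {0..T} ==> Hs (m + 3) (A t)" "!!t. t \<in> {0..T} ==> Nm (m + 3) (A t) <= R"
  and cont: "!!t. t \<in> {0..T} ==> ((%s. Nm (m + 3) (A s - A t)) \<longlongrightarrow> 0) (at t within {0..T})"
 shows "background m (sob2 * R) (1 / \<delta> + sob2 * R) (bgr \<delta> T A) (bgr_d T A)"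
proof -
 define c where "c t = clip T t" for t
 have c: "c t \<in> {0..T}" "\<bar>c s - c t\<bar> <= \<bar>s - t\<bar>" for s t using clip(1)[OF T] clip(3) by (auto simp: c_def)
 note AH = A(1)[OF c(1)] and AN = A(2)[OF c(1)]
 define Ek where "Ek k t x = (1 / \<delta>, 0) + lift3 (Jf (eps k) (A (c t))) x" for k t and x :: "real^3"
 have R0: "R >= 0" using order_trans[OF Nm_nonneg AN[of 0]] .
 have s: "sob2 >= 1" by (rule sob_const_ge)
 have sm: "smooth (lift3 (Jf (eps k) u) :: real^3 => state)" for k u
  by (intro smooth_lift h_inf_smooth h_inf_Jf eps_pos)
 have DE: "D is (Ek k t) x = (if is = [] then (1 / \<delta>, 0) else 0) + D is (lift3 (Jf (eps k) (A (c t)))) x" for "is" k t x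
  unfolding Ek_def[abs_def] by (simp add: D_add[OF smooth_const sm] D_const)
 have n: "norm ((1 / \<delta>, 0) :: state) = 1 / \<delta>" using \<delta> by (simp add: norm_Pair)
 have binf: "b_inf (Ek k t)" for k t unfolding Ek_def[abs_def]
 proof (rule b_inf_add[OF b_inf_const])
  have h: "h_inf (Jf (eps k) (A (c t)))" by (rule h_inf_Jf[OF eps_pos])
  have "EX B. ALL x. norm (D is (lift3 (Jf (eps k) (A (c t)))) x) <= B" for "is"
  proof (intro exI allI)
   fix x
   show "norm (D is (lift3 (Jf (eps k) (A (c t)))) x) <= sob2 * hn (length is + 2) (Jf (eps k) (A (c t)))"
    using lift_bound[OF eps_pos Hs_J[OF eps_pos], of "length is + 2"] s D_lift[OF h_inf_smooth[OF h], of "is"] sobolev_sup[OF h, of _ "length is + 2"]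
    by (auto simp: lift3_def)
  qed
  thus "b_inf (lift3 (Jf (eps k) (A (c t))))" using sm by (simp add: b_inf_def)
 qed
 have sbg: "smooth_background m (sob2 * R) (1 / \<delta> + sob2 * R) (Ek k)" for k unfolding smooth_background_def
 proof (intro allI conjI impI binf)
  fix t "is" x assume "1 <= length is" "length (is :: 3 list) <= m + 1"
  thus "norm (D is (Ek k t) x) <= sob2 * R" using lift_bound[OF eps_pos[of k] AH[of t] AN[of t], of "is" x] by (auto simp: DE)
 next
  fix t x
  show "norm (Ek k t x) <= 1 / \<delta> + sob2 * R"
   using norm_triangle_ineq[of "(1 / \<delta>, 0) :: state" "lift3 (Jf (eps k) (A (c t))) x"] lift_bound[OF eps_pos[of k] AH[of t] AN[of t], of "[]" x]
   unfolding n by (simp add: Ek_def)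
 next
  fix t r :: real assume r: "r > 0"
  have "\<forall>\<^sub>F s in at (c t) within {0..T}. Nm (m + 3) (A s - A (c t)) < r / sob2"
   using cont[OF c(1)[of t]] by (rule order_tendstoD) (use r s in simp)
  then obtain d where d: "d > 0" "!!s. s \<in> {0..T} ==> s ~= c t ==> dist s (c t) < d ==> Nm (m + 3) (A s - A (c t)) < r / sob2"
   unfolding eventually_at by blast
  have near: "norm (D a (Ek k s) x - D a (Ek k t) x) <= r" if st: "\<bar>s - t\<bar> < d" and a: "length a <= 1" for s x a
  proof (cases "c s = c t")
   case True thus ?thesis using r by (simp add: DE)
  next
   case False
   have "Nm (m + 3) (A (c s) - A (c t)) <= r / sob2"
    using d(2)[OF c(1) False] c(2)[of s t] st by (simp add: dist_real_def)
   from lift_bound[OF eps_pos[of k] Hs_diff[OF AH AH] this, of a x]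
   have "norm (D a (lift3 (Jf (eps k) (A (c s) - A (c t)))) x) <= r" using a s by simp
   moreover have "lift3 (Jf (eps k) (A (c s) - A (c t))) = (%x. lift3 (Jf (eps k) (A (c s))) x - lift3 (Jf (eps k) (A (c t))) x)"
    by (rule ext) (simp add: lift3_def Jf_def conv_rp_diff[OF moll_kernel[OF eps_pos]])
   ultimately show ?thesis by (simp add: D_diff[OF sm sm] DE)
  qed
  have "norm (Ek k s x - Ek k t x) <= r" "norm (pd j (Ek k s) x - pd j (Ek k t) x) <= r" if "\<bar>s - t\<bar> < d" for s x j
   using near[OF that, of "[]"] near[OF that, of "[j]"] by simp_all
  thus "EX d>0. ALL s. \<bar>s - t\<bar> < d --> (ALL x. norm (Ek k s x - Ek k t x) <= r & (ALL j. norm (pd j (Ek k s) x - pd j (Ek k t) x) <= r))"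
   using d(1) by blast
 qed
 have A4: "Hs 4 (A (c t))" "Nm 4 (A (c t)) <= R" for t
 proof -
  show "Hs 4 (A (c t))" using Hs_mono[OF AH] m by simp
  have "(Nm 4 (A (c t)))^2 <= (Nm (m + 3) (A (c t)))^2"
   unfolding Nm_sq using m by (intro sum_mono2) (auto simp: lists_le_def finite_lists_length_le[of UNIV, simplified])
  thus "Nm 4 (A (c t)) <= R" using AN[of t] by (meson Nm_nonneg order_trans power2_le_imp_le)
 qed
 have dist: "AE x in lborel. norm (D a (lift3 (Jf (eps k) (A (c t)))) x - lift3 (rp (dv b (A (c t)))) x) <= eps k * rate R"
  if "D a (lift3 (Jf (eps k) (A (c t)))) = lift3 (D b (Jf (eps k) (A (c t))))" "length b <= 1" for a b k t
  using AE_lift[OF Jf_AE[OF eps_pos A4 that(2)]] unfolding that(1) by (simp add: lift3_def)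
 show ?thesis unfolding background_def
 proof (intro conjI allI exI[of _ Ek] exI[of _ "%k. eps k * rate R"])
  show "bmeas (bgr \<delta> T A t)" for t
   unfolding bgr_def[abs_def] using lift_measurable[OF rp_measurable] by (intro borel_measurable_add) auto
  show "bmeas (bgr_d T A t j)" for t j by (simp add: bgr_d_def lift_measurable)
  have "(%k. eps k * rate R) \<longlonglongrightarrow> 0 * rate R" by (intro tendsto_intros eps_tendsto)
  thus "(%k. eps k * rate R) \<longlonglongrightarrow> 0" by simp
  fix k t j
  have r0: "rate R >= 0" using s R0 by (simp add: rate_def)
  thus "0 <= eps k * rate R" by (simp add: less_imp_le)
  show "smooth_background m (sob2 * R) (1 / \<delta> + sob2 * R) (Ek k)" by (rule sbg)
  show "AE x in lborel. norm (Ek k t x - bgr \<delta> T A t x) <= eps k * rate R"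
   using dist[of "[]" k t "[]"] by (simp add: Ek_def bgr_def c_def)
  show "AE x in lborel. norm (pd j (Ek k t) x - bgr_d T A t j x) <= eps k * rate R"
  proof (cases j rule: emb_cases)
   case 1
   thus ?thesis using DE[of "[j]" k t] pd_lift(2)[OF h_inf_smooth[OF h_inf_Jf[OF eps_pos[of k], where u="A (c t)"]]] r0
    by (simp add: bgr_d_def less_imp_le)
  next
   case (2 i)
   have "AE x in lborel. norm (D [j] (lift3 (Jf (eps k) (A (c t)))) x - lift3 (rp (dv [i] (A (c t)))) x) <= eps k * rate R"
    by (rule dist) (simp_all add: 2 pd_lift(1)[OF h_inf_smooth[OF h_inf_Jf[OF eps_pos]]])
   thus ?thesis using DE[of "[j]" k t] 2 by (simp add: bgr_d_def c_def)
  qed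
 qed
qed

text \<open>A constant background has derivative bound 0, so the planar existence time depends on
  the norm of the planar data, on m and on gb alone.\<close>

lemma planar_background: assumes "\<delta> > 0" shows "background m 0 (1 / \<delta>) (%t x. (1 / \<delta>, 0) :: state) (%t j x. 0)"
proof -
 have "norm ((1 / \<delta>, 0) :: state) = 1 / \<delta>" using assms by (simp add: norm_Pair)
 hence "smooth_background m 0 (1 / \<delta>) (%t x. (1 / \<delta>, 0) :: state)"
  unfolding smooth_background_def by (auto simp: b_inf_const D_const intro!: exI[of _ 1])
 thus ?thesis unfolding background_def
  by (intro conjI allI exI[of _ "%k t x. (1 / \<delta>, 0)"] exI[of _ "%k. 0"]) auto
qed

section \<open>Representation of the two systems and of their sum\<close>

lemma Hs_has_weak_deriv: assumes "rep f u" "Hs m u" "length is <= m" shows "has_weak_deriv is f (rp (dv is u))"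
 using has_weak_deriv_wd[OF assms(1) rep_rp] Hs_wd[OF assms(2,3)] by blast

definition lift_d :: "(real^2, state) l2 => 3 => real^3 => state" where
 "lift_d u i = (if i = 3 then (%x. 0) else lift3 (rp (dv [proj i] u)))"

lemma has_weak_deriv_lift:
 assumes f: "rep f u" and u: "Hs 1 u" shows "has_weak_deriv [i] (lift3 f) (lift_d u i)"
proof (rule has_weak_deriv_cong)
 have w: "wd [j] u (dv [j] u)" for j by (rule Hs_wd[OF u]) simp
 show "has_weak_deriv [i] (lift3 (rp u)) (lift_d u i)"
  by (cases i rule: emb_cases) (use lift_weak_deriv[OF w] in "auto simp: lift_d_def")
 show "AE x in lebesgue. lift3 (rp u) x = lift3 f x" by (rule lift_cong) (use f in "auto simp: rep_def elim: eventually_mono")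
qed simp

lemma planar_represents:
 assumes "m >= 1"
 shows "planar.represents gb (gb / \<delta> * \<nu>) m T (%t x. (1 / \<delta>, 0)) (%t j x. 0) (%t. planar_system gb \<nu> \<delta>)"
 unfolding planar.represents_def
proof (intro ballI allI impI)
 fix t and f :: "real^2 => state" and u assume f: "rep f u" and u: "Hs m u"
 have "has_weak_deriv [j] f (rp (dv [j] u))" for j by (rule Hs_has_weak_deriv[OF f u]) (use assms in simp)
 from planar_system_AE[OF this, of gb \<nu> \<delta>] f
 show "AE x in lebesgue. planar_system gb \<nu> \<delta> f x = planar.FFf gb (gb / \<delta> * \<nu>) (%x. (1 / \<delta>, 0)) (%j x. 0) (rp u) (%j. rp (dv [j] u)) x"
  unfolding rep_def by eventually_elim (simp add: planar.FFf_def bounded_bilinear.zero_right[OF bounded_bilinear_Sst])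
qed

lemma spatial_represents:
 assumes A: "!!t. t \<in> {0..T} ==> rep (A t) (VA t)" "!!t. t \<in> {0..T} ==> Hs 1 (VA t)" and m: "m >= 1"
 shows "spatial.represents gb (gb / \<delta> * \<nu>) m T (bgr \<delta> T VA) (bgr_d T VA) (%t. perturbation_system gb \<nu> \<delta> (A t))"
 unfolding spatial.represents_def
proof (intro ballI allI impI)
 fix t and f :: "real^3 => state" and u assume t: "t \<in> {0..T}" and f: "rep f u" and u: "Hs m u"
 have w: "has_weak_deriv [j] f (rp (dv [j] u))" for j by (rule Hs_has_weak_deriv[OF f u]) (use m in simp)
 have l: "AE x in lebesgue. lift3 (A t) x = lift3 (rp (VA t)) x" by (rule lift_cong) (use A(1)[OF t] in "simp add: rep_def")
 have bd: "bgr_d T VA t = lift_d (VA t)" by (rule ext) (simp only: bgr_d_def lift_d_def clip(2)[OF t])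
 from perturbation_system_AE[OF w has_weak_deriv_lift[OF A(1)[OF t] A(2)[OF t]], of gb \<nu> \<delta>] f l
 show "AE x in lebesgue. perturbation_system gb \<nu> \<delta> (A t) f x =
   spatial.FFf gb (gb / \<delta> * \<nu>) (bgr \<delta> T VA t) (bgr_d T VA t) (rp u) (%j. rp (dv [j] u)) x"
  unfolding rep_def by eventually_elim (simp add: spatial.FFf_def bgr_def bd clip(2)[OF t])
qed

text \<open>Bilinear expansion: the terms without \<open>v\<close> form the planar system, all
  others the perturbation system, whose background is (1/\<delta>, 0) plus the lifted planar
  state.\<close>

lemma full_system_sum:
 assumes A: "Hs 1 u" and V: "Hs 1 v"
 shows "AE x in lebesgue. full_system gb \<nu> \<delta> (%x. lift3 (rp u) x + rp v x) x =
  lift3 (planar.FFf gb (gb / \<delta> * \<nu>) (%x. (1 / \<delta>, 0)) (%j x. 0) (rp u) (%j. rp (dv [j] u))) x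
  + spatial.FFf gb (gb / \<delta> * \<nu>) (%x. (1 / \<delta>, 0) + lift3 (rp u) x) (lift_d u) (rp v) (%j. rp (dv [j] v)) x"
  (is "AE x in lebesgue. _ = ?P x + ?Q x")
proof -
 have w: "has_weak_deriv [i] (%x. lift3 (rp u) x + rp v x) (%x. lift_d u i x + rp (dv [i] v) x)" for i
  by (intro has_weak_deriv_add has_weak_deriv_lift[OF rep_rp A] Hs_has_weak_deriv[OF rep_rp V]) simp
 show ?thesis using full_system_AE[OF w, of gb \<nu> \<delta>]
 proof eventually_elim
  case (elim x)
  have d: "(\<Sum>i\<in>UNIV. Sst gb i p (lift_d u i x)) = (\<Sum>j\<in>UNIV. Sst gb (emb j) p (rp (dv [j] u) (horiz x)))" for p
   by (simp add: sum_3 sum_2 lift_d_def proj_def lift3_def bounded_bilinear.zero_right[OF bounded_bilinear_Sst])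
  have "?P x = (\<Sum>i\<in>UNIV. Sst gb i (lift3 (rp u) x + (1 / \<delta>, 0)) (lift_d u i x)) + Gst (gb / \<delta> * \<nu>) (lift3 (rp u) x)"
   unfolding d by (simp add: lift3_def planar.FFf_def bounded_bilinear.zero_right[OF bounded_bilinear_Sst])
  thus ?case unfolding elim
   by (simp add: spatial.FFf_def bounded_bilinear.add_left[OF bounded_bilinear_Sst] bounded_bilinear.add_right[OF bounded_bilinear_Sst]
     linear_add[OF bounded_linear.linear[OF bounded_linear_Gst]] sum.distrib algebra_simps)
 qed
qed

lemma sobolev_linear:
 fixes f :: "real^'n::finite => 'b::euclidean_space" and L :: "'b => 'c::euclidean_space"
 assumes L: "bounded_linear L" and f: "f \<in> sobolev m" shows "(%x. L (f x)) \<in> sobolev m"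
proof -
 have "square_integrable (%x. L (g x))" if g: "square_integrable g" for g :: "real^'n => 'b"
 proof -
  obtain v where v: "rep g v" using g unfolding square_integrable_rep by blast
  have "rep (%x. L (rp v x)) (cl (%x. L (rp v x)))" by (rule rep_cl[OF sqi_bounded_linear[OF L sqi_rp]])
  hence "rep (%x. L (g x)) (cl (%x. L (rp v x)))" by (rule rep_cong) (use v in "auto simp: rep_def elim: eventually_mono")
  thus ?thesis unfolding square_integrable_rep by blast
 qed
 thus ?thesis using f has_weak_deriv_linear[OF L] unfolding sobolev_def by blast
qed

lemma sobolev_add: assumes "f \<in> sobolev m" "g \<in> sobolev m" shows "(%x. f x + g x) \<in> sobolev m"
proof -
 have "(%x. - g x) \<in> sobolev m" by (rule sobolev_linear[OF bounded_linear_minus[OF bounded_linear_ident] assms(2)])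
 then obtain u v where "rep f u" "Hs m u" "rep (%x. - g x) v" "Hs m v" using assms(1) unfolding sobolev_rep by blast
 thus ?thesis unfolding sobolev_rep using rep_diff[of f u "%x. - g x" v] Hs_diff[of m u v] by auto
qed

lemma test_integral_sum:
 assumes f: "rep f u" and g: "rep g v" and \<phi>: "test_function \<phi>" and r: "r >= 0" "!!x. norm x > r ==> \<phi> x = 0"
 shows "(LINT x|lebesgue. \<phi> x *\<^sub>R (lift3 f x + g x)) = pr \<phi> (cut r u) + pr \<phi> v"
 using test_integrable[OF \<phi> locally_integrable_lift[OF f]] test_integrable[OF \<phi> locally_integrable_rep[OF g]]
  test_integral_lift[OF f \<phi> r] test_integral_pr[OF g \<phi>] by (simp add: scaleR_add_right)

text \<open>The sum is not square-integrable in space, so its equation is checked after testing: a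
  test function sees the planar part only in a slab, where \<open>cut\<close> is bounded and linear
  and so commutes with the time derivative.\<close>

lemma solves_ivp_superposition:
 assumes T: "T >= 0" and A0: "rep A0 (VA 0)" and V0: "rep V0 (VV 0)"
  and A: "!!t. t \<in> {0..T} ==> Hs 1 (VA t)" "!!t. t \<in> {0..T} ==> (VA has_vector_derivative - FA t) (at t within {0..T})"
   "!!t. t \<in> {0..T} ==> rep (P t) (FA t)"
  and V: "!!t. t \<in> {0..T} ==> Hs 1 (VV t)" "!!t. t \<in> {0..T} ==> (VV has_vector_derivative - FV t) (at t within {0..T})"
   "!!t. t \<in> {0..T} ==> rep (Q t) (FV t)"
  and F: "!!t. t \<in> {0..T} ==> AE x in lebesgue. F (%x. lift3 (rp (VA t)) x + rp (VV t) x) x = lift3 (P t) x + Q t x"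
 shows "solves_ivp T (%t. F) (%x. lift3 A0 x + V0 x) (%t x. lift3 (rp (VA t)) x + rp (VV t) x :: state)"
 unfolding solves_ivp_def
proof (intro conjI ballI allI impI)
 have "AE x in lebesgue. lift3 (rp (VA 0)) x = lift3 A0 x" by (rule lift_cong) (use A0 in "auto simp: rep_def elim: eventually_mono")
 with V0 show "AE x in lebesgue. lift3 (rp (VA 0)) x + rp (VV 0) x = lift3 A0 x + V0 x"
  unfolding rep_def by eventually_elim simp
 fix t assume t: "t \<in> {0..T}"
 show "EX g. has_weak_deriv [i] (%x. lift3 (rp (VA t)) x + rp (VV t) x) g" for i
  using has_weak_deriv_add[OF has_weak_deriv_lift[OF rep_rp A(1)[OF t]] Hs_has_weak_deriv[OF rep_rp V(1)[OF t]], of i] by auto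
 have F': "AE x in lebesgue. lift3 (P t) x + Q t x = F (%x. lift3 (rp (VA t)) x + rp (VV t) x) x" using F[OF t] by eventually_elim simp
 have l: "locally_integrable (%x. lift3 (P t) x + Q t x)"
  by (intro locally_integrable_add locally_integrable_lift[OF A(3)[OF t]] locally_integrable_rep[OF V(3)[OF t]])
 show "locally_integrable (F (%x. lift3 (rp (VA t)) x + rp (VV t) x))" by (rule locally_integrable_cong[OF l F'])
 fix \<phi> :: "real^3 => real" assume \<phi>: "test_function \<phi>"
 obtain r where r: "r >= 0" "!!x. norm x > r ==> \<phi> x = 0" using test_function_radius[OF \<phi>] by blast
 note b1 = bounded_linear_pr[OF test_function_sqi[OF \<phi>]]
 note b2 = bounded_linear_compose[OF b1 bounded_linear_cut[OF r(1)]]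
 have "((%s. pr \<phi> (cut r (VA s)) + pr \<phi> (VV s)) has_vector_derivative pr \<phi> (cut r (- FA t)) + pr \<phi> (- FV t)) (at t within {0..T})"
  by (intro has_vector_derivative_add bounded_linear.has_vector_derivative[OF b1 V(2)[OF t]] bounded_linear.has_vector_derivative[OF b2 A(2)[OF t]])
 moreover have "(LINT x|lebesgue. \<phi> x *\<^sub>R F (%x. lift3 (rp (VA t)) x + rp (VV t) x) x) = pr \<phi> (cut r (FA t)) + pr \<phi> (FV t)"
  using test_integral_cong[OF l F' \<phi>] test_integral_sum[OF A(3)[OF t] V(3)[OF t] \<phi> r] by simp
 moreover have "(LINT x|lebesgue. \<phi> x *\<^sub>R (lift3 (rp (VA s)) x + rp (VV s) x)) = pr \<phi> (cut r (VA s)) + pr \<phi> (VV s)" for s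
  by (rule test_integral_sum[OF rep_rp rep_rp \<phi> r])
 ultimately show "((%s. LINT x|lebesgue. \<phi> x *\<^sub>R (lift3 (rp (VA s)) x + rp (VV s) x)) has_vector_derivative
   - (LINT x|lebesgue. \<phi> x *\<^sub>R F (%x. lift3 (rp (VA t)) x + rp (VV t) x) x)) (at t within {0..T})"
  by (simp add: linear_neg[OF bounded_linear.linear[OF b1]] linear_neg[OF bounded_linear.linear[OF b2]])
qed

theorem theorem1p2:
  fixes \<gamma> \<nu> :: real and m :: nat
    and b0 :: "real^3 \<Rightarrow> real" and u0 :: "real^3 \<Rightarrow> real^3"
    and bL :: "real^2 \<Rightarrow> real" and uhL :: "real^2 \<Rightarrow> real^2" and u3L :: "real^2 \<Rightarrow> real"
  assumes "\<gamma> > 1" and "\<nu> > 0" and "m \<ge> 3"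
    and "b0 \<in> sobolev m" and "u0 \<in> sobolev m"
    and "bL \<in> sobolev (m + 3)" and "uhL \<in> sobolev (m + 3)" and "u3L \<in> sobolev (m + 3)"
  defines "gb \<equiv> (\<gamma> - 1) / 2"
    and "A0 \<equiv> (\<lambda>y. (bL y, join3 (uhL y) (u3L y)))"
    and "V0 \<equiv> (\<lambda>x. (b0 x, u0 x))"
  shows "\<exists>T>0. \<exists>C>0. \<forall>\<delta>>0. \<exists>U A V.
           split_solution gb \<nu> \<delta> m T A0 V0 U A V \<and>
           (\<forall>U' A' V'. split_solution gb \<nu> \<delta> m T A0 V0 U' A' V' \<longrightarrow>
              (\<forall>t\<in>{0..T}. AE x in lebesgue. U' t x = U t x)) \<and>
           (SUP t\<in>{0..T}. sobolev_norm (m + 3) (A t)) + (SUP t\<in>{0..T}. sobolev_norm m (V t)) \<le> C"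
proof -
 note m = \<open>m >= 3\<close>
 have bl: "bounded_linear (%b::real. (b, 0::real^3))" "bounded_linear (%u::real^3. (0::real, u))"
  "bounded_linear (%h. (0::real, join3 h 0))" "bounded_linear (%z. (0::real, join3 0 z))"
  unfolding linear_conv_bounded_linear[symmetric]
  by (rule linearI; simp add: prod_eq_iff vec_eq_iff forall_3 join3_def)+
 have "(%y. ((bL y, 0) + (0, join3 (uhL y) 0)) + (0, join3 0 (u3L y))) \<in> sobolev (m + 3)"
  by (intro sobolev_add sobolev_linear[OF bl(1)] sobolev_linear[OF bl(3)] sobolev_linear[OF bl(4)]) (rule assms)+
 moreover have "(%y. ((bL y, 0) + (0, join3 (uhL y) 0)) + (0, join3 0 (u3L y))) = A0"
  by (auto simp: A0_def fun_eq_iff vec_eq_iff forall_3 join3_def)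
 ultimately obtain a0 where a0: "rep A0 a0" "Hs (m + 3) a0" unfolding sobolev_rep by auto
 have "(%x. (b0 x, 0) + (0, u0 x)) \<in> sobolev m"
  by (intro sobolev_add sobolev_linear[OF bl(1)] sobolev_linear[OF bl(2)]) (rule assms)+
 then obtain v0 where v0: "rep V0 v0" "Hs m v0" unfolding sobolev_rep by (auto simp: V0_def)
 \<comment> \<open>The bounds sqrt (R^2 + 1) of \<open>well_posed_functions\<close>, with R the norm
   of the respective data; their sum is the constant C.\<close>
 define RA RV where "RA = sqrt ((Nm (m + 3) a0)^2 + 1)" and "RV = sqrt ((Nm m v0)^2 + 1)"
 have R: "RA > 0" "RV > 0" by (auto simp: RA_def RV_def intro!: add_nonneg_pos)
 have M0: "sob2 * RA >= 0" using R sob_const_ge[where 'n=2] by simp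
 \<comment> \<open>\<open>life\<close> depends on the systems only through \<open>Sst\<close>, so
   the coefficient of \<open>Gst\<close>, which is proportional to 1/\<delta>, does not occur; the
   background derivatives are bounded by 0 and by sob2 * RA. Hence \<open>T\<close> is fixed before
   \<delta>.\<close>
 define T where "T = min (planar.life gb (m + 3) 0 (Nm (m + 3) a0)) (spatial.life gb m (sob2 * RA) (Nm m v0))"
 have T: "T > 0" "T <= planar.life gb (m + 3) 0 (Nm (m + 3) a0)" "T <= spatial.life gb m (sob2 * RA) (Nm m v0)"
  using planar.life_pos[of 0] spatial.life_pos[OF M0] by (auto simp: T_def)
 have main: "EX U A V. split_solution gb \<nu> \<delta> m T A0 V0 U A V &
     (ALL U' A' V'. split_solution gb \<nu> \<delta> m T A0 V0 U' A' V' -->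
       (\<forall>t\<in>{0..T}. AE x in lebesgue. U' t x = U t x)) &
     (SUP t\<in>{0..T}. sobolev_norm (m + 3) (A t)) + (SUP t\<in>{0..T}. sobolev_norm m (V t)) <= RA + RV" if \<delta>: "\<delta> > 0" for \<delta>
 proof -
  let ?c = "gb / \<delta> * \<nu>"
  let ?E = "%x. (1 / \<delta>, 0) :: state" and ?e = "%j x. 0 :: state"
  have m1: "m + 3 >= 3" "m + 3 >= 1" "m >= 1" using m by auto
  note pb = planar_background[OF \<delta>] and pr = planar_represents[OF m1(2), of gb \<delta> \<nu> T]
  obtain VA where VA: "!!t. t \<in> {0..T} ==> Hs (m + 3) (VA t)" "!!t. t \<in> {0..T} ==> Nm (m + 3) (VA t) <= RA"
    "!!t. t \<in> {0..T} ==> (VA has_vector_derivative - planar.FF gb ?c ?E ?e (VA t)) (at t within {0..T})"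
    "!!t. t \<in> {0..T} ==> ((%s. Nm (m + 3) (VA s - VA t)) \<longlongrightarrow> 0) (at t within {0..T})"
   and solA: "solves_ivp T (%t. planar_system gb \<nu> \<delta>) A0 (%t. rp (VA t))" "rep A0 (VA 0)"
   and uniqA: "!!f. continuous_in_sobolev T (m + 3) f ==> solves_ivp T (%t. planar_system gb \<nu> \<delta>) A0 f ==> (\<forall>t\<in>{0..T}. rep (f t) (VA t))"
   using planar.well_posed_functions[OF m1(1) pb a0 order_refl T(1,2) pr] pr unfolding RA_def by blast
  have HA: "Hs 1 (VA t)" if "t \<in> {0..T}" for t using Hs_mono[OF VA(1)[OF that]] by simp
  have T0: "T >= 0" using T(1) by simp
  note sb = background_bgr[OF m T0 \<delta> VA(1,2,4)]
  have sr: "spatial.represents gb ?c m T (bgr \<delta> T VA) (bgr_d T VA) (%t. perturbation_system gb \<nu> \<delta> (A t))"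
   if "!!t. t \<in> {0..T} ==> rep (A t) (VA t)" for A
   by (rule spatial_represents[OF that HA m1(3)])
  obtain VV where VV: "!!t. t \<in> {0..T} ==> Hs m (VV t)" "!!t. t \<in> {0..T} ==> Nm m (VV t) <= RV"
    "!!t. t \<in> {0..T} ==> (VV has_vector_derivative - spatial.FF gb ?c (bgr \<delta> T VA t) (bgr_d T VA t) (VV t)) (at t within {0..T})"
    "!!t. t \<in> {0..T} ==> ((%s. Nm m (VV s - VV t)) \<longlongrightarrow> 0) (at t within {0..T})"
   and solV: "solves_ivp T (%t. perturbation_system gb \<nu> \<delta> (rp (VA t))) V0 (%t. rp (VV t))" "rep V0 (VV 0)"
   and uniqV: "!!F f. spatial.represents gb ?c m T (bgr \<delta> T VA) (bgr_d T VA) F ==> continuous_in_sobolev T m f ==> solves_ivp T F V0 f ==> (\<forall>t\<in>{0..T}. rep (f t) (VV t))"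
   using spatial.well_posed_functions[OF m sb v0 order_refl T(1,3) sr[OF rep_rp]] unfolding RV_def by blast
  have HV: "Hs 1 (VV t)" if "t \<in> {0..T}" for t using Hs_mono[OF VV(1)[OF that]] m by simp
  define A V where "A t = rp (VA t)" and "V t = rp (VV t)" for t
  define U where "U t x = lift3 (A t) x + V t x" for t x
  have bE: "bgr \<delta> T VA t = (%x. (1 / \<delta>, 0) + lift3 (rp (VA t)) x)" "bgr_d T VA t = lift_d (VA t)" if "t \<in> {0..T}" for t
   by (rule ext, simp only: bgr_def bgr_d_def lift_d_def clip(2)[OF that])+
  have "solves_ivp T (%t. full_system gb \<nu> \<delta>) (%x. lift3 A0 x + V0 x) U"
   unfolding U_def[abs_def] A_def V_def
  proof (rule solves_ivp_superposition[OF T0 solA(2) solV(2) HA VA(3) _ HV VV(3)])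
   fix t assume t: "t \<in> {0..T}"
   show "rep (planar.FFf gb ?c ?E ?e (rp (VA t)) (%j. rp (dv [j] (VA t)))) (planar.FF gb ?c ?E ?e (VA t))"
    unfolding planar.FF_def using rep_cl[OF planar.FF_sqi[OF pb VA(1)[OF t] m1(1)]] by blast
   show "rep (spatial.FFf gb ?c (bgr \<delta> T VA t) (bgr_d T VA t) (rp (VV t)) (%j. rp (dv [j] (VV t)))) (spatial.FF gb ?c (bgr \<delta> T VA t) (bgr_d T VA t) (VV t))"
    unfolding spatial.FF_def by (rule rep_cl[OF spatial.FF_sqi[OF sb VV(1)[OF t] m]])
   show "AE x in lebesgue. full_system gb \<nu> \<delta> (%x. lift3 (rp (VA t)) x + rp (VV t) x) x =
     lift3 (planar.FFf gb ?c ?E ?e (rp (VA t)) (%j. rp (dv [j] (VA t)))) x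
     + spatial.FFf gb ?c (bgr \<delta> T VA t) (bgr_d T VA t) (rp (VV t)) (%j. rp (dv [j] (VV t))) x"
    unfolding bE[OF t] by (rule full_system_sum[OF HA[OF t] HV[OF t]])
  qed
  moreover have "has_weak_deriv [3] (lift3 (%y. snd (A t y))) (%x. 0)" if "t \<in> {0..T}" for t
   using has_weak_deriv_linear[OF bounded_linear_snd has_weak_deriv_lift[OF rep_rp HA[OF that], of 3]]
   by (simp add: A_def lift_d_def lift3_def[abs_def])
  ultimately have split: "split_solution gb \<nu> \<delta> m T A0 V0 U A V"
   using continuous_in_sobolevI[OF VA(1,4)] continuous_in_sobolevI[OF VV(1,4)] solA(1) solV(1)
   unfolding split_solution_def A_def V_def U_def by simp
  \<comment> \<open>The planar part comes first, as its system does not involve V'. Then A' and A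
    agree almost everywhere, so V' solves a system represented by the same background as V.\<close>
  have uniq: "AE x in lebesgue. U' t x = U t x" if s: "split_solution gb \<nu> \<delta> m T A0 V0 U' A' V'" and t: "t \<in> {0..T}" for U' A' V' t
  proof -
   have A': "!!t. t \<in> {0..T} ==> rep (A' t) (VA t)" using uniqA[of A'] s unfolding split_solution_def by blast
   have V': "rep (V' t) (VV t)" using uniqV[OF sr[OF A'], of V'] s t unfolding split_solution_def by blast
   have U': "AE x in lebesgue. U' t x = lift3 (A' t) x + V' t x" using s t unfolding split_solution_def by blast
   have "AE x in lebesgue. lift3 (A' t) x = lift3 (A t) x" using A'[OF t] by (intro lift_cong) (simp add: rep_def A_def)
   with U' V' show ?thesis unfolding rep_def U_def V_def by eventually_elim simp
  qed
  have "(SUP t\<in>{0..T}. sobolev_norm (m + 3) (A t)) <= RA" "(SUP t\<in>{0..T}. sobolev_norm m (V t)) <= RV"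
   using T0 VA(2) VV(2) by (auto intro!: cSUP_least simp: A_def V_def sobolev_norm_rep[OF rep_rp VA(1)] sobolev_norm_rep[OF rep_rp VV(1)])
  thus ?thesis using split uniq by (intro exI[of _ U] exI[of _ A] exI[of _ V]) auto
 qed
 show ?thesis
  by (rule exI[of _ T], intro conjI T(1), rule exI[of _ "RA + RV"]) (use R main in auto)
qed

end
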